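(* Suppose $J_1=J_2>0$. Then for each $\delta>0$ there are constants $c=c(\delta)>0$ and $\beta_0=\beta_0(\delta)<\infty$ such that for each $\beta\ge\beta_0$ and each spin magnitude $\mathcal S\ge c\beta^2$, if the even integer $N$ is sufficiently large then for all $\boldsymbol r,\boldsymbol r'\in\mathbb T_N$: $$\mathcal S^{-4}\bigl\langle[\hat S^\alpha_{\boldsymbol r}]^2[\hat S^\alpha_{\boldsymbol r'}]^2\bigr\rangle_{N,\beta}\ge\tfrac12-\delta,\quad\alpha=x,z,$$ $$\mathcal S^{-4}\bigl\langle[\hat S^y_{\boldsymbol r}]^2[\hat S^y_{\boldsymbol r'}]^2\bigr\rangle_{N,\beta}<\delta,\qquad \mathcal S^{-4}\bigl|\bigl\langle[\hat S^x_{\boldsymbol r}]^2[\hat S^z_{\boldsymbol r'}]^2\bigr\rangle_{N,\beta}\bigr|<\delta.$$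
   Context: Let $\mathcal S\in\{\frac12,1,\frac32,\dots\}$. On each site $\boldsymbol r$ of the torus $\mathbb T_N=(\mathbb Z/N\mathbb Z)^2$ ($N$ even) put a copy of $\mathbb C^{2\mathcal S+1}$ with basis $|M\rangle$, $M=-\mathcal S,\dots,\mathcal S$; the Hilbert space is the tensor product. Single-site operators act by $\hat S^z|M\rangle=M|M\rangle$, $\hat S^{\pm}|M\rangle=\sqrt{\mathcal S(\mathcal S+1)-M(M\pm1)}\,|M\pm1\rangle$, and $\hat S^x=\frac12(\hat S^++\hat S^-)$, $\hat S^y=\frac1{2i}(\hat S^+-\hat S^-)$; $\hat S^\alpha_{\boldsymbol r}$ denotes the operator acting at site $\boldsymbol r$. Edge types: the horizontal edge $\langle \boldsymbol r,\boldsymbol r+\boldsymbol e_1\rangle$ is an $x$-edge if $r_1$ is even and a $z$-edge otherwise; the vertical edge $\langle\boldsymbol r,\boldsymbol r+\boldsymbol e_2\rangle$ is an $x$-edge if $r_2$ is even and a $z$-edge otherwise. The Hamiltonian is $\hat{\mathcal H}_N=-J_1\mathcal S^{-2}\sum_{x\text{-edges}}\hat S^x_{\boldsymbol r}\hat S^x_{\boldsymbol r'}-J_2\mathcal S^{-2}\sum_{z\text{-edges}}\hat S^z_{\boldsymbol r}\hat S^z_{\boldsymbol r'}$, and $\langle\hat A\rangle_{N,\beta}=\mathrm{Tr}(\hat A e^{-\beta\hat{\mathcal H}_N})/\mathrm{Tr}(e^{-\beta\hat{\mathcal H}_N})$. *)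

theory Defs
  imports Complex_Main "HOL-Library.FuncSet"
begin

text \<open>Sites of the torus T_N are pairs (r1, r2) with r1, r2 < N.  The spin magnitude
  is S = n/2 with n = 2S a positive natural number; the basis state |M> at a site is
  encoded by the index k in {0..n}, with M = k - S.  Basis vectors of the full Hilbert
  space are configurations (extensional functions sites -> {0..n}); operators are given
  by their matrix entries A sigma tau = <sigma| A |tau>.\<close>

type_synonym site = "nat \<times> nat"
type_synonym conf = "site \<Rightarrow> nat"
type_synonym op = "conf \<Rightarrow> conf \<Rightarrow> complex"

definition sites :: "nat \<Rightarrow> site set" where
  "sites N = {..<N} \<times> {..<N}"

definition confs :: "nat \<Rightarrow> nat \<Rightarrow> conf set" where
  "confs N n = PiE (sites N) (\<lambda>_. {..n})"

definition spinS :: "nat \<Rightarrow> real" where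
  "spinS n = real n / 2"

definition op_id :: op where
  "op_id = (\<lambda>\<sigma> \<tau>. if \<sigma> = \<tau> then 1 else 0)"

definition op_mult :: "nat \<Rightarrow> nat \<Rightarrow> op \<Rightarrow> op \<Rightarrow> op" where
  "op_mult N n A B = (\<lambda>\<sigma> \<tau>. \<Sum>\<rho>\<in>confs N n. A \<sigma> \<rho> * B \<rho> \<tau>)"

fun op_pow :: "nat \<Rightarrow> nat \<Rightarrow> op \<Rightarrow> nat \<Rightarrow> op" where
  "op_pow N n A 0 = op_id"
| "op_pow N n A (Suc k) = op_mult N n A (op_pow N n A k)"

definition op_trace :: "nat \<Rightarrow> nat \<Rightarrow> op \<Rightarrow> complex" where
  "op_trace N n A = (\<Sum>\<sigma>\<in>confs N n. A \<sigma> \<sigma>)"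

definition op_exp :: "nat \<Rightarrow> nat \<Rightarrow> op \<Rightarrow> op" where
  "op_exp N n A = (\<lambda>\<sigma> \<tau>. \<Sum>k. op_pow N n A k \<sigma> \<tau> / of_nat (fact k))"

definition Sz_op :: "nat \<Rightarrow> site \<Rightarrow> op" where
  "Sz_op n r = (\<lambda>\<sigma> \<tau>. if \<sigma> = \<tau> then complex_of_real (real (\<tau> r) - spinS n) else 0)"

definition Splus_op :: "nat \<Rightarrow> site \<Rightarrow> op" where
  "Splus_op n r = (\<lambda>\<sigma> \<tau>. let S = spinS n; M = real (\<tau> r) - S in
     if \<sigma> = \<tau>(r := Suc (\<tau> r)) then complex_of_real (sqrt (S * (S + 1) - M * (M + 1))) else 0)"

definition Sminus_op :: "nat \<Rightarrow> site \<Rightarrow> op" where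
  "Sminus_op n r = (\<lambda>\<sigma> \<tau>. let S = spinS n; M = real (\<tau> r) - S in
     if 1 \<le> \<tau> r \<and> \<sigma> = \<tau>(r := \<tau> r - 1) then complex_of_real (sqrt (S * (S + 1) - M * (M - 1))) else 0)"

definition Sx_op :: "nat \<Rightarrow> site \<Rightarrow> op" where
  "Sx_op n r = (\<lambda>\<sigma> \<tau>. (Splus_op n r \<sigma> \<tau> + Sminus_op n r \<sigma> \<tau>) / 2)"

definition Sy_op :: "nat \<Rightarrow> site \<Rightarrow> op" where
  "Sy_op n r = (\<lambda>\<sigma> \<tau>. (Splus_op n r \<sigma> \<tau> - Sminus_op n r \<sigma> \<tau>) / (2 * \<i>))"

datatype axis = AX | AY | AZ

fun spin_op :: "axis \<Rightarrow> nat \<Rightarrow> site \<Rightarrow> op" where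
  "spin_op AX = Sx_op"
| "spin_op AY = Sy_op"
| "spin_op AZ = Sz_op"

definition nb1 :: "nat \<Rightarrow> site \<Rightarrow> site" where
  "nb1 N r = ((fst r + 1) mod N, snd r)"

definition nb2 :: "nat \<Rightarrow> site \<Rightarrow> site" where
  "nb2 N r = (fst r, (snd r + 1) mod N)"

definition hamiltonian :: "nat \<Rightarrow> nat \<Rightarrow> real \<Rightarrow> real \<Rightarrow> op" where
  "hamiltonian N n J1 J2 = (\<lambda>\<sigma> \<tau>.
     - complex_of_real (J1 / (spinS n)\<^sup>2) *
       (\<Sum>r\<in>sites N.
          (if even (fst r) then op_mult N n (Sx_op n r) (Sx_op n (nb1 N r)) \<sigma> \<tau> else 0)
        + (if even (snd r) then op_mult N n (Sx_op n r) (Sx_op n (nb2 N r)) \<sigma> \<tau> else 0))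
     - complex_of_real (J2 / (spinS n)\<^sup>2) *
       (\<Sum>r\<in>sites N.
          (if odd (fst r) then op_mult N n (Sz_op n r) (Sz_op n (nb1 N r)) \<sigma> \<tau> else 0)
        + (if odd (snd r) then op_mult N n (Sz_op n r) (Sz_op n (nb2 N r)) \<sigma> \<tau> else 0)))"

definition gibbs :: "nat \<Rightarrow> nat \<Rightarrow> real \<Rightarrow> real \<Rightarrow> real \<Rightarrow> op" where
  "gibbs N n J1 J2 \<beta> = op_exp N n (\<lambda>\<sigma> \<tau>. - complex_of_real \<beta> * hamiltonian N n J1 J2 \<sigma> \<tau>)"

definition expect :: "nat \<Rightarrow> nat \<Rightarrow> real \<Rightarrow> real \<Rightarrow> real \<Rightarrow> op \<Rightarrow> complex" where
  "expect N n J1 J2 \<beta> A =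
     op_trace N n (op_mult N n A (gibbs N n J1 J2 \<beta>)) / op_trace N n (gibbs N n J1 J2 \<beta>)"

definition sq_corr :: "nat \<Rightarrow> nat \<Rightarrow> axis \<Rightarrow> site \<Rightarrow> axis \<Rightarrow> site \<Rightarrow> op" where
  "sq_corr N n a r b r' =
     op_mult N n (op_mult N n (spin_op a n r) (spin_op a n r))
                 (op_mult N n (spin_op b n r') (spin_op b n r'))"

end

theory Submission
 imports Defs "HOL-Analysis.Analysis" "HOL-Computational_Algebra.Polynomial" "HOL-Library.Transitive_Closure_Table"
begin

text \<open>Reflection positivity through bond reflections turns the probability of any local pattern into partition
  functions of homogeneous or striped patterns. In the \<open>z\<close>-basis the diagonal of the Gibbs weight is bounded above by
  splitting off the diagonal part of the Hamiltonian and by Gaussian bounds on the hopping part, and the partition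
  function is bounded below by Jensen's inequality on product states made of sine windows. The entropy of the states
  that agree up to \<open>1 / sqrt b\<close> on every \<open>z\<close>-plaquette, near the equator, shows that a spin with \<open>m\<^sup>2\<close> away from 0 and 1 is rare
  (order by disorder), and neighbours with \<open>m\<^sup>2\<close> near 0 and near 1 are exponentially rare, so a Peierls argument gives
  long range order for \<open>m\<^sup>2\<close>. The energy bound from convexity of the free energy makes the second component
  negligible, and an intertwiner exchanging the first and third component identifies their second moments.\<close>

text \<open>Only the first and third spin components occur in the Hamiltonian, so in the z-basis
  everything is a real matrix, and the ferromagnetic signs make the off-diagonal entries of the
  exponent nonnegative: the diagonal of the Gibbs matrix is a positive weight under which m at each
  site is an ordinary random variable. What shapes the estimates is that the classical energy does
  not distinguish the angles: the leading exponent is \<open>b\<close> per site at every angle, with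
  \<open>b\<close> the inverse temperature times the coupling. Bad spins can lose only by a power of
  \<open>b\<close>. The lower bound for the partition function carries a factor of order
  \<open>b^(1/4)\<close> for each of the \<open>N^2 / 4\<close> z-plaquettes, which has to beat a
  constant to the power \<open>N^2\<close>. All other errors must therefore be constant factors per
  site, uniformly in \<open>b\<close> and \<open>n\<close>; a spin magnitude of order
  \<open>b^2\<close> keeps the quantum corrections, of order \<open>b * (b / n)\<close> per site,
  bounded. A clash of neighbours is a relation between two sites, hence no product of one-site
  weights; the usual chessboard estimate cannot see it, and a second argument on rings, which counts
  clashes, takes its place.\<close>

definition mmul :: "'i set => ('i => 'i => real) => ('i => 'i => real) => 'i => 'i => real" where
 "mmul I A B = (%i j. \<Sum>k\<in>I. A i k * B k j)"

definition mid :: "'i => 'i => real" where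
 "mid = (%i j. if i = j then 1 else 0)"

definition msc :: "real => ('i => 'i => real) => 'i => 'i => real" where
 "msc t A = (%i j. t * A i j)"

fun mpow :: "'i set => ('i => 'i => real) => nat => 'i => 'i => real" where
 "mpow I A 0 = mid"
| "mpow I A (Suc k) = mmul I A (mpow I A k)"

definition mexp :: "'i set => ('i => 'i => real) => 'i => 'i => real" where
 "mexp I A = (%i j. \<Sum>k. mpow I A k i j / fact k)"

definition mtr :: "'i set => ('i => 'i => real) => real" where
 "mtr I A = (\<Sum>i\<in>I. A i i)"

definition mcomm :: "'i set => ('i => 'i => real) => ('i => 'i => real) => bool" where
 "mcomm I A B \<longleftrightarrow> (\<forall>i\<in>I. \<forall>j\<in>I. mmul I A B i j = mmul I B A i j)"

section \<open>Algebra of real matrices over a finite index set\<close>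

lemma msc_apply: "msc t A i j = t * A i j"
 by (simp add: msc_def)

lemma mmul_assoc: "mmul I (mmul I A B) C = mmul I A (mmul I B C)"
proof (intro ext)
 fix i j
 have "mmul I (mmul I A B) C i j = (\<Sum>k\<in>I. \<Sum>l\<in>I. A i l * B l k * C k j)"
  by (simp add: mmul_def sum_distrib_right)
 also have "... = (\<Sum>l\<in>I. \<Sum>k\<in>I. A i l * B l k * C k j)" by (rule sum.swap)
 also have "... = mmul I A (mmul I B C) i j"
  by (simp add: mmul_def sum_distrib_left mult.assoc)
 finally show "mmul I (mmul I A B) C i j = mmul I A (mmul I B C) i j" .
qed

lemma mmul_cong:
 assumes "!!k. k \<in> I ==> A i k = A' i k" "!!k. k \<in> I ==> B k j = B' k j"
 shows "mmul I A B i j = mmul I A' B' i j"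
 using assms by (simp add: mmul_def)

lemma mmul_mid_left: "finite I ==> i \<in> I ==> mmul I mid B i j = B i j"
 by (simp add: mmul_def mid_def if_distrib[of "%x. x * _"] cong: if_cong)

lemma mmul_mid_right: "finite I ==> j \<in> I ==> mmul I A mid i j = A i j"
 by (simp add: mmul_def mid_def if_distrib[of "%x. _ * x"] cong: if_cong)

lemma mmul_add_left: "mmul I (%i j. A i j + A' i j) B i j = mmul I A B i j + mmul I A' B i j"
 by (simp add: mmul_def ring_distribs sum.distrib)

lemma mmul_add_right: "mmul I A (%i j. B i j + B' i j) i j = mmul I A B i j + mmul I A B' i j"
 by (simp add: mmul_def ring_distribs sum.distrib)

lemma mmul_diff_right: "mmul I A (%i j. B i j - B' i j) i j = mmul I A B i j - mmul I A B' i j"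
 by (simp add: mmul_def ring_distribs sum_subtractf)

lemma mmul_diff_left: "mmul I (%i j. A i j - A' i j) B i j = mmul I A B i j - mmul I A' B i j"
 by (simp add: mmul_def ring_distribs sum_subtractf)

lemma mmul_msc_left: "mmul I (msc t A) B = msc t (mmul I A B)"
 by (simp add: mmul_def msc_def sum_distrib_left mult.assoc)

lemma mmul_msc_right: "mmul I A (msc t B) = msc t (mmul I A B)"
 by (simp add: mmul_def msc_def sum_distrib_left mult.left_commute)

lemma mmul_sum_left: "mmul I (%i j. \<Sum>a\<in>S. A a i j) B i j = (\<Sum>a\<in>S. mmul I (A a) B i j)"
 unfolding mmul_def sum_distrib_right by (rule sum.swap)

lemma mmul_sum_right: "mmul I A (%i j. \<Sum>a\<in>S. B a i j) i j = (\<Sum>a\<in>S. mmul I A (B a) i j)"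
 unfolding mmul_def sum_distrib_left by (rule sum.swap)

lemma mpow_msc: "mpow I (msc t A) k = msc (t ^ k) (mpow I A k)"
proof (induction k)
 case 0 show ?case by (simp add: msc_def)
next
 case (Suc k)
 show ?case by (simp only: mpow.simps Suc mmul_msc_left mmul_msc_right) (simp add: fun_eq_iff msc_apply)
qed

lemma mpow_cong:
 assumes "!!i j. i \<in> I ==> j \<in> I ==> A i j = B i j" "i \<in> I" "j \<in> I"
 shows "mpow I A k i j = mpow I B k i j"
 using assms(2,3)
proof (induction k arbitrary: i j)
 case (Suc k)
 then show ?case by (simp add: mmul_def assms(1))
qed simp

lemma mexp_cong:
 assumes "!!i j. i \<in> I ==> j \<in> I ==> A i j = B i j" "i \<in> I" "j \<in> I"
 shows "mexp I A i j = mexp I B i j"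
 using mpow_cong[OF assms] by (simp add: mexp_def)

lemma mcomm_sym: "mcomm I A B ==> mcomm I B A"
 by (simp add: mcomm_def)

lemma mcomm_refl: "mcomm I A A"
 by (simp add: mcomm_def)

lemma mcomm_msc_right: "mcomm I A B ==> mcomm I A (msc t B)"
 by (simp add: mcomm_def mmul_msc_left mmul_msc_right msc_apply)

lemma mcomm_mmul:
 assumes "mcomm I A B" "mcomm I A C"
 shows "mcomm I A (mmul I B C)"
 unfolding mcomm_def
proof (intro ballI)
 fix i j assume ij: "i \<in> I" "j \<in> I"
 have "mmul I A (mmul I B C) i j = mmul I (mmul I A B) C i j" by (simp add: mmul_assoc)
 also have "... = mmul I (mmul I B A) C i j"
  using assms(1) ij by (intro mmul_cong[of I "mmul I A B"]) (auto simp: mcomm_def)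
 also have "... = mmul I B (mmul I A C) i j" by (simp add: mmul_assoc)
 also have "... = mmul I B (mmul I C A) i j"
  using assms(2) ij by (intro mmul_cong[of I B _ B "mmul I A C"]) (auto simp: mcomm_def)
 finally show "mmul I A (mmul I B C) i j = mmul I (mmul I B C) A i j" by (simp add: mmul_assoc)
qed

lemma mcomm_sum:
 assumes "!!a. a \<in> S ==> mcomm I A (B a)"
 shows "mcomm I A (%i j. \<Sum>a\<in>S. B a i j)"
 using assms by (simp add: mcomm_def mmul_sum_left mmul_sum_right)

lemma mcomm_mid: "finite I ==> mcomm I A mid"
 by (simp add: mcomm_def mmul_mid_left mmul_mid_right)

lemma mcomm_mpow: "finite I ==> mcomm I A B ==> mcomm I A (mpow I B k)"
 by (induction k) (auto intro: mcomm_mid mcomm_mmul)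

lemma mpow_Suc_right:
 assumes "finite I" "i \<in> I" "j \<in> I"
 shows "mpow I A (Suc k) i j = mmul I (mpow I A k) A i j"
 using mcomm_mpow[OF assms(1) mcomm_refl, of A k] assms by (simp add: mcomm_def)

section \<open>The matrix exponential through its differential equation\<close>

locale fin_index =
 fixes I :: "'i set"
 assumes finI: "finite I"
begin

lemma mpow_bound:
 obtains c where "c >= 0" "!!k i j. i \<in> I ==> j \<in> I ==> \<bar>mpow I A k i j\<bar> <= c ^ k"
proof
 define c where "c = 1 + (\<Sum>i\<in>I. \<Sum>j\<in>I. \<bar>A i j\<bar>)"
 show c0: "c >= 0" by (auto simp: c_def intro!: add_nonneg_nonneg sum_nonneg)
 fix k i j assume "i \<in> I" "j \<in> I"
 then show "\<bar>mpow I A k i j\<bar> <= c ^ k"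
 proof (induction k arbitrary: i j)
  case (Suc k)
  have row: "(\<Sum>l\<in>I. \<bar>A i l\<bar>) <= c"
  proof -
   have "(\<Sum>l\<in>I. \<bar>A i l\<bar>) <= (\<Sum>i\<in>I. \<Sum>j\<in>I. \<bar>A i j\<bar>)"
    using member_le_sum[of i I "%i. \<Sum>j\<in>I. \<bar>A i j\<bar>"] Suc finI by (auto simp: sum_nonneg)
   then show ?thesis by (simp add: c_def)
  qed
  have "\<bar>mpow I A (Suc k) i j\<bar> <= (\<Sum>l\<in>I. \<bar>A i l\<bar> * \<bar>mpow I A k l j\<bar>)"
   by (simp add: mmul_def sum_abs[THEN order_trans] abs_mult)
  also have "... <= (\<Sum>l\<in>I. \<bar>A i l\<bar> * c ^ k)"
   using Suc by (intro sum_mono mult_left_mono) auto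
  also have "... = (\<Sum>l\<in>I. \<bar>A i l\<bar>) * c ^ k" by (simp add: sum_distrib_right)
  also have "... <= c * c ^ k" using row c0 by (intro mult_right_mono) auto
  finally show ?case by simp
 qed (auto simp: mid_def)
qed

lemma summable_mpow: 
 assumes "i \<in> I" "j \<in> I"
 shows "summable (%k. mpow I A k i j / fact k)"
proof -
 obtain c where c: "c >= 0" "!!k i j. i \<in> I ==> j \<in> I ==> \<bar>mpow I A k i j\<bar> <= c ^ k"
  using mpow_bound by blast
 show ?thesis
 proof (rule summable_comparison_test')
  show "summable (%k. c ^ k / fact k)"
   using summable_exp[of c] by (simp add: field_simps)
  show "norm (mpow I A k i j / fact k) <= c ^ k / fact k" if "0 <= k" for k
   using c(2)[OF assms] by (simp add: divide_right_mono)
 qed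
qed

lemma mexp_sums: "i \<in> I ==> j \<in> I ==> (%k. mpow I A k i j / fact k) sums mexp I A i j"
 unfolding mexp_def using summable_mpow by (simp add: summable_sums)

lemma mmul_mexp_sums:
 assumes "j \<in> I"
 shows "(%k. mmul I B (mpow I A k) i j / fact k) sums mmul I B (mexp I A) i j"
proof -
 have "(%k. \<Sum>l\<in>I. B i l * (mpow I A k l j / fact k)) sums (\<Sum>l\<in>I. B i l * mexp I A l j)"
  using assms by (intro sums_sum sums_mult mexp_sums)
 then show ?thesis by (simp add: mmul_def sum_divide_distrib)
qed

lemma mexp_mmul_sums:
 assumes "i \<in> I"
 shows "(%k. mmul I (mpow I A k) B i j / fact k) sums mmul I (mexp I A) B i j"
proof -
 have "(%k. \<Sum>l\<in>I. (mpow I A k i l / fact k) * B l j) sums (\<Sum>l\<in>I. mexp I A i l * B l j)"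
  using assms by (intro sums_sum sums_mult2 mexp_sums)
 then show ?thesis by (simp add: mmul_def sum_divide_distrib)
qed

lemma mcomm_mexp:
 assumes "mcomm I B A" shows "mcomm I B (mexp I A)"
 unfolding mcomm_def
proof (intro ballI)
 fix i j assume ij: "i \<in> I" "j \<in> I"
 have "mmul I B (mpow I A k) i j = mmul I (mpow I A k) B i j" for k
  using mcomm_mpow[OF finI assms, of k] ij by (simp add: mcomm_def)
 then show "mmul I B (mexp I A) i j = mmul I (mexp I A) B i j"
  using sums_unique2[OF mmul_mexp_sums[OF ij(2), of B A i]] mexp_mmul_sums[OF ij(1), of A B j]
  by simp
qed

lemma mexp_0: 
 assumes ij: "i \<in> I" "j \<in> I" shows "mexp I (msc 0 A) i j = mid i j"
proof -
 have "(%k. mpow I (msc 0 A) k i j / fact k) sums (\<Sum>k\<in>{0}. mpow I (msc 0 A) k i j / fact k)"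
  by (rule sums_finite) (auto simp: mpow_msc msc_apply)
 with mexp_sums[OF ij, of "msc 0 A"] 
 have "mexp I (msc 0 A) i j = (\<Sum>k\<in>{0}. mpow I (msc 0 A) k i j / fact k)" by (rule sums_unique2)
 then show ?thesis by simp
qed

text \<open>Entrywise this is a power series in \<open>t\<close>; \<open>diffs\<close> shifts the
  coefficients by one, and the factor released in this way is the matrix \<open>A\<close>.\<close>

lemma mexp_deriv:
 assumes ij: "i \<in> I" "j \<in> I"
 shows "((%t. mexp I (msc t A) i j) has_real_derivative mmul I A (mexp I (msc t A)) i j) (at t)"
proof -
 define c where "c = (%k. mpow I A k i j / fact k)"
 have e: "mexp I (msc t A) i j = (\<Sum>k. c k * t ^ k)" for t
  by (simp add: mexp_def mpow_msc msc_apply c_def mult.commute)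
 have s: "summable (%k. c k * t ^ k)" for t
  using summable_mpow[OF ij, of "msc t A"] by (simp add: mpow_msc msc_apply c_def mult.commute)
 have "((%t. \<Sum>k. c k * t ^ k) has_real_derivative (\<Sum>k. diffs c k * t ^ k)) (at t)"
  by (rule termdiffs_strong_converges_everywhere) (rule s)
 moreover have "(\<Sum>k. diffs c k * t ^ k) = mmul I A (mexp I (msc t A)) i j"
 proof -
  have "diffs c k * t ^ k = mmul I A (mpow I (msc t A) k) i j / fact k" for k
   by (simp add: diffs_def c_def mpow_msc mmul_msc_right msc_apply)
  then show ?thesis using mmul_mexp_sums[OF ij(2), of A "msc t A" i] by (simp add: sums_iff)
 qed
 ultimately show ?thesis by (simp add: e)
qed

lemma mexp_deriv':
 assumes ij: "i \<in> I" "j \<in> I"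
 shows "((%t. mexp I (msc t A) i j) has_real_derivative mmul I (mexp I (msc t A)) A i j) (at t)"
proof -
 have "mcomm I A (mexp I (msc t A))" by (intro mcomm_mexp mcomm_msc_right mcomm_refl)
 then show ?thesis using mexp_deriv[OF ij, of A t] ij by (simp add: mcomm_def)
qed

lemma mmul_deriv:
 assumes "!!k. k \<in> I ==> ((%t. F t i k) has_real_derivative F' i k) (at t)"
  and "!!k. k \<in> I ==> ((%t. G t k j) has_real_derivative G' k j) (at t)"
 shows "((%t. mmul I (F t) (G t) i j) has_real_derivative
      mmul I F' (G t) i j + mmul I (F t) G' i j) (at t)"
proof -
 have "((%t. \<Sum>k\<in>I. F t i k * G t k j) has_real_derivative
   (\<Sum>k\<in>I. F' i k * G t k j + G' k j * F t i k)) (at t)"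
  using assms by (intro DERIV_sum DERIV_mult) auto
 then show ?thesis by (simp add: mmul_def sum.distrib mult.commute)
qed

lemma mexp_deriv_backward:
 assumes ij: "i \<in> I" "j \<in> I"
 shows "((%s. mexp I (msc (t - s) A) i j) has_real_derivative
   - mmul I (mexp I (msc (t - s) A)) A i j) (at s)"
proof -
 have "((%s. t - s) has_real_derivative -1) (at s)" by (auto intro!: derivative_eq_intros)
 from DERIV_chain2[OF mexp_deriv'[OF ij] this, of A] show ?thesis by simp
qed


text \<open>Duhamel's device: the derivative along the path sees only the difference of the two
  generators. It yields uniqueness if the difference vanishes, a perturbation bound if it is small,
  and an entrywise comparison if it is nonnegative.\<close>

lemma interpolation_deriv:
 assumes Y: "!!i j. i \<in> I ==> j \<in> I ==> ((%s. Y s i j) has_real_derivative mmul I (B s) (Y s) i j) (at s)"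
  and ij: "i \<in> I" "j \<in> I"
 shows "((%s. mmul I (mexp I (msc (t - s) A)) (Y s) i j) has_real_derivative
   mmul I (mexp I (msc (t - s) A)) (mmul I (%i j. B s i j - A i j) (Y s)) i j) (at s)"
proof -
 have "((%s. mmul I (mexp I (msc (t - s) A)) (Y s) i j) has_real_derivative
   mmul I (%i j. - mmul I (mexp I (msc (t - s) A)) A i j) (Y s) i j
   + mmul I (mexp I (msc (t - s) A)) (mmul I (B s) (Y s)) i j) (at s)"
  using ij by (intro mmul_deriv mexp_deriv_backward Y) auto
 also have "mmul I (%i j. - mmul I (mexp I (msc (t - s) A)) A i j) (Y s) i j
   = - mmul I (mexp I (msc (t - s) A)) (mmul I A (Y s)) i j"
  by (simp add: mmul_assoc[symmetric]) (simp add: mmul_def sum_negf)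
 also have "- mmul I (mexp I (msc (t - s) A)) (mmul I A (Y s)) i j
   + mmul I (mexp I (msc (t - s) A)) (mmul I (B s) (Y s)) i j
   = mmul I (mexp I (msc (t - s) A)) (mmul I (%i j. B s i j - A i j) (Y s)) i j"
 proof -
  have "mmul I (%i j. B s i j - A i j) (Y s) = (%i j. mmul I (B s) (Y s) i j - mmul I A (Y s) i j)"
   by (intro ext) (rule mmul_diff_left)
  then show ?thesis by (simp add: mmul_diff_right)
 qed
 finally show ?thesis .
qed

text \<open>The product formulas below, for commuting sums, diagonal matrices and independent
  coordinates, are all proved by exhibiting a solution of this equation, which avoids any
  manipulation of double series.\<close>

lemma mexp_ode_unique:
 assumes Y: "!!s i j. i \<in> I ==> j \<in> I ==> ((%s. Y s i j) has_real_derivative mmul I A (Y s) i j) (at s)"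
  and Y0: "!!i j. i \<in> I ==> j \<in> I ==> Y 0 i j = mid i j"
  and ij: "i \<in> I" "j \<in> I"
 shows "Y t i j = mexp I (msc t A) i j"
proof -
 let ?Z = "%s. mmul I (mexp I (msc (t - s) A)) (Y s) i j"
 have "(?Z has_real_derivative 0) (at s)" for s
  using interpolation_deriv[of Y "%_. A" s i j t A] Y ij by (simp add: mmul_def)
 then have "?Z t = ?Z 0" by (intro DERIV_isconst_all) auto
 moreover have "?Z t = Y t i j"
 proof -
  have "?Z t = mmul I mid (Y t) i j"
   using ij by (intro mmul_cong) (auto simp: mexp_0)
  then show ?thesis using ij finI by (simp add: mmul_mid_left)
 qed
 moreover have "?Z 0 = mexp I (msc t A) i j"
 proof -
  have "?Z 0 = mmul I (mexp I (msc t A)) mid i j"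
   using ij by (intro mmul_cong) (auto simp: Y0)
  then show ?thesis using ij finI by (simp add: mmul_mid_right)
 qed
 ultimately show ?thesis by simp
qed

lemma mexp_add:
 assumes "mcomm I A B" and ij: "i \<in> I" "j \<in> I"
 shows "mexp I (%i j. A i j + B i j) i j = mmul I (mexp I A) (mexp I B) i j"
proof -
 define Y where "Y = (%t. mmul I (mexp I (msc t A)) (mexp I (msc t B)))"
 have "Y 1 i j = mexp I (msc 1 (%i j. A i j + B i j)) i j"
 proof (rule mexp_ode_unique[OF _ _ ij])
  fix s i j assume ij: "i \<in> I" "j \<in> I"
  have "((%t. Y t i j) has_real_derivative
    mmul I (mmul I A (mexp I (msc s A))) (mexp I (msc s B)) i j
    + mmul I (mexp I (msc s A)) (mmul I B (mexp I (msc s B))) i j) (at s)"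
   unfolding Y_def using ij by (intro mmul_deriv mexp_deriv) auto
  also have "mmul I (mexp I (msc s A)) (mmul I B (mexp I (msc s B))) i j
    = mmul I (mmul I B (mexp I (msc s A))) (mexp I (msc s B)) i j"
  proof -
   have "mcomm I B (mexp I (msc s A))"
    by (intro mcomm_mexp mcomm_msc_right mcomm_sym[OF assms(1)])
   then have "mmul I (mmul I (mexp I (msc s A)) B) (mexp I (msc s B)) i j
     = mmul I (mmul I B (mexp I (msc s A))) (mexp I (msc s B)) i j"
    using ij by (intro mmul_cong[of I "mmul I (mexp I (msc s A)) B"]) (auto simp: mcomm_def)
   then show ?thesis by (simp only: mmul_assoc)
  qed
  finally show "((%s. Y s i j) has_real_derivative
     mmul I (%i j. A i j + B i j) (Y s) i j) (at s)"
   by (simp add: mmul_add_left Y_def mmul_assoc)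
 next
  fix i j assume ij: "i \<in> I" "j \<in> I"
  have "Y 0 i j = mmul I mid mid i j"
   unfolding Y_def using ij by (intro mmul_cong) (auto simp: mexp_0)
  then show "Y 0 i j = mid i j" using ij finI by (simp add: mmul_mid_left)
 qed
 then show ?thesis by (simp add: Y_def msc_def)
qed

lemma mexp_diag:
 assumes ij: "i \<in> I" "j \<in> I"
 shows "mexp I (%i j. if i = j then d i else 0) i j = (if i = j then exp (d i) else 0)"
proof -
 have "(%t i j. if i = j then exp (t * d i) else 0) 1 i j
   = mexp I (msc 1 (%i j. if i = j then d i else 0)) i j"
 proof (rule mexp_ode_unique[OF _ _ ij])
  fix s i j assume ij: "i \<in> I" "j \<in> I"
  have "mmul I (%i j. if i = j then d i else 0) (%i j. if i = j then exp (s * d i) else 0) i j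
   = (if i = j then exp (s * d i) * d i else 0)"
  proof -
   have "mmul I (%i j. if i = j then d i else 0) (%i j. if i = j then exp (s * d i) else 0) i j
    = (\<Sum>k\<in>I. if i = k then d i * (if i = j then exp (s * d i) else 0) else 0)"
    unfolding mmul_def by (intro sum.cong) auto
   then show ?thesis using ij finI by auto
  qed
  then show "((%s. if i = j then exp (s * d i) else 0) has_real_derivative
    mmul I (%i j. if i = j then d i else 0) (%i j. if i = j then exp (s * d i) else 0) i j) (at s)"
   by (auto intro!: derivative_eq_intros)
 qed (auto simp: mid_def)
 then show ?thesis unfolding msc_def by (simp only: mult_1)
qed

lemma mexp_shift:
 assumes ij: "i \<in> I" "j \<in> I"
 shows "mexp I (%i j. A i j + c * mid i j) i j = exp c * mexp I A i j"
proof -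
 have "mexp I (%i j. A i j + c * mid i j) i j = mmul I (mexp I A) (mexp I (%i j. c * mid i j)) i j"
  using mcomm_msc_right[OF mcomm_mid[OF finI], of A c] ij
  by (intro mexp_add) (simp_all add: msc_def)
 also have "... = mmul I (mexp I A) (msc (exp c) mid) i j"
 proof (intro mmul_cong refl)
  fix k assume k: "k \<in> I"
  have "mexp I (%i j. c * mid i j) k j = mexp I (%i j. if i = j then c else 0) k j"
   by (rule mexp_cong) (use k ij in \<open>auto simp: mid_def\<close>)
  then show "mexp I (%i j. c * mid i j) k j = msc (exp c) mid k j"
   using mexp_diag[OF k ij(2), of "%_. c"] by (auto simp: msc_def mid_def)
 qed
 also have "... = exp c * mexp I A i j"
  using ij finI by (simp add: mmul_msc_right msc_apply mmul_mid_right)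
 finally show ?thesis .
qed

lemma mpow_nonneg:
 assumes "!!i j. i \<in> I ==> j \<in> I ==> A i j >= 0" "i \<in> I" "j \<in> I"
 shows "mpow I A k i j >= 0"
 using assms(2,3)
 by (induction k arbitrary: i j) (auto simp: mid_def mmul_def assms(1) intro!: sum_nonneg mult_nonneg_nonneg)

lemma mexp_nonneg0:
 assumes "!!i j. i \<in> I ==> j \<in> I ==> A i j >= 0" "i \<in> I" "j \<in> I"
 shows "mexp I A i j >= 0"
 unfolding mexp_def using assms by (intro suminf_nonneg summable_mpow) (auto simp: mpow_nonneg)

text \<open>Negative diagonal entries do no harm: adding a multiple of the identity to
  \<open>A\<close> only multiplies the exponential by a positive number.\<close>

lemma mexp_nonneg:
 assumes A: "!!i j. i \<in> I ==> j \<in> I ==> i ~= j ==> A i j >= 0" and ij: "i \<in> I" "j \<in> I"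
 shows "mexp I A i j >= 0"
proof -
 define c where "c = (\<Sum>i\<in>I. \<bar>A i i\<bar>)"
 have c: "\<bar>A i i\<bar> <= c" if "i \<in> I" for i
  unfolding c_def using that finI by (intro member_le_sum) auto
 have "mexp I (%i j. A i j + c * mid i j) i j >= 0"
 proof (rule mexp_nonneg0[OF _ ij])
  fix i j assume "i \<in> I" "j \<in> I"
  then show "A i j + c * mid i j >= 0" using A[of i j] c[of i] by (auto simp: mid_def)
 qed
 then show ?thesis by (simp add: mexp_shift[OF ij] zero_le_mult_iff)
qed

lemma mexp_half:
 assumes ij: "i \<in> I" "j \<in> I"
 shows "mexp I A i j = mmul I (mexp I (msc (1/2) A)) (mexp I (msc (1/2) A)) i j"
proof -
 have "mexp I A i j = mexp I (%i j. msc (1/2) A i j + msc (1/2) A i j) i j"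
  by (simp add: msc_def)
 then show ?thesis using mexp_add[OF mcomm_refl ij, of "msc (1/2) A"] by simp
qed

lemma mpow_sym:
 assumes "!!i j. i \<in> I ==> j \<in> I ==> A i j = A j i" "i \<in> I" "j \<in> I"
 shows "mpow I A k i j = mpow I A k j i"
 using assms(2,3)
proof (induction k arbitrary: i j)
 case 0 then show ?case by (auto simp: mid_def)
next
 case (Suc k)
 have "mpow I A (Suc k) i j = mmul I (mpow I A k) A i j"
  using Suc.prems by (intro mpow_Suc_right[OF finI])
 also have "... = mpow I A (Suc k) j i"
  unfolding mpow.simps mmul_def
  by (intro sum.cong refl) (use Suc assms(1) in \<open>auto simp: mult.commute\<close>)
 finally show ?case .
qed

lemma mexp_sym:
 assumes "!!i j. i \<in> I ==> j \<in> I ==> A i j = A j i" "i \<in> I" "j \<in> I"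
 shows "mexp I A i j = mexp I A j i"
 using mpow_sym[OF assms] by (simp add: mexp_def)

end

section \<open>Quadratic forms, traces and convexity\<close>

lemma quadratic_nonneg_imp_discriminant:
 fixes a b c :: real
 assumes nn: "!!t. a + 2 * t * b + t\<^sup>2 * c >= 0"
 shows "b\<^sup>2 <= a * c"
proof (cases "c = 0")
 case True
 have "b = 0"
 proof (rule ccontr)
  assume "b ~= 0"
  have "a + 2 * (- (a + 1) / (2 * b)) * b = -1" using \<open>b ~= 0\<close> by (simp add: field_simps)
  with nn[of "- (a + 1) / (2 * b)"] True show False by simp
 qed
 with True show ?thesis by simp
next
 case False
 have c: "c > 0"
 proof (rule ccontr)
  assume "~ c > 0"
  with False have c: "c < 0" by simp
  \<comment> \<open>With \<open>c < 0\<close> this point lies so far out that the quadratic term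
    outweighs the linear and the constant one.\<close>
  define t where "t = (1 + \<bar>a\<bar> + 2 * \<bar>b\<bar>) / (- c) + 1"
  have t1: "t >= 1" unfolding t_def using c by (simp add: divide_nonneg_nonneg del: minus_divide_right divide_minus_right)
  have "t * (-c) >= 1 + \<bar>a\<bar> + 2 * \<bar>b\<bar>" using c by (simp add: t_def field_simps)
  then have "t * (t * (-c)) >= t * (1 + \<bar>a\<bar> + 2 * \<bar>b\<bar>)" using t1 by (intro mult_left_mono) auto
  then have "t\<^sup>2 * c <= - (t + t * \<bar>a\<bar> + 2 * t * \<bar>b\<bar>)" by (simp add: power2_eq_square algebra_simps)
  moreover have "t * \<bar>a\<bar> >= \<bar>a\<bar>" using t1 by (simp add: mult_le_cancel_right1)
  moreover have "2 * t * b <= 2 * t * \<bar>b\<bar>" using t1 by simp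
  ultimately have "a + 2 * t * b + t\<^sup>2 * c < 0" using t1 by linarith
  with nn[of t] show False by simp
 qed
 have "a + 2 * (- b / c) * b + (- b / c)\<^sup>2 * c = a - b\<^sup>2 / c"
  using c by (simp add: power2_eq_square field_simps)
 with nn[of "- b / c"] have "b\<^sup>2 / c <= a" by simp
 with c show ?thesis by (simp add: field_simps)
qed

definition qf :: "'i set => ('i => 'i => real) => ('i => real) => real" where
 "qf I A v = (\<Sum>i\<in>I. \<Sum>j\<in>I. v i * A i j * v j)"

definition mv :: "'i set => ('i => 'i => real) => ('i => real) => 'i => real" where
 "mv I A v = (%i. \<Sum>j\<in>I. A i j * v j)"

definition mtp :: "('i => 'i => real) => 'i => 'i => real" where
 "mtp A = (%i j. A j i)"

definition msym :: "'i set => ('i => 'i => real) => bool" where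
 "msym I A \<longleftrightarrow> (\<forall>i\<in>I. \<forall>j\<in>I. A i j = A j i)"

lemma msym_msc: "msym I A ==> msym I (msc t A)"
 by (simp add: msym_def msc_apply)

lemma qf_cong: "(!!i j. i \<in> I ==> j \<in> I ==> A i j = B i j) ==> qf I A v = qf I B v"
 by (simp add: qf_def)

lemma qf_mid: "finite I ==> qf I mid v = (\<Sum>i\<in>I. (v i)\<^sup>2)"
 by (auto simp: qf_def mid_def if_distrib[of "%x. _ * x * _"] power2_eq_square cong: if_cong intro!: sum.cong)

lemma qf_add: "qf I (%i j. A i j + B i j) v = qf I A v + qf I B v"
 by (simp add: qf_def algebra_simps sum.distrib)

lemma qf_msc: "qf I (msc c A) v = c * qf I A v"
 by (simp add: qf_def msc_apply sum_distrib_left mult_ac)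

lemma qf_sandwich:
 assumes "msym I B"
 shows "qf I (mmul I B (mmul I C B)) v = qf I C (mv I B v)"
proof -
 have "qf I (mmul I B (mmul I C B)) v
  = (\<Sum>i\<in>I. \<Sum>j\<in>I. \<Sum>k\<in>I. \<Sum>l\<in>I. (B k i * v i) * C k l * (B l j * v j))"
  unfolding qf_def mmul_def sum_distrib_left sum_distrib_right
  using assms by (intro sum.cong refl) (auto simp: msym_def mult_ac)
 also have "... = (\<Sum>i\<in>I. \<Sum>k\<in>I. \<Sum>j\<in>I. \<Sum>l\<in>I. (B k i * v i) * C k l * (B l j * v j))"
  by (intro sum.cong refl sum.swap)
 also have "... = (\<Sum>k\<in>I. \<Sum>i\<in>I. \<Sum>j\<in>I. \<Sum>l\<in>I. (B k i * v i) * C k l * (B l j * v j))"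
  by (rule sum.swap)
 also have "... = (\<Sum>k\<in>I. \<Sum>i\<in>I. \<Sum>l\<in>I. \<Sum>j\<in>I. (B k i * v i) * C k l * (B l j * v j))"
  by (intro sum.cong refl sum.swap)
 also have "... = (\<Sum>k\<in>I. \<Sum>l\<in>I. \<Sum>i\<in>I. \<Sum>j\<in>I. (B k i * v i) * C k l * (B l j * v j))"
  by (intro sum.cong refl sum.swap)
 also have "... = qf I C (mv I B v)"
  unfolding qf_def mv_def sum_distrib_left sum_distrib_right
  by (intro sum.cong refl sum.swap)
 finally show ?thesis .
qed

lemma mcomm_add: "mcomm I A B ==> mcomm I A C ==> mcomm I A (%i j. B i j + C i j)"
 by (simp add: mcomm_def mmul_add_left mmul_add_right)

context fin_index begin

lemma msym_mexp: "msym I A ==> msym I (mexp I A)"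
 by (auto simp: msym_def intro!: mexp_sym)

lemma qf_mmul_self:
 assumes "msym I B"
 shows "qf I (mmul I B B) v = (\<Sum>k\<in>I. (mv I B v k)\<^sup>2)"
proof -
 have "qf I (mmul I B B) v = qf I (mmul I B (mmul I mid B)) v"
  by (intro qf_cong mmul_cong) (auto simp: mmul_mid_left finI)
 then show ?thesis using assms by (simp add: qf_sandwich qf_mid finI)
qed

lemma qf_mexp_square:
 assumes "msym I A"
 shows "qf I (mexp I A) v = (\<Sum>k\<in>I. (mv I (mexp I (msc (1/2) A)) v k)\<^sup>2)"
proof -
 have "qf I (mexp I A) v = qf I (mmul I (mexp I (msc (1/2) A)) (mexp I (msc (1/2) A))) v"
  by (intro qf_cong mexp_half)
 then show ?thesis using assms by (simp add: qf_mmul_self msym_mexp msym_msc)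
qed

lemma qf_mexp_nonneg: "msym I A ==> qf I (mexp I A) v >= 0"
 by (simp add: qf_mexp_square sum_nonneg)

lemma qf_deriv:
 assumes "!!i j. i \<in> I ==> j \<in> I ==> ((%t. F t i j) has_real_derivative F' i j) (at t)"
 shows "((%t. qf I (F t) v) has_real_derivative qf I F' v) (at t)"
 unfolding qf_def using assms
 by (auto intro!: derivative_eq_intros sum.cong)

text \<open>The function \<open>t -> qf I (mexp I (msc t A)) v\<close> is convex, because its second
  derivative is the form of the exponential at the vector \<open>A v\<close>, which is nonnegative;
  so it lies above its tangent at 0. This replaces diagonalisation throughout.\<close>

lemma qf_mexp_ge_linear:
 assumes sym: "msym I A"
 shows "qf I (mexp I A) v >= (\<Sum>i\<in>I. (v i)\<^sup>2) + qf I A v"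
proof -
 let ?E = "%t. mexp I (msc t A)"
 let ?f = "%t. qf I (?E t) v" and ?f1 = "%t. qf I (mmul I A (?E t)) v"
  and ?f2 = "%t. qf I (mmul I A (mmul I (?E t) A)) v"
 have d1: "(?f has_real_derivative ?f1 t) (at t)" for t
  by (intro qf_deriv mexp_deriv)
 have d2: "(?f1 has_real_derivative ?f2 t) (at t)" for t
 proof (intro qf_deriv)
  fix i j assume ij: "i \<in> I" "j \<in> I"
  have "((%t. mmul I A (?E t) i j) has_real_derivative
    mmul I (%i j. 0) (?E t) i j + mmul I A (mmul I (?E t) A) i j) (at t)"
   using ij by (intro mmul_deriv mexp_deriv') auto
  then show "((%t. mmul I A (?E t) i j) has_real_derivative mmul I A (mmul I (?E t) A) i j) (at t)"
   by (simp add: mmul_def)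
 qed
 have nn: "?f2 t >= 0" for t
  using sym by (simp add: qf_sandwich qf_mexp_nonneg msym_msc)
 obtain x where x: "0 < x" "x < 1" "?f 1 - ?f 0 = (1 - 0) * ?f1 x"
  using MVT2[of 0 1 ?f ?f1] d1 by auto
 have "?f1 0 <= ?f1 x"
 proof (rule DERIV_nonneg_imp_nondecreasing[of 0 x ?f1])
  show "\<exists>z. (?f1 has_real_derivative z) (at y) & 0 <= z" for y
   using d2[of y] nn[of y] by blast
 qed (use x in simp)
 moreover have "?f1 0 = qf I A v"
 proof (intro qf_cong)
  fix i j assume ij: "i \<in> I" "j \<in> I"
  have "mmul I A (?E 0) i j = mmul I A mid i j"
   using ij by (intro mmul_cong) (auto simp: mexp_0)
  then show "mmul I A (?E 0) i j = A i j" using ij by (simp add: mmul_mid_right finI)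
 qed
 moreover have "?f 0 = (\<Sum>i\<in>I. (v i)\<^sup>2)"
  using qf_cong[of I "?E 0" mid v] by (simp add: mexp_0 qf_mid finI)
 moreover have "?f 1 = qf I (mexp I A) v" by (simp add: msc_def)
 ultimately show ?thesis using x(3) by simp
qed

text \<open>Shift \<open>A\<close> by its mean in the state \<open>v\<close>: the tangent bound for
  the shifted matrix has slope zero, and undoing the shift produces the exponential of the
  mean.\<close>

lemma qf_mexp_jensen:
 assumes sym: "msym I A" and s: "(\<Sum>i\<in>I. (v i)\<^sup>2) = s" "s > 0"
 shows "qf I (mexp I A) v >= s * exp (qf I A v / s)"
proof -
 define c where "c = qf I A v / s"
 define A' where "A' = (%i j. A i j + (-c) * mid i j)"
 have "msym I A'" using sym by (auto simp: A'_def msym_def mid_def)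
 from qf_mexp_ge_linear[OF this, of v]
 have "qf I (mexp I A') v >= s + qf I A' v" using s by simp
 also have "qf I A' v = qf I A v + (-c) * s"
  using qf_add[of I A "msc (-c) mid" v] s(1) by (simp add: A'_def msc_apply qf_mid finI qf_msc)
 also have "s + (qf I A v + (-c) * s) = s" using s by (simp add: c_def)
 finally have 1: "qf I (mexp I A') v >= s" .
 have "qf I (mexp I A') v = qf I (msc (exp (-c)) (mexp I A)) v"
  unfolding A'_def by (intro qf_cong) (simp add: mexp_shift[of _ _ A "-c", simplified] msc_apply)
 with 1 have "exp (-c) * qf I (mexp I A) v >= s" by (simp add: qf_msc)
 then show ?thesis unfolding c_def[symmetric] by (simp add: exp_minus field_simps)
qed

text \<open>Cauchy-Schwarz with the square root \<open>exp (A / 2)\<close>. Trial vectors supported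
  on disjoint sets \<open>U\<close> thus draw on disjoint parts of the trace, so that lower bounds
  obtained from many of them can be added.\<close>

lemma qf_mexp_le_block_trace:
 assumes sym: "msym I A" and U: "U <= I" and v: "!!i. i \<in> I - U ==> v i = 0"
 shows "qf I (mexp I A) v <= (\<Sum>i\<in>I. (v i)\<^sup>2) * (\<Sum>i\<in>U. mexp I A i i)"
proof -
 let ?B = "mexp I (msc (1/2) A)"
 have fU: "finite U" using U finI finite_subset by blast
 have sB: "msym I ?B" using sym by (simp add: msym_mexp msym_msc)
 have "qf I (mexp I A) v = (\<Sum>k\<in>I. (\<Sum>j\<in>U. ?B k j * v j)\<^sup>2)"
  unfolding qf_mexp_square[OF sym] mv_def
  using U v finI by (intro sum.cong refl arg_cong[of _ _ "%x. x\<^sup>2"] sum.mono_neutral_right) auto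
 also have "... <= (\<Sum>k\<in>I. (\<Sum>j\<in>U. (?B k j)\<^sup>2) * (\<Sum>j\<in>U. (v j)\<^sup>2))"
  by (intro sum_mono Cauchy_Schwarz_ineq_sum)
 also have "... = (\<Sum>j\<in>U. (v j)\<^sup>2) * (\<Sum>k\<in>I. \<Sum>j\<in>U. (?B k j)\<^sup>2)"
  by (simp add: sum_distrib_left mult.commute)
 also have "(\<Sum>j\<in>U. (v j)\<^sup>2) = (\<Sum>i\<in>I. (v i)\<^sup>2)"
  using U v finI by (intro sum.mono_neutral_left) auto
 also have "(\<Sum>k\<in>I. \<Sum>j\<in>U. (?B k j)\<^sup>2) = (\<Sum>j\<in>U. \<Sum>k\<in>I. (?B k j)\<^sup>2)" by (rule sum.swap)
 also have "... = (\<Sum>i\<in>U. mexp I A i i)"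
  using U sB by (intro sum.cong refl) (auto simp: mexp_half[of _ _ A] mmul_def msym_def power2_eq_square subset_iff intro!: sum.cong)
 finally show ?thesis .
qed

lemma mtr_mmul_comm: "mtr I (mmul I A B) = mtr I (mmul I B A)"
 unfolding mtr_def mmul_def by (subst sum.swap) (simp add: mult.commute)

lemma mtr_sandwich: "mtr I (mmul I (mmul I (mtp B) B) G) = (\<Sum>k\<in>I. qf I G (B k))"
 if "msym I G"
proof -
 have "mtr I (mmul I (mmul I (mtp B) B) G) = (\<Sum>i\<in>I. \<Sum>j\<in>I. \<Sum>k\<in>I. B k i * B k j * G j i)"
  by (simp add: mtr_def mmul_def mtp_def sum_distrib_right)
 also have "... = (\<Sum>i\<in>I. \<Sum>k\<in>I. \<Sum>j\<in>I. B k i * G i j * B k j)"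
  using that by (subst sum.swap) (intro sum.cong refl, auto simp: msym_def mult_ac)
 also have "... = (\<Sum>k\<in>I. qf I G (B k))"
  unfolding qf_def by (rule sum.swap)
 finally show ?thesis .
qed

lemma mtr_square_nonneg: "msym I A ==> mtr I (mmul I (mmul I (mtp B) B) (mexp I A)) >= 0"
 by (simp add: mtr_sandwich msym_mexp sum_nonneg qf_mexp_nonneg)

text \<open>The form \<open>B, C -> tr (B^T C exp A)\<close> is symmetric, because
  \<open>exp A\<close> is, and positive semidefinite by \<open>mtr_square_nonneg\<close>.\<close>

lemma mtr_cauchy_schwarz:
 assumes "msym I A"
 shows "(mtr I (mmul I (mmul I (mtp B) C) (mexp I A)))\<^sup>2
   <= mtr I (mmul I (mmul I (mtp B) B) (mexp I A)) * mtr I (mmul I (mmul I (mtp C) C) (mexp I A))"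
proof (rule quadratic_nonneg_imp_discriminant)
 fix t :: real
 let ?G = "mexp I A"
 define D where "D = (%i j. B i j + t * C i j)"
 have sG: "msym I ?G" using assms by (rule msym_mexp)
 have exp1: "mtr I (mmul I (mmul I (mtp X) Y) ?G) = (\<Sum>k\<in>I. \<Sum>i\<in>I. \<Sum>j\<in>I. X k i * ?G i j * Y k j)" for X Y
 proof -
  have "mtr I (mmul I (mmul I (mtp X) Y) ?G) = (\<Sum>i\<in>I. \<Sum>j\<in>I. \<Sum>k\<in>I. X k i * Y k j * ?G j i)"
   by (simp add: mtr_def mmul_def mtp_def sum_distrib_right)
  also have "... = (\<Sum>i\<in>I. \<Sum>k\<in>I. \<Sum>j\<in>I. X k i * ?G i j * Y k j)"
   using sG by (subst sum.swap) (intro sum.cong refl, auto simp: msym_def mult_ac)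
  also have "... = (\<Sum>k\<in>I. \<Sum>i\<in>I. \<Sum>j\<in>I. X k i * ?G i j * Y k j)" by (rule sum.swap)
  finally show ?thesis .
 qed
 have symm: "mtr I (mmul I (mmul I (mtp C) B) ?G) = mtr I (mmul I (mmul I (mtp B) C) ?G)"
  unfolding exp1
 proof (rule sum.cong[OF refl])
  fix k
  have "(\<Sum>i\<in>I. \<Sum>j\<in>I. C k i * ?G i j * B k j) = (\<Sum>j\<in>I. \<Sum>i\<in>I. C k i * ?G i j * B k j)"
   by (rule sum.swap)
  also have "... = (\<Sum>i\<in>I. \<Sum>j\<in>I. B k i * ?G i j * C k j)"
   using sG by (intro sum.cong refl) (auto simp: msym_def mult_ac)
  finally show "(\<Sum>i\<in>I. \<Sum>j\<in>I. C k i * ?G i j * B k j) = (\<Sum>i\<in>I. \<Sum>j\<in>I. B k i * ?G i j * C k j)" .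
 qed
 have "0 <= mtr I (mmul I (mmul I (mtp D) D) ?G)" using assms by (rule mtr_square_nonneg)
 also have "... = mtr I (mmul I (mmul I (mtp B) B) ?G) + t * mtr I (mmul I (mmul I (mtp B) C) ?G)
   + t * mtr I (mmul I (mmul I (mtp C) B) ?G) + t\<^sup>2 * mtr I (mmul I (mmul I (mtp C) C) ?G)"
  unfolding exp1 D_def
  by (simp add: algebra_simps sum.distrib sum_distrib_left power2_eq_square)
 finally show "0 <= mtr I (mmul I (mmul I (mtp B) B) ?G) + 2 * t * mtr I (mmul I (mmul I (mtp B) C) ?G)
   + t\<^sup>2 * mtr I (mmul I (mmul I (mtp C) C) ?G)"
  by (simp add: symm)
qed

lemma mtr_mexp_pos:
 assumes "msym I A" "I ~= {}"
 shows "mtr I (mexp I A) > 0"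
proof -
 obtain i where i: "i \<in> I" using assms by blast
 have q: "qf I (mexp I A) (%j. if j = k then 1 else 0) = mexp I A k k" if "k \<in> I" for k
  using that finI by (simp add: qf_def if_distrib[of "%x. x * _"] if_distrib[of "%x. _ * x"] cong: if_cong)
 have n: "(\<Sum>j\<in>I. (if j = k then 1 else 0 :: real)\<^sup>2) = 1" if "k \<in> I" for k
  using that finI by (simp add: if_distrib[of "%x. x\<^sup>2"] cong: if_cong)
 have p: "mexp I A k k > 0" if "k \<in> I" for k
  using qf_mexp_jensen[OF assms(1) n[OF that]] that
  by (simp add: q) (meson exp_gt_zero less_le_trans)
 then show ?thesis unfolding mtr_def using i finI by (intro sum_pos) auto
qed

text \<open>The entropy bound: the free energy at infinite temperature dominates its linearisation.\<close>

lemma trace_energy_bound: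
 assumes sym: "msym I A" and ne: "I ~= {}"
 shows "mtr I (mmul I A (mexp I A)) / mtr I (mexp I A) >= ln (mtr I (mexp I A) / card I)"
proof -
 let ?Z = "mtr I (mexp I A)"
 have Z: "?Z > 0" using mtr_mexp_pos[OF sym ne] .
 define c where "c = mtr I (mmul I A (mexp I A)) / ?Z"
 \<comment> \<open>\<open>B = c - A\<close> has mean zero in the Gibbs state, so the tangent
   inequality for \<open>exp B\<close> gives \<open>tr (exp B exp A) >= Z\<close>; on the other hand
   \<open>exp B exp A\<close> is \<open>exp c\<close> times the identity.\<close>
 define B where "B = (%i j. msc (-1) A i j + c * mid i j)"
 let ?R = "mexp I (msc (1/2) A)"
 have sB: "msym I B" using sym by (auto simp: B_def msym_def msc_apply mid_def)
 have sR: "msym I ?R" using sym by (simp add: msym_mexp msym_msc)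
 have tr: "mtr I (mmul I C (mexp I A)) = (\<Sum>k\<in>I. qf I C (?R k))" for C
 proof -
  have "mtr I (mmul I C (mexp I A)) = mtr I (mmul I C (mmul I ?R ?R))"
   unfolding mtr_def by (intro sum.cong refl mmul_cong) (auto simp: mexp_half[symmetric])
  also have "... = mtr I (mmul I (mmul I C ?R) ?R)" by (simp add: mmul_assoc)
  also have "... = mtr I (mmul I ?R (mmul I C ?R))" by (rule mtr_mmul_comm)
  also have "... = (\<Sum>k\<in>I. qf I C (?R k))"
   unfolding mtr_def qf_def mmul_def sum_distrib_left
   using sR by (intro sum.cong refl) (auto simp: msym_def mult_ac)
  finally show ?thesis .
 qed
 have "(\<Sum>k\<in>I. qf I (mexp I B) (?R k)) >= (\<Sum>k\<in>I. (\<Sum>i\<in>I. (?R k i)\<^sup>2) + qf I B (?R k))"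
  by (intro sum_mono qf_mexp_ge_linear sB)
 also have "(\<Sum>k\<in>I. (\<Sum>i\<in>I. (?R k i)\<^sup>2) + qf I B (?R k)) = (\<Sum>k\<in>I. qf I mid (?R k)) + (\<Sum>k\<in>I. qf I B (?R k))"
  by (simp add: sum.distrib qf_mid finI)
 also have "(\<Sum>k\<in>I. qf I B (?R k)) = (\<Sum>k\<in>I. - qf I A (?R k) + c * qf I mid (?R k))"
  using qf_add[of I "msc (-1) A" "msc c mid"] by (simp add: B_def qf_msc msc_apply)
 also have "(\<Sum>k\<in>I. qf I mid (?R k)) + ... = ?Z - mtr I (mmul I A (mexp I A)) + c * ?Z"
  unfolding sum.distrib sum_negf sum_distrib_left[symmetric] tr[symmetric]
  using finI by (simp add: mtr_def mmul_mid_left)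
 also have "... = ?Z" using Z by (simp add: c_def)
 finally have 1: "mtr I (mmul I (mexp I B) (mexp I A)) >= ?Z" by (simp add: tr)
 have "mtr I (mmul I (mexp I B) (mexp I A)) = exp c * card I"
 proof -
  have "mcomm I A B"
   using mcomm_add[OF mcomm_msc_right[OF mcomm_refl, of I A "-1"]
     mcomm_msc_right[OF mcomm_mid[OF finI], of A c]]
   by (simp add: B_def msc_apply)
  then have cm: "mcomm I B A" by (rule mcomm_sym)
  have "mtr I (mmul I (mexp I B) (mexp I A)) = mtr I (mexp I (%i j. msc 0 A i j + c * mid i j))"
   unfolding mtr_def
  proof (intro sum.cong refl)
   fix i assume i: "i \<in> I"
   show "mmul I (mexp I B) (mexp I A) i i = mexp I (%i j. msc 0 A i j + c * mid i j) i i"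
    unfolding mexp_add[OF cm i i, symmetric] by (simp add: B_def msc_def algebra_simps)
  qed
  also have "... = exp c * card I"
   unfolding mtr_def using finI by (simp add: mexp_shift mexp_0) (simp add: mid_def)
  finally show ?thesis .
 qed
 with 1 have "?Z <= exp c * card I" by simp
 then have "?Z / card I <= exp c" using finI ne by (simp add: field_simps card_gt_0_iff)
 then have "ln (?Z / card I) <= ln (exp c)"
  using Z finI ne by (subst ln_le_cancel_iff) (auto simp: card_gt_0_iff)
 then show ?thesis by (simp add: c_def)
qed

text \<open>Conjugating K by exp D costs at most the factor exp l per entry.\<close>

lemma mexp_diag_plus_nonneg_le:
 fixes d :: "'i => real"
 assumes K: "!!i j. i \<in> I ==> j \<in> I ==> K i j >= 0"
  and l: "l >= 0" "!!i j. i \<in> I ==> j \<in> I ==> K i j ~= 0 ==> \<bar>d i - d j\<bar> <= l"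
  and ij: "i \<in> I" "j \<in> I"
 shows "mexp I (%i j. (if i = j then d i else 0) + K i j) i j <= exp (d i) * mexp I (msc (exp l) K) i j"
proof -
 define A where "A = (%i j. (if i = j then d i else 0) + K i j)"
 define Y where "Y = (%t i j. exp (t * d i) * mexp I (msc t (msc (exp l) K)) i j)"
 \<comment> \<open>\<open>Y\<close> solves the equation with generator \<open>B t\<close>, in which
   the hopping part \<open>exp l * K\<close> is conjugated by \<open>exp (t D)\<close>. A jump of
   \<open>d\<close> by at most \<open>l\<close> cannot undo the factor \<open>exp l\<close> while
   \<open>t <= 1\<close>, so \<open>B t >= A\<close> entrywise.\<close>
 define B where "B = (%t i j. (if i = j then d i else 0) + exp (t * (d i - d j)) * (exp l * K i j))"
 have Yd: "((%s. Y s i j) has_real_derivative mmul I (B s) (Y s) i j) (at s)"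
  if ij: "i \<in> I" "j \<in> I" for s i j
 proof -
  have "((%s. Y s i j) has_real_derivative
    d i * Y s i j + exp (s * d i) * mmul I (msc (exp l) K) (mexp I (msc s (msc (exp l) K))) i j) (at s)"
   unfolding Y_def by (rule derivative_eq_intros mexp_deriv ij refl | simp)+
  also have "d i * Y s i j = mmul I (%i j. if i = j then d i else 0) (Y s) i j"
   using ij finI by (simp add: mmul_def if_distrib[of "%x. x * _"] cong: if_cong)
  also have "exp (s * d i) * mmul I (msc (exp l) K) (mexp I (msc s (msc (exp l) K))) i j
    = mmul I (%i j. exp (s * (d i - d j)) * (exp l * K i j)) (Y s) i j"
   unfolding mmul_def Y_def sum_distrib_left msc_apply
   by (intro sum.cong refl) (simp add: right_diff_distrib exp_diff)
  finally show ?thesis unfolding B_def by (simp add: mmul_add_left)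
 qed
 have Ynn: "Y s i j >= 0" if "i \<in> I" "j \<in> I" "s >= 0" for s i j
  unfolding Y_def using that K by (intro mult_nonneg_nonneg mexp_nonneg0) (auto simp: msc_apply)
 have Ann: "mexp I (msc t A) i j >= 0" if "t >= 0" "i \<in> I" "j \<in> I" for t i j
  using that K by (intro mexp_nonneg) (auto simp: A_def msc_apply)
 have BA: "B s i j - A i j >= 0" if "i \<in> I" "j \<in> I" "0 <= s" "s <= 1" for s i j
 proof (cases "K i j = 0")
  case False
  have "s * (d i - d j) >= s * (-l)" using l(2)[of i j] that False by (intro mult_left_mono) auto
  also have "s * (-l) >= - l" using that l(1) by (simp add: mult_left_le_one_le)
  finally have "s * (d i - d j) + l >= 0" by linarith
  then have "1 <= exp (s * (d i - d j)) * exp l" by (simp flip: exp_add)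
  then have "1 * K i j <= (exp (s * (d i - d j)) * exp l) * K i j"
   using K that by (intro mult_right_mono) auto
  then show ?thesis by (simp add: A_def B_def mult.assoc)
 qed (simp add: A_def B_def)
 let ?Z = "%s. mmul I (mexp I (msc (1 - s) A)) (Y s) i j"
 have "?Z 0 <= ?Z 1"
 proof (rule DERIV_nonneg_imp_nondecreasing[of 0 1 ?Z])
  fix s :: real assume s: "0 <= s" "s <= 1"
  have "mmul I (mexp I (msc (1 - s) A)) (mmul I (%i j. B s i j - A i j) (Y s)) i j >= 0"
   unfolding mmul_def using s ij
   by (intro sum_nonneg mult_nonneg_nonneg Ann BA Ynn) auto
  moreover have "(?Z has_real_derivative
    mmul I (mexp I (msc (1 - s) A)) (mmul I (%i j. B s i j - A i j) (Y s)) i j) (at s)"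
   by (rule interpolation_deriv[OF _ ij]) (rule Yd)
  ultimately show "\<exists>y. (?Z has_real_derivative y) (at s) & 0 <= y" by blast
 qed simp
 moreover have "?Z 0 = mexp I A i j"
 proof -
  have "?Z 0 = mmul I (mexp I (msc 1 A)) mid i j"
   using ij by (intro mmul_cong) (auto simp: Y_def mexp_0)
  then show ?thesis using ij finI by (simp add: mmul_mid_right msc_def)
 qed
 moreover have "?Z 1 = Y 1 i j"
 proof -
  have "?Z 1 = mmul I mid (Y 1) i j"
   using ij by (intro mmul_cong) (auto simp: mexp_0)
  then show ?thesis using ij finI by (simp add: mmul_mid_left)
 qed
 ultimately show ?thesis by (simp add: A_def Y_def msc_def)
qed

lemma mexp_reindex:
 assumes f: "bij_betw f J I" and ij: "i \<in> J" "j \<in> J"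
 shows "mexp J (%i j. A (f i) (f j)) i j = mexp I A (f i) (f j)"
proof -
 have "mpow J (%i j. A (f i) (f j)) k i j = mpow I A k (f i) (f j)" if "i \<in> J" "j \<in> J" for k i j
  using that
 proof (induction k arbitrary: i j)
  case 0 then show ?case using f by (auto simp: mid_def bij_betw_def inj_on_def)
 next
  case (Suc k)
  then show ?case
   by (simp add: mmul_def sum.reindex_bij_betw[OF f, symmetric])
 qed
 then show ?thesis using ij by (simp add: mexp_def)
qed

lemma mexp_abs_le:
 assumes ij: "i \<in> I" "j \<in> I" and c: "!!i. i \<in> I ==> (\<Sum>j\<in>I. \<bar>A i j\<bar>) <= c" 
 shows "\<bar>mexp I A i j\<bar> <= exp c"
proof -
 have c0: "c >= 0" using c[OF ij(1)] by (meson abs_ge_zero order_trans sum_nonneg)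
 have b: "\<bar>mpow I A k i j\<bar> <= c ^ k" if "i \<in> I" "j \<in> I" for k i j
  using that
 proof (induction k arbitrary: i j)
  case (Suc k)
  have "\<bar>mpow I A (Suc k) i j\<bar> <= (\<Sum>l\<in>I. \<bar>A i l\<bar> * \<bar>mpow I A k l j\<bar>)"
   by (simp add: mmul_def sum_abs[THEN order_trans] abs_mult)
  also have "... <= (\<Sum>l\<in>I. \<bar>A i l\<bar> * c ^ k)"
   using Suc by (intro sum_mono mult_left_mono) auto
  also have "... = (\<Sum>l\<in>I. \<bar>A i l\<bar>) * c ^ k" by (simp add: sum_distrib_right)
  also have "... <= c * c ^ k" using c[OF Suc.prems(1)] c0 by (intro mult_right_mono) auto
  finally show ?case by simp
 qed (auto simp: mid_def)
 have s: "summable (%k. c ^ k / fact k)" using summable_exp[of c] by (simp add: field_simps)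
 have ab: "norm (mpow I A k i j / fact k) <= c ^ k / fact k" for k
  using b[OF ij] by (simp add: divide_right_mono)
 have "norm (mexp I A i j) <= (\<Sum>k. c ^ k / fact k)"
  unfolding mexp_def using ab s by (rule norm_suminf_le)
 also have "... = exp c" by (simp add: exp_def field_simps)
 finally show ?thesis by simp
qed

end

context fin_index begin

text \<open>The constant may depend on everything but \<open>e\<close>; linear dependence on
  \<open>e\<close> is what lets an auxiliary term of the generator be switched off in the limit in
  the proof of reflection positivity.\<close>

lemma mexp_perturb:
 obtains C where "!!e i j. 0 <= e ==> e <= 1 ==> i \<in> I ==> j \<in> I ==>
   \<bar>mexp I (%i j. M i j + e * R i j) i j - mexp I M i j\<bar> <= e * C"
proof
 define c where "c = (\<Sum>i\<in>I. \<Sum>j\<in>I. \<bar>M i j\<bar> + \<bar>R i j\<bar>)"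
 fix e :: real and i j assume e: "0 <= e" "e <= 1" and ij: "i \<in> I" "j \<in> I"
 let ?A = "%i j. M i j + e * R i j"
 have row: "(\<Sum>j\<in>I. \<bar>msc s B i j\<bar>) <= c"
  if "!!i j. \<bar>B i j\<bar> <= \<bar>M i j\<bar> + \<bar>R i j\<bar>" "0 <= s" "s <= 1" "i \<in> I" for B s i
 proof -
  have "(\<Sum>j\<in>I. \<bar>msc s B i j\<bar>) <= (\<Sum>j\<in>I. \<bar>M i j\<bar> + \<bar>R i j\<bar>)"
  proof (intro sum_mono)
   fix j
   have "\<bar>msc s B i j\<bar> = s * \<bar>B i j\<bar>" using that by (simp add: msc_apply abs_mult)
   also have "... <= 1 * \<bar>B i j\<bar>" using that by (intro mult_right_mono) auto
   finally show "\<bar>msc s B i j\<bar> <= \<bar>M i j\<bar> + \<bar>R i j\<bar>" using that(1)[of i j] by simp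
  qed
  also have "... <= c" unfolding c_def
   using member_le_sum[of i I "%i. \<Sum>j\<in>I. \<bar>M i j\<bar> + \<bar>R i j\<bar>"] that finI by (auto simp: sum_nonneg)
  finally show ?thesis .
 qed
 have bA: "\<bar>?A i j\<bar> <= \<bar>M i j\<bar> + \<bar>R i j\<bar>" for i j
 proof -
  have "\<bar>?A i j\<bar> <= \<bar>M i j\<bar> + e * \<bar>R i j\<bar>" using e abs_triangle_ineq[of "M i j" "e * R i j"] by (simp add: abs_mult)
  also have "... <= \<bar>M i j\<bar> + 1 * \<bar>R i j\<bar>" using e by (intro add_left_mono mult_right_mono) auto
  finally show ?thesis by simp
 qed
 let ?Z = "%s. mmul I (mexp I (msc (1 - s) M)) (mexp I (msc s ?A)) i j"
 let ?Z' = "%s. mmul I (mexp I (msc (1 - s) M)) (mmul I (%i j. e * R i j) (mexp I (msc s ?A))) i j"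
 have d: "(?Z has_real_derivative ?Z' s) (at s)" for s
  using interpolation_deriv[of "%s. mexp I (msc s ?A)" "%_. ?A" s i j 1 M] ij mexp_deriv
  by simp
 obtain x where x: "0 < x" "x < 1" "?Z 1 - ?Z 0 = (1 - 0) * ?Z' x"
  using MVT2[of 0 1 ?Z ?Z'] d by auto
 have "\<bar>?Z' x\<bar> <= (\<Sum>k\<in>I. exp c * (\<Sum>l\<in>I. (e * \<bar>R k l\<bar>) * exp c))"
 proof -
  have "\<bar>?Z' x\<bar> <= (\<Sum>k\<in>I. \<bar>mexp I (msc (1 - x) M) i k\<bar> * (\<Sum>l\<in>I. \<bar>e * R k l\<bar> * \<bar>mexp I (msc x ?A) l j\<bar>))"
   unfolding mmul_def
   by (rule order_trans[OF sum_abs], intro sum_mono, simp only: abs_mult, intro mult_left_mono order_trans[OF sum_abs])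
    (auto simp: abs_mult)
  also have "... <= (\<Sum>k\<in>I. exp c * (\<Sum>l\<in>I. (e * \<bar>R k l\<bar>) * exp c))"
   using x ij e bA
   by (intro sum_mono mult_mono mexp_abs_le row sum_nonneg) (auto simp: abs_mult)
  finally show ?thesis .
 qed
 also have "... = e * (exp c * exp c * (\<Sum>k\<in>I. \<Sum>l\<in>I. \<bar>R k l\<bar>))"
  by (simp add: sum_distrib_left sum_distrib_right mult_ac)
 finally have "\<bar>?Z 1 - ?Z 0\<bar> <= e * (exp c * exp c * (\<Sum>k\<in>I. \<Sum>l\<in>I. \<bar>R k l\<bar>))"
  using x(3) by simp
 moreover have "?Z 1 = mexp I ?A i j"
 proof -
  have "?Z 1 = mmul I mid (mexp I (msc 1 ?A)) i j"
   using ij by (intro mmul_cong) (auto simp: mexp_0)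
  then show ?thesis using ij finI by (simp add: mmul_mid_left msc_def)
 qed
 moreover have "?Z 0 = mexp I M i j"
 proof -
  have "?Z 0 = mmul I (mexp I (msc 1 M)) mid i j"
   using ij by (intro mmul_cong) (auto simp: mexp_0)
  then show ?thesis using ij finI by (simp add: mmul_mid_right msc_def)
 qed
 ultimately show "\<bar>mexp I ?A i j - mexp I M i j\<bar> <= e * (exp c * exp c * (\<Sum>k\<in>I. \<Sum>l\<in>I. \<bar>R k l\<bar>))"
  by simp
qed

end

section \<open>Reflection positivity on a doubled index set\<close>

fun cword :: "'i set => ('c => 'i => 'i => real) => 'c list => 'i => 'i => real" where
 "cword I C [] = mid"
| "cword I C (c # w) = mmul I (C c) (cword I C w)"

fun words :: "'c set => nat => 'c list set" where
 "words S 0 = {[]}"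
| "words S (Suc k) = (%(c, w). c # w) ` (S \<times> words S k)"

text \<open>Each word contributes a tensor square. Weighted by \<open>a (fst p) * a (snd p)\<close>
  and traced, it becomes the square of a real number: this is the whole source of
  positivity.\<close>

lemma mpow_tensor_words:
 assumes "finite I" "p \<in> I \<times> I" "q \<in> I \<times> I"
 shows "mpow (I \<times> I) (%p q. \<Sum>c\<in>S. C c (fst p) (fst q) * C c (snd p) (snd q)) k p q
  = (\<Sum>w\<in>words S k. cword I C w (fst p) (fst q) * cword I C w (snd p) (snd q))"
 using assms(2)
proof (induction k arbitrary: p)
 case 0
 then show ?case by (auto simp: mid_def prod_eq_iff)
next
 case (Suc k)
 let ?T = "%p q. \<Sum>c\<in>S. C c (fst p) (fst q) * C c (snd p) (snd q)"
 have "mpow (I \<times> I) ?T (Suc k) p q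
   = (\<Sum>r\<in>I \<times> I. ?T p r * (\<Sum>w\<in>words S k. cword I C w (fst r) (fst q) * cword I C w (snd r) (snd q)))"
  using Suc.IH by (simp add: mmul_def)
 also have "... = (\<Sum>r\<in>I \<times> I. \<Sum>c\<in>S. \<Sum>w\<in>words S k. (C c (fst p) (fst r) * cword I C w (fst r) (fst q)) *
    (C c (snd p) (snd r) * cword I C w (snd r) (snd q)))"
  by (simp add: sum_distrib_left sum_distrib_right mult_ac)
    (subst sum.swap, simp)
 also have "... = (\<Sum>c\<in>S. \<Sum>w\<in>words S k. \<Sum>r\<in>I \<times> I. (C c (fst p) (fst r) * cword I C w (fst r) (fst q)) *
    (C c (snd p) (snd r) * cword I C w (snd r) (snd q)))"
  by (subst sum.swap) (intro sum.cong refl sum.swap)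
 also have "... = (\<Sum>c\<in>S. \<Sum>w\<in>words S k. cword I C (c # w) (fst p) (fst q) * cword I C (c # w) (snd p) (snd q))"
 proof (intro sum.cong refl)
  fix c w
  show "(\<Sum>r\<in>I \<times> I. (C c (fst p) (fst r) * cword I C w (fst r) (fst q)) *
    (C c (snd p) (snd r) * cword I C w (snd r) (snd q)))
    = cword I C (c # w) (fst p) (fst q) * cword I C (c # w) (snd p) (snd q)"
   by (simp add: mmul_def sum_product sum.cartesian_product split_beta)
 qed
 also have "... = (\<Sum>w\<in>words S (Suc k). cword I C w (fst p) (fst q) * cword I C w (snd p) (snd q))"
 proof -
  have inj: "inj_on (%(c, w). c # w) (S \<times> words S k)" by (auto simp: inj_on_def)
  show ?thesis
   by (simp only: words.simps sum.reindex[OF inj] sum.cartesian_product)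
    (simp add: split_beta o_def)
 qed
 finally show ?case .
qed

text \<open>The generator of two mirror halves: the same \<open>X\<close> acts inside each half, and
  every bond across the cut couples a matrix with its own mirror copy, with a positive sign.\<close>

definition rp_matrix :: "('i => 'i => real) => 'c set => ('c => 'i => 'i => real) => 'i \<times> 'i => 'i \<times> 'i => real" where
 "rp_matrix X S C = (%p q. X (fst p) (fst q) * mid (snd p) (snd q) + mid (fst p) (fst q) * X (snd p) (snd q)
   + (\<Sum>c\<in>S. C c (fst p) (fst q) * C c (snd p) (snd q)))"

text \<open>The one-sided terms are completed to a positive kernel by
 $(s + X/s) \otimes (s + X/s) - s^2 = X \otimes 1 + 1 \otimes X + X \otimes X / s^2$; then $s$ tends to infinity.\<close>

theorem reflection_positive_kernel:
 assumes I: "finite I" and S: "finite S"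
 shows "(\<Sum>p\<in>I \<times> I. a (fst p) * a (snd p) * mexp (I \<times> I) (rp_matrix X S C) p p) >= 0"
proof -
 interpret P: fin_index "I \<times> I" using I by unfold_locales simp
 define M where "M = rp_matrix X S C"
 define R where "R = (%p q. X (fst p) (fst q) * X (snd p) (snd q))"
 define h where "h = (%N. \<Sum>p\<in>I \<times> I. a (fst p) * a (snd p) * mexp (I \<times> I) N p p)"
 have pos: "h (%p q. M p q + e * R p q) >= 0" if e: "e > 0" for e
 proof -
  \<comment> \<open>Then \<open>1 / s^2 = e\<close>, so the surplus term
    \<open>X \<otimes> X / s^2\<close> is \<open>e * R\<close>; the letter \<open>None\<close>
    stands for the added tensor square.\<close>
  define s where "s = 1 / sqrt e"
  have s: "s > 0" "1 / s\<^sup>2 = e" using e by (auto simp: s_def power_divide)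
  define C' where "C' = (%c i j. case c of None => s * mid i j + X i j / s | Some c => C c i j)"
  define S' where "S' = insert None (Some ` S)"
  define T where "T = (%p q. \<Sum>c\<in>S'. C' c (fst p) (fst q) * C' c (snd p) (snd q))"
  have T: "T p q = M p q + e * R p q + s\<^sup>2 * mid p q" for p q
  proof -
   have "(\<Sum>c\<in>S'. C' c (fst p) (fst q) * C' c (snd p) (snd q))
     = C' None (fst p) (fst q) * C' None (snd p) (snd q) + (\<Sum>c\<in>S. C c (fst p) (fst q) * C c (snd p) (snd q))"
    unfolding S'_def using S by (subst sum.insert) (auto simp: sum.reindex C'_def)
   moreover have "mid (fst p) (fst q) * mid (snd p) (snd q) = mid p q"
    by (auto simp: mid_def prod_eq_iff)
   moreover have "C' None (fst p) (fst q) * C' None (snd p) (snd q)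
     = s\<^sup>2 * (mid (fst p) (fst q) * mid (snd p) (snd q)) + X (fst p) (fst q) * mid (snd p) (snd q)
      + mid (fst p) (fst q) * X (snd p) (snd q) + (1 / s\<^sup>2) * R p q"
    using s(1) by (simp add: C'_def R_def field_simps power2_eq_square)
   ultimately show ?thesis by (simp add: T_def M_def rp_matrix_def s(2))
  qed
  have "0 <= h T"
  proof -
   have nn: "(\<Sum>p\<in>I \<times> I. a (fst p) * a (snd p) * (mpow (I \<times> I) T k p p / fact k)) >= 0" for k
   proof -
    have "(\<Sum>p\<in>I \<times> I. a (fst p) * a (snd p) * mpow (I \<times> I) T k p p)
      = (\<Sum>p\<in>I \<times> I. \<Sum>w\<in>words S' k. (a (fst p) * cword I C' w (fst p) (fst p)) * (a (snd p) * cword I C' w (snd p) (snd p)))"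
     unfolding T_def by (intro sum.cong refl) (simp add: mpow_tensor_words I sum_distrib_left mult_ac)
    also have "... = (\<Sum>w\<in>words S' k. \<Sum>p\<in>I \<times> I. (a (fst p) * cword I C' w (fst p) (fst p)) * (a (snd p) * cword I C' w (snd p) (snd p)))"
     by (rule sum.swap)
    also have "... = (\<Sum>w\<in>words S' k. (\<Sum>i\<in>I. a i * cword I C' w i i)\<^sup>2)"
     by (intro sum.cong refl) (simp add: power2_eq_square sum_product sum.cartesian_product split_beta)
    also have "... >= 0" by (simp add: sum_nonneg)
    finally have "(\<Sum>p\<in>I \<times> I. a (fst p) * a (snd p) * mpow (I \<times> I) T k p p) / fact k >= 0" by simp
    then show ?thesis by (simp add: sum_divide_distrib)
   qed
   have "(%k. \<Sum>p\<in>I \<times> I. a (fst p) * a (snd p) * (mpow (I \<times> I) T k p p / fact k)) sums h T"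
    unfolding h_def by (intro sums_sum sums_mult P.mexp_sums)
   from sums_le[OF nn sums_zero this] show ?thesis .
  qed
  also have "h T = exp (s\<^sup>2) * h (%p q. M p q + e * R p q)"
  proof -
   have "mexp (I \<times> I) T p p = exp (s\<^sup>2) * mexp (I \<times> I) (%p q. M p q + e * R p q) p p" if "p \<in> I \<times> I" for p
    using P.mexp_shift[OF that that, of "%p q. M p q + e * R p q" "s\<^sup>2"]
    by (simp add: T[abs_def])
   then show ?thesis by (simp add: h_def sum_distrib_left mult_ac)
  qed
  finally show ?thesis by (simp add: zero_le_mult_iff)
 qed
 obtain K where K: "!!e p q. 0 <= e ==> e <= 1 ==> p \<in> I \<times> I ==> q \<in> I \<times> I ==>
   \<bar>mexp (I \<times> I) (%p q. M p q + e * R p q) p q - mexp (I \<times> I) M p q\<bar> <= e * K"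
  using P.mexp_perturb[of M R] by blast
 define K' where "K' = (\<Sum>p\<in>I \<times> I. \<bar>a (fst p) * a (snd p)\<bar> * K)"
 have le: "h (%p q. M p q + e * R p q) - h M <= e * K'" if e: "0 <= e" "e <= 1" for e
 proof -
  have "h (%p q. M p q + e * R p q) - h M
    = (\<Sum>p\<in>I \<times> I. a (fst p) * a (snd p) * (mexp (I \<times> I) (%p q. M p q + e * R p q) p p - mexp (I \<times> I) M p p))"
   by (simp add: h_def sum_subtractf right_diff_distrib)
  also have "... <= (\<Sum>p\<in>I \<times> I. \<bar>a (fst p) * a (snd p)\<bar> * (e * K))"
  proof (intro sum_mono)
   fix p assume p: "p \<in> I \<times> I"
   have "a (fst p) * a (snd p) * (mexp (I \<times> I) (%p q. M p q + e * R p q) p p - mexp (I \<times> I) M p p)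
     <= \<bar>a (fst p) * a (snd p)\<bar> * \<bar>mexp (I \<times> I) (%p q. M p q + e * R p q) p p - mexp (I \<times> I) M p p\<bar>"
    by (rule order_trans[OF abs_ge_self]) (simp add: abs_mult)
   also have "... <= \<bar>a (fst p) * a (snd p)\<bar> * (e * K)" using K[OF e p p] by (intro mult_left_mono) auto
   finally show "a (fst p) * a (snd p) * (mexp (I \<times> I) (%p q. M p q + e * R p q) p p - mexp (I \<times> I) M p p)
     <= \<bar>a (fst p) * a (snd p)\<bar> * (e * K)" .
  qed
  also have "... = e * K'" by (simp add: K'_def sum_distrib_left mult_ac)
  finally show ?thesis .
 qed
 have "h M >= 0"
 proof (rule ccontr)
  assume neg: "~ h M >= 0"
  \<comment> \<open>Small enough that switching on \<open>e * R\<close> moves \<open>h\<close> by at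
    most half the distance from \<open>h M\<close> to 0.\<close>
  define e where "e = min 1 (- h M / (2 * (\<bar>K'\<bar> + 1)))"
  have e: "0 < e" "e <= 1" using neg by (auto simp: e_def divide_neg_pos)
  have "e * K' <= e * (\<bar>K'\<bar> + 1)" using e by (intro mult_left_mono) auto
  also have "... <= - h M / (2 * (\<bar>K'\<bar> + 1)) * (\<bar>K'\<bar> + 1)" by (intro mult_right_mono) (auto simp: e_def)
  also have "... = - h M / 2" by (simp add: field_simps)
  finally have "- h M <= - h M / 2" using le[of e] pos[OF e(1)] e by linarith
  with neg show False by simp
 qed
 then show ?thesis by (simp add: h_def M_def)
qed

text \<open>By the product rule the product of the single-coordinate exponentials solves the linear
  equation of the sum; the matrix product on the right is a sum over \<open>PiE\<close> that
  factorises coordinate by coordinate.\<close>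

lemma mexp_PiE_product:
 fixes h :: "'t => 'k => 'k => real"
 assumes T: "finite T" and J: "!!t. t \<in> T ==> finite (J t)"
  and st: "sg \<in> PiE T J" "ta \<in> PiE T J"
 shows "mexp (PiE T J) (%sg ta. \<Sum>t\<in>T. h t (sg t) (ta t) * (\<Prod>s\<in>T - {t}. mid (sg s) (ta s))) sg ta
  = (\<Prod>t\<in>T. mexp (J t) (h t) (sg t) (ta t))"
proof -
 interpret P: fin_index "PiE T J" using T J by unfold_locales (rule finite_PiE)
 have fJ: "fin_index (J t)" if "t \<in> T" for t using J[OF that] by unfold_locales
 define M where "M = (%sg ta. \<Sum>t\<in>T. h t (sg t) (ta t) * (\<Prod>s\<in>T - {t}. mid (sg s) (ta s)))"
 define Y where "Y = (%u sg ta. \<Prod>t\<in>T. mexp (J t) (msc u (h t)) (sg t) (ta t))"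
 have "Y 1 sg ta = mexp (PiE T J) (msc 1 M) sg ta"
 proof (rule P.mexp_ode_unique[OF _ _ st])
  fix u sg ta assume st: "sg \<in> PiE T J" "ta \<in> PiE T J"
  have mem: "sg t \<in> J t" "ta t \<in> J t" if "t \<in> T" for t using st that by auto
  let ?E = "%t. mexp (J t) (msc u (h t))"
  have d: "((%u. Y u sg ta) has_real_derivative
    (\<Sum>t\<in>T. mmul (J t) (h t) (?E t) (sg t) (ta t) * (\<Prod>s\<in>T - {t}. ?E s (sg s) (ta s)))) (at u)"
   unfolding Y_def
   using mem by (intro has_field_derivative_prod fin_index.mexp_deriv[OF fJ]) auto
  have "mmul (PiE T J) M (Y u) sg ta
    = (\<Sum>\<rho>\<in>PiE T J. \<Sum>t\<in>T. (\<Prod>s\<in>T. (if s = t then h t (sg t) (\<rho> t) else mid (sg s) (\<rho> s)) * ?E s (\<rho> s) (ta s)))"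
   unfolding mmul_def M_def Y_def sum_distrib_right
  proof (intro sum.cong refl)
   fix \<rho> t assume t: "t \<in> T"
   have "(\<Prod>s\<in>T. (if s = t then h t (sg t) (\<rho> t) else mid (sg s) (\<rho> s)))
     = h t (sg t) (\<rho> t) * (\<Prod>s\<in>T - {t}. mid (sg s) (\<rho> s))"
    using t T by (subst prod.remove[of T t]) (auto intro!: prod.cong)
   then show "h t (sg t) (\<rho> t) * (\<Prod>s\<in>T - {t}. mid (sg s) (\<rho> s)) * (\<Prod>s\<in>T. ?E s (\<rho> s) (ta s))
     = (\<Prod>s\<in>T. (if s = t then h t (sg t) (\<rho> t) else mid (sg s) (\<rho> s)) * ?E s (\<rho> s) (ta s))"
    by (simp only: prod.distrib)
  qed
  also have "... = (\<Sum>t\<in>T. \<Sum>\<rho>\<in>PiE T J. (\<Prod>s\<in>T. (if s = t then h t (sg t) (\<rho> s) else mid (sg s) (\<rho> s)) * ?E s (\<rho> s) (ta s)))"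
   by (subst sum.swap) (auto intro!: sum.cong prod.cong)
  also have "... = (\<Sum>t\<in>T. \<Prod>s\<in>T. \<Sum>k\<in>J s. (if s = t then h t (sg t) k else mid (sg s) k) * ?E s k (ta s))"
   using T J by (intro sum.cong refl prod_sum_PiE[symmetric]) auto
  also have "... = (\<Sum>t\<in>T. mmul (J t) (h t) (?E t) (sg t) (ta t) * (\<Prod>s\<in>T - {t}. ?E s (sg s) (ta s)))"
  proof (intro sum.cong refl)
   fix t assume t: "t \<in> T"
   have "(\<Prod>s\<in>T. \<Sum>k\<in>J s. (if s = t then h t (sg t) k else mid (sg s) k) * ?E s k (ta s))
    = (\<Sum>k\<in>J t. h t (sg t) k * ?E t k (ta t)) * (\<Prod>s\<in>T - {t}. \<Sum>k\<in>J s. mid (sg s) k * ?E s k (ta s))"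
    using t T by (subst prod.remove[of T t]) (auto intro!: prod.cong)
   also have "(\<Prod>s\<in>T - {t}. \<Sum>k\<in>J s. mid (sg s) k * ?E s k (ta s)) = (\<Prod>s\<in>T - {t}. ?E s (sg s) (ta s))"
    using mem J by (intro prod.cong refl) (auto simp: mmul_mid_left[unfolded mmul_def])
   finally show "(\<Prod>s\<in>T. \<Sum>k\<in>J s. (if s = t then h t (sg t) k else mid (sg s) k) * ?E s k (ta s))
     = mmul (J t) (h t) (?E t) (sg t) (ta t) * (\<Prod>s\<in>T - {t}. ?E s (sg s) (ta s))"
    by (simp add: mmul_def)
  qed
  finally show "((%u. Y u sg ta) has_real_derivative mmul (PiE T J) M (Y u) sg ta) (at u)"
   using d by simp
 next
  fix sg ta assume st: "sg \<in> PiE T J" "ta \<in> PiE T J"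
  have mem: "sg t \<in> J t" "ta t \<in> J t" if "t \<in> T" for t using st that by auto
  have "Y 0 sg ta = (\<Prod>t\<in>T. mid (sg t) (ta t))"
   unfolding Y_def using mem by (intro prod.cong refl fin_index.mexp_0[OF fJ]) auto
  also have "... = mid sg ta"
  proof (cases "sg = ta")
   case False
   then obtain t where "t \<in> T" "sg t ~= ta t" using st PiE_ext by metis
   then show ?thesis using T False by (auto simp: mid_def intro!: prod_zero)
  qed (simp add: mid_def)
  finally show "Y 0 sg ta = mid sg ta" .
 qed
 then show ?thesis by (simp add: Y_def M_def msc_def)
qed

declare split_paired_All [simp del] split_paired_Ex [simp del]

section \<open>The model as a real matrix\<close>

definition mz :: "nat => nat => real" where
 "mz n k = (2 * real k - real n) / real n"

text \<open>Single-site matrices are divided by the spin magnitude \<open>n / 2\<close>: the entry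
  is half a ladder coefficient over \<open>n / 2\<close>.\<close>

definition xm :: "nat => nat => nat => real" where
 "xm n k l = (if l = Suc k then sqrt ((real n - real k) * (real k + 1)) / n
   else if k = Suc l then sqrt ((real n - real l) * (real l + 1)) / n else 0)"

text \<open>The second component over the spin magnitude is \<open>-\<i>\<close> times this real
  antisymmetric matrix; its square is therefore minus the square of \<open>ym\<close>.\<close>

definition ym :: "nat => nat => nat => real" where
 "ym n k l = (if l = Suc k then - sqrt ((real n - real k) * (real k + 1)) / n
   else if k = Suc l then sqrt ((real n - real l) * (real l + 1)) / n else 0)"

definition zm :: "nat => nat => nat => real" where
 "zm n k l = (if k = l then mz n k else 0)"

definition sop :: "site => (nat => nat => real) => conf => conf => real" where
 "sop r X sg ta = (if \<forall>s. s ~= r --> sg s = ta s then X (sg r) (ta r) else 0)"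

definition eop :: "site => site => (nat => nat => real) => conf => conf => real" where
 "eop r r' X sg ta = (if \<forall>s. s ~= r & s ~= r' --> sg s = ta s then X (sg r) (ta r) * X (sg r') (ta r') else 0)"

definition nbd :: "nat => bool => site => site" where
 "nbd N d r = (if d then nb2 N r else nb1 N r)"

definition crd :: "bool => site => nat" where
 "crd d r = (if d then snd r else fst r)"

definition edges :: "nat => (site \<times> bool) set" where
 "edges N = sites N \<times> UNIV"

definition ety :: "nat => site \<times> bool => nat => nat => real" where
 "ety n e = (if even (crd (snd e) (fst e)) then xm n else zm n)"

text \<open>This is the exponent of the Gibbs matrix, already with the sign of the Hamiltonian
  reversed. The edge matrices \<open>Y\<close> are a parameter because the model with the two edge
  types exchanged is needed as well.\<close>

definition hamr :: "nat => nat => real => (site \<times> bool => nat => nat => real) => conf => conf => real" where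
 "hamr N n b Y = (%sg ta. b * (\<Sum>e\<in>edges N. eop (fst e) (nbd N (snd e) (fst e)) (Y e) sg ta))"

abbreviation "ham N n b \<equiv> hamr N n b (ety n)"

lemma finite_sites [simp]: "finite (sites N)"
 by (simp add: sites_def)

lemma finite_confs [simp]: "finite (confs N n)"
 unfolding confs_def by (intro finite_PiE) auto

lemma finite_edges [simp]: "finite (edges N)"
 by (simp add: edges_def)

lemma card_sites: "card (sites N) = N * N"
 by (simp add: sites_def card_cartesian_product)

lemma card_confs: "card (confs N n) = (n + 1) ^ (N * N)"
 by (simp add: confs_def card_PiE card_sites)

lemma confs_nonempty: "confs N n ~= {}"
 using card_confs[of N n] by (metis card.empty power_not_zero add_is_0 one_neq_zero)

lemma conf_le: "sg \<in> confs N n ==> r \<in> sites N ==> sg r <= n"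
 by (auto simp: confs_def)

lemma conf_upd: "sg \<in> confs N n ==> r \<in> sites N ==> k <= n ==> sg(r := k) \<in> confs N n"
 unfolding confs_def by (auto simp: PiE_def extensional_def)

lemma conf_eqI: "sg \<in> confs N n ==> ta \<in> confs N n ==> (!!r. r \<in> sites N ==> sg r = ta r) ==> sg = ta"
 unfolding confs_def by (rule PiE_ext)

lemma nbd_sites: "r \<in> sites N ==> nbd N d r \<in> sites N"
 by (auto simp: sites_def nbd_def nb1_def nb2_def)

lemma nbd_neq: "r \<in> sites N ==> N >= 2 ==> nbd N d r ~= r"
 by (auto simp: sites_def nbd_def nb1_def nb2_def prod_eq_iff mod_Suc split: if_splits)

lemma mmul_sop:
 assumes r: "r \<in> sites N" and s: "sg \<in> confs N n"
 shows "mmul (confs N n) (sop r X) B sg ta = (\<Sum>k\<le>n. X (sg r) k * B (sg(r := k)) ta)"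
proof -
 have inj: "inj_on (%k. sg(r := k)) {..n}" by (auto simp: inj_on_def fun_eq_iff split: if_splits)
 have "mmul (confs N n) (sop r X) B sg ta = (\<Sum>\<rho>\<in>(%k. sg(r := k)) ` {..n}. sop r X sg \<rho> * B \<rho> ta)"
  unfolding mmul_def
 proof (intro sum.mono_neutral_right ballI)
  show "(%k. sg(r := k)) ` {..n} <= confs N n" using r s by (auto simp: conf_upd)
  fix \<rho> assume "\<rho> \<in> confs N n - (%k. sg(r := k)) ` {..n}"
  then have "\<rho> \<in> confs N n" "!!k. k <= n ==> \<rho> ~= sg(r := k)" by auto
  from this(2)[of "\<rho> r"] conf_le[OF this(1) r] have "\<rho> ~= sg(r := \<rho> r)" by blast
  then have "~ (\<forall>s. s ~= r --> sg s = \<rho> s)" by (auto simp: fun_eq_iff split: if_splits)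
  then show "sop r X sg \<rho> * B \<rho> ta = 0" by (auto simp: sop_def)
 qed simp
 also have "... = (\<Sum>k\<le>n. X (sg r) k * B (sg(r := k)) ta)"
  by (subst sum.reindex[OF inj]) (simp add: sop_def)
 finally show ?thesis .
qed

lemma mmul_sop_same:
 assumes r: "r \<in> sites N" and s: "sg \<in> confs N n"
 shows "mmul (confs N n) (sop r X) (sop r Y) sg ta = sop r (mmul {..n} X Y) sg ta"
 unfolding mmul_sop[OF r s] by (auto simp: sop_def mmul_def intro!: sum.neutral)

lemma mmul_sop_diff:
 assumes r: "r \<in> sites N" "r' \<in> sites N" "r ~= r'" and s: "sg \<in> confs N n" "ta \<in> confs N n"
 shows "mmul (confs N n) (sop r X) (sop r' Y) sg ta =
  (if \<forall>s. s ~= r & s ~= r' --> sg s = ta s then X (sg r) (ta r) * Y (sg r') (ta r') else 0)"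
proof -
 have "mmul (confs N n) (sop r X) (sop r' Y) sg ta
   = (\<Sum>k\<le>n. if k = ta r then X (sg r) k * sop r' Y (sg(r := k)) ta else 0)"
  unfolding mmul_sop[OF r(1) s(1)] using r(3) by (intro sum.cong refl) (auto simp: sop_def)
 also have "... = X (sg r) (ta r) * sop r' Y (sg(r := ta r)) ta"
  using conf_le[OF s(2) r(1)] by simp
 also have "... = (if \<forall>s. s ~= r & s ~= r' --> sg s = ta s then X (sg r) (ta r) * Y (sg r') (ta r') else 0)"
  using r(3) by (auto simp: sop_def)
 finally show ?thesis .
qed

lemma eop_eq_mmul:
 assumes "r \<in> sites N" "r' \<in> sites N" "r ~= r'" "sg \<in> confs N n" "ta \<in> confs N n"
 shows "eop r r' X sg ta = mmul (confs N n) (sop r X) (sop r' X) sg ta"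
 using mmul_sop_diff[OF assms, of X X] by (simp add: eop_def)

lemma eop_commute: "eop r r' X = eop r' r X"
 by (auto simp: eop_def fun_eq_iff)

lemma xm_nonneg: "k <= n ==> l <= n ==> xm n k l >= 0"
 by (auto simp: xm_def intro!: divide_nonneg_nonneg)

lemma xm_sym: "xm n k l = xm n l k"
 by (auto simp: xm_def)

lemma zm_sym: "zm n k l = zm n l k"
 by (auto simp: zm_def)

lemma ety_sym: "ety n e k l = ety n e l k"
 using xm_sym[of n k l] zm_sym[of n k l] by (simp add: ety_def)

lemma eop_sym: "(!!k l. X k l = X l k) ==> eop r r' X sg ta = eop r r' X ta sg"
 by (auto simp: eop_def)

lemma msym_hamr: "(!!e k l. Y e k l = Y e l k) ==> msym I (hamr N n b Y)"
 unfolding msym_def hamr_def by (auto intro!: sum.cong eop_sym)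

lemma msym_ham: "msym I (ham N n b)"
 by (rule msym_hamr) (rule ety_sym)

text \<open>z-edges are diagonal and x-edges have nonnegative entries. This makes \<open>gw\<close>
  a nonnegative weight on configurations.\<close>

lemma ham_offdiag_nonneg:
 assumes "b >= 0" "sg \<in> confs N n" "ta \<in> confs N n" "sg ~= ta"
 shows "ham N n b sg ta >= 0"
proof -
 have "eop (fst e) (nbd N (snd e) (fst e)) (ety n e) sg ta >= 0" if e: "e \<in> edges N" for e
 proof (cases "even (crd (snd e) (fst e))")
  case True
  have "fst e \<in> sites N" "nbd N (snd e) (fst e) \<in> sites N"
   using e by (auto simp: edges_def nbd_sites)
  then show ?thesis using True assms
   by (auto simp: eop_def ety_def intro!: mult_nonneg_nonneg xm_nonneg conf_le)
 next
  case False
  then show ?thesis using assms(4)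
   by (auto simp: eop_def ety_def zm_def fun_eq_iff) metis
 qed
 then show ?thesis unfolding hamr_def using assms(1) by (intro mult_nonneg_nonneg sum_nonneg) auto
qed

definition gw :: "nat => nat => real => conf => real" where
 "gw N n b sg = mexp (confs N n) (ham N n b) sg sg"

lemma fin_index_confs: "fin_index (confs N n)"
 by unfold_locales simp

lemma gw_nonneg: "b >= 0 ==> sg \<in> confs N n ==> gw N n b sg >= 0"
 unfolding gw_def by (rule fin_index.mexp_nonneg[OF fin_index_confs]) (auto intro: ham_offdiag_nonneg)

definition Zr :: "nat => nat => real => real" where
 "Zr N n b = mtr (confs N n) (mexp (confs N n) (ham N n b))"

lemma Zr_sum: "Zr N n b = (\<Sum>sg\<in>confs N n. gw N n b sg)"
 by (simp add: Zr_def mtr_def gw_def)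

lemma Zr_pos: "Zr N n b > 0"
 unfolding Zr_def by (rule fin_index.mtr_mexp_pos[OF fin_index_confs msym_ham confs_nonempty])

section \<open>From complex operators to real matrices\<close>

definition crel :: "nat => nat => op => (conf => conf => real) => bool" where
 "crel N n A B \<longleftrightarrow> (\<forall>sg\<in>confs N n. \<forall>ta\<in>confs N n. A sg ta = complex_of_real (B sg ta))"

lemma crel_mult: "crel N n A A' ==> crel N n B B' ==> crel N n (op_mult N n A B) (mmul (confs N n) A' B')"
 by (simp add: crel_def op_mult_def mmul_def)

lemma crel_pow: "crel N n A A' ==> crel N n (op_pow N n A k) (mpow (confs N n) A' k)"
 by (induction k) (auto simp: crel_mult, simp add: crel_def op_id_def mid_def)

lemma crel_exp: 
 assumes "crel N n A A'" shows "crel N n (op_exp N n A) (mexp (confs N n) A')"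
 unfolding crel_def
proof (intro ballI)
 fix sg ta assume st: "sg \<in> confs N n" "ta \<in> confs N n"
 have "(%k. complex_of_real (mpow (confs N n) A' k sg ta / fact k)) sums complex_of_real (mexp (confs N n) A' sg ta)"
  using fin_index.mexp_sums[OF fin_index_confs st] by (simp only: sums_of_real_iff)
 then have "(%k. op_pow N n A k sg ta / of_nat (fact k)) sums complex_of_real (mexp (confs N n) A' sg ta)"
  using crel_pow[OF assms] st by (simp add: crel_def)
 then show "op_exp N n A sg ta = complex_of_real (mexp (confs N n) A' sg ta)"
  unfolding op_exp_def by (rule sums_unique[symmetric])
qed

lemma crel_trace: "crel N n A A' ==> op_trace N n A = complex_of_real (mtr (confs N n) A')"
 by (simp add: crel_def op_trace_def mtr_def)

lemma conf_upd_eq_iff: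
 "sg = ta(r := k) \<longleftrightarrow> (\<forall>s. s ~= r --> sg s = ta s) & sg r = k"
 by (auto simp: fun_eq_iff)

lemma Splus_entry:
 "Splus_op n r sg ta = (if (\<forall>s. s ~= r --> sg s = ta s) & sg r = Suc (ta r)
   then complex_of_real (sqrt ((real n - real (ta r)) * (real (ta r) + 1))) else 0)"
proof -
 have "spinS n * (spinS n + 1) - (real (ta r) - spinS n) * (real (ta r) - spinS n + 1)
   = (real n - real (ta r)) * (real (ta r) + 1)"
  by (simp add: spinS_def field_simps)
 then show ?thesis unfolding Splus_op_def Let_def conf_upd_eq_iff by (simp only:)
qed

lemma Sminus_entry:
 "Sminus_op n r sg ta = (if (\<forall>s. s ~= r --> sg s = ta s) & ta r = Suc (sg r)
   then complex_of_real (sqrt ((real n - real (sg r)) * (real (sg r) + 1))) else 0)"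
proof -
 have "spinS n * (spinS n + 1) - (real (ta r) - spinS n) * (real (ta r) - spinS n - 1)
   = (real n - (real (ta r) - 1)) * real (ta r)"
  by (simp add: spinS_def field_simps)
 moreover have "(1 <= ta r & sg = ta(r := ta r - 1)) \<longleftrightarrow> (\<forall>s. s ~= r --> sg s = ta s) & ta r = Suc (sg r)"
  by (auto simp: conf_upd_eq_iff)
 ultimately show ?thesis unfolding Sminus_op_def Let_def by (simp only:) auto
qed

lemma crel_Sx: "n >= 1 ==> crel N n (Sx_op n r) (msc (spinS n) (sop r (xm n)))"
proof -
 assume n: "n >= 1"
 have "Sx_op n r sg ta = complex_of_real (msc (spinS n) (sop r (xm n)) sg ta)" for sg ta
 proof -
  consider "sg r = Suc (ta r)" | "ta r = Suc (sg r)" | "sg r ~= Suc (ta r)" "ta r ~= Suc (sg r)" by blast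
  then show ?thesis using n
   by cases (simp_all add: Sx_op_def Splus_entry Sminus_entry sop_def xm_def msc_apply spinS_def, blast+)
 qed
 then show ?thesis by (simp add: crel_def)
qed

lemma crel_Sz: "n >= 1 ==> crel N n (Sz_op n r) (msc (spinS n) (sop r (zm n)))"
proof -
 assume n: "n >= 1"
 have "(sg = ta) \<longleftrightarrow> (\<forall>s. s ~= r --> sg s = ta s) & sg r = ta r" for sg ta :: conf by (auto simp: fun_eq_iff)
 then show ?thesis using n
  by (auto simp: crel_def Sz_op_def sop_def zm_def mz_def msc_apply spinS_def field_simps)
qed

lemma Sy_entry: "n >= 1 ==> Sy_op n r sg ta = - \<i> * complex_of_real (msc (spinS n) (sop r (ym n)) sg ta)"
proof -
 assume n: "n >= 1"
 have 1: "Splus_op n r sg ta - Sminus_op n r sg ta = complex_of_real (real n * sop r (ym n) sg ta)"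
 proof -
  consider "sg r = Suc (ta r)" | "ta r = Suc (sg r)" | "sg r ~= Suc (ta r)" "ta r ~= Suc (sg r)" by blast
  then show ?thesis
   using n by cases (simp_all add: Splus_entry Sminus_entry sop_def ym_def, blast+)
 qed
 have "complex_of_real a / (2 * \<i>) = - \<i> * complex_of_real (a / 2)" for a
  by (simp add: complex_eq_iff)
 then show ?thesis unfolding Sy_op_def 1 msc_apply spinS_def by simp
qed

lemma crel_spin_sq:
 assumes "n >= 1" "r \<in> sites N"
 shows "crel N n (op_mult N n (Sx_op n r) (Sx_op n r)) (msc ((spinS n)\<^sup>2) (sop r (mmul {..n} (xm n) (xm n))))"
  "crel N n (op_mult N n (Sz_op n r) (Sz_op n r)) (msc ((spinS n)\<^sup>2) (sop r (mmul {..n} (zm n) (zm n))))"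
  "crel N n (op_mult N n (Sy_op n r) (Sy_op n r)) (msc ((spinS n)\<^sup>2) (sop r (msc (-1) (mmul {..n} (ym n) (ym n)))))"
proof -
 have *: "mmul (confs N n) (msc (spinS n) (sop r X)) (msc (spinS n) (sop r X)) sg ta
   = msc ((spinS n)\<^sup>2) (sop r (mmul {..n} X X)) sg ta" if "sg \<in> confs N n" for X sg ta
  by (simp add: mmul_msc_left mmul_msc_right msc_apply mmul_sop_same[OF assms(2) that] power2_eq_square)
 show "crel N n (op_mult N n (Sx_op n r) (Sx_op n r)) (msc ((spinS n)\<^sup>2) (sop r (mmul {..n} (xm n) (xm n))))"
  using crel_mult[OF crel_Sx crel_Sx, of n N r r] assms(1) * by (simp add: crel_def)
 show "crel N n (op_mult N n (Sz_op n r) (Sz_op n r)) (msc ((spinS n)\<^sup>2) (sop r (mmul {..n} (zm n) (zm n))))"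
  using crel_mult[OF crel_Sz crel_Sz, of n N r r] assms(1) * by (simp add: crel_def)
 show "crel N n (op_mult N n (Sy_op n r) (Sy_op n r)) (msc ((spinS n)\<^sup>2) (sop r (msc (-1) (mmul {..n} (ym n) (ym n)))))"
  unfolding crel_def
 proof (intro ballI)
  fix sg ta assume st: "sg \<in> confs N n" "ta \<in> confs N n"
  have "op_mult N n (Sy_op n r) (Sy_op n r) sg ta
   = - complex_of_real (mmul (confs N n) (msc (spinS n) (sop r (ym n))) (msc (spinS n) (sop r (ym n))) sg ta)"
  proof -
   have "(- \<i> * complex_of_real a) * (- \<i> * complex_of_real b) = - complex_of_real (a * b)" for a b
    by (simp add: complex_eq_iff)
   then show ?thesis unfolding op_mult_def mmul_def Sy_entry[OF assms(1)]
    by (simp only: of_real_sum sum_negf[symmetric])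
  qed
  also have "... = complex_of_real (msc ((spinS n)\<^sup>2) (sop r (msc (-1) (mmul {..n} (ym n) (ym n)))) sg ta)"
   unfolding *[OF st(1)] by (auto simp: msc_apply sop_def)
  finally show "op_mult N n (Sy_op n r) (Sy_op n r) sg ta = ..." .
 qed
qed

text \<open>\<open>N >= 2\<close> makes the two ends of every edge distinct, so that a product of
  two site operators is an \<open>eop\<close>; the division by the squared spin magnitude is
  absorbed by the normalised single-site matrices.\<close>

lemma crel_hamiltonian:
 assumes n: "n >= 1" and N: "N >= 2"
 shows "crel N n (%sg ta. - complex_of_real \<beta> * hamiltonian N n J J sg ta) (ham N n (\<beta> * J))"
 unfolding crel_def
proof (intro ballI)
 fix sg ta assume st: "sg \<in> confs N n" "ta \<in> confs N n"
 define S where "S = spinS n"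
 have S: "S > 0" using n by (simp add: S_def spinS_def)
 let ?e = "%r d X. eop r (nbd N d r) X sg ta"
 have x: "op_mult N n (Sx_op n r) (Sx_op n (nbd N d r)) sg ta = complex_of_real (S\<^sup>2 * ?e r d (xm n))"
  if r: "r \<in> sites N" for r d
 proof -
  have "op_mult N n (Sx_op n r) (Sx_op n (nbd N d r)) sg ta
   = complex_of_real (mmul (confs N n) (msc S (sop r (xm n))) (msc S (sop (nbd N d r) (xm n))) sg ta)"
   using crel_mult[OF crel_Sx crel_Sx, of n N r "nbd N d r"] n st by (simp add: crel_def S_def)
  then show ?thesis using eop_eq_mmul[OF r nbd_sites[OF r] _ st, of d "xm n"] nbd_neq[OF r N, of d]
   by (simp add: mmul_msc_left mmul_msc_right msc_apply power2_eq_square)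
 qed
 have z: "op_mult N n (Sz_op n r) (Sz_op n (nbd N d r)) sg ta = complex_of_real (S\<^sup>2 * ?e r d (zm n))"
  if r: "r \<in> sites N" for r d
 proof -
  have "op_mult N n (Sz_op n r) (Sz_op n (nbd N d r)) sg ta
   = complex_of_real (mmul (confs N n) (msc S (sop r (zm n))) (msc S (sop (nbd N d r) (zm n))) sg ta)"
   using crel_mult[OF crel_Sz crel_Sz, of n N r "nbd N d r"] n st by (simp add: crel_def S_def)
  then show ?thesis using eop_eq_mmul[OF r nbd_sites[OF r] _ st, of d "zm n"] nbd_neq[OF r N, of d]
   by (simp add: mmul_msc_left mmul_msc_right msc_apply power2_eq_square)
 qed
 have nb: "nb1 N r = nbd N False r" "nb2 N r = nbd N True r" for r by (simp_all add: nbd_def)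
 have 1: "(\<Sum>r\<in>sites N.
     (if even (fst r) then op_mult N n (Sx_op n r) (Sx_op n (nb1 N r)) sg ta else 0)
    + (if even (snd r) then op_mult N n (Sx_op n r) (Sx_op n (nb2 N r)) sg ta else 0))
   = complex_of_real (S\<^sup>2 * (\<Sum>r\<in>sites N. (if even (fst r) then ?e r False (xm n) else 0)
     + (if even (snd r) then ?e r True (xm n) else 0)))"
  unfolding nb sum_distrib_left of_real_sum by (intro sum.cong refl) (simp add: x distrib_left)
 have 2: "(\<Sum>r\<in>sites N.
     (if odd (fst r) then op_mult N n (Sz_op n r) (Sz_op n (nb1 N r)) sg ta else 0)
    + (if odd (snd r) then op_mult N n (Sz_op n r) (Sz_op n (nb2 N r)) sg ta else 0))
   = complex_of_real (S\<^sup>2 * (\<Sum>r\<in>sites N. (if odd (fst r) then ?e r False (zm n) else 0)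
     + (if odd (snd r) then ?e r True (zm n) else 0)))"
  unfolding nb sum_distrib_left of_real_sum by (intro sum.cong refl) (simp add: z distrib_left)
 have 3: "(\<Sum>e\<in>edges N. eop (fst e) (nbd N (snd e) (fst e)) (ety n e) sg ta)
   = (\<Sum>r\<in>sites N. (if even (fst r) then ?e r False (xm n) else 0)
     + (if even (snd r) then ?e r True (xm n) else 0))
   + (\<Sum>r\<in>sites N. (if odd (fst r) then ?e r False (zm n) else 0)
     + (if odd (snd r) then ?e r True (zm n) else 0))"
 proof -
  have "(\<Sum>e\<in>edges N. eop (fst e) (nbd N (snd e) (fst e)) (ety n e) sg ta)
   = (\<Sum>r\<in>sites N. \<Sum>d\<in>UNIV. eop r (nbd N d r) (ety n (r, d)) sg ta)"
   by (simp add: edges_def sum.cartesian_product split_beta)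
  also have "... = (\<Sum>r\<in>sites N. ((if even (fst r) then ?e r False (xm n) else 0)
     + (if even (snd r) then ?e r True (xm n) else 0))
   + ((if odd (fst r) then ?e r False (zm n) else 0)
     + (if odd (snd r) then ?e r True (zm n) else 0)))"
   by (intro sum.cong refl) (simp add: UNIV_bool ety_def crd_def)
  finally show ?thesis by (simp add: sum.distrib)
 qed
 show "- complex_of_real \<beta> * hamiltonian N n J J sg ta = complex_of_real (ham N n (\<beta> * J) sg ta)"
 proof -
  have *: "complex_of_real (J / S\<^sup>2) * complex_of_real (S\<^sup>2 * a) = complex_of_real (J * a)" for a
   unfolding of_real_mult[symmetric] using S by (simp add: field_simps)
  have "- complex_of_real \<beta> * (- (complex_of_real (J * a)) - complex_of_real (J * b))
    = complex_of_real (\<beta> * J * (a + b))" for a b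
   by (simp add: algebra_simps)
  then show ?thesis
   unfolding hamiltonian_def hamr_def 1 2 3 S_def[symmetric] mult_minus_left * .
 qed
qed

section \<open>Edge sums and relabelling of sites\<close>

lemma nbd_bij: "bij_betw (nbd N d) (sites N) (sites N)"
proof (rule bij_betwI')
 fix r s assume "r \<in> sites N" "s \<in> sites N"
 then show "(nbd N d r = nbd N d s) = (r = s)"
  by (auto simp: sites_def nbd_def nb1_def nb2_def prod_eq_iff mod_Suc split: if_splits)
next
 fix s assume s: "s \<in> sites N"
 define p where "p = (%x. if x = 0 then N - 1 else x - 1)"
 have p: "(Suc (p x)) mod N = x" "p x < N" if "x < N" for x using that by (auto simp: p_def)
 show "\<exists>r\<in>sites N. s = nbd N d r"
 proof (cases d)
  case True
  then show ?thesis using s p[of "snd s"]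
   by (intro bexI[of _ "(fst s, p (snd s))"]) (auto simp: sites_def nbd_def nb2_def)
 next
  case False
  then show ?thesis using s p[of "fst s"]
   by (intro bexI[of _ "(p (fst s), snd s)"]) (auto simp: sites_def nbd_def nb1_def)
 qed
qed (rule nbd_sites)

lemma even_mod_even: "even (N::nat) ==> even (x mod N) = even x"
 by (metis dvd_mod_iff)

lemma crd_nbd_parity: "even N ==> even (crd d (nbd N d r)) = odd (crd d r)"
 by (auto simp: crd_def nbd_def nb1_def nb2_def even_mod_even)

lemma sum_nbd: "(\<Sum>r\<in>sites N. f (nbd N d r)) = (\<Sum>r\<in>sites N. f r)"
 by (rule sum.reindex_bij_betw[OF nbd_bij])

text \<open>For even \<open>N\<close> the edges of one direction and one parity form a perfect
  matching of the torus, so each site is met once.\<close>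

lemma edge_sum_dir:
 fixes w :: "site => real"
 assumes "even N"
 shows "(\<Sum>r\<in>sites N. if even (crd d r) = c then w r + w (nbd N d r) else 0) = (\<Sum>r\<in>sites N. w r)"
proof -
 have "(\<Sum>r\<in>sites N. if even (crd d r) = c then w r + w (nbd N d r) else 0)
   = (\<Sum>r\<in>sites N. if even (crd d r) = c then w r else 0)
   + (\<Sum>r\<in>sites N. if even (crd d (nbd N d r)) ~= c then w (nbd N d r) else 0)"
  unfolding sum.distrib[symmetric] using assms by (intro sum.cong refl) (auto simp: crd_nbd_parity)
 also have "(\<Sum>r\<in>sites N. if even (crd d (nbd N d r)) ~= c then w (nbd N d r) else 0)
   = (\<Sum>r\<in>sites N. if even (crd d r) ~= c then w r else 0)"
  by (rule sum_nbd)
 also have "(\<Sum>r\<in>sites N. if even (crd d r) = c then w r else 0) + ... = (\<Sum>r\<in>sites N. w r)"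
  unfolding sum.distrib[symmetric] by (intro sum.cong refl) auto
 finally show ?thesis .
qed

lemma sum_edges: "(\<Sum>e\<in>edges N. f e) = (\<Sum>r\<in>sites N. f (r, False)) + (\<Sum>r\<in>sites N. f (r, True))"
proof -
 have "(\<Sum>e\<in>edges N. f e) = (\<Sum>r\<in>sites N. \<Sum>d\<in>UNIV. f (r, d))"
  by (simp add: edges_def sum.cartesian_product split_beta)
 then show ?thesis by (simp add: UNIV_bool sum.distrib add.commute)
qed

lemma edge_sum:
 fixes w :: "site => real"
 assumes "even N"
 shows "(\<Sum>e\<in>edges N. if even (crd (snd e) (fst e)) = c then w (fst e) + w (nbd N (snd e) (fst e)) else 0)
   = 2 * (\<Sum>r\<in>sites N. w r)"
 unfolding sum_edges fst_conv snd_conv using edge_sum_dir[OF assms, of _ c w] by simp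

definition rl :: "nat => (site => site) => conf => conf" where
 "rl N \<pi> sg = (%s. if s \<in> sites N then sg (\<pi> s) else undefined)"

lemma rl_confs: "bij_betw \<pi> (sites N) (sites N) ==> sg \<in> confs N n ==> rl N \<pi> sg \<in> confs N n"
 unfolding confs_def rl_def by (auto simp: bij_betw_def PiE_def extensional_def Pi_def)

lemma rl_bij:
 assumes p: "bij_betw \<pi> (sites N) (sites N)"
 shows "bij_betw (rl N \<pi>) (confs N n) (confs N n)"
proof -
 have "inj_on (rl N \<pi>) (confs N n)"
 proof (rule inj_onI)
  fix sg ta assume st: "sg \<in> confs N n" "ta \<in> confs N n" "rl N \<pi> sg = rl N \<pi> ta"
  show "sg = ta"
  proof (rule conf_eqI[OF st(1,2)])
   fix r assume "r \<in> sites N"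
   then obtain s where "s \<in> sites N" "r = \<pi> s" using p by (metis bij_betw_imp_surj_on imageE)
   then show "sg r = ta r" using fun_cong[OF st(3), of s] by (simp add: rl_def)
  qed
 qed
 moreover have "rl N \<pi> ` confs N n <= confs N n" using rl_confs[OF p] by auto
 ultimately show ?thesis
  by (metis bij_betw_def endo_inj_surj finite_confs)
qed

lemma rl_agree:
 assumes p: "bij_betw \<pi> (sites N) (sites N)" and st: "sg \<in> confs N n" "ta \<in> confs N n"
  and W: "W <= sites N"
 shows "(\<forall>s. s ~: W --> rl N \<pi> sg s = rl N \<pi> ta s) \<longleftrightarrow> (\<forall>s. s ~: \<pi> ` W --> sg s = ta s)"
proof -
 have out: "sg s = ta s" if "s ~: sites N" for s
  using st that by (auto simp: confs_def PiE_def extensional_def)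
 have inj: "inj_on \<pi> (sites N)" and im: "\<pi> ` sites N = sites N" using p by (auto simp: bij_betw_def)
 show ?thesis
 proof
  assume L: "\<forall>s. s ~: W --> rl N \<pi> sg s = rl N \<pi> ta s"
  show "\<forall>s. s ~: \<pi> ` W --> sg s = ta s"
  proof (intro allI impI)
   fix t assume t: "t ~: \<pi> ` W"
   show "sg t = ta t"
   proof (cases "t \<in> sites N")
    case True
    then obtain s where s: "s \<in> sites N" "t = \<pi> s" using im by (metis imageE)
    with t have "s ~: W" by auto
    with L s show ?thesis by (auto simp: rl_def)
   qed (rule out)
  qed
 next
  assume R: "\<forall>s. s ~: \<pi> ` W --> sg s = ta s"
  show "\<forall>s. s ~: W --> rl N \<pi> sg s = rl N \<pi> ta s"
  proof (intro allI impI)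
   fix s assume s: "s ~: W"
   show "rl N \<pi> sg s = rl N \<pi> ta s"
   proof (cases "s \<in> sites N")
    case True
    with s inj W have "\<pi> s ~: \<pi> ` W" by (auto simp: inj_on_def)
    with R True show ?thesis by (simp add: rl_def)
   qed (simp add: rl_def)
  qed
 qed
qed

lemma sop_rl:
 assumes p: "bij_betw \<pi> (sites N) (sites N)" and st: "sg \<in> confs N n" "ta \<in> confs N n"
  and r: "r \<in> sites N"
 shows "sop r X (rl N \<pi> sg) (rl N \<pi> ta) = sop (\<pi> r) X sg ta"
proof -
 have A: "(\<forall>s. s ~= r --> rl N \<pi> sg s = rl N \<pi> ta s) \<longleftrightarrow> (\<forall>s. s ~= \<pi> r --> sg s = ta s)"
  using rl_agree[OF p st, of "{r}"] r by simp
 show ?thesis unfolding sop_def A using r by (auto simp: rl_def)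
qed

lemma eop_rl:
 assumes p: "bij_betw \<pi> (sites N) (sites N)" and st: "sg \<in> confs N n" "ta \<in> confs N n"
  and r: "r \<in> sites N" "r' \<in> sites N"
 shows "eop r r' X (rl N \<pi> sg) (rl N \<pi> ta) = eop (\<pi> r) (\<pi> r') X sg ta"
proof -
 have A: "(\<forall>s. s ~= r & s ~= r' --> rl N \<pi> sg s = rl N \<pi> ta s) \<longleftrightarrow> (\<forall>s. s ~= \<pi> r & s ~= \<pi> r' --> sg s = ta s)"
  using rl_agree[OF p st, of "{r, r'}"] r by simp
 show ?thesis unfolding eop_def A using r by (auto simp: rl_def)
qed

text \<open>The alternative in the hypothesis allows \<open>\<phi>\<close> to reverse an edge: a
  reflection exchanges base point and far end of the edges perpendicular to its plane.\<close>

lemma hamr_rl: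
 assumes p: "bij_betw \<pi> (sites N) (sites N)" and st: "sg \<in> confs N n" "ta \<in> confs N n"
  and phi: "bij_betw \<phi> (edges N) (edges N)"
  and e: "!!e. e \<in> edges N ==> 
    (\<pi> (fst e) = fst (\<phi> e) & \<pi> (nbd N (snd e) (fst e)) = nbd N (snd (\<phi> e)) (fst (\<phi> e))) \<or>
    (\<pi> (fst e) = nbd N (snd (\<phi> e)) (fst (\<phi> e)) & \<pi> (nbd N (snd e) (fst e)) = fst (\<phi> e))"
  and Y: "!!e. e \<in> edges N ==> Y e = Y' (\<phi> e)"
 shows "hamr N n b Y (rl N \<pi> sg) (rl N \<pi> ta) = hamr N n b Y' sg ta"
proof -
 have "(\<Sum>e\<in>edges N. eop (fst e) (nbd N (snd e) (fst e)) (Y e) (rl N \<pi> sg) (rl N \<pi> ta))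
   = (\<Sum>e\<in>edges N. eop (fst (\<phi> e)) (nbd N (snd (\<phi> e)) (fst (\<phi> e))) (Y' (\<phi> e)) sg ta)"
 proof (intro sum.cong refl)
  fix x assume x: "x \<in> edges N"
  then have "fst x \<in> sites N" by (auto simp: edges_def)
  then have "eop (fst x) (nbd N (snd x) (fst x)) (Y x) (rl N \<pi> sg) (rl N \<pi> ta)
    = eop (\<pi> (fst x)) (\<pi> (nbd N (snd x) (fst x))) (Y x) sg ta"
   by (intro eop_rl[OF p st] nbd_sites)
  also have "... = eop (fst (\<phi> x)) (nbd N (snd (\<phi> x)) (fst (\<phi> x))) (Y' (\<phi> x)) sg ta"
   using e[OF x] eop_commute[of "nbd N (snd (\<phi> x)) (fst (\<phi> x))" "fst (\<phi> x)"] by (auto simp: Y[OF x])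
  finally show "eop (fst x) (nbd N (snd x) (fst x)) (Y x) (rl N \<pi> sg) (rl N \<pi> ta) = ..." .
 qed
 also have "... = (\<Sum>e\<in>edges N. eop (fst e) (nbd N (snd e) (fst e)) (Y' e) sg ta)"
  by (rule sum.reindex_bij_betw[OF phi])
 finally show ?thesis by (simp add: hamr_def)
qed

text \<open>The unnormalised thermal expectation of \<open>B\<close>; for \<open>Y = ety n\<close>
  division by \<open>Zr\<close> gives the Gibbs mean.\<close>

definition tg :: "nat => nat => real => (site \<times> bool => nat => nat => real) => (conf => conf => real) => real" where
 "tg N n b Y B = mtr (confs N n) (mmul (confs N n) B (mexp (confs N n) (hamr N n b Y)))"

lemma mexp_rl:
 assumes p: "bij_betw \<pi> (sites N) (sites N)" and st: "sg \<in> confs N n" "ta \<in> confs N n"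
  and H: "!!sg ta. sg \<in> confs N n ==> ta \<in> confs N n ==> hamr N n b Y (rl N \<pi> sg) (rl N \<pi> ta) = hamr N n b Y' sg ta"
 shows "mexp (confs N n) (hamr N n b Y) (rl N \<pi> sg) (rl N \<pi> ta) = mexp (confs N n) (hamr N n b Y') sg ta"
proof -
 have "mexp (confs N n) (hamr N n b Y) (rl N \<pi> sg) (rl N \<pi> ta)
   = mexp (confs N n) (%sg ta. hamr N n b Y (rl N \<pi> sg) (rl N \<pi> ta)) sg ta"
  by (rule fin_index.mexp_reindex[OF fin_index_confs rl_bij[OF p] st, symmetric])
 also have "... = mexp (confs N n) (hamr N n b Y') sg ta"
  by (rule mexp_cong[OF H st])
 finally show ?thesis .
qed

lemma mmul_rl:
 assumes p: "bij_betw \<pi> (sites N) (sites N)"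
 shows "mmul (confs N n) A B (rl N \<pi> sg) (rl N \<pi> ta)
  = mmul (confs N n) (%sg ta. A (rl N \<pi> sg) (rl N \<pi> ta)) (%sg ta. B (rl N \<pi> sg) (rl N \<pi> ta)) sg ta"
 unfolding mmul_def by (rule sum.reindex_bij_betw[OF rl_bij[OF p], symmetric])

lemma tg_rl:
 assumes p: "bij_betw \<pi> (sites N) (sites N)"
  and H: "!!sg ta. sg \<in> confs N n ==> ta \<in> confs N n ==> hamr N n b Y (rl N \<pi> sg) (rl N \<pi> ta) = hamr N n b Y' sg ta"
 shows "tg N n b Y B = tg N n b Y' (%sg ta. B (rl N \<pi> sg) (rl N \<pi> ta))"
proof -
 let ?G = "mexp (confs N n) (hamr N n b Y)"
 have "tg N n b Y B = (\<Sum>sg\<in>confs N n. mmul (confs N n) B ?G (rl N \<pi> sg) (rl N \<pi> sg))"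
  unfolding tg_def mtr_def
  by (rule sum.reindex_bij_betw[OF rl_bij[OF p], where g="%sg. mmul (confs N n) B ?G sg sg", symmetric])
 also have "... = tg N n b Y' (%sg ta. B (rl N \<pi> sg) (rl N \<pi> ta))"
  unfolding mmul_rl[OF p] tg_def mtr_def
  by (intro sum.cong refl mmul_cong) (auto simp: mexp_rl[OF p _ _ H])
 finally show ?thesis .
qed

lemma tg_cong:
 assumes "!!sg ta. sg \<in> confs N n ==> ta \<in> confs N n ==> B sg ta = B' sg ta"
 shows "tg N n b Y B = tg N n b Y B'"
 unfolding tg_def mtr_def using assms by (intro sum.cong refl mmul_cong) auto

subsection \<open>The intertwiner exchanging the first and third spin components\<close>

text \<open>Model the spin space by polynomials of degree at most \<open>n\<close>, with
  \<open>u ^ k\<close> the k-th basis state up to normalisation. Then this is the image of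
  \<open>u ^ k\<close> under the Hadamard substitution \<open>(u, 1) -> (u + 1, u - 1)\<close>,
  which exchanges the first and third components.\<close>

definition kpoly :: "nat => nat => real poly" where
 "kpoly n k = [:1, 1:] ^ k * [:-1, 1:] ^ (n - k)"

text \<open>The same substitution in the basis \<open>sqrt (n choose k) * u ^ k\<close>, scaled to
  an involution: a normalised Krawtchouk matrix.\<close>

definition vm :: "nat => nat => nat => real" where
 "vm n j k = sqrt (real (n choose k)) / sqrt (real (n choose j)) * coeff (kpoly n k) j / sqrt (2 ^ n)"

lemma degree_kpoly: "k <= n ==> degree (kpoly n k) = n"
 unfolding kpoly_def by (subst degree_mult_eq) (auto simp: degree_power_eq)

text \<open>Substituting twice doubles both variables. In the affine coordinate the substitution is
  the Moebius map \<open>w = (u + 1) / (u - 1)\<close>, its own inverse; the identity holds at all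
  \<open>u\<close> other than 1, hence for the polynomials.\<close>

lemma kpoly_sum:
 assumes "j <= n"
 shows "(\<Sum>k\<le>n. smult (coeff (kpoly n j) k) (kpoly n k)) = monom (2 ^ n) j"
proof -
 have "poly (\<Sum>k\<le>n. smult (coeff (kpoly n j) k) (kpoly n k)) u = poly (monom (2 ^ n) j) u"
  if u: "u \<in> - {1}" for u
 proof -
  have u1: "u - 1 ~= 0" using u by auto
  define w where "w = (u + 1) / (u - 1)"
  have w: "w + 1 = 2 * u / (u - 1)" "w - 1 = 2 / (u - 1)" using u1 by (auto simp: w_def field_simps)
  have "(\<Sum>k\<le>n. coeff (kpoly n j) k * ((u + 1) ^ k * (u - 1) ^ (n - k)))
    = (\<Sum>k\<le>n. (u - 1) ^ n * (coeff (kpoly n j) k * w ^ k))"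
   using u1 by (intro sum.cong refl) (auto simp: w_def power_divide power_diff field_simps)
  also have "... = (u - 1) ^ n * poly (kpoly n j) w"
   using degree_kpoly[OF assms] by (simp add: poly_altdef sum_distrib_left)
  also have "poly (kpoly n j) w = (w + 1) ^ j * (w - 1) ^ (n - j)"
   by (simp add: kpoly_def poly_power add.commute)
  also have "(u - 1) ^ n * ... = 2 ^ n * u ^ j"
  proof -
   have "(u - 1) ^ n = (u - 1) ^ j * (u - 1) ^ (n - j)" "2 ^ n = (2::real) ^ j * 2 ^ (n - j)"
    using assms by (simp_all flip: power_add)
   then show ?thesis using u1 by (simp add: w power_divide power_mult_distrib)
  qed
  finally show ?thesis
   by (simp add: poly_sum kpoly_def poly_power poly_monom add.commute)
 qed
 then have sub: "- {1} <= {u. poly ((\<Sum>k\<le>n. smult (coeff (kpoly n j) k) (kpoly n k)) - monom (2 ^ n) j) u = 0}"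
  by auto
 moreover have "infinite (- {1 :: real})" by (simp add: Compl_eq_Diff_UNIV infinite_UNIV_char_0)
 ultimately show ?thesis
  using poly_roots_finite[of "(\<Sum>k\<le>n. smult (coeff (kpoly n j) k) (kpoly n k)) - monom (2 ^ n) j"]
   finite_subset by (metis (no_types, lifting) eq_iff_diff_eq_0)
qed

lemma vm_involution:
 assumes "i <= n" "j <= n"
 shows "mmul {..n} (vm n) (vm n) i j = mid i j"
proof -
 have pos: "real (n choose k) > 0" if "k <= n" for k using that by simp
 have "mmul {..n} (vm n) (vm n) i j
  = (\<Sum>k\<le>n. (sqrt (real (n choose j)) / sqrt (real (n choose i)) / 2 ^ n) * (coeff (kpoly n j) k * coeff (kpoly n k) i))"
  unfolding mmul_def
 proof (intro sum.cong refl)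
  fix k assume "k \<in> {..n}"
  then have "sqrt (real (n choose k)) ~= 0" using pos by simp
  moreover have "sqrt (2 ^ n) * sqrt (2 ^ n) = (2 ^ n :: real)" by simp
  ultimately show "vm n i k * vm n k j = (sqrt (real (n choose j)) / sqrt (real (n choose i)) / 2 ^ n) * (coeff (kpoly n j) k * coeff (kpoly n k) i)"
   unfolding vm_def by (simp add: field_simps)
 qed
 also have "... = (sqrt (real (n choose j)) / sqrt (real (n choose i)) / 2 ^ n)
   * coeff (\<Sum>k\<le>n. smult (coeff (kpoly n j) k) (kpoly n k)) i"
  by (simp add: sum_distrib_left coeff_sum)
 also have "... = mid i j"
  unfolding kpoly_sum[OF assms(2)] using pos[OF assms(1)] by (auto simp: mid_def)
 finally show ?thesis .
qed

text \<open>Comparing coefficients in this first-order equation yields a three-term recurrence,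
  which is the eigenvalue equation of the first component.\<close>

lemma kpoly_ode:
 assumes "k <= n"
 shows "[:-1, 0, 1:] * pderiv (kpoly n k) = [:real n - 2 * real k, real n:] * kpoly n k"
proof -
 let ?A = "[:1, 1:] :: real poly" and ?B = "[:-1, 1:] :: real poly"
 have AB: "[:-1, 0, 1:] = ?A * ?B" by simp
 have d: "p * pderiv (p ^ m) = smult (real m) (p ^ m)" if "pderiv p = 1" for p :: "real poly" and m
  using that by (cases m) (simp_all add: pderiv_power_Suc mult_ac del: power_Suc, simp)
 have dA: "?A * pderiv (?A ^ m) = smult (real m) (?A ^ m)" for m
  by (rule d) (simp add: pderiv_pCons)
 have dB: "?B * pderiv (?B ^ m) = smult (real m) (?B ^ m)" for m
  by (rule d) (simp add: pderiv_pCons)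
 have "[:-1, 0, 1:] * pderiv (kpoly n k)
   = ?B * (?A * pderiv (?A ^ k)) * ?B ^ (n - k) + ?A * ?A ^ k * (?B * pderiv (?B ^ (n - k)))"
  unfolding AB kpoly_def pderiv_mult by (simp only: algebra_simps)
 also have "... = (smult (real k) ?B + smult (real (n - k)) ?A) * kpoly n k"
 proof -
  have "B * smult r P * Q + A * P * smult t Q = (smult r B + smult t A) * (P * Q)"
   for A B P Q :: "real poly" and r t by (simp add: algebra_simps)
  then show ?thesis unfolding dA dB kpoly_def .
 qed
 also have "smult (real k) ?B + smult (real (n - k)) ?A = [:real n - 2 * real k, real n:]"
  using assms by (simp add: of_nat_diff)
 finally show ?thesis .
qed

lemma kpoly_rec:
 assumes "k <= n"
 shows "coeff (kpoly n k) 1 = (2 * real k - real n) * coeff (kpoly n k) 0"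
  "(real i + 2) * coeff (kpoly n k) (Suc (Suc i)) + (real n - real i) * coeff (kpoly n k) i
    = (2 * real k - real n) * coeff (kpoly n k) (Suc i)"
 using arg_cong[OF kpoly_ode[OF assms], of "%p. coeff p 0"]
  arg_cong[OF kpoly_ode[OF assms], of "%p. coeff p (Suc i)"]
 by (auto simp: coeff_pderiv algebra_simps coeff_pCons split: nat.splits)

lemma sum_xm:
 assumes "i <= n"
 shows "(\<Sum>l\<le>n. xm n i l * f l) = sqrt ((real n - real i) * (real i + 1)) / n * f (Suc i)
   + (case i of 0 => 0 | Suc j => sqrt ((real n - real j) * (real j + 1)) / n * f j)"
proof -
 have "(\<Sum>l\<le>n. xm n i l * f l) = (\<Sum>l\<le>n. if l = Suc i then sqrt ((real n - real i) * (real i + 1)) / n * f l else 0)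
   + (\<Sum>l\<le>n. if i = Suc l then sqrt ((real n - real l) * (real l + 1)) / n * f l else 0)"
  unfolding sum.distrib[symmetric] by (intro sum.cong refl) (auto simp: xm_def)
 also have "(\<Sum>l\<le>n. if l = Suc i then sqrt ((real n - real i) * (real i + 1)) / n * f l else 0)
   = sqrt ((real n - real i) * (real i + 1)) / n * f (Suc i)"
  using assms by (cases "i = n") (auto simp: sum.delta)
 also have "(\<Sum>l\<le>n. if i = Suc l then sqrt ((real n - real l) * (real l + 1)) / n * f l else 0)
   = (case i of 0 => 0 | Suc j => sqrt ((real n - real j) * (real j + 1)) / n * f j)"
  using assms by (cases i) (auto simp: sum.delta')
 finally show ?thesis .
qed

text \<open>By \<open>kpoly_rec\<close> the columns of \<open>vm\<close> are eigenvectors of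
  \<open>xm\<close> with eigenvalues \<open>mz n k\<close>. The facts \<open>up\<close> and
  \<open>dn\<close> turn a ladder coefficient times the square root of a binomial into a rational
  factor times the neighbouring square root.\<close>

lemma xm_vm:
 assumes i: "i <= n" and k: "k <= n" and n: "n >= 1"
 shows "mmul {..n} (xm n) (vm n) i k = mmul {..n} (vm n) (zm n) i k"
proof -
 let ?w = "%i. sqrt (real (n choose i))" and ?c = "coeff (kpoly n k)"
 have w: "?w j > 0" if "j <= n" for j using that by simp
 have up: "sqrt ((real n - real j) * (real j + 1)) * ?w j = (real j + 1) * ?w (Suc j)" if "Suc j <= n" for j
 proof -
  have "real (Suc j) * real (n choose Suc j) = real (n choose j) * real (n - j)"
   by (metis binomial_absorb_comp binomial_absorption mult.commute of_nat_mult binomial_fact_lemma Suc_times_binomial_eq)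
  then have e: "(real j + 1) * real (n choose Suc j) = real (n choose j) * (real n - real j)"
   using that by (simp add: of_nat_diff add.commute)
  have "(real n - real j) * (real j + 1) * real (n choose j) = (real j + 1) * (real (n choose j) * (real n - real j))"
   by simp
  also have "... = (real j + 1)\<^sup>2 * real (n choose Suc j)"
   unfolding e[symmetric] by (simp add: power2_eq_square)
  finally have "(real n - real j) * (real j + 1) * real (n choose j) = (real j + 1)\<^sup>2 * real (n choose Suc j)" .
  then show ?thesis by (simp flip: real_sqrt_mult) (simp add: real_sqrt_mult)
 qed
 have dn: "sqrt ((real n - real j) * (real j + 1)) * ?w (Suc j) = (real n - real j) * ?w j" if "Suc j <= n" for j
 proof -
  have "sqrt ((real n - real j) * (real j + 1)) * (sqrt ((real n - real j) * (real j + 1)) * ?w j)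
    = sqrt ((real n - real j) * (real j + 1)) * ((real j + 1) * ?w (Suc j))"
   using up[OF that] by simp
  moreover have "sqrt ((real n - real j) * (real j + 1)) * sqrt ((real n - real j) * (real j + 1))
    = (real n - real j) * (real j + 1)" using that by simp
  ultimately have "(real j + 1) * ((real n - real j) * ?w j)
    = (real j + 1) * (sqrt ((real n - real j) * (real j + 1)) * ?w (Suc j))"
   by (simp add: mult_ac)
  then show ?thesis by simp
 qed
 define K where "K = ?w k / sqrt (2 ^ n)"
 have v: "vm n j k = K * ?c j / ?w j" for j by (simp add: vm_def K_def)
 have gen: "q * (K * c / b') = K * (x * c) / a" if "q * a = x * b'" "a > 0" "b' > 0" for q a x b' c K :: real
 proof -
  have "q = x * b' / a" using that by (simp add: field_simps)
  then show ?thesis using that by simp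
 qed
 have A: "sqrt ((real n - real i) * (real i + 1)) * vm n (Suc i) k = K * ((real i + 1) * ?c (Suc i)) / ?w i"
 proof (cases "i = n")
  case True
  then show ?thesis using degree_kpoly[OF k] by (simp add: coeff_eq_0)
 next
  case False
  then show ?thesis unfolding v using gen[OF up[of i], where K=K and c="?c (Suc i)"] i w[of i] w[of "Suc i"] by simp
 qed
 have B: "sqrt ((real n - real j) * (real j + 1)) * vm n j k = K * ((real n - real j) * ?c j) / ?w (Suc j)"
  if "i = Suc j" for j
  unfolding v using gen[OF dn[of j], where K=K and c="?c j"] i that w[of j] w[of "Suc j"] by simp
 have "mmul {..n} (xm n) (vm n) i k = vm n i k * mz n k"
 proof (cases i)
  case 0
  have "mmul {..n} (xm n) (vm n) i k = K * ((real i + 1) * ?c (Suc i)) / ?w i / n"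
   unfolding mmul_def sum_xm[OF i] using A 0 by simp
  also have "(real i + 1) * ?c (Suc i) = (2 * real k - real n) * ?c i"
   using kpoly_rec(1)[OF k] 0 by simp
  finally show ?thesis by (simp add: v mz_def)
 next
  case (Suc j)
  have "mmul {..n} (xm n) (vm n) i k = K * ((real i + 1) * ?c (Suc i) + (real n - real j) * ?c j) / ?w i / n"
   unfolding mmul_def sum_xm[OF i] using A B[OF Suc] Suc by (simp add: add_divide_distrib distrib_left)
  also have "(real i + 1) * ?c (Suc i) + (real n - real j) * ?c j = (2 * real k - real n) * ?c i"
   using kpoly_rec(2)[OF k, of j] Suc by (simp add: algebra_simps)
  finally show ?thesis by (simp add: v mz_def)
 qed
 also have "... = mmul {..n} (vm n) (zm n) i k"
  using k by (simp add: mmul_def zm_def if_distrib[of "%x. _ * x"] cong: if_cong)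
 finally show ?thesis .
qed

lemma zm_vm:
 assumes i: "i <= n" and k: "k <= n" and n: "n >= 1"
 shows "mmul {..n} (zm n) (vm n) i k = mmul {..n} (vm n) (xm n) i k"
proof -
 let ?m = "mmul {..n}" and ?v = "vm n"
 have "?m (zm n) ?v i k = ?m mid (?m (zm n) ?v) i k" using i by (simp add: mmul_mid_left)
 also have "... = ?m (?m ?v ?v) (?m (zm n) ?v) i k"
  using i by (intro mmul_cong) (auto simp: vm_involution)
 also have "... = ?m ?v (?m (?m ?v (zm n)) ?v) i k" by (simp add: mmul_assoc)
 also have "... = ?m ?v (?m (?m (xm n) ?v) ?v) i k"
  using k n by (intro mmul_cong[of _ ?v _ ?v] refl mmul_cong[of _ "?m ?v (zm n)"]) (auto simp: xm_vm)
 also have "... = ?m (?m ?v (xm n)) (?m ?v ?v) i k" by (simp add: mmul_assoc)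
 also have "... = ?m (?m ?v (xm n)) mid i k"
  using k by (intro mmul_cong) (auto simp: vm_involution)
 also have "... = ?m ?v (xm n) i k" using k by (simp add: mmul_mid_right)
 finally show ?thesis .
qed

definition pvm :: "nat => nat => conf => conf => real" where
 "pvm N n sg ta = (\<Prod>r\<in>sites N. vm n (sg r) (ta r))"

definition intw :: "'i set => ('i => 'i => real) => ('i => 'i => real) => ('i => 'i => real) => bool" where
 "intw I V A B \<longleftrightarrow> (\<forall>i\<in>I. \<forall>j\<in>I. mmul I A V i j = mmul I V B i j)"

lemma intw_mmul:
 assumes "intw I V A A'" "intw I V B B'"
 shows "intw I V (mmul I A B) (mmul I A' B')"
 unfolding intw_def
proof (intro ballI)
 fix i j assume ij: "i \<in> I" "j \<in> I"
 have "mmul I (mmul I A B) V i j = mmul I A (mmul I B V) i j" by (simp add: mmul_assoc)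
 also have "... = mmul I A (mmul I V B') i j"
  using assms(2) ij by (intro mmul_cong[of I A _ A]) (auto simp: intw_def)
 also have "... = mmul I (mmul I A V) B' i j" by (simp add: mmul_assoc)
 also have "... = mmul I (mmul I V A') B' i j"
  using assms(1) ij by (intro mmul_cong[of I "mmul I A V"]) (auto simp: intw_def)
 finally show "mmul I (mmul I A B) V i j = mmul I V (mmul I A' B') i j" by (simp add: mmul_assoc)
qed

lemma intw_sum: "(!!a. a \<in> S ==> intw I V (A a) (B a)) ==> intw I V (%i j. \<Sum>a\<in>S. A a i j) (%i j. \<Sum>a\<in>S. B a i j)"
 by (simp add: intw_def mmul_sum_left mmul_sum_right)

lemma intw_msc: "intw I V A B ==> intw I V (msc c A) (msc c B)"
 by (simp add: intw_def mmul_msc_left mmul_msc_right msc_apply)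

lemma intw_cong:
 assumes "intw I V A B" "!!i j. i \<in> I ==> j \<in> I ==> A i j = A' i j" "!!i j. i \<in> I ==> j \<in> I ==> B i j = B' i j"
 shows "intw I V A' B'"
 using assms unfolding intw_def mmul_def by simp

lemma intw_mpow: "finite I ==> intw I V A B ==> intw I V (mpow I A k) (mpow I B k)"
 by (induction k) (simp_all add: intw_mmul, simp add: intw_def mmul_mid_left mmul_mid_right)

context fin_index begin

lemma intw_mexp:
 assumes "intw I V A B" shows "intw I V (mexp I A) (mexp I B)"
 unfolding intw_def
proof (intro ballI)
 fix i j assume ij: "i \<in> I" "j \<in> I"
 have "mmul I (mpow I A k) V i j = mmul I V (mpow I B k) i j" for k
  using intw_mpow[OF finI assms, of k] ij by (simp add: intw_def)
 then show "mmul I (mexp I A) V i j = mmul I V (mexp I B) i j"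
  using sums_unique2[OF mexp_mmul_sums[OF ij(1), of A V j]] mmul_mexp_sums[OF ij(2), of V B i] by simp
qed

text \<open>With \<open>V V = 1\<close> the intertwining relation is a similarity, and the trace is
  cyclic.\<close>

lemma mtr_intw:
 assumes VV: "!!i j. i \<in> I ==> j \<in> I ==> mmul I V V i j = mid i j" and AB: "intw I V A B"
 shows "mtr I A = mtr I B"
proof -
 have "mtr I A = mtr I (mmul I A (mmul I V V))"
  unfolding mtr_def
 proof (intro sum.cong refl)
  fix i assume i: "i \<in> I"
  have "mmul I A (mmul I V V) i i = mmul I A mid i i"
   using i by (intro mmul_cong) (auto simp: VV)
  then show "A i i = mmul I A (mmul I V V) i i" using i finI by (simp add: mmul_mid_right)
 qed
 also have "... = mtr I (mmul I (mmul I A V) V)" by (simp add: mmul_assoc)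
 also have "... = mtr I (mmul I (mmul I V B) V)"
  using AB unfolding mtr_def intw_def by (intro sum.cong refl mmul_cong[of I "mmul I A V"]) auto
 also have "... = mtr I (mmul I (mmul I V V) B)"
  by (subst mtr_mmul_comm) (simp add: mmul_assoc)
 also have "... = mtr I B"
  unfolding mtr_def
 proof (intro sum.cong refl)
  fix i assume i: "i \<in> I"
  have "mmul I (mmul I V V) B i i = mmul I mid B i i"
   using i by (intro mmul_cong) (auto simp: VV)
  then show "mmul I (mmul I V V) B i i = B i i" using i finI by (simp add: mmul_mid_left)
 qed
 finally show ?thesis .
qed

end

lemma pvm_involution:
 assumes st: "sg \<in> confs N n" "ta \<in> confs N n"
 shows "mmul (confs N n) (pvm N n) (pvm N n) sg ta = mid sg ta"
proof -
 have "mmul (confs N n) (pvm N n) (pvm N n) sg ta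
   = (\<Sum>\<rho>\<in>PiE (sites N) (%_. {..n}). \<Prod>r\<in>sites N. vm n (sg r) (\<rho> r) * vm n (\<rho> r) (ta r))"
  by (simp add: mmul_def pvm_def prod.distrib confs_def)
 also have "... = (\<Prod>r\<in>sites N. \<Sum>k\<le>n. vm n (sg r) k * vm n k (ta r))"
  by (intro prod_sum_PiE[symmetric]) auto
 also have "... = (\<Prod>r\<in>sites N. mid (sg r) (ta r))"
  using st by (intro prod.cong refl) (simp add: vm_involution[unfolded mmul_def] conf_le)
 also have "... = mid sg ta"
 proof (cases "sg = ta")
  case False
  then obtain r where "r \<in> sites N" "sg r ~= ta r" using conf_eqI[OF st] by blast
  then have "(\<Prod>r\<in>sites N. mid (sg r) (ta r)) = 0"
   by (intro prod_zero bexI[of _ r]) (auto simp: mid_def)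
  then show ?thesis using False by (simp add: mid_def)
 qed (simp add: mid_def)
 finally show ?thesis .
qed

lemma mmul_sop_right:
 assumes r: "r \<in> sites N" and t: "ta \<in> confs N n"
 shows "mmul (confs N n) B (sop r X) sg ta = (\<Sum>k\<le>n. B sg (ta(r := k)) * X k (ta r))"
proof -
 have "mmul (confs N n) B (sop r X) sg ta = mmul (confs N n) (sop r (%i j. X j i)) (%i j. B j i) ta sg"
  unfolding mmul_def by (intro sum.cong refl) (auto simp: sop_def mult.commute)
 then show ?thesis by (simp add: mmul_sop[OF r t] mult.commute)
qed

lemma intw_sop:
 assumes r: "r \<in> sites N" and X: "!!i k. i <= n ==> k <= n ==> mmul {..n} X (vm n) i k = mmul {..n} (vm n) X' i k"
 shows "intw (confs N n) (pvm N n) (sop r X) (sop r X')"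
 unfolding intw_def
proof (intro ballI)
 fix sg ta assume st: "sg \<in> confs N n" "ta \<in> confs N n"
 let ?P = "\<Prod>s\<in>sites N - {r}. vm n (sg s) (ta s)"
 have split: "pvm N n sg' ta' = vm n (sg' r) (ta' r) * (\<Prod>s\<in>sites N - {r}. vm n (sg' s) (ta' s))" for sg' ta'
  unfolding pvm_def using r by (subst prod.remove[of _ r]) auto
 have "mmul (confs N n) (sop r X) (pvm N n) sg ta = (\<Sum>k\<le>n. X (sg r) k * (vm n k (ta r) * ?P))"
  unfolding mmul_sop[OF r st(1)] split by (intro sum.cong refl) (auto intro!: prod.cong)
 also have "... = mmul {..n} X (vm n) (sg r) (ta r) * ?P"
  by (simp add: mmul_def sum_distrib_right mult.assoc)
 also have "... = mmul {..n} (vm n) X' (sg r) (ta r) * ?P"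
  using X st r by (simp add: conf_le)
 also have "... = (\<Sum>k\<le>n. vm n (sg r) k * ?P * X' k (ta r))"
  by (simp add: mmul_def sum_distrib_right mult_ac)
 also have "... = mmul (confs N n) (pvm N n) (sop r X') sg ta"
  unfolding mmul_sop_right[OF r st(2)] split by (intro sum.cong refl) (auto intro!: prod.cong)
 finally show "mmul (confs N n) (sop r X) (pvm N n) sg ta = mmul (confs N n) (pvm N n) (sop r X') sg ta" .
qed

text \<open>Conjugation by \<open>pvm\<close> exchanges the two edge types; the result is not the
  original model, but a lattice symmetry carries it back (\<open>ham_inv2\<close>).\<close>

definition etys :: "nat => site \<times> bool => nat => nat => real" where
 "etys n e = (if even (crd (snd e) (fst e)) then zm n else xm n)"

lemma intw_ham:
 assumes N: "N >= 2" and n: "n >= 1"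
 shows "intw (confs N n) (pvm N n) (ham N n b) (hamr N n b (etys n))"
proof -
 have "intw (confs N n) (pvm N n) 
   (msc b (%sg ta. \<Sum>e\<in>edges N. eop (fst e) (nbd N (snd e) (fst e)) (ety n e) sg ta))
   (msc b (%sg ta. \<Sum>e\<in>edges N. eop (fst e) (nbd N (snd e) (fst e)) (etys n e) sg ta))"
 proof (intro intw_msc intw_sum)
  fix e assume "e \<in> edges N"
  then have r: "fst e \<in> sites N" "nbd N (snd e) (fst e) \<in> sites N" "fst e ~= nbd N (snd e) (fst e)"
   using nbd_neq[OF _ N, of "fst e" "snd e"] nbd_sites by (force simp: edges_def)+
  have X: "mmul {..n} (ety n e) (vm n) i k = mmul {..n} (vm n) (etys n e) i k" if "i <= n" "k <= n" for i k
   using xm_vm[OF that n] zm_vm[OF that n] by (simp add: ety_def etys_def)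
  have "intw (confs N n) (pvm N n)
    (mmul (confs N n) (sop (fst e) (ety n e)) (sop (nbd N (snd e) (fst e)) (ety n e)))
    (mmul (confs N n) (sop (fst e) (etys n e)) (sop (nbd N (snd e) (fst e)) (etys n e)))"
   by (intro intw_mmul intw_sop r X)
  then show "intw (confs N n) (pvm N n) (eop (fst e) (nbd N (snd e) (fst e)) (ety n e))
     (eop (fst e) (nbd N (snd e) (fst e)) (etys n e))"
   by (rule intw_cong) (auto simp: eop_eq_mmul[OF r])
 qed
 then show ?thesis by (simp add: hamr_def msc_def)
qed

lemma tg_swap:
 assumes "N >= 2" "n >= 1" "intw (confs N n) (pvm N n) B B'"
 shows "tg N n b (ety n) B = tg N n b (etys n) B'"
 unfolding tg_def
 by (rule fin_index.mtr_intw[OF fin_index_confs pvm_involution intw_mmul[OF assms(3)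
   fin_index.intw_mexp[OF fin_index_confs intw_ham[OF assms(1,2)]]]])

section \<open>Reflections and inversions of the torus\<close>

definition rf :: "nat => nat => nat => nat" where
 "rf N a x = nat ((int a - int x) mod int N)"

lemma rf_int: "N > 0 ==> int (rf N a x) = (int a - int x) mod int N"
 by (simp add: rf_def)

lemma rf_lt: "N > 0 ==> rf N a x < N"
 using rf_int[of N a x] by (metis of_nat_0_less_iff of_nat_less_iff pos_mod_bound)

lemma rf_rf: "x < N ==> rf N a (rf N a x) = x"
proof -
 assume x: "x < N"
 then have N: "N > 0" by simp
 have "int (rf N a (rf N a x)) = (int a - (int a - int x) mod int N) mod int N"
  using N by (simp add: rf_int)
 also have "... = int x mod int N" by (simp add: mod_simps)
 also have "... = int x" using x by simp
 finally show ?thesis by simp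
qed

lemma rf_Suc: "x < N ==> Suc (rf N a (Suc x mod N)) mod N = rf N a x"
proof -
 assume x: "x < N"
 then have N: "N > 0" by simp
 have "int (Suc (rf N a (Suc x mod N)) mod N) = (1 + (int a - (1 + int x) mod int N) mod int N) mod int N"
  using N by (simp add: rf_int zmod_int)
 also have "... = (int a - int x) mod int N" by (simp add: mod_simps)
 finally show ?thesis using rf_int[OF N, of a x] by simp
qed

lemma rf_parity: "N > 0 ==> even N ==> even (rf N a x) = even (a + x)"
proof -
 assume N: "N > 0" "even N"
 have "even (int (rf N a x)) = even (int a - int x)"
  using N by (simp add: rf_int dvd_mod_iff)
 then show ?thesis by simp
qed

lemma bij_involution: "(!!s. s \<in> S ==> f s \<in> S) ==> (!!s. s \<in> S ==> f (f s) = s) ==> bij_betw f S S"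
 by (rule bij_betw_byWitness[of _ f]) auto

definition refl1 :: "nat => nat => site => site" where
 "refl1 N a s = (rf N a (fst s), snd s)"

definition inv2 :: "nat => site => site => site" where
 "inv2 N r s = (rf N (2 * fst r) (fst s), rf N (2 * snd r) (snd s))"

lemma sites_fst_lt: "s \<in> sites N ==> fst s < N" "s \<in> sites N ==> snd s < N"
 by (auto simp: sites_def)

lemma sitesI: "fst s < N ==> snd s < N ==> s \<in> sites N"
 by (auto simp: sites_def mem_Times_iff)

lemma refl1_sites: "s \<in> sites N ==> refl1 N a s \<in> sites N"
 by (intro sitesI) (auto simp: refl1_def sites_def intro!: rf_lt)

lemma refl1_refl1: "s \<in> sites N ==> refl1 N a (refl1 N a s) = s"
 by (simp add: refl1_def rf_rf sites_fst_lt)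

lemma refl1_bij: "bij_betw (refl1 N a) (sites N) (sites N)"
 by (rule bij_involution) (auto simp: refl1_sites refl1_refl1)

lemma inv2_bij: "bij_betw (inv2 N r) (sites N) (sites N)"
proof (rule bij_involution)
 fix s assume s: "s \<in> sites N"
 then show "inv2 N r s \<in> sites N"
  by (intro sitesI) (auto simp: inv2_def sites_def intro!: rf_lt)
 show "inv2 N r (inv2 N r s) = s" using s by (simp add: inv2_def rf_rf sites_fst_lt)
qed

lemma inv2_self: "r \<in> sites N ==> inv2 N r r = r"
proof -
 assume "r \<in> sites N"
 then have "fst r < N" "snd r < N" by (auto simp: sites_def)
 then have "rf N (2 * fst r) (fst r) = fst r" "rf N (2 * snd r) (snd r) = snd r" by (auto simp: rf_def)
 then show ?thesis by (simp add: inv2_def)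
qed

lemma swap_bij: "bij_betw prod.swap (sites N) (sites N)"
 by (rule bij_involution) (auto simp: sites_def)

lemma bij_edges_involution:
 assumes "!!e. e \<in> edges N ==> \<phi> e \<in> edges N" "!!e. e \<in> edges N ==> \<phi> (\<phi> e) = e"
 shows "bij_betw \<phi> (edges N) (edges N)"
 using assms by (rule bij_involution)

lemma edges_iff: "e \<in> edges N \<longleftrightarrow> fst e \<in> sites N"
 by (auto simp: edges_def mem_Times_iff)

text \<open>A reflection \<open>x -> a - x\<close> sends the edge based at \<open>x\<close> to the
  edge based at \<open>a - x - 1\<close>, which for odd \<open>a\<close> has the parity of
  \<open>x\<close>, hence the same type. These are the reflections through the middle of a
  bond.\<close>

lemma ham_refl1:
 assumes N: "even N" "N > 0" and a: "odd a" and st: "sg \<in> confs N n" "ta \<in> confs N n"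
 shows "ham N n b (rl N (refl1 N a) sg) (rl N (refl1 N a) ta) = ham N n b sg ta"
proof -
 define \<phi> where "\<phi> = (%e. if snd e then (refl1 N a (fst e), True) else (refl1 N a (nbd N False (fst e)), False))"
 have nf: "nbd N False (refl1 N a (nbd N False s)) = refl1 N a s" if "s \<in> sites N" for s
  using rf_Suc[of "fst s" N a] that by (simp add: nbd_def nb1_def refl1_def sites_fst_lt)
 show ?thesis
 proof (rule hamr_rl[OF refl1_bij st])
  show "bij_betw \<phi> (edges N) (edges N)"
  proof (rule bij_edges_involution)
   fix e assume e: "e \<in> edges N"
   then show "\<phi> e \<in> edges N" by (simp add: \<phi>_def edges_iff refl1_sites nbd_sites)
   show "\<phi> (\<phi> e) = e" using e
    by (auto simp: \<phi>_def edges_iff refl1_refl1 nbd_sites nf prod_eq_iff)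
  qed
  fix e assume e: "e \<in> edges N"
  then have s: "fst e \<in> sites N" by (simp add: edges_iff)
  have nt: "refl1 N a (nbd N True (fst e)) = nbd N True (refl1 N a (fst e))"
   by (simp add: nbd_def nb2_def refl1_def)
  show "(refl1 N a (fst e) = fst (\<phi> e) & refl1 N a (nbd N (snd e) (fst e)) = nbd N (snd (\<phi> e)) (fst (\<phi> e))) \<or>
    (refl1 N a (fst e) = nbd N (snd (\<phi> e)) (fst (\<phi> e)) & refl1 N a (nbd N (snd e) (fst e)) = fst (\<phi> e))"
   using nf[OF s] nt by (cases "snd e") (auto simp: \<phi>_def)
  show "ety n e = ety n (\<phi> e)"
  proof (cases "snd e")
   case False
   have "even (fst (refl1 N a (nbd N False (fst e)))) = even (fst (fst e))"
    using a N by (simp add: refl1_def rf_parity nbd_def nb1_def even_mod_even)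
   then show ?thesis using False by (simp add: ety_def crd_def \<phi>_def)
  qed (simp add: ety_def crd_def \<phi>_def refl1_def)
 qed
qed

text \<open>Inversion about the site \<open>r\<close> sends the edge based at \<open>x\<close> to
  one based at \<open>2 * r - x - 1\<close>, of opposite parity. It exchanges the edge types and
  fixes \<open>r\<close>, so it undoes the exchange made by the intertwiner without moving an
  observable at \<open>r\<close>.\<close>

lemma ham_inv2:
 assumes N: "even N" "N > 0" and st: "sg \<in> confs N n" "ta \<in> confs N n"
 shows "hamr N n b (etys n) (rl N (inv2 N r) sg) (rl N (inv2 N r) ta) = ham N n b sg ta"
proof -
 define \<phi> where "\<phi> = (%e :: site \<times> bool. (inv2 N r (nbd N (snd e) (fst e)), snd e))"
 have nf: "nbd N d (inv2 N r (nbd N d s)) = inv2 N r s" if "s \<in> sites N" for s d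
  using rf_Suc[of "fst s" N "2 * fst r"] rf_Suc[of "snd s" N "2 * snd r"] that
  by (simp add: nbd_def nb1_def nb2_def inv2_def sites_fst_lt)
 have ii: "inv2 N r (inv2 N r s) = s" "inv2 N r s \<in> sites N" if "s \<in> sites N" for s
 proof -
  show "inv2 N r s \<in> sites N" using inv2_bij that by (metis bij_betwE)
  show "inv2 N r (inv2 N r s) = s" using that by (simp add: inv2_def rf_rf sites_fst_lt)
 qed
 show ?thesis
 proof (rule hamr_rl[OF inv2_bij st])
  show "bij_betw \<phi> (edges N) (edges N)"
  proof (rule bij_edges_involution)
   fix e assume e: "e \<in> edges N"
   then show "\<phi> e \<in> edges N" by (simp add: \<phi>_def edges_iff ii nbd_sites)
   show "\<phi> (\<phi> e) = e" using e
    by (auto simp: \<phi>_def edges_iff ii nbd_sites nf prod_eq_iff)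
  qed
  fix e assume e: "e \<in> edges N"
  then have s: "fst e \<in> sites N" by (simp add: edges_iff)
  show "(inv2 N r (fst e) = fst (\<phi> e) & inv2 N r (nbd N (snd e) (fst e)) = nbd N (snd (\<phi> e)) (fst (\<phi> e))) \<or>
    (inv2 N r (fst e) = nbd N (snd (\<phi> e)) (fst (\<phi> e)) & inv2 N r (nbd N (snd e) (fst e)) = fst (\<phi> e))"
   using nf[OF s] by (auto simp: \<phi>_def)
  have "even (crd (snd e) (inv2 N r (nbd N (snd e) (fst e)))) = odd (crd (snd e) (fst e))"
   using N by (simp add: crd_def inv2_def rf_parity nbd_def nb1_def nb2_def even_mod_even)
  then show "etys n e = ety n (\<phi> e)"
   by (simp add: ety_def etys_def \<phi>_def)
 qed
qed

lemma ham_swap: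
 assumes st: "sg \<in> confs N n" "ta \<in> confs N n"
 shows "ham N n b (rl N prod.swap sg) (rl N prod.swap ta) = ham N n b sg ta"
proof -
 define \<phi> where "\<phi> = (%e :: site \<times> bool. (prod.swap (fst e), ~ snd e))"
 show ?thesis
 proof (rule hamr_rl[OF swap_bij st])
  show "bij_betw \<phi> (edges N) (edges N)"
   by (rule bij_edges_involution) (auto simp: \<phi>_def edges_iff sites_def)
  fix e assume e: "e \<in> edges N"
  show "(prod.swap (fst e) = fst (\<phi> e) & prod.swap (nbd N (snd e) (fst e)) = nbd N (snd (\<phi> e)) (fst (\<phi> e))) \<or>
    (prod.swap (fst e) = nbd N (snd (\<phi> e)) (fst (\<phi> e)) & prod.swap (nbd N (snd e) (fst e)) = fst (\<phi> e))"
   by (auto simp: \<phi>_def nbd_def nb1_def nb2_def)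
  show "ety n e = ety n (\<phi> e)" by (auto simp: ety_def crd_def \<phi>_def)
 qed
qed

lemma gw_rl:
 assumes p: "bij_betw \<pi> (sites N) (sites N)" and s: "sg \<in> confs N n"
  and H: "!!sg ta. sg \<in> confs N n ==> ta \<in> confs N n ==> ham N n b (rl N \<pi> sg) (rl N \<pi> ta) = ham N n b sg ta"
 shows "gw N n b (rl N \<pi> sg) = gw N n b sg"
 unfolding gw_def by (rule mexp_rl[OF p s s H])

subsection \<open>Reflection positivity\<close>

text \<open>The second half is stored in the coordinates of \<open>L\<close> and read through the
  mirror \<open>\<theta>\<close>, so that pairs with equal components are the mirror-symmetric
  configurations and both halves share one index set.\<close>

definition glue :: "nat => site set => (site => site) => conf \<times> conf => conf" where
 "glue N L \<theta> p = (%s. if s \<in> L then fst p s else if s \<in> sites N then snd p (\<theta> s) else undefined)"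

definition fw :: "nat => nat => real => (site => nat => real) => real" where
 "fw N n b f = (\<Sum>sg\<in>confs N n. gw N n b sg * (\<Prod>s\<in>sites N. f s (sg s)))"

text \<open>The plane passes through the middle of bonds: no site is fixed, and a bond that crosses
  joins a site to its own mirror image with the same matrix at both ends. This gives the coupling
  exactly the form of the tensor squares in \<open>rp_matrix\<close>.\<close>

locale rp_cut =
 fixes N n :: nat and b :: real and \<theta> :: "site => site" and L :: "site set"
 assumes b: "b >= 0"
  and th: "!!s. s \<in> sites N ==> \<theta> s \<in> sites N" "!!s. s \<in> sites N ==> \<theta> (\<theta> s) = s"
  and L: "L <= sites N" "!!s. s \<in> sites N ==> s \<in> L \<longleftrightarrow> \<theta> s ~: L"
  and cut: "!!e. e \<in> edges N ==> (fst e \<in> L) ~= (nbd N (snd e) (fst e) \<in> L) ==>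
    nbd N (snd e) (fst e) = \<theta> (fst e)"
  and inv: "!!sg ta. sg \<in> confs N n ==> ta \<in> confs N n ==> ham N n b (rl N \<theta> sg) (rl N \<theta> ta) = ham N n b sg ta"
  and phi: "\<exists>\<phi>. bij_betw \<phi> {e \<in> edges N. fst e \<in> L & nbd N (snd e) (fst e) \<in> L}
        {e \<in> edges N. fst e ~: L & nbd N (snd e) (fst e) ~: L} &
      (\<forall>e \<in> edges N. ety n (\<phi> e) = ety n e & ((fst (\<phi> e) = \<theta> (fst e) & nbd N (snd (\<phi> e)) (fst (\<phi> e)) = \<theta> (nbd N (snd e) (fst e)))
        \<or> (fst (\<phi> e) = \<theta> (nbd N (snd e) (fst e)) & nbd N (snd (\<phi> e)) (fst (\<phi> e)) = \<theta> (fst e))))"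
begin

definition IL :: "conf set" where "IL = PiE L (%_. {..n})"

lemma finite_IL: "finite IL"
 unfolding IL_def using L(1) finite_subset[OF _ finite_sites] by (intro finite_PiE) auto

abbreviation "gl \<equiv> glue N L \<theta>"

lemma theta_bij: "bij_betw \<theta> (sites N) (sites N)"
 by (rule bij_involution) (auto simp: th)

lemma IL_out: "i \<in> IL ==> s ~: L ==> i s = undefined"
 by (auto simp: IL_def PiE_def extensional_def)

lemma gl_in: "s \<in> L ==> gl p s = fst p s"
 by (simp add: glue_def)

lemma gl_th: "s \<in> L ==> gl p (\<theta> s) = snd p s"
proof -
 assume s: "s \<in> L"
 then have "s \<in> sites N" using L(1) by blast
 then have "\<theta> s ~: L" "\<theta> s \<in> sites N" "\<theta> (\<theta> s) = s" using L(2)[of s] s th[of s] by simp_all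
 then show ?thesis by (simp add: glue_def)
qed

lemma gl_conf: "p \<in> IL \<times> IL ==> gl p \<in> confs N n"
proof -
 assume p: "p \<in> IL \<times> IL"
 have "fst p s <= n" "snd p s <= n" if "s \<in> L" for s
  using p that by (auto simp: IL_def)
 moreover have "\<theta> s \<in> L" if "s \<in> sites N" "s ~: L" for s using L(2)[OF that(1)] that by blast
 ultimately show ?thesis using L(1)
  unfolding confs_def PiE_iff glue_def extensional_def by auto
qed

lemma gl_bij: "bij_betw gl (IL \<times> IL) (confs N n)"
proof (rule bij_betwI[where g="%sg. (restrict sg L, restrict (%s. sg (\<theta> s)) L)"])
 show "gl \<in> IL \<times> IL \<rightarrow> confs N n" using gl_conf by blast
 show "(%sg. (restrict sg L, restrict (%s. sg (\<theta> s)) L)) \<in> confs N n \<rightarrow> IL \<times> IL"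
 proof (intro Pi_I SigmaI)
  fix x assume x: "x \<in> confs N n"
  have "x r <= n" "x (\<theta> r) <= n" if "r \<in> L" for r
   using conf_le[OF x, of r] conf_le[OF x, of "\<theta> r"] th(1)[of r] L(1) that by blast+
  then show "restrict x L \<in> IL" "restrict (%s. x (\<theta> s)) L \<in> IL"
   unfolding IL_def by (simp_all add: PiE_iff)
 qed
next
 fix p assume p: "p \<in> IL \<times> IL"
 have "restrict (gl p) L = fst p"
  using p by (auto simp: fun_eq_iff restrict_def gl_in IL_out)
 moreover have "restrict (%s. gl p (\<theta> s)) L = snd p"
  using p by (auto simp: fun_eq_iff restrict_def gl_th IL_out)
 ultimately show "(restrict (gl p) L, restrict (%s. gl p (\<theta> s)) L) = p" by (simp add: prod_eq_iff)
next
 fix sg assume s: "sg \<in> confs N n"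
 show "gl (restrict sg L, restrict (%s. sg (\<theta> s)) L) = sg"
 proof
  fix r show "gl (restrict sg L, restrict (%s. sg (\<theta> s)) L) r = sg r"
  proof (cases "r \<in> sites N")
   case True
   then have "r ~: L ==> \<theta> r \<in> L" using L(2)[OF True] by blast
   then show ?thesis using True th(2)[OF True] by (auto simp: glue_def)
  next
   case False
   then show ?thesis using s L(1) by (auto simp: glue_def confs_def PiE_def extensional_def)
  qed
 qed
qed

lemma gl_agree:
 assumes p: "p \<in> IL \<times> IL" "q \<in> IL \<times> IL" and W: "W <= L" "W' <= L"
 shows "(\<forall>s. s ~: W \<union> \<theta> ` W' --> gl p s = gl q s) \<longleftrightarrow>
   (\<forall>s. s ~: W --> fst p s = fst q s) & (\<forall>s. s ~: W' --> snd p s = snd q s)"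
proof
 assume A: "\<forall>s. s ~: W \<union> \<theta> ` W' --> gl p s = gl q s"
 have thL: "\<theta> s ~: L" if "s \<in> L" for s using L that by blast
 show "(\<forall>s. s ~: W --> fst p s = fst q s) & (\<forall>s. s ~: W' --> snd p s = snd q s)"
 proof (intro conjI allI impI)
  fix s assume s: "s ~: W"
  show "fst p s = fst q s"
  proof (cases "s \<in> L")
   case True
   then have "s ~: \<theta> ` W'" using thL W(2) by blast
   with A s True show ?thesis by (metis UnE gl_in)
  qed (use p IL_out[of "fst p" s] IL_out[of "fst q" s] in \<open>simp add: mem_Times_iff\<close>)
 next
  fix s assume s: "s ~: W'"
  show "snd p s = snd q s"
  proof (cases "s \<in> L")
   case True
   have "\<theta> s ~: \<theta> ` W'"
   proof
    assume "\<theta> s \<in> \<theta> ` W'"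
    then obtain w where w: "w \<in> W'" "\<theta> s = \<theta> w" by blast
    then have "s = w" using th(2)[of s] th(2)[of w] True W(2) L(1) by (metis subsetD)
    with w s show False by simp
   qed
   moreover have "\<theta> s ~: W" using thL[OF True] W(1) by blast
   ultimately show ?thesis using A True by (metis UnE gl_th)
  qed (use p IL_out[of "snd p" s] IL_out[of "snd q" s] in \<open>simp add: mem_Times_iff\<close>)
 qed
next
 assume A: "(\<forall>s. s ~: W --> fst p s = fst q s) & (\<forall>s. s ~: W' --> snd p s = snd q s)"
 show "\<forall>s. s ~: W \<union> \<theta> ` W' --> gl p s = gl q s"
 proof (intro allI impI)
  fix s assume s: "s ~: W \<union> \<theta> ` W'"
  show "gl p s = gl q s"
  proof (cases "s \<in> L")
   case False
   show ?thesis
   proof (cases "s \<in> sites N")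
    case True
    have "\<theta> s ~: W'" using s th(2)[OF True] by (metis UnI2 image_eqI)
    with A False True show ?thesis by (simp add: glue_def)
   qed (use False in \<open>simp add: glue_def\<close>)
  qed (use A s in \<open>simp add: gl_in\<close>)
 qed
qed

lemma mid_conv: "mid (i::conf) j = (if \<forall>s. i s = j s then 1 else 0)"
 by (auto simp: mid_def fun_eq_iff)

lemma eop_L:
 assumes p: "p \<in> IL \<times> IL" "q \<in> IL \<times> IL" and r: "r \<in> L" "r' \<in> L"
 shows "eop r r' X (gl p) (gl q) = eop r r' X (fst p) (fst q) * mid (snd p) (snd q)"
proof -
 have A: "(\<forall>s. s ~= r & s ~= r' --> gl p s = gl q s) \<longleftrightarrow>
   (\<forall>s. s ~= r & s ~= r' --> fst p s = fst q s) & (\<forall>s. snd p s = snd q s)"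
  using gl_agree[OF p, of "{r, r'}" "{}"] r by simp
 show ?thesis unfolding eop_def A mid_conv using r by (auto simp: gl_in)
qed

lemma eop_R:
 assumes p: "p \<in> IL \<times> IL" "q \<in> IL \<times> IL" and r: "r \<in> L" "r' \<in> L"
 shows "eop (\<theta> r) (\<theta> r') X (gl p) (gl q) = mid (fst p) (fst q) * eop r r' X (snd p) (snd q)"
proof -
 have A: "(\<forall>s. s ~= \<theta> r & s ~= \<theta> r' --> gl p s = gl q s) \<longleftrightarrow>
   (\<forall>s. fst p s = fst q s) & (\<forall>s. s ~= r & s ~= r' --> snd p s = snd q s)"
  using gl_agree[OF p, of "{}" "{r, r'}"] r by simp
 show ?thesis unfolding eop_def A mid_conv using r by (auto simp: gl_th)
qed

lemma eop_C:
 assumes p: "p \<in> IL \<times> IL" "q \<in> IL \<times> IL" and r: "r \<in> L"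
 shows "eop r (\<theta> r) X (gl p) (gl q) = sop r X (fst p) (fst q) * sop r X (snd p) (snd q)"
proof -
 have A: "(\<forall>s. s ~= r & s ~= \<theta> r --> gl p s = gl q s) \<longleftrightarrow>
   (\<forall>s. s ~= r --> fst p s = fst q s) & (\<forall>s. s ~= r --> snd p s = snd q s)"
  using gl_agree[OF p, of "{r}" "{r}"] r by (simp add: conj_commute)
 show ?thesis unfolding eop_def sop_def A using r by (auto simp: gl_th gl_in)
qed

definition EL where "EL = {e \<in> edges N. fst e \<in> L & nbd N (snd e) (fst e) \<in> L}"
definition ER where "ER = {e \<in> edges N. fst e ~: L & nbd N (snd e) (fst e) ~: L}"
definition EC where "EC = {e \<in> edges N. (fst e \<in> L) ~= (nbd N (snd e) (fst e) \<in> L)}"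
definition XL where "XL = (%i j. b * (\<Sum>e\<in>EL. eop (fst e) (nbd N (snd e) (fst e)) (ety n e) i j))"
definition CC where "CC = (%e i j. sqrt b * sop (if fst e \<in> L then fst e else nbd N (snd e) (fst e)) (ety n e) i j)"

lemma ham_glue:
 assumes p: "p \<in> IL \<times> IL" "q \<in> IL \<times> IL"
 shows "ham N n b (gl p) (gl q) = rp_matrix XL EC CC p q"
proof -
 let ?h = "%e. eop (fst e) (nbd N (snd e) (fst e)) (ety n e)"
 have fin: "finite EL" "finite ER" "finite EC" by (simp_all add: EL_def ER_def EC_def)
 have "edges N = EL \<union> (ER \<union> EC)" "EL \<inter> (ER \<union> EC) = {}" "ER \<inter> EC = {}"
  by (auto simp: EL_def ER_def EC_def)
 then have "(\<Sum>e\<in>edges N. ?h e (gl p) (gl q)) = (\<Sum>e\<in>EL. ?h e (gl p) (gl q)) + ((\<Sum>e\<in>ER. ?h e (gl p) (gl q)) + (\<Sum>e\<in>EC. ?h e (gl p) (gl q)))"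
  using fin by (simp add: sum.union_disjoint)
 moreover have "(\<Sum>e\<in>EL. ?h e (gl p) (gl q)) = (\<Sum>e\<in>EL. ?h e (fst p) (fst q)) * mid (snd p) (snd q)"
  unfolding sum_distrib_right by (intro sum.cong refl eop_L[OF p]) (auto simp: EL_def)
 moreover have "(\<Sum>e\<in>ER. ?h e (gl p) (gl q)) = mid (fst p) (fst q) * (\<Sum>e\<in>EL. ?h e (snd p) (snd q))"
 proof -
  obtain \<phi> where f: "bij_betw \<phi> EL ER" "!!e. e \<in> edges N ==> ety n (\<phi> e) = ety n e"
    "!!e. e \<in> edges N ==> (fst (\<phi> e) = \<theta> (fst e) & nbd N (snd (\<phi> e)) (fst (\<phi> e)) = \<theta> (nbd N (snd e) (fst e)))
        \<or> (fst (\<phi> e) = \<theta> (nbd N (snd e) (fst e)) & nbd N (snd (\<phi> e)) (fst (\<phi> e)) = \<theta> (fst e))"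
   using phi unfolding EL_def ER_def by blast
  have "(\<Sum>e\<in>ER. ?h e (gl p) (gl q)) = (\<Sum>e\<in>EL. ?h (\<phi> e) (gl p) (gl q))"
   by (rule sum.reindex_bij_betw[OF f(1), symmetric])
  also have "... = (\<Sum>e\<in>EL. mid (fst p) (fst q) * ?h e (snd p) (snd q))"
  proof (intro sum.cong refl)
   fix e assume e: "e \<in> EL"
   then have ee: "e \<in> edges N" "fst e \<in> L" "nbd N (snd e) (fst e) \<in> L" by (auto simp: EL_def)
   have "?h (\<phi> e) (gl p) (gl q) = eop (\<theta> (fst e)) (\<theta> (nbd N (snd e) (fst e))) (ety n e) (gl p) (gl q)"
    using f(2,3)[OF ee(1)] eop_commute[of "\<theta> (fst e)" "\<theta> (nbd N (snd e) (fst e))"] by auto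
   then show "?h (\<phi> e) (gl p) (gl q) = mid (fst p) (fst q) * ?h e (snd p) (snd q)"
    using eop_R[OF p ee(2,3)] by simp
  qed
  finally show ?thesis by (simp add: sum_distrib_left)
 qed
 moreover have "b * (\<Sum>e\<in>EC. ?h e (gl p) (gl q)) = (\<Sum>e\<in>EC. CC e (fst p) (fst q) * CC e (snd p) (snd q))"
  unfolding sum_distrib_left
 proof (intro sum.cong refl)
  fix e assume e: "e \<in> EC"
  then have ee: "e \<in> edges N" "(fst e \<in> L) ~= (nbd N (snd e) (fst e) \<in> L)" by (auto simp: EC_def)
  have nt: "nbd N (snd e) (fst e) = \<theta> (fst e)" by (rule cut[OF ee])
  have fs: "fst e \<in> sites N" using ee by (simp add: edges_iff)
  define c where "c = (if fst e \<in> L then fst e else nbd N (snd e) (fst e))"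
  have cL: "c \<in> L" using ee(2) by (auto simp: c_def)
  have "?h e (gl p) (gl q) = eop c (\<theta> c) (ety n e) (gl p) (gl q)"
   unfolding c_def nt using th(2)[OF fs] eop_commute[of "\<theta> (fst e)" "fst e"] by auto
  also have "... = sop c (ety n e) (fst p) (fst q) * sop c (ety n e) (snd p) (snd q)"
   by (rule eop_C[OF p cL])
  finally show "b * ?h e (gl p) (gl q) = CC e (fst p) (fst q) * CC e (snd p) (snd q)"
   using b by (simp add: CC_def c_def[symmetric])
 qed
 ultimately show ?thesis
  by (simp add: hamr_def rp_matrix_def XL_def distrib_left)
qed

lemma gw_glue:
 assumes p: "p \<in> IL \<times> IL"
 shows "gw N n b (gl p) = mexp (IL \<times> IL) (rp_matrix XL EC CC) p p"
proof -
 have "gw N n b (gl p) = mexp (IL \<times> IL) (%p q. ham N n b (gl p) (gl q)) p p"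
  unfolding gw_def
  by (rule fin_index.mexp_reindex[OF fin_index_confs gl_bij p p, symmetric])
 also have "... = mexp (IL \<times> IL) (rp_matrix XL EC CC) p p"
  using p by (intro mexp_cong ham_glue) auto
 finally show ?thesis .
qed

lemma rp_nonneg: "(\<Sum>p\<in>IL \<times> IL. a (fst p) * a (snd p) * gw N n b (gl p)) >= 0"
proof -
 have "finite EC" by (simp add: EC_def)
 from reflection_positive_kernel[OF finite_IL this, of a XL CC]
 show ?thesis by (simp add: gw_glue cong: sum.cong)
qed

lemma gw_glue_sym: "p \<in> IL \<times> IL ==> gw N n b (gl (snd p, fst p)) = gw N n b (gl p)"
proof -
 assume p: "p \<in> IL \<times> IL"
 have "rl N \<theta> (gl p) = gl (snd p, fst p)"
 proof
  fix s show "rl N \<theta> (gl p) s = gl (snd p, fst p) s"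
  proof (cases "s \<in> sites N")
   case True
   show ?thesis
   proof (cases "s \<in> L")
    case False
    then have "\<theta> s \<in> L" using L(2)[OF True] by blast
    then show ?thesis using True False by (simp add: rl_def glue_def)
   next
    case s: True
    then show ?thesis using True by (simp add: rl_def gl_th gl_in)
   qed
  qed (use L(1) in \<open>auto simp: rl_def glue_def\<close>)
 qed
 then show ?thesis using gw_rl[OF theta_bij gl_conf[OF p] inv] by simp
qed

lemma fw_split: "fw N n b f = (\<Sum>p\<in>IL \<times> IL. (\<Prod>s\<in>L. f s (fst p s)) * (\<Prod>s\<in>L. f (\<theta> s) (snd p s)) * gw N n b (gl p))"
proof -
 have fL: "finite L" using L(1) finite_subset finite_sites by blast
 have sp: "sites N = L \<union> \<theta> ` L" "L \<inter> \<theta> ` L = {}"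
 proof -
  show "L \<inter> \<theta> ` L = {}" using L by blast
  show "sites N = L \<union> \<theta> ` L"
  proof
   show "sites N <= L \<union> \<theta> ` L"
   proof
    fix s assume s: "s \<in> sites N"
    show "s \<in> L \<union> \<theta> ` L"
    proof (cases "s \<in> L")
     case False
     then have "\<theta> s \<in> L" using L(2)[OF s] by blast
     then show ?thesis using th(2)[OF s] by (metis UnI2 image_eqI)
    qed simp
   qed
   show "L \<union> \<theta> ` L <= sites N" using L(1) th(1) by auto
  qed
 qed
 have inj: "inj_on \<theta> L" by (metis L(1) inj_on_inverseI subsetD th(2))
 have "(\<Prod>s\<in>sites N. f s (gl p s)) = (\<Prod>s\<in>L. f s (fst p s)) * (\<Prod>s\<in>L. f (\<theta> s) (snd p s))" for p
  unfolding sp(1) using fL sp(2) inj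
  by (subst prod.union_disjoint) (auto simp: prod.reindex gl_in gl_th)
 moreover have "fw N n b f = (\<Sum>p\<in>IL \<times> IL. gw N n b (gl p) * (\<Prod>s\<in>sites N. f s (gl p s)))"
  unfolding fw_def by (rule sum.reindex_bij_betw[OF gl_bij, symmetric])
 ultimately show ?thesis by (simp add: mult_ac)
qed

text \<open>\<open>Q\<close> is positive semidefinite by \<open>rp_nonneg\<close> and symmetric
  because the mirror preserves the weight. The functions on one half and the mirrored functions on
  the other are its two arguments.\<close>

theorem rp_cauchy_schwarz:
 "(fw N n b f)\<^sup>2 <= fw N n b (%s. if s \<in> L then f s else f (\<theta> s)) * fw N n b (%s. if s \<in> L then f (\<theta> s) else f s)"
proof -
 let ?a = "%i. \<Prod>s\<in>L. f s (i s)" and ?c = "%i. \<Prod>s\<in>L. f (\<theta> s) (i s)"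
 define Q where "Q = (%u v. \<Sum>p\<in>IL \<times> IL. u (fst p) * v (snd p) * gw N n b (gl p))"
 have thL: "\<theta> s ~: L" "\<theta> (\<theta> s) = s" if "s \<in> L" for s using L th that by blast+
 have 1: "fw N n b f = Q ?a ?c" unfolding fw_split Q_def ..
 have 2: "fw N n b (%s. if s \<in> L then f s else f (\<theta> s)) = Q ?a ?a"
  unfolding fw_split Q_def by (intro sum.cong refl) (simp add: thL cong: prod.cong)
 have 3: "fw N n b (%s. if s \<in> L then f (\<theta> s) else f s) = Q ?c ?c"
  unfolding fw_split Q_def by (intro sum.cong refl) (simp add: thL cong: prod.cong)
 have sym: "Q u v = Q v u" for u v
 proof -
  have bij: "bij_betw prod.swap (IL \<times> IL) (IL \<times> IL)" by (rule bij_involution) auto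
  have "Q u v = (\<Sum>p\<in>IL \<times> IL. u (fst (prod.swap p)) * v (snd (prod.swap p)) * gw N n b (gl (prod.swap p)))"
   unfolding Q_def by (rule sum.reindex_bij_betw[OF bij, symmetric])
  also have "... = Q v u"
   unfolding Q_def by (intro sum.cong refl) (simp add: prod.swap_def gw_glue_sym mult_ac)
  finally show ?thesis .
 qed
 have "(Q ?a ?c)\<^sup>2 <= Q ?a ?a * Q ?c ?c"
 proof (rule quadratic_nonneg_imp_discriminant)
  fix t :: real
  have "0 <= Q (%i. ?a i + t * ?c i) (%i. ?a i + t * ?c i)"
   unfolding Q_def by (rule rp_nonneg)
  also have "... = Q ?a ?a + t * Q ?a ?c + t * Q ?c ?a + t\<^sup>2 * Q ?c ?c"
   unfolding Q_def by (simp add: algebra_simps sum.distrib sum_distrib_left power2_eq_square)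
  finally show "0 <= Q ?a ?a + 2 * t * Q ?a ?c + t\<^sup>2 * Q ?c ?c" using sym[of ?c ?a] by simp
 qed
 then show ?thesis by (simp only: 1 2 3)
qed

end

section \<open>The bond planes of the torus\<close>

definition halfL :: "nat => nat => nat set" where
 "halfL N k = {x. x < N & (int x - int k - 1) mod int N < int N div 2}"

text \<open>In the coordinate \<open>y = x - k - 1\<close> modulo \<open>N\<close> the half ring is
  \<open>y < N / 2\<close> and the reflection is \<open>y -> N - 1 - y\<close>; the two bonds that
  leave the half ring are those which the reflection reverses.\<close>

lemma halfL_props:
 assumes N: "N > 0" "even N" and x: "x < N"
 shows "x \<in> halfL N k \<longleftrightarrow> rf N (2 * k + 1) x ~: halfL N k"
  "(x \<in> halfL N k) ~= (Suc x mod N \<in> halfL N k) ==> Suc x mod N = rf N (2 * k + 1) x"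
proof -
 define y where "y = (int x - int k - 1) mod int N"
 have y: "0 <= y" "y < int N" using N by (auto simp: y_def)
 obtain h where h: "int N = 2 * h" using N by (metis dvd_def even_of_nat_iff of_nat_numeral)
 have hN: "int N div 2 = h" using h by simp
 have 1: "(int (rf N (2 * k + 1) x) - int k - 1) mod int N = int N - 1 - y"
 proof -
  have "(int (rf N (2 * k + 1) x) - int k - 1) mod int N = ((2 * int k + 1 - int x) mod int N - int k - 1) mod int N"
   using N by (simp add: rf_int add.commute)
  also have "... = (- 1 - (int x - int k - 1)) mod int N" by (simp add: mod_simps algebra_simps)
  also have "... = (- 1 - y) mod int N" unfolding y_def by (simp add: mod_simps)
  also have "... = (int N - 1 - y) mod int N" using mod_add_self1[of "int N" "- 1 - y"] by (simp add: algebra_simps)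
  also have "... = int N - 1 - y" using y by simp
  finally show ?thesis .
 qed
 have m: "x \<in> halfL N k \<longleftrightarrow> y < h" using x by (simp add: halfL_def y_def hN)
 show "x \<in> halfL N k \<longleftrightarrow> rf N (2 * k + 1) x ~: halfL N k"
  unfolding m using 1 h hN rf_lt[OF N(1)] by (auto simp: halfL_def)
 have 2: "(int (Suc x mod N) - int k - 1) mod int N = (y + 1) mod int N"
 proof -
  have "(int (Suc x mod N) - int k - 1) mod int N = ((1 + int x) mod int N - int k - 1) mod int N"
   by (simp add: zmod_int)
  also have "... = ((int x - int k - 1) + 1) mod int N" by (simp add: mod_simps algebra_simps)
  also have "... = (y + 1) mod int N" unfolding y_def by (simp add: mod_simps)
  finally show ?thesis .
 qed
 assume "(x \<in> halfL N k) ~= (Suc x mod N \<in> halfL N k)"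
 then have ne: "(y < h) ~= ((y + 1) mod int N < h)" using m 2 hN N by (simp add: halfL_def)
 \<comment> \<open>A crossing bond is based at \<open>N / 2 - 1\<close> or at \<open>N - 1\<close>.
   Both cases say that \<open>2 * y + 2\<close> vanishes modulo \<open>N\<close>, which is
   \<open>x + 1 = 2 * k + 1 - x\<close> in the original coordinate.\<close>
 have "2 * y + 2 = int N \<or> 2 * y + 2 = 2 * int N"
 proof (cases "y + 1 = int N")
  case False
  then have "(y + 1) mod int N = y + 1" using y by simp
  with ne have "y + 1 = h" by auto
  then show ?thesis using h by auto
 qed auto
 then have d: "(2 * y + 2) mod int N = 0" by auto
 have "int (Suc x mod N) = (1 + int x) mod int N" by (simp add: zmod_int)
 also have "... = (2 * int k + 1 - int x) mod int N"
 proof -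
  have "(1 + int x - (2 * int k + 1 - int x)) mod int N = (2 * (int x - int k - 1) + 2) mod int N"
   by (simp add: algebra_simps)
  also have "... = (2 * y + 2) mod int N" unfolding y_def by (metis mod_add_left_eq mod_mult_right_eq)
  finally have "(1 + int x - (2 * int k + 1 - int x)) mod int N = 0" using d by simp
  then show ?thesis by (simp add: mod_eq_dvd_iff mod_0_imp_dvd)
 qed
 also have "... = int (rf N (2 * k + 1) x)" using N by (simp add: rf_int add.commute)
 finally show "Suc x mod N = rf N (2 * k + 1) x" by simp
qed

theorem rp_horizontal:
 assumes N: "N > 0" "even N" and b: "b >= 0"
 shows "(fw N n b f)\<^sup>2 <= fw N n b (%s. if fst s \<in> halfL N k then f s else f (refl1 N (2 * k + 1) s))
   * fw N n b (%s. if fst s \<in> halfL N k then f (refl1 N (2 * k + 1) s) else f s)"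
proof -
 define L where "L = {s \<in> sites N. fst s \<in> halfL N k}"
 let ?t = "refl1 N (2 * k + 1)"
 have nF: "fst (nbd N False s) = Suc (fst s) mod N" "snd (nbd N False s) = snd s" for s by (simp_all add: nbd_def nb1_def)
 have nT: "fst (nbd N True s) = fst s" for s by (simp add: nbd_def nb2_def)
 interpret rp_cut N n b ?t L
 proof
  show "b >= 0" by fact
  show "?t s \<in> sites N" if "s \<in> sites N" for s by (rule refl1_sites[OF that])
  show "?t (?t s) = s" if "s \<in> sites N" for s by (rule refl1_refl1[OF that])
  show "L <= sites N" by (auto simp: L_def)
  show Lt: "s \<in> L \<longleftrightarrow> ?t s ~: L" if "s \<in> sites N" for s
   using halfL_props(1)[OF N sites_fst_lt(1)[OF that], of k] that refl1_sites[OF that] by (simp add: L_def refl1_def)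
  show "nbd N (snd e) (fst e) = ?t (fst e)"
   if e: "e \<in> edges N" "(fst e \<in> L) ~= (nbd N (snd e) (fst e) \<in> L)" for e
  proof -
   have s: "fst e \<in> sites N" using e by (simp add: edges_iff)
   show ?thesis
   proof (cases "snd e")
    case True
    then show ?thesis using e s nbd_sites[OF s, of True] by (simp add: L_def nT)
   next
    case False
    then have "Suc (fst (fst e)) mod N = rf N (2 * k + 1) (fst (fst e))"
     using e s nbd_sites[OF s, of False] by (intro halfL_props(2)[OF N sites_fst_lt(1)[OF s]]) (simp add: L_def nF)
    then show ?thesis using False by (simp add: refl1_def nbd_def nb1_def)
   qed
  qed
  show "ham N n b (rl N ?t sg) (rl N ?t ta) = ham N n b sg ta" if "sg \<in> confs N n" "ta \<in> confs N n" for sg ta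
   using N that by (intro ham_refl1) auto
  define \<phi> where "\<phi> = (%e. if snd e then (?t (fst e), True) else (?t (nbd N False (fst e)), False))"
  have nf: "nbd N False (?t (nbd N False s)) = ?t s" if "s \<in> sites N" for s
   using rf_Suc[of "fst s" N "2 * k + 1"] that by (simp add: nbd_def nb1_def refl1_def sites_fst_lt)
  have nt: "?t (nbd N True s) = nbd N True (?t s)" for s
   by (simp add: nbd_def nb2_def refl1_def)
  have prp: "ety n (\<phi> e) = ety n e & ((fst (\<phi> e) = ?t (fst e) & nbd N (snd (\<phi> e)) (fst (\<phi> e)) = ?t (nbd N (snd e) (fst e)))
        \<or> (fst (\<phi> e) = ?t (nbd N (snd e) (fst e)) & nbd N (snd (\<phi> e)) (fst (\<phi> e)) = ?t (fst e)))"
   if e: "e \<in> edges N" for e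
  proof (cases "snd e")
   case False
   have "even (fst (?t (nbd N False (fst e)))) = even (fst (fst e))"
    using N by (simp add: refl1_def rf_parity nbd_def nb1_def even_mod_even)
   then show ?thesis using False nf e by (simp add: ety_def crd_def \<phi>_def edges_iff)
  qed (simp add: ety_def crd_def \<phi>_def refl1_def nbd_def nb2_def)
  have ph: "\<phi> e \<in> edges N" "\<phi> (\<phi> e) = e" if "e \<in> edges N" for e
   using that by (auto simp: \<phi>_def edges_iff refl1_refl1 refl1_sites nbd_sites nf[simplified] prod_eq_iff)
  have "bij_betw \<phi> {e \<in> edges N. fst e \<in> L & nbd N (snd e) (fst e) \<in> L}
        {e \<in> edges N. fst e ~: L & nbd N (snd e) (fst e) ~: L}"
  proof (rule bij_betw_byWitness[where f'=\<phi>])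
   have Lt': "?t s \<in> L \<longleftrightarrow> s ~: L" if "s \<in> sites N" for s using Lt[OF that] by blast
   have mem: "(fst (\<phi> e) \<in> L & nbd N (snd (\<phi> e)) (fst (\<phi> e)) \<in> L) \<longleftrightarrow> (fst e ~: L & nbd N (snd e) (fst e) ~: L)"
    "(fst (\<phi> e) ~: L & nbd N (snd (\<phi> e)) (fst (\<phi> e)) ~: L) \<longleftrightarrow> (fst e \<in> L & nbd N (snd e) (fst e) \<in> L)"
    if e: "e \<in> edges N" for e
   proof -
    have s: "fst e \<in> sites N" using e by (simp add: edges_iff)
    note l = Lt'[OF s] Lt'[OF nbd_sites[OF s, of "snd e"]]
    show "(fst (\<phi> e) \<in> L & nbd N (snd (\<phi> e)) (fst (\<phi> e)) \<in> L) \<longleftrightarrow> (fst e ~: L & nbd N (snd e) (fst e) ~: L)"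
     "(fst (\<phi> e) ~: L & nbd N (snd (\<phi> e)) (fst (\<phi> e)) ~: L) \<longleftrightarrow> (fst e \<in> L & nbd N (snd e) (fst e) \<in> L)"
     using prp[OF e] l by auto
   qed
   show "\<phi> ` {e \<in> edges N. fst e \<in> L & nbd N (snd e) (fst e) \<in> L} <= {e \<in> edges N. fst e ~: L & nbd N (snd e) (fst e) ~: L}"
    using mem ph(1) by blast
   show "\<phi> ` {e \<in> edges N. fst e ~: L & nbd N (snd e) (fst e) ~: L} <= {e \<in> edges N. fst e \<in> L & nbd N (snd e) (fst e) \<in> L}"
    using mem ph(1) by blast
  qed (use ph(2) in blast)+
  with prp show "\<exists>\<phi>. bij_betw \<phi> {e \<in> edges N. fst e \<in> L & nbd N (snd e) (fst e) \<in> L}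
        {e \<in> edges N. fst e ~: L & nbd N (snd e) (fst e) ~: L} &
      (\<forall>e \<in> edges N. ety n (\<phi> e) = ety n e & ((fst (\<phi> e) = ?t (fst e) & nbd N (snd (\<phi> e)) (fst (\<phi> e)) = ?t (nbd N (snd e) (fst e)))
        \<or> (fst (\<phi> e) = ?t (nbd N (snd e) (fst e)) & nbd N (snd (\<phi> e)) (fst (\<phi> e)) = ?t (fst e))))"
   by blast
 qed
 have eq: "fw N n b (%s. if s \<in> L then u s else v s) = fw N n b (%s. if fst s \<in> halfL N k then u s else v s)" for u v
  unfolding fw_def by (intro sum.cong refl arg_cong2[of _ _ _ _ times] prod.cong) (auto simp: L_def)
 show ?thesis using rp_cauchy_schwarz[of f] unfolding eq .
qed

text \<open>The exchange of the two coordinates preserves the model, so reflection positivity in the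
  horizontal direction serves for both directions.\<close>

lemma fw_swap: "fw N n b (%s. f (prod.swap s)) = fw N n b f"
proof -
 have "fw N n b f = (\<Sum>sg\<in>confs N n. gw N n b (rl N prod.swap sg) * (\<Prod>s\<in>sites N. f s (rl N prod.swap sg s)))"
  unfolding fw_def by (rule sum.reindex_bij_betw[OF rl_bij[OF swap_bij], symmetric])
 also have "... = (\<Sum>sg\<in>confs N n. gw N n b sg * (\<Prod>s\<in>sites N. f (prod.swap s) (sg s)))"
 proof (intro sum.cong refl)
  fix sg assume s: "sg \<in> confs N n"
  have "(\<Prod>s\<in>sites N. f s (rl N prod.swap sg s)) = (\<Prod>s\<in>sites N. f (prod.swap s) (rl N prod.swap sg (prod.swap s)))"
   by (rule prod.reindex_bij_betw[OF swap_bij, symmetric])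
  also have "... = (\<Prod>s\<in>sites N. f (prod.swap s) (sg s))"
   by (intro prod.cong refl) (auto simp: rl_def sites_def)
  finally show "gw N n b (rl N prod.swap sg) * (\<Prod>s\<in>sites N. f s (rl N prod.swap sg s))
    = gw N n b sg * (\<Prod>s\<in>sites N. f (prod.swap s) (sg s))"
   using gw_rl[OF swap_bij s ham_swap] by simp
 qed
 finally show ?thesis by (simp add: fw_def)
qed

section \<open>Chessboard estimates on a ring\<close>

definition refL :: "nat => nat => (nat => 'a) => nat => 'a" where
 "refL N k c i = (if i \<in> halfL N k then c i else c (rf N (2 * k + 1) i))"

definition refR :: "nat => nat => (nat => 'a) => nat => 'a" where
 "refR N k c i = (if i \<in> halfL N k then c (rf N (2 * k + 1) i) else c i)"

text \<open>Coordinates in which the half ring is \<open>{..<h}\<close> and the reflection is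
  \<open>y -> 2 * h - 1 - y\<close>, free of modular arithmetic.\<close>

definition rot :: "nat => nat => (nat => 'a) => nat => 'a" where
 "rot N k c y = c ((y + k + 1) mod N)"

definition linL :: "nat => (nat => 'a) => nat => 'a" where
 "linL h d y = (if y < h then d y else d (2 * h - 1 - y))"

definition linR :: "nat => (nat => 'a) => nat => 'a" where
 "linR h d y = (if y < h then d (2 * h - 1 - y) else d y)"

lemma halfL_rot:
 assumes "N = 2 * h" "y < N"
 shows "(y + k + 1) mod N \<in> halfL N k \<longleftrightarrow> y < h"
  "rf N (2 * k + 1) ((y + k + 1) mod N) = ((N - 1 - y) + k + 1) mod N"
proof -
 have N: "N > 0" using assms by simp
 have "(int ((y + k + 1) mod N) - int k - 1) mod int N = ((int y + int k + 1) mod int N - int k - 1) mod int N"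
  by (simp add: zmod_int add_ac)
 also have "... = ((int y + int k + 1) mod int N - (int k + 1)) mod int N" by (simp add: diff_diff_eq)
 also have "... = int y mod int N" unfolding mod_diff_left_eq by simp
 also have "... = int y" using assms by simp
 finally show "(y + k + 1) mod N \<in> halfL N k \<longleftrightarrow> y < h"
  using N assms by (simp add: halfL_def)
 have "int (rf N (2 * k + 1) ((y + k + 1) mod N)) = (int (2 * k + 1) - (int y + int k + 1) mod int N) mod int N"
  using N by (simp add: rf_int zmod_int add_ac)
 also have "... = (int k - int y) mod int N" by (simp add: mod_simps)
 also have "... = (int k - int y + int N) mod int N" by simp
 also have "int k - int y + int N = int ((N - 1 - y) + k + 1)" using assms by simp
 finally show "rf N (2 * k + 1) ((y + k + 1) mod N) = ((N - 1 - y) + k + 1) mod N"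
  by (metis of_nat_eq_iff zmod_int)
qed

lemma rot_refL: "N = 2 * h ==> y < N ==> rot N k (refL N k c) y = linL h (rot N k c) y"
 using halfL_rot[of N h y k] by (auto simp: rot_def refL_def linL_def)

lemma rot_refR: "N = 2 * h ==> y < N ==> rot N k (refR N k c) y = linR h (rot N k c) y"
 using halfL_rot[of N h y k] by (auto simp: rot_def refR_def linR_def)

lemma rot_bij: "N > 0 ==> bij_betw (%y::nat. (y + k + 1) mod N) {..<N} {..<N}"
proof -
 assume N: "N > 0"
 have "inj_on (%y::nat. (y + k + 1) mod N) {..<N}"
 proof (rule inj_onI)
  fix x y assume xy: "x \<in> {..<N}" "y \<in> {..<N}" "(x + k + 1) mod N = (y + k + 1) mod N"
  then have "int (x + k + 1) mod int N = int (y + k + 1) mod int N" by (metis zmod_int)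
  from mod_diff_cong[OF this refl, of "int (k + 1)"] have "int x mod int N = int y mod int N" by simp
  then show "x = y" using xy by simp
 qed
 moreover have "(%y::nat. (y + k + 1) mod N) ` {..<N} <= {..<N}" using N by auto
 ultimately show ?thesis by (metis bij_betw_def endo_inj_surj finite_lessThan)
qed

text \<open>One reflected pattern carries every letter of one half twice, the other one every letter
  of the other half twice.\<close>

lemma prod_ring_ref:
 fixes w :: "'a => real"
 assumes N: "N = 2 * h" "h > 0"
 shows "(\<Prod>i<N. w (refL N k c i)) * (\<Prod>i<N. w (refR N k c i)) = (\<Prod>i<N. w (c i))\<^sup>2"
proof -
 have r: "(\<Prod>i<N. w (c i)) = (\<Prod>y<N. w (rot N k c y))" for c
  unfolding rot_def using N by (intro prod.reindex_bij_betw[OF rot_bij, symmetric]) simp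
 let ?d = "rot N k c"
 have sp: "(\<Prod>y<N. f y) = (\<Prod>y<h. f y) * (\<Prod>y<h. f (2 * h - 1 - y))" for f :: "nat => real"
 proof -
  have "(\<Prod>y<N. f y) = (\<Prod>y\<in>{..<h} \<union> {h..<2*h}. f y)" using N by (intro prod.cong) auto
  also have "... = (\<Prod>y<h. f y) * (\<Prod>y\<in>{h..<2*h}. f y)" by (intro prod.union_disjoint) auto
  also have "(\<Prod>y\<in>{h..<2*h}. f y) = (\<Prod>y<h. f (2 * h - 1 - y))"
   by (rule prod.reindex_bij_witness[of _ "%y. 2*h - 1 - y" "%y. 2*h - 1 - y"]) auto
  finally show ?thesis .
 qed
 have L: "(\<Prod>i<N. w (refL N k c i)) = (\<Prod>y<N. w (linL h ?d y))"
  unfolding r[of "refL N k c"] using N by (intro prod.cong refl) (simp add: rot_refL)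
 have R: "(\<Prod>i<N. w (refR N k c i)) = (\<Prod>y<N. w (linR h ?d y))"
  unfolding r[of "refR N k c"] using N by (intro prod.cong refl) (simp add: rot_refR)
 have "(\<Prod>y<N. w (linL h ?d y)) = (\<Prod>y<h. w (?d y)) * (\<Prod>y<h. w (?d y))"
  unfolding sp by (intro arg_cong2[of _ _ _ _ times] prod.cong refl) (auto simp: linL_def)
 moreover have "(\<Prod>y<N. w (linR h ?d y)) = (\<Prod>y<h. w (?d (2*h - 1 - y))) * (\<Prod>y<h. w (?d (2*h - 1 - y)))"
  unfolding sp by (intro arg_cong2[of _ _ _ _ times] prod.cong refl) (auto simp: linR_def)
 ultimately show ?thesis unfolding L R r[of c] sp[of "%y. w (?d y)"]
  by (simp add: power2_eq_square mult_ac)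
qed

definition mis :: "('a => 'a => bool) => nat => (nat => 'a) => nat => nat" where
 "mis P N c i = (if P (c (i mod N)) (c (Suc i mod N)) then 1 else 0)"

definition nmis :: "('a => 'a => bool) => nat => (nat => 'a) => nat" where
 "nmis P N c = (\<Sum>i<N. mis P N c i)"

definition qmis :: "('a => 'a => bool) => nat => (nat => 'a) => nat" where
 "qmis P N c = (\<Sum>i<N. mis P N c i * mis P N c (i + 2))"

lemma mis_mod: "mis P N c (i mod N) = mis P N c i"
 by (simp add: mis_def mod_Suc_eq)

lemma mis_rot: "mis P N (rot N k c) i = mis P N c (i + k + 1)"
proof -
 have "(j mod N + k + 1) mod N = (j + k + 1) mod N" for j
  by (metis add.assoc mod_add_left_eq)
 then show ?thesis unfolding mis_def rot_def by simp
qed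

lemma nmis_rot: "N > 0 ==> nmis P N (rot N k c) = nmis P N c"
proof -
 assume N: "N > 0"
 have "nmis P N c = (\<Sum>y<N. mis P N c ((y + k + 1) mod N))"
  unfolding nmis_def by (rule sum.reindex_bij_betw[OF rot_bij[OF N], symmetric])
 then show ?thesis by (simp add: nmis_def mis_rot mis_mod del: add_Suc_right)
qed

lemma qmis_rot: "N > 0 ==> qmis P N (rot N k c) = qmis P N c"
proof -
 assume N: "N > 0"
 have "mis P N c ((y + k + 1) mod N + 2) = mis P N c (y + 2 + k + 1)" for y
 proof -
  have "((y + k + 1) mod N + 2) mod N = (y + 2 + k + 1) mod N"
   unfolding mod_add_left_eq by (simp add: add_ac)
  then show ?thesis using mis_mod[of P N c "(y + k + 1) mod N + 2"] mis_mod[of P N c "y + 2 + k + 1"] by simp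
 qed
 moreover have "qmis P N c = (\<Sum>y<N. mis P N c ((y + k + 1) mod N) * mis P N c ((y + k + 1) mod N + 2))"
  unfolding qmis_def by (rule sum.reindex_bij_betw[OF rot_bij[OF N], symmetric])
 ultimately show ?thesis by (simp add: qmis_def mis_rot mis_mod del: add_Suc_right add_2_eq_Suc add_2_eq_Suc')
qed

lemma mis_cong: "N > 0 ==> (!!i. i < N ==> c i = c' i) ==> mis P N c i = mis P N c' i"
 by (simp add: mis_def)

lemma nmis_cong: "N > 0 ==> (!!i. i < N ==> c i = c' i) ==> nmis P N c = nmis P N c'"
 by (simp add: nmis_def mis_cong[of N c c'])

lemma qmis_cong: "N > 0 ==> (!!i. i < N ==> c i = c' i) ==> qmis P N c = qmis P N c'"
 by (simp add: qmis_def mis_cong[of N c c'])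

lemma mis_linL:
 assumes irr: "!!a. ~ P a a" and sym: "!!a b. P a b = P b a" and h: "h > 0" and y: "y < 2 * h"
 shows "mis P (2 * h) (linL h d) y = (if y = h - 1 \<or> y = 2 * h - 1 then 0 
   else if y < h then mis P (2 * h) d y else mis P (2 * h) d (2 * h - 2 - y))"
proof -
 consider "y < h - 1" | "y = h - 1" | "h <= y" "y < 2 * h - 1" | "y = 2 * h - 1" using y by linarith
 then show ?thesis
 proof cases
  case 3
  then have "2 * h - 1 - y = Suc (2 * h - 2 - y)" "2 * h - 1 - Suc y = 2 * h - 2 - y" by auto
  with 3 y sym show ?thesis by (auto simp: mis_def linL_def)
 qed (use h irr y in \<open>auto simp: mis_def linL_def\<close>)
qed

lemma mis_linR:
 assumes irr: "!!a. ~ P a a" and sym: "!!a b. P a b = P b a" and h: "h > 0" and y: "y < 2 * h"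
 shows "mis P (2 * h) (linR h d) y = (if y = h - 1 \<or> y = 2 * h - 1 then 0 
   else if y < h then mis P (2 * h) d (2 * h - 2 - y) else mis P (2 * h) d y)"
proof -
 consider "y < h - 1" | "y = h - 1" | "h <= y" "y < 2 * h - 1" | "y = 2 * h - 1" using y by linarith
 then show ?thesis
 proof cases
  case 1
  then have "2 * h - 1 - y = Suc (2 * h - 2 - y)" "2 * h - 1 - Suc y = 2 * h - 2 - y" by auto
  with 1 y sym show ?thesis by (auto simp: mis_def linR_def)
 next
  case 2
  then have "2 * h - 1 - y = h" "Suc y = h" using h by auto
  with 2 h irr show ?thesis by (auto simp: mis_def linR_def)
 next
  case 3
  then show ?thesis by (auto simp: mis_def linR_def)
 next
  case 4
  then show ?thesis using h irr by (auto simp: mis_def linR_def)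
 qed
qed

lemma sum_split_ring:
 fixes f :: "nat => nat"
 assumes "h > 0"
 shows "(\<Sum>y<2*h. f y) = (\<Sum>y<h-1. f y) + f (h-1) + (\<Sum>y<h-1. f (2*h-2-y)) + f (2*h-1)"
proof -
 have "{..<2*h} = {..<h-1} \<union> {h-1} \<union> {h..<2*h-1} \<union> {2*h-1}" using assms by auto
 then have "(\<Sum>y<2*h. f y) = (\<Sum>y\<in>{..<h-1} \<union> {h-1} \<union> {h..<2*h-1} \<union> {2*h-1}. f y)" by simp
 also have "... = (\<Sum>y<h-1. f y) + f (h-1) + (\<Sum>y\<in>{h..<2*h-1}. f y) + f (2*h-1)"
  using assms by (subst sum.union_disjoint, simp, simp, force)+ simp
 also have "(\<Sum>y\<in>{h..<2*h-1}. f y) = (\<Sum>y<h-1. f (2*h-2-y))"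
  by (rule sum.reindex_bij_witness[of _ "%y. 2*h-2-y" "%y. 2*h-2-y"]) (auto intro!: arg_cong[of _ _ f])
 finally show ?thesis .
qed

text \<open>A reflection doubles the mismatches inside the half that is kept and heals the two bonds
  across the cut, whose ends become equal.\<close>

lemma nmis_lin:
 assumes irr: "!!a. ~ P a a" and sym: "!!a b. P a b = P b a" and h: "h > 0"
 shows "nmis P (2*h) (linL h d) + nmis P (2*h) (linR h d) + 2 * mis P (2*h) d (h-1) + 2 * mis P (2*h) d (2*h-1)
   = 2 * nmis P (2*h) d"
proof -
 let ?m = "mis P (2*h) d"
 have L: "nmis P (2*h) (linL h d) = (\<Sum>y<h-1. ?m y) + (\<Sum>y<h-1. ?m y)"
 proof -
  have "(\<Sum>y<h-1. mis P (2*h) (linL h d) y) = (\<Sum>y<h-1. ?m y)"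
  proof (intro sum.cong refl)
   fix y assume "y \<in> {..<h-1}"
   then have "y < h - 1" "~ 2*h-2-y < h" "2*h-2-y < 2*h" "2*h-2-y ~= h - 1" "2*h-2-y ~= 2*h-1" "2*h-2-(2*h-2-y) = y" by auto
   then show "mis P (2*h) (linL h d) y = ?m y"
    by (subst mis_linL[of P, OF irr sym h]) auto
  qed
  moreover have "(\<Sum>y<h-1. mis P (2*h) (linL h d) (2*h-2-y)) = (\<Sum>y<h-1. ?m y)"
  proof (intro sum.cong refl)
   fix y assume "y \<in> {..<h-1}"
   then have "y < h - 1" "~ 2*h-2-y < h" "2*h-2-y < 2*h" "2*h-2-y ~= h - 1" "2*h-2-y ~= 2*h-1" "2*h-2-(2*h-2-y) = y" by auto
   then show "mis P (2*h) (linL h d) (2*h-2-y) = ?m y"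
    by (subst mis_linL[of P, OF irr sym h]) auto
  qed
  moreover have "mis P (2*h) (linL h d) (h-1) = 0" "mis P (2*h) (linL h d) (2*h-1) = 0"
   using h by (subst mis_linL[of P, OF irr sym h]; simp)+
  ultimately show ?thesis unfolding nmis_def sum_split_ring[OF h] by (simp only: add_0_right)
 qed
 have R: "nmis P (2*h) (linR h d) = (\<Sum>y<h-1. ?m (2*h-2-y)) + (\<Sum>y<h-1. ?m (2*h-2-y))"
 proof -
  have "(\<Sum>y<h-1. mis P (2*h) (linR h d) y) = (\<Sum>y<h-1. ?m (2*h-2-y))"
  proof (intro sum.cong refl)
   fix y assume "y \<in> {..<h-1}"
   then have "y < h - 1" "~ 2*h-2-y < h" "2*h-2-y < 2*h" "2*h-2-y ~= h - 1" "2*h-2-y ~= 2*h-1" "2*h-2-(2*h-2-y) = y" by auto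
   then show "mis P (2*h) (linR h d) y = ?m (2*h-2-y)"
    by (subst mis_linR[of P, OF irr sym h]) auto
  qed
  moreover have "(\<Sum>y<h-1. mis P (2*h) (linR h d) (2*h-2-y)) = (\<Sum>y<h-1. ?m (2*h-2-y))"
  proof (intro sum.cong refl)
   fix y assume "y \<in> {..<h-1}"
   then have "y < h - 1" "~ 2*h-2-y < h" "2*h-2-y < 2*h" "2*h-2-y ~= h - 1" "2*h-2-y ~= 2*h-1" "2*h-2-(2*h-2-y) = y" by auto
   then show "mis P (2*h) (linR h d) (2*h-2-y) = ?m (2*h-2-y)"
    by (subst mis_linR[of P, OF irr sym h]) auto
  qed
  moreover have "mis P (2*h) (linR h d) (h-1) = 0" "mis P (2*h) (linR h d) (2*h-1) = 0"
   using h by (subst mis_linR[of P, OF irr sym h]; simp)+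
  ultimately show ?thesis unfolding nmis_def sum_split_ring[OF h] by (simp only: add_0_right)
 qed
 show ?thesis unfolding L R unfolding nmis_def sum_split_ring[OF h] by simp
qed


text \<open>Only pairs that straddle a cut bond behave differently from the rest. After reflection
  the bonds on the two sides of the cut agree, so the two reflected patterns contribute
  \<open>m\<close> and \<open>m'\<close> where the original had \<open>m * m'\<close> twice;
  \<open>m + m'\<close> exceeds \<open>2 * m * m'\<close> by one exactly when the two values differ.
  Pairs containing a cut bond vanish before and after, by hypothesis \<open>z\<close>.\<close>

lemma qmis_lin:
 assumes irr: "!!a. ~ P a a" and sym: "!!a b. P a b = P b a" and h: "h >= 4"
  and z: "mis P (2*h) d (h-1) = 0" "mis P (2*h) d (2*h-1) = 0"
 shows "qmis P (2*h) (linL h d) + qmis P (2*h) (linR h d) = 2 * qmis P (2*h) d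
   + (if mis P (2*h) d (h-2) = mis P (2*h) d h then 0 else 1)
   + (if mis P (2*h) d (2*h-2) = mis P (2*h) d 0 then 0 else 1)"
proof -
 let ?m = "mis P (2*h) d"
 have h0: "h > 0" using h by simp
 have S: "(\<Sum>y<2*h. f y) = (\<Sum>y<h-3. f y) + f (h-3) + f (h-2) + f (h-1) + (\<Sum>y<h-3. f (2*h-4-y)) + f (2*h-3) + f (2*h-2) + f (2*h-1)"
  for f :: "nat => nat"
 proof -
  have e: "h - 1 = Suc (Suc (h - 3))" "Suc (h - 3) = h - 2" using h by auto
  have a: "(\<Sum>y<h-1. f' y) = (\<Sum>y<h-3. f' y) + f' (h-3) + f' (h-2)" for f' :: "nat => nat"
   unfolding e(1) sum.lessThan_Suc unfolding e(2) ..
  have b: "(\<Sum>y<h-1. f' y) = f' 0 + (f' 1 + (\<Sum>y<h-3. f' (Suc (Suc y))))" for f' :: "nat => nat"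
   unfolding e(1) by (simp only: sum.lessThan_Suc_shift One_nat_def)
  have c: "2*h-2-0 = 2*h-2" "2*h-2-1 = 2*h-3" "2*h-2-Suc (Suc y) = 2*h-4-y" for y by auto
  show ?thesis unfolding sum_split_ring[OF h0] a[of f] b[of "%y. f (2*h-2-y)"] c by simp
 qed
 have md: "mis P (2*h) c (2*h-2+2) = mis P (2*h) c 0" "mis P (2*h) c (2*h-1+2) = mis P (2*h) c 1" for c
 proof -
  have e: "2*h-2+2 = 2*h" "2*h-1+2 = 2*h+1" using h by auto
  have "(2*h+1) mod (2*h) = 1" unfolding mod_add_self1 using h by simp
  then show "mis P (2*h) c (2*h-2+2) = mis P (2*h) c 0" "mis P (2*h) c (2*h-1+2) = mis P (2*h) c 1"
   unfolding e using mis_mod[of P "2*h" c "2*h"] mis_mod[of P "2*h" c "2*h+1"] by simp_all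
 qed
 have sq: "?m i * ?m i = ?m i" for i by (simp add: mis_def)
 have ar: "h-3+2 = h-1" "h-2+2 = h" "h-1+2 = h+1" "2*h-3+2 = 2*h-1" using h by auto
 note simpsL = mis_linL[of P, OF irr sym h0] and simpsR = mis_linR[of P, OF irr sym h0]
 have L: "qmis P (2*h) (linL h d) = (\<Sum>y<h-3. ?m y * ?m (y+2)) + (\<Sum>y<h-3. ?m (y+2) * ?m y) + ?m (h-2) + ?m 0"
 proof -
  have 1: "(\<Sum>y<h-3. mis P (2*h) (linL h d) y * mis P (2*h) (linL h d) (y+2)) = (\<Sum>y<h-3. ?m y * ?m (y+2))"
   by (intro sum.cong refl) (auto simp: simpsL)
  have 2: "(\<Sum>y<h-3. mis P (2*h) (linL h d) (2*h-4-y) * mis P (2*h) (linL h d) (2*h-4-y+2)) = (\<Sum>y<h-3. ?m (y+2) * ?m y)"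
  proof (intro sum.cong refl)
   fix y assume "y \<in> {..<h-3}"
   then have a: "2*h-4-y+2 = 2*h-2-y" "~ 2*h-4-y < h" "2*h-4-y < 2*h-1" "~ 2*h-2-y < h" "2*h-2-y < 2*h-1"
     "2*h-2-(2*h-4-y) = y+2" "2*h-2-(2*h-2-y) = y" using h by auto
   have "mis P (2*h) (linL h d) (2*h-4-y) = ?m (y+2)"
    using a by (subst simpsL) auto
   moreover have "mis P (2*h) (linL h d) (2*h-2-y) = ?m y"
    using a by (subst simpsL) auto
   ultimately show "mis P (2*h) (linL h d) (2*h-4-y) * mis P (2*h) (linL h d) (2*h-4-y+2) = ?m (y+2) * ?m y"
    using a(1) by simp
  qed
  have 3: "mis P (2*h) (linL h d) (h-1) = 0" "mis P (2*h) (linL h d) (2*h-1) = 0"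
   "mis P (2*h) (linL h d) (h-2) = ?m (h-2)" "mis P (2*h) (linL h d) h = ?m (h-2)"
   "mis P (2*h) (linL h d) (2*h-2) = ?m 0" "mis P (2*h) (linL h d) 0 = ?m 0"
  proof -
   have a: "2*h-2-h = h-2" "2*h-2-(2*h-2) = 0" by auto
   show "mis P (2*h) (linL h d) (h-1) = 0" "mis P (2*h) (linL h d) (2*h-1) = 0"
    using h by (subst simpsL; simp)+
   show "mis P (2*h) (linL h d) (h-2) = ?m (h-2)" "mis P (2*h) (linL h d) h = ?m (h-2)"
    using h a by (subst simpsL; auto)+
   show "mis P (2*h) (linL h d) (2*h-2) = ?m 0" "mis P (2*h) (linL h d) 0 = ?m 0"
    using h a by (subst simpsL; auto)+
  qed
  show ?thesis unfolding qmis_def S 1 2 ar md 3 sq by simp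
 qed
 have R: "qmis P (2*h) (linR h d) = (\<Sum>y<h-3. ?m (2*h-2-y) * ?m (2*h-4-y)) + (\<Sum>y<h-3. ?m (2*h-4-y) * ?m (2*h-2-y)) + ?m h + ?m (2*h-2)"
 proof -
  have 1: "(\<Sum>y<h-3. mis P (2*h) (linR h d) y * mis P (2*h) (linR h d) (y+2)) = (\<Sum>y<h-3. ?m (2*h-2-y) * ?m (2*h-4-y))"
  proof (intro sum.cong refl)
   fix y assume "y \<in> {..<h-3}"
   then have "y < h - 1" "y + 2 < h - 1" "2*h-2-(y+2) = 2*h-4-y" using h by auto
   then show "mis P (2*h) (linR h d) y * mis P (2*h) (linR h d) (y+2) = ?m (2*h-2-y) * ?m (2*h-4-y)"
    by (subst (1 2) simpsR) auto
  qed
  have 2: "(\<Sum>y<h-3. mis P (2*h) (linR h d) (2*h-4-y) * mis P (2*h) (linR h d) (2*h-4-y+2)) = (\<Sum>y<h-3. ?m (2*h-4-y) * ?m (2*h-2-y))"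
  proof (intro sum.cong refl)
   fix y assume "y \<in> {..<h-3}"
   then have a: "2*h-4-y+2 = 2*h-2-y" "~ 2*h-4-y < h" "2*h-4-y < 2*h-1" "~ 2*h-2-y < h" "2*h-2-y < 2*h-1" using h by auto
   have "mis P (2*h) (linR h d) (2*h-4-y) = ?m (2*h-4-y)"
    using a by (subst simpsR) auto
   moreover have "mis P (2*h) (linR h d) (2*h-2-y) = ?m (2*h-2-y)"
    using a by (subst simpsR) auto
   ultimately show "mis P (2*h) (linR h d) (2*h-4-y) * mis P (2*h) (linR h d) (2*h-4-y+2) = ?m (2*h-4-y) * ?m (2*h-2-y)"
    using a(1) by simp
  qed
  have 3: "mis P (2*h) (linR h d) (h-1) = 0" "mis P (2*h) (linR h d) (2*h-1) = 0"
   "mis P (2*h) (linR h d) (h-2) = ?m h" "mis P (2*h) (linR h d) h = ?m h"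
   "mis P (2*h) (linR h d) (2*h-2) = ?m (2*h-2)" "mis P (2*h) (linR h d) 0 = ?m (2*h-2)"
  proof -
   have a: "2*h-2-(h-2) = h" using h by auto
   show "mis P (2*h) (linR h d) (h-1) = 0" "mis P (2*h) (linR h d) (2*h-1) = 0"
    using h by (subst simpsR; simp)+
   show "mis P (2*h) (linR h d) (h-2) = ?m h" "mis P (2*h) (linR h d) h = ?m h"
    using h a by (subst simpsR; auto)+
   show "mis P (2*h) (linR h d) (2*h-2) = ?m (2*h-2)" "mis P (2*h) (linR h d) 0 = ?m (2*h-2)"
    using h by (subst simpsR; auto)+
  qed
  show ?thesis unfolding qmis_def S 1 2 ar md 3 sq by simp
 qed
 have Q: "qmis P (2*h) d = (\<Sum>y<h-3. ?m y * ?m (y+2)) + ?m (h-2) * ?m h + (\<Sum>y<h-3. ?m (2*h-4-y) * ?m (2*h-2-y)) + ?m (2*h-2) * ?m 0"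
 proof -
  have 2: "(\<Sum>y<h-3. ?m (2*h-4-y) * ?m (2*h-4-y+2)) = (\<Sum>y<h-3. ?m (2*h-4-y) * ?m (2*h-2-y))"
  proof (intro sum.cong refl)
   fix y assume "y \<in> {..<h-3}"
   then have "2*h-4-y+2 = 2*h-2-y" using h by auto
   then show "?m (2*h-4-y) * ?m (2*h-4-y+2) = ?m (2*h-4-y) * ?m (2*h-2-y)" by simp
  qed
  show ?thesis unfolding qmis_def S ar md 2 z by simp
 qed
 have g: "?m i + ?m j = 2 * (?m i * ?m j) + (if ?m i = ?m j then 0 else 1)" for i j by (simp add: mis_def)
 have c: "(\<Sum>y<h-3. ?m (y+2) * ?m y) = (\<Sum>y<h-3. ?m y * ?m (y+2))"
  "(\<Sum>y<h-3. ?m (2*h-2-y) * ?m (2*h-4-y)) = (\<Sum>y<h-3. ?m (2*h-4-y) * ?m (2*h-2-y))"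
  by (simp_all add: mult.commute)
 show ?thesis unfolding L R Q c using g[of "h-2" h] g[of "2*h-2" 0] by simp
qed


lemma ref_lt: "N > 0 ==> i < N ==> (\<forall>j<N. c j \<in> A) ==> refL N k c i \<in> A & refR N k c i \<in> A"
 by (simp add: refL_def refR_def rf_lt)

lemma nmis_ref:
 assumes irr: "!!a. ~ P a a" and sym: "!!a b. P a b = P b a" and N: "N = 2 * h" "h > 0"
 shows "nmis P N (refL N k c) + nmis P N (refR N k c) + 2 * mis P N c (k + h) + 2 * mis P N c k = 2 * nmis P N c"
proof -
 have N0: "N > 0" using N by simp
 have L: "nmis P N (refL N k c) = nmis P N (linL h (rot N k c))"
  unfolding nmis_rot[OF N0, of P k "refL N k c", symmetric] by (intro nmis_cong[OF N0] rot_refL N)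
 have R: "nmis P N (refR N k c) = nmis P N (linR h (rot N k c))"
  unfolding nmis_rot[OF N0, of P k "refR N k c", symmetric] by (intro nmis_cong[OF N0] rot_refR N)
 have "2 * h - 1 + k + 1 = N + k" "h - 1 + k + 1 = k + h" using N by auto
 then have "mis P N (rot N k c) (2 * h - 1) = mis P N c k" "mis P N (rot N k c) (h - 1) = mis P N c (k + h)"
  using mis_mod[of P N c "N + k"] mis_mod[of P N c k] unfolding mis_rot by (simp_all only: mod_add_self1)
 then show ?thesis using nmis_lin[of P h "rot N k c", OF irr sym N(2)]
  unfolding L R N(1)[symmetric] nmis_rot[OF N0] by simp
qed

lemma product_max:
 fixes x y M :: real
 assumes "M\<^sup>2 <= x * y" "x <= M" "y <= M" "M > 0" "x >= 0" "y >= 0"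
 shows "x = M & y = M"
proof -
 have "x * y <= x * M" using assms by (intro mult_left_mono) auto
 then have "M * M <= x * M" using assms(1) by (simp add: power2_eq_square)
 then have "M <= x" using assms(4) by simp
 have "x * y <= M * y" using assms by (intro mult_right_mono) auto
 then have "M * M <= M * y" using assms(1) by (simp add: power2_eq_square)
 then have "M <= y" using assms(4) by simp
 with \<open>M <= x\<close> assms show ?thesis by simp
qed

text \<open>Among the maximisers of \<open>\<Phi> c / W c\<close> take one with fewest unequal
  neighbours. Reflection positivity makes both reflections of a maximiser maximisers, and reflecting
  in a plane through an unequal bond would leave one with fewer. So the chosen pattern is constant,
  and there \<open>const\<close> applies.\<close>

theorem ring_chessboard:
 fixes \<Phi> :: "(nat => 'a) => real"
 assumes N: "N = 2 * h" "h > 0" and fin: "finite \<A>"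
  and cong: "!!c c'. (!!i. i < N ==> c i = c' i) ==> \<Phi> c = \<Phi> c'"
  and nn: "!!c. (\<forall>i<N. c i \<in> \<A>) ==> \<Phi> c >= 0"
  and rp: "!!c k. (\<forall>i<N. c i \<in> \<A>) ==> (\<Phi> c)\<^sup>2 <= \<Phi> (refL N k c) * \<Phi> (refR N k c)"
  and w: "!!a. a \<in> \<A> ==> w a > 0" and const: "!!a. a \<in> \<A> ==> \<Phi> (%_. a) <= Z * w a ^ N" and Z: "Z > 0"
  and c0: "\<forall>i<N. c0 i \<in> \<A>"
 shows "\<Phi> c0 <= Z * (\<Prod>i<N. w (c0 i))"
proof (rule ccontr)
 assume neg: "~ \<Phi> c0 <= Z * (\<Prod>i<N. w (c0 i))"
 have N0: "N > 0" using N by simp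
 define X where "X = PiE {..<N} (%_. \<A>)"
 define W where "W = (%c. \<Prod>i<N. w (c i))"
 define f where "f = (%c. \<Phi> c / W c)"
 have fX: "finite X" unfolding X_def using fin by (intro finite_PiE) auto
 have Wp: "W c > 0" if "\<forall>i<N. c i \<in> \<A>" for c unfolding W_def using that w by (intro prod_pos) auto
 have Xm: "\<forall>i<N. c i \<in> \<A>" if "c \<in> X" for c using that by (auto simp: X_def)
 have rX: "restrict c {..<N} \<in> X" if "\<forall>i<N. c i \<in> \<A>" for c using that by (auto simp: X_def)
 have fr: "f (restrict c {..<N}) = f c" for c
 proof -
  have "\<Phi> (restrict c {..<N}) = \<Phi> c" by (rule cong) simp
  moreover have "W (restrict c {..<N}) = W c" unfolding W_def by (intro prod.cong) auto
  ultimately show ?thesis by (simp add: f_def)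
 qed
 define M where "M = Max (f ` X)"
 have ub: "f c <= M" if "c \<in> X" for c unfolding M_def using that fX by simp
 have "f c0 > Z" using neg Wp[OF c0] by (simp add: f_def W_def field_simps)
 then have MZ: "M > Z" using ub[OF rX[OF c0]] fr[of c0] by simp
 obtain c1 where "c1 \<in> X" "f c1 = M"
 proof -
  have "M \<in> f ` X" unfolding M_def using fX rX[OF c0] by (intro Max_in) auto
  then show ?thesis using that by blast
 qed
 then obtain c where c: "c \<in> X" "f c = M" and min: "!!c'. c' \<in> X ==> f c' = M ==> nmis (~=) N c <= nmis (~=) N c'"
 proof -
  assume c1: "c1 \<in> X" "f c1 = M"
  have "\<exists>c. (c \<in> X & f c = M) & (\<forall>c'. (c' \<in> X & f c' = M) --> nmis (~=) N c <= nmis (~=) N c')"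
   by (rule ex_has_least_nat[of "%c. c \<in> X & f c = M" c1]) (use c1 in simp)
  then show ?thesis using that by (elim exE conjE) simp
 qed
 note cA = Xm[OF c(1)]
 have nomis: "mis (~=) N c k = 0" for k
 proof (rule ccontr)
  assume k: "mis (~=) N c k ~= 0"
  define cL where "cL = restrict (refL N k c) {..<N}"
  define cR where "cR = restrict (refR N k c) {..<N}"
  have LA: "\<forall>i<N. refL N k c i \<in> \<A>" and RA: "\<forall>i<N. refR N k c i \<in> \<A>"
   using ref_lt[OF N0 _ cA] by auto
  have X: "cL \<in> X" "cR \<in> X" unfolding cL_def cR_def using LA RA by (auto intro: rX)
  have "M\<^sup>2 = (\<Phi> c)\<^sup>2 / (W c)\<^sup>2" unfolding c(2)[symmetric] f_def power_divide ..
  also have "(W c)\<^sup>2 = W (refL N k c) * W (refR N k c)"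
   unfolding W_def using prod_ring_ref[OF N, of w k c] by simp
  also have "(\<Phi> c)\<^sup>2 / ... <= \<Phi> (refL N k c) * \<Phi> (refR N k c) / (W (refL N k c) * W (refR N k c))"
   using rp[OF cA, of k] Wp[OF LA] Wp[OF RA] by (intro divide_right_mono) auto
  also have "... = f cL * f cR" unfolding cL_def cR_def fr by (simp add: f_def)
  finally have "M\<^sup>2 <= f cL * f cR" .
  moreover have "f cL >= 0" "f cR >= 0"
   unfolding cL_def cR_def fr unfolding f_def
   using nn[OF LA] nn[OF RA] Wp[OF LA] Wp[OF RA] by auto
  ultimately have "f cL = M & f cR = M"
   using ub[OF X(1)] ub[OF X(2)] MZ Z by (intro product_max) auto
  then have "nmis (~=) N c <= nmis (~=) N cL" "nmis (~=) N c <= nmis (~=) N cR"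
   using min X by auto
  moreover have "nmis (~=) N cL = nmis (~=) N (refL N k c)" "nmis (~=) N cR = nmis (~=) N (refR N k c)"
   unfolding cL_def cR_def by (intro nmis_cong[OF N0]; simp)+
  moreover have "nmis (~=) N (refL N k c) + nmis (~=) N (refR N k c) + 2 * mis (~=) N c (k + h) + 2 * mis (~=) N c k
    = 2 * nmis (~=) N c"
   by (rule nmis_ref[OF _ _ N]) auto
  ultimately show False using k by linarith
 qed
 have "c i = c 0" if "i < N" for i
  using that
 proof (induction i)
  case (Suc i)
  have "c i = c (Suc i)" using nomis[of i] Suc.prems by (simp add: mis_def split: if_splits)
  then show ?case using Suc by simp
 qed simp
 then have ci: "!!i. i < N ==> c i = c 0" .
 have e1: "\<Phi> c = \<Phi> (%_. c 0)" by (rule cong) (rule ci)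
 have "W c = (\<Prod>i<N. w (c 0))" unfolding W_def by (intro prod.cong refl arg_cong[of _ _ w] ci) simp
 then have e2: "W c = w (c 0) ^ N" by simp
 have a: "c 0 \<in> \<A>" using cA N0 by auto
 have "f c <= Z" unfolding f_def e1 e2 using const[OF a] w[OF a] by (simp add: divide_le_eq)
 with c MZ show False by simp
qed

lemma sum_periodic:
 fixes F :: "nat => nat"
 assumes "N > 0" "!!i. F (i mod N) = F i"
 shows "(\<Sum>i<N. F (i + t)) = (\<Sum>i<N. F i)"
proof (cases t)
 case (Suc k)
 have "(\<Sum>i<N. F i) = (\<Sum>y<N. F ((y + k + 1) mod N))"
  by (rule sum.reindex_bij_betw[OF rot_bij[OF assms(1)], symmetric])
 then show ?thesis using Suc assms(2) by simp
qed simp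

text \<open>The plane through bond \<open>u + 1\<close> also cuts the opposite bond, so
  \<open>st\<close> speaks only if both are matched; this is why \<open>B\<close> marks a position
  together with its opposite one. Every position of \<open>B\<close> has another within the next two
  steps, so \<open>B\<close> fills at least half of the ring, and a mismatch accounts for at most
  two of its elements.\<close>

lemma mismatch_density:
 assumes N: "N = 2 * h" "h > 0"
  and st: "!!u. mis P N c (u + 1) = 0 ==> mis P N c (u + 1 + h) = 0 ==> mis P N c u = mis P N c (u + 2)"
  and ex: "mis P N c u0 ~= 0"
 shows "N <= 4 * nmis P N c"
proof -
 have N0: "N > 0" using N by simp
 define B where "B = (%u. mis P N c u ~= 0 \<or> mis P N c (u + h) ~= 0)"
 have per: "mis P N c (i + N) = mis P N c i" for i
  using mis_mod[of P N c "i + N"] mis_mod[of P N c i] by simp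
 have Bmod: "B (i mod N) = B i" for i
 proof -
  have "(i mod N + h) mod N = (i + h) mod N" by (simp add: mod_add_left_eq)
  then show ?thesis unfolding B_def
   using mis_mod[of P N c i] mis_mod[of P N c "i mod N + h"] mis_mod[of P N c "i + h"] by simp
 qed
 have step: "B (u + 1) \<or> B (u + 2)" if "B u" for u
 proof (rule disjCI)
  assume nb: "~ B (u + 2)"
  show "B (u + 1)"
  proof (rule ccontr)
   assume n1: "~ B (u + 1)"
   then have z: "mis P N c (u + 1) = 0" "mis P N c (u + 1 + h) = 0" by (auto simp: B_def)
   have "mis P N c u = mis P N c (u + 2)" using st z by simp
   moreover have "mis P N c (u + h) = mis P N c (u + h + 2)"
   proof (rule st)
    show "mis P N c (u + h + 1) = 0" using z(2) by (simp add: add_ac)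
    have "u + h + 1 + h = u + 1 + N" using N by simp
    then show "mis P N c (u + h + 1 + h) = 0" by (simp only: per z(1))
   qed
   ultimately show False using that nb by (auto simp: B_def add_ac)
  qed
 qed
 have B0: "B u0" using ex by (simp add: B_def)
 have all: "B (u0 + t) \<or> B (u0 + t + 1)" for t
 proof (induction t)
  case 0 then show ?case using B0 by simp
 next
  case (Suc t)
  then show ?case using step[of "u0 + t"] by auto
 qed
 have one: "1 <= (if B i then 1 else 0) + (if B (i + 1) then 1 else (0::nat))" for i
 proof -
  obtain t where t: "(u0 + t) mod N = i mod N"
  proof
   have "u0 + (i + (N - u0 mod N) ) = i + (u0 - u0 mod N) + N"
    using N0 mod_less_eq_dividend[of u0 N] mod_less_divisor[OF N0, of u0] by linarith
   moreover have "u0 - u0 mod N = N * (u0 div N)" by (metis minus_mod_eq_mult_div)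
   ultimately have "u0 + (i + (N - u0 mod N)) = i + N * (u0 div N) + N" by linarith
   then show "(u0 + (i + (N - u0 mod N))) mod N = i mod N" by (simp only:) simp
  qed
  then have "(u0 + t + 1) mod N = (i + 1) mod N" by (metis mod_add_left_eq)
  then have "B (u0 + t) = B i" "B (u0 + t + 1) = B (i + 1)" using t Bmod by metis+
  with all[of t] show ?thesis by auto
 qed
 have "N = (\<Sum>i<N. 1)" by simp
 also have "... <= (\<Sum>i<N. (if B i then 1 else 0) + (if B (i + 1) then 1 else 0))"
  by (intro sum_mono one)
 also have "... = 2 * (\<Sum>i<N. if B i then 1 else 0)"
  using sum_periodic[of N "%i. if B i then 1 else 0" 1, OF N0] Bmod by (simp add: sum.distrib)
 also have "(\<Sum>i<N. if B i then 1 else 0) <= (\<Sum>i<N. mis P N c i + mis P N c (i + h))"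
  by (intro sum_mono) (auto simp: B_def mis_def)
 also have "... = 2 * nmis P N c"
  using sum_periodic[of N "mis P N c" h, OF N0 mis_mod] by (simp add: sum.distrib nmis_def)
 finally show ?thesis by simp
qed

text \<open>Among the maximisers of the weighted functional take one with the most pairs of mismatches at
 distance two: a reflection in a plane that cuts no mismatch would produce more of them unless the
 mismatches already have density at least one quarter.\<close>

theorem ring_mismatch_bound:
 fixes \<Phi> :: "(nat => 'a) => real"
 assumes N: "N = 2 * h" "h >= 4" and fin: "finite \<A>"
  and irr: "!!a. ~ P a a" and sym: "!!a b. P a b = P b a"
  and cong: "!!c c'. (!!i. i < N ==> c i = c' i) ==> \<Phi> c = \<Phi> c'"
  and nn: "!!c. (\<forall>i<N. c i \<in> \<A>) ==> \<Phi> c >= 0"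
  and rp: "!!c k. (\<forall>i<N. c i \<in> \<A>) ==> (\<Phi> c)\<^sup>2 <= \<Phi> (refL N k c) * \<Phi> (refR N k c)"
  and triv: "!!c. (\<forall>i<N. c i \<in> \<A>) ==> \<Phi> c <= Z"
  and big: "!!c. (\<forall>i<N. c i \<in> \<A>) ==> N <= 4 * nmis P N c ==> \<Phi> c <= Z * z ^ nmis P N c"
  and Z: "Z > 0" and z: "z > 0"
  and c0: "\<forall>i<N. c0 i \<in> \<A>"
 shows "\<Phi> c0 <= Z * z ^ nmis P N c0"
proof (rule ccontr)
 assume neg: "~ \<Phi> c0 <= Z * z ^ nmis P N c0"
 have h0: "h > 0" using N by simp
 have N0: "N > 0" using N by simp
 define X where "X = PiE {..<N} (%_. \<A>)"
 define W where "W = (%c. z ^ nmis P N c)"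
 define f where "f = (%c. \<Phi> c / W c)"
 have fX: "finite X" unfolding X_def using fin by (intro finite_PiE) auto
 have Wp: "W c > 0" for c unfolding W_def using z by simp
 have Xm: "\<forall>i<N. c i \<in> \<A>" if "c \<in> X" for c using that by (auto simp: X_def)
 have rX: "restrict c {..<N} \<in> X" if "\<forall>i<N. c i \<in> \<A>" for c using that by (auto simp: X_def)
 have fr: "f (restrict c {..<N}) = f c" for c
 proof -
  have "\<Phi> (restrict c {..<N}) = \<Phi> c" by (rule cong) simp
  moreover have "W (restrict c {..<N}) = W c" unfolding W_def by (subst nmis_cong[OF N0, of _ c]) auto
  ultimately show ?thesis by (simp add: f_def)
 qed
 define M where "M = Max (f ` X)"
 have ub: "f c <= M" if "c \<in> X" for c unfolding M_def using that fX by simp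
 have "f c0 > Z" using neg Wp[of c0] by (simp add: f_def W_def field_simps)
 then have MZ: "M > Z" using ub[OF rX[OF c0]] fr[of c0] by simp
 define Y where "Y = {c \<in> X. f c = M}"
 have fY: "finite Y" using fX by (simp add: Y_def)
 have "M \<in> f ` X" unfolding M_def using fX rX[OF c0] by (intro Max_in) auto
 then have Yne: "Y ~= {}" by (auto simp: Y_def)
 obtain c where c: "c \<in> Y" and max: "!!c'. c' \<in> Y ==> qmis P N c' <= qmis P N c"
 proof -
  have "Max (qmis P N ` Y) \<in> qmis P N ` Y" using fY Yne by (intro Max_in) auto
  then obtain c where c: "c \<in> Y" "qmis P N c = Max (qmis P N ` Y)" by (metis imageE)
  show ?thesis
  proof (rule that[OF c(1)])
   show "qmis P N c' <= qmis P N c" if "c' \<in> Y" for c' unfolding c(2) using that fY by (intro Max_ge) auto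
  qed
 qed
 have cX: "c \<in> X" "f c = M" using c by (auto simp: Y_def)
 note cA = Xm[OF cX(1)]
 have key: "mis P N c u = mis P N c (u + 2)" if u: "mis P N c (u + 1) = 0" "mis P N c (u + 1 + h) = 0" for u
 proof -
  define k where "k = u + 1"
  define cL where "cL = restrict (refL N k c) {..<N}"
  define cR where "cR = restrict (refR N k c) {..<N}"
  have LA: "\<forall>i<N. refL N k c i \<in> \<A>" and RA: "\<forall>i<N. refR N k c i \<in> \<A>"
   using ref_lt[OF N0 _ cA] by auto
  have XX: "cL \<in> X" "cR \<in> X" unfolding cL_def cR_def using LA RA by (auto intro: rX)
  \<comment> \<open>Neither of the two bonds cut by the plane is a mismatch, so none is healed: the
    reflected patterns have twice the count together, and their weights multiply to
    \<open>(W c)^2\<close>.\<close>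
  have nm: "nmis P N (refL N k c) + nmis P N (refR N k c) = 2 * nmis P N c"
   using nmis_ref[of P N h k c, OF irr sym N(1) h0] u by (simp add: k_def)
  have "M\<^sup>2 = (\<Phi> c)\<^sup>2 / (W c)\<^sup>2" unfolding cX(2)[symmetric] f_def power_divide ..
  also have "(W c)\<^sup>2 = W (refL N k c) * W (refR N k c)"
   unfolding W_def power_add[symmetric] nm by (simp add: power_mult[symmetric] mult.commute)
  also have "(\<Phi> c)\<^sup>2 / ... <= \<Phi> (refL N k c) * \<Phi> (refR N k c) / (W (refL N k c) * W (refR N k c))"
   using rp[OF cA, of k] Wp[of "refL N k c"] Wp[of "refR N k c"] by (intro divide_right_mono) auto
  also have "... = f cL * f cR" unfolding cL_def cR_def fr by (simp add: f_def)
  finally have "M\<^sup>2 <= f cL * f cR" .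
  moreover have "f cL >= 0" "f cR >= 0"
   unfolding cL_def cR_def fr unfolding f_def
   using nn[OF LA] nn[OF RA] Wp[of "refL N k c"] Wp[of "refR N k c"] by auto
  ultimately have "f cL = M & f cR = M"
   using ub[OF XX(1)] ub[OF XX(2)] MZ Z by (intro product_max) auto
  then have "qmis P N cL <= qmis P N c" "qmis P N cR <= qmis P N c"
   using max XX by (auto simp: Y_def)
  moreover have "qmis P N cL = qmis P N (linL h (rot N k c))"
  proof -
   have "qmis P N cL = qmis P N (rot N k (refL N k c))"
    unfolding cL_def qmis_rot[OF N0] by (intro qmis_cong[OF N0]) simp
   also have "... = qmis P N (linL h (rot N k c))" by (intro qmis_cong[OF N0] rot_refL N)
   finally show ?thesis .
  qed
  moreover have "qmis P N cR = qmis P N (linR h (rot N k c))"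
  proof -
   have "qmis P N cR = qmis P N (rot N k (refR N k c))"
    unfolding cR_def qmis_rot[OF N0] by (intro qmis_cong[OF N0]) simp
   also have "... = qmis P N (linR h (rot N k c))" by (intro qmis_cong[OF N0] rot_refR N)
   finally show ?thesis .
  qed
  ultimately have le: "qmis P N (linL h (rot N k c)) + qmis P N (linR h (rot N k c)) <= 2 * qmis P N (rot N k c)"
   unfolding qmis_rot[OF N0] by simp
  have per: "mis P N c (N + i) = mis P N c i" for i
   using mis_mod[of P N c "N + i"] mis_mod[of P N c i] by simp
  have ix: "2 * h - 1 + k + 1 = N + k" "h - 1 + k + 1 = k + h" "2 * h - 2 + k + 1 = N + u" "0 + k + 1 = u + 2"
   using N by (auto simp: k_def)
  have m: "mis P N (rot N k c) (2*h-1) = 0" "mis P N (rot N k c) (h-1) = 0"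
   "mis P N (rot N k c) (2*h-2) = mis P N c u" "mis P N (rot N k c) 0 = mis P N c (u + 2)"
   using u unfolding mis_rot ix per by (simp_all add: k_def)
  from qmis_lin[of P h "rot N k c", OF irr sym N(2)] m(1,2) le
  have "mis P N (rot N k c) (2*h-2) = mis P N (rot N k c) 0"
   unfolding N(1)[symmetric] by (auto split: if_splits)
  then show ?thesis unfolding m .
 qed
 \<comment> \<open>The chosen maximiser either has mismatches of density at least one quarter, where
   \<open>big\<close> applies, or has none, where \<open>triv\<close> suffices.\<close>
 have "f c <= Z"
 proof (cases "\<exists>u. mis P N c u ~= 0")
  case True
  then obtain u where "mis P N c u ~= 0" by blast
  from mismatch_density[OF N(1) h0 key this] have "N <= 4 * nmis P N c" by simp
  from big[OF cA this] show ?thesis using Wp[of c] by (simp add: f_def W_def divide_le_eq)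
 next
  case False
  then have "nmis P N c = 0" by (simp add: nmis_def)
  then show ?thesis using triv[OF cA] by (simp add: f_def W_def)
 qed
 with cX MZ show False by simp
qed

section \<open>Chessboard estimates for letter patterns\<close>

datatype letter = LI | LB | L1 | L0

lemma finite_letter: "finite (UNIV :: letter set)"
proof -
 have "(UNIV :: letter set) = {LI, LB, L1, L0}" by (auto intro: letter.exhaust)
 moreover have "finite {LI, LB, L1, L0}" by simp
 ultimately show ?thesis by (simp only:)
qed

definition lf :: "real => nat => letter => nat => real" where
 "lf ep n l k = (case l of LI => 1
   | LB => of_bool (ep < (mz n k)\<^sup>2 & (mz n k)\<^sup>2 < 1 - ep)
   | L1 => of_bool ((mz n k)\<^sup>2 >= 1 - ep)
   | L0 => of_bool ((mz n k)\<^sup>2 <= ep))"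

text \<open>Bad letters are left out on purpose: they are paid for site by site, so a mismatch has
  to be costly only for two good letters of different kind.\<close>

definition mism :: "letter => letter => bool" where
 "mism a b \<longleftrightarrow> (a = L1 & b = L0) \<or> (a = L0 & b = L1)"

lemma lf_range: "0 <= lf ep n l k" "lf ep n l k <= 1"
 by (auto simp: lf_def split: letter.splits)

definition LF :: "nat => nat => real => real => (site => letter) => real" where
 "LF N n b ep f = fw N n b (%s. lf ep n (f s))"

lemma LF_cong: "(!!s. s \<in> sites N ==> f s = f' s) ==> LF N n b ep f = LF N n b ep f'"
 unfolding LF_def fw_def by (intro sum.cong refl arg_cong2[of _ _ _ _ times] prod.cong) auto

lemma LF_nonneg: "b >= 0 ==> LF N n b ep f >= 0"
 unfolding LF_def fw_def by (intro sum_nonneg mult_nonneg_nonneg prod_nonneg gw_nonneg) (auto simp: lf_range)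

lemma LF_le_Z: "b >= 0 ==> LF N n b ep f <= Zr N n b"
 unfolding LF_def fw_def Zr_sum
proof (rule sum_mono)
 fix sg assume "b >= 0" "sg \<in> confs N n"
 then have "gw N n b sg >= 0" by (rule gw_nonneg)
 moreover have "(\<Prod>s\<in>sites N. lf ep n (f s) (sg s)) <= 1" by (intro prod_le_1) (auto simp: lf_range)
 ultimately show "gw N n b sg * (\<Prod>s\<in>sites N. lf ep n (f s) (sg s)) <= gw N n b sg"
  by (simp add: mult_left_le)
qed

lemma LF_swap: "LF N n b ep (%s. f (prod.swap s)) = LF N n b ep f"
 unfolding LF_def by (rule fw_swap)

lemma LF_rp:
 assumes "N > 0" "even N" "b >= 0"
 shows "(LF N n b ep (%s. c (fst s) (snd s)))\<^sup>2
  <= LF N n b ep (%s. refL N k c (fst s) (snd s)) * LF N n b ep (%s. refR N k c (fst s) (snd s))"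
proof -
 have "LF N n b ep (%s. refL N k c (fst s) (snd s)) =
   fw N n b (%s. if fst s \<in> halfL N k then lf ep n (c (fst s) (snd s))
     else lf ep n (c (fst (refl1 N (2 * k + 1) s)) (snd (refl1 N (2 * k + 1) s))))"
  unfolding LF_def refL_def refl1_def by (rule arg_cong[of _ _ "fw N n b"]) auto
 moreover have "LF N n b ep (%s. refR N k c (fst s) (snd s)) =
   fw N n b (%s. if fst s \<in> halfL N k then lf ep n (c (fst (refl1 N (2 * k + 1) s)) (snd (refl1 N (2 * k + 1) s)))
     else lf ep n (c (fst s) (snd s)))"
  unfolding LF_def refR_def refl1_def by (rule arg_cong[of _ _ "fw N n b"]) auto
 ultimately show ?thesis
  using rp_horizontal[OF assms, of n "%s. lf ep n (c (fst s) (snd s))" k] unfolding LF_def by simp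
qed

lemma LF_rp1:
 assumes "N > 0" "even N" "b >= 0"
 shows "(LF N n b ep (%s. g (fst s)))\<^sup>2
  <= LF N n b ep (%s. refL N k g (fst s)) * LF N n b ep (%s. refR N k g (fst s))"
proof -
 have "refL N k (%i _. g i) i j = refL N k g i" "refR N k (%i _. g i) i j = refR N k g i" for i j :: nat
  by (auto simp: refL_def refR_def)
 then show ?thesis using LF_rp[OF assms, of n ep "%i _. g i" k] by simp
qed

text \<open>The ring estimate with whole columns as letters. Its constant patterns depend on the
  vertical coordinate alone, and the exchange of coordinates turns them into the stripes of
  \<open>const\<close>, to which a second one-dimensional argument can be applied.\<close>

lemma LF_columns:
 assumes N: "N = 2 * h" "h > 0" and b: "b >= 0"
  and w: "!!g. w g > 0" "!!g g'. (!!j. j < N ==> g j = g' j) ==> w g = w g'"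
  and const: "!!g. LF N n b ep (%s. g (fst s)) <= Zr N n b * w g ^ N"
 shows "LF N n b ep f <= Zr N n b * (\<Prod>i<N. w (%j. f (i, j)))"
proof -
 \<comment> \<open>Columns are restricted to \<open>{..<N}\<close> to make the alphabet
   finite.\<close>
 define \<A> where "\<A> = PiE {..<N} (%_. UNIV :: letter set)"
 define c where "c = (%i. restrict (%j. f (i, j)) {..<N})"
 have "LF N n b ep (%s. c (fst s) (snd s)) <= Zr N n b * (\<Prod>i<N. w (c i))"
 proof (rule ring_chessboard[OF N, where \<A>=\<A> and \<Phi>="%c. LF N n b ep (%s. c (fst s) (snd s))"])
  show "finite \<A>" unfolding \<A>_def using finite_letter by (intro finite_PiE) auto
  show "LF N n b ep (%s. c (fst s) (snd s)) = LF N n b ep (%s. c' (fst s) (snd s))"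
   if "!!i. i < N ==> c i = c' i" for c c' :: "nat => nat => letter"
   using that by (intro LF_cong) (simp add: sites_fst_lt)
  show "(LF N n b ep (%s. c (fst s) (snd s)))\<^sup>2
   <= LF N n b ep (%s. refL N k c (fst s) (snd s)) * LF N n b ep (%s. refR N k c (fst s) (snd s))" for c k
   using N b by (intro LF_rp) auto
  show "LF N n b ep (%s. g (snd s)) <= Zr N n b * w g ^ N" for g
   using const[of g] LF_swap[of N n b ep "%s. g (fst s)"] by simp
  show "\<forall>i<N. c i \<in> \<A>" by (auto simp: c_def \<A>_def)
 qed (use b w(1) in \<open>auto simp: LF_nonneg Zr_pos\<close>)
 moreover have "LF N n b ep (%s. c (fst s) (snd s)) = LF N n b ep f"
  by (intro LF_cong) (simp add: c_def sites_fst_lt)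
 moreover have "(\<Prod>i<N. w (c i)) = (\<Prod>i<N. w (%j. f (i, j)))"
  by (intro prod.cong refl w(2)) (simp add: c_def)
 ultimately show ?thesis by simp
qed

theorem LF_bad_bound:
 assumes N: "N = 2 * h" "h > 0" and b: "b >= 0" and \<eta>: "\<eta> > 0"
  and all: "LF N n b ep (%_. LB) <= Zr N n b * \<eta> ^ (N * N)"
 shows "LF N n b ep f <= Zr N n b * \<eta> ^ card {s \<in> sites N. f s = LB}"
proof -
 define v where "v = (%l. if l = LB then \<eta> else 1)"
 have "LF N n b ep f <= Zr N n b * (\<Prod>i<N. \<Prod>j<N. v (f (i, j)))"
 proof (rule LF_columns[OF N b])
  show "(\<Prod>j<N. v (g j)) > 0" for g :: "nat => letter" using \<eta> by (intro prod_pos) (simp add: v_def)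
  show "(\<Prod>j<N. v (g j)) = (\<Prod>j<N. v (g' j))" if "!!j. j < N ==> g j = g' j" for g g' :: "nat => letter"
   using that by simp
  fix g :: "nat => letter"
  have "LF N n b ep (%s. g (fst s)) <= Zr N n b * (\<Prod>i<N. v (g i) ^ N)"
  proof (rule ring_chessboard[OF N finite_letter, where \<Phi>="%g. LF N n b ep (%s. g (fst s))"])
   show "LF N n b ep (%s. c (fst s)) = LF N n b ep (%s. c' (fst s))"
    if "!!i. i < N ==> c i = c' i" for c c' :: "nat => letter"
    using that by (intro LF_cong) (simp add: sites_fst_lt)
   show "(LF N n b ep (%s. c (fst s)))\<^sup>2 <= LF N n b ep (%s. refL N k c (fst s)) * LF N n b ep (%s. refR N k c (fst s))"
    for c k using N b by (intro LF_rp1) auto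
   show "LF N n b ep (%s. a) <= Zr N n b * (v a ^ N) ^ N" for a
    using all LF_le_Z[OF b] by (simp add: v_def power_mult)
  qed (use b \<eta> in \<open>auto simp: LF_nonneg Zr_pos v_def\<close>)
  then show "LF N n b ep (%s. g (fst s)) <= Zr N n b * (\<Prod>j<N. v (g j)) ^ N"
   by (simp add: prod_power_distrib)
 qed
 also have "(\<Prod>i<N. \<Prod>j<N. v (f (i, j))) = (\<Prod>s\<in>sites N. v (f s))"
  unfolding sites_def by (simp add: prod.cartesian_product split_beta)
 also have "... = \<eta> ^ card {s \<in> sites N. f s = LB}"
  unfolding v_def by (subst prod.If_cases) (auto simp: Int_def)
 finally show ?thesis .
qed

definition nvert :: "nat => (site => letter) => nat" where
 "nvert N f = (\<Sum>i<N. nmis mism N (%j. f (i, j)))"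

definition nhor :: "nat => (site => letter) => nat" where
 "nhor N f = (\<Sum>j<N. nmis mism N (%i. f (i, j)))"

text \<open>Mismatches inside the columns are first spread over the torus by the chessboard estimate
  in the other direction; a stripe mismatch then occupies \<open>N\<close> bonds, hence
  \<open>\<zeta> ^ N\<close>. What remains to be estimated are stripes with a positive density of
  mismatches, the hypothesis \<open>big\<close>.\<close>

theorem LF_mismatch_bound:
 assumes N: "N = 2 * h" "h >= 4" and b: "b >= 0" and \<zeta>: "\<zeta> > 0"
  and big: "!!g. N <= 4 * nmis mism N g ==> LF N n b ep (%s. g (fst s)) <= Zr N n b * (\<zeta> ^ N) ^ nmis mism N g"
 shows "LF N n b ep f <= Zr N n b * \<zeta> ^ nvert N f" "LF N n b ep f <= Zr N n b * \<zeta> ^ nhor N f"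
proof -
 have N0: "N > 0" "h > 0" using N by auto
 have *: "LF N n b ep f <= Zr N n b * \<zeta> ^ nvert N f" for f
 proof -
  have "LF N n b ep f <= Zr N n b * (\<Prod>i<N. \<zeta> ^ nmis mism N (%j. f (i, j)))"
  proof (rule LF_columns[OF N(1) N0(2) b])
   show "\<zeta> ^ nmis mism N g > 0" for g using \<zeta> by simp
   show "\<zeta> ^ nmis mism N g = \<zeta> ^ nmis mism N g'" if "!!j. j < N ==> g j = g' j" for g g'
    using nmis_cong[OF N0(1), of g g' mism] that by simp
   fix g :: "nat => letter"
   have "LF N n b ep (%s. g (fst s)) <= Zr N n b * (\<zeta> ^ N) ^ nmis mism N g"
   proof (rule ring_mismatch_bound[OF N finite_letter, where \<Phi>="%g. LF N n b ep (%s. g (fst s))"])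
    show "LF N n b ep (%s. c (fst s)) = LF N n b ep (%s. c' (fst s))"
     if "!!i. i < N ==> c i = c' i" for c c' :: "nat => letter"
     using that by (intro LF_cong) (simp add: sites_fst_lt)
    show "(LF N n b ep (%s. c (fst s)))\<^sup>2 <= LF N n b ep (%s. refL N k c (fst s)) * LF N n b ep (%s. refR N k c (fst s))"
     for c k using N b by (intro LF_rp1) auto
    show "LF N n b ep (%s. c (fst s)) <= Zr N n b * (\<zeta> ^ N) ^ nmis mism N c" if "N <= 4 * nmis mism N c" for c
     by (rule big[OF that])
   qed (use b \<zeta> in \<open>auto simp: LF_nonneg LF_le_Z Zr_pos mism_def\<close>)
   then show "LF N n b ep (%s. g (fst s)) <= Zr N n b * (\<zeta> ^ nmis mism N g) ^ N"
    by (simp add: power_mult[symmetric] mult.commute)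
  qed
  then show ?thesis by (simp add: nvert_def power_sum)
 qed
 show "LF N n b ep f <= Zr N n b * \<zeta> ^ nvert N f" by (rule *)
 show "LF N n b ep f <= Zr N n b * \<zeta> ^ nhor N f"
  using *[of "%s. f (prod.swap s)"] by (simp add: LF_swap nvert_def nhor_def)
qed

section \<open>Walk counting and the hopping factor of a bond\<close>

fun wk :: "nat => int => nat" where
 "wk 0 d = (if d = 0 then 1 else 0)"
| "wk (Suc i) d = wk i (d - 1) + wk i (d + 1)"

lemma wk_zero: "\<bar>d\<bar> > int i ==> wk i d = 0"
 by (induction i arbitrary: d) auto

lemma wk_odd: "odd (int i + d) ==> wk i d = 0"
 by (induction i arbitrary: d) auto

lemma wk_binomial: "wk i (2 * int t - int i) = i choose t"
proof (induction i arbitrary: t)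
 case 0
 then show ?case by (cases t) auto
next
 case (Suc i)
 have 1: "wk i (2 * int t - int i) = i choose t" by (rule Suc)
 have 2: "wk i (2 * int t - int i - 2) = (case t of 0 => 0 | Suc u => i choose u)"
 proof (cases t)
  case 0
  then show ?thesis by (simp add: wk_zero)
 next
  case (Suc u)
  then show ?thesis using Suc.IH[of u] by simp
 qed
 have "wk (Suc i) (2 * int t - int (Suc i)) = wk i (2 * int t - int i - 2) + wk i (2 * int t - int i)"
  by (simp add: algebra_simps)
 also have "... = Suc i choose t" unfolding 1 2 by (cases t) auto
 finally show ?case .
qed

lemma wk_return: "wk (2 * i) 0 = (2 * i) choose i" "odd j ==> wk j 0 = 0"
 using wk_binomial[of "2 * i" i] wk_odd[of j 0] by auto

text \<open>\<open>xm\<close> hops between neighbouring levels, so in \<open>m\<close> steps the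
  walk cannot leave the window of radius \<open>m\<close> about \<open>k0\<close>, where no entry
  exceeds \<open>\<alpha>\<close>; what is left is the number of walks.\<close>

lemma mpow_xm_walk:
 assumes k0: "k0 <= n" and \<alpha>: "\<alpha> >= 0"
  and ent: "!!k l. k <= n ==> l <= n ==> \<bar>int k - int k0\<bar> <= int m ==> \<bar>int l - int k0\<bar> <= int m ==> xm n k l <= \<alpha>"
 shows "i <= m ==> k <= n ==> mpow {..n} (xm n) i k k0 <= \<alpha> ^ i * wk i (int k - int k0)"
proof (induction i arbitrary: k)
 case 0
 then show ?case by (auto simp: mid_def)
next
 case (Suc i)
 let ?W = "%d. real (wk i d)"
 let ?B = "%l. mpow {..n} (xm n) i l k0"
 have step: "c * ?B l <= \<alpha> ^ Suc i * ?W (int l - int k0)"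
  if l: "l <= n" and adj: "\<bar>int l - int k\<bar> <= 1" and c: "0 <= c" "c = xm n k l" for l c
 proof (cases "wk i (int l - int k0) = 0")
  case True
  have "?B l <= 0" using Suc.IH[of l] Suc.prems l True by simp
  moreover have "?B l >= 0"
  proof (rule fin_index.mpow_nonneg)
   show "fin_index {..n}" by unfold_locales simp
  qed (use l k0 in \<open>auto simp: xm_nonneg\<close>)
  ultimately show ?thesis using True by simp
 next
  case False
  then have d: "\<bar>int l - int k0\<bar> <= int i" using wk_zero by (metis not_le)
  have "c <= \<alpha>" unfolding c(2) using d adj Suc.prems l by (intro ent) auto
  then have "c * ?B l <= \<alpha> * (\<alpha> ^ i * ?W (int l - int k0))"
   using Suc.IH[of l] Suc.prems l c \<alpha>
   by (intro mult_mono) (auto intro!: fin_index.mpow_nonneg[of "{..n}"] simp: fin_index_def xm_nonneg k0)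
  then show ?thesis by simp
 qed
 have "mpow {..n} (xm n) (Suc i) k k0 = (\<Sum>l\<le>n. xm n k l * ?B l)" by (simp add: mmul_def)
 also have "... = sqrt ((real n - real k) * (real k + 1)) / n * ?B (Suc k)
   + (case k of 0 => 0 | Suc j => sqrt ((real n - real j) * (real j + 1)) / n * ?B j)"
  by (rule sum_xm) (use Suc in simp)
 also have "sqrt ((real n - real k) * (real k + 1)) / n * ?B (Suc k) <= \<alpha> ^ Suc i * ?W (int k - int k0 + 1)"
 proof (cases "k = n")
  case True
  then show ?thesis using \<alpha> by simp
 next
  case False
  have e: "sqrt ((real n - real k) * (real k + 1)) / n = xm n k (Suc k)" by (simp add: xm_def)
  have d: "int (Suc k) - int k0 = int k - int k0 + 1" by simp
  show ?thesis unfolding e d[symmetric] using False Suc.prems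
   by (intro step) (auto simp: xm_nonneg)
 qed
 also have "(case k of 0 => 0 | Suc j => sqrt ((real n - real j) * (real j + 1)) / n * ?B j)
   <= \<alpha> ^ Suc i * ?W (int k - int k0 - 1)"
 proof (cases k)
  case 0
  then show ?thesis using \<alpha> by simp
 next
  case (Suc j)
  then have e: "sqrt ((real n - real j) * (real j + 1)) / n = xm n k j" by (simp add: xm_def)
  have d: "int j - int k0 = int k - int k0 - 1" using Suc by simp
  have "xm n k j * ?B j <= \<alpha> ^ Suc i * ?W (int k - int k0 - 1)"
   unfolding d[symmetric] using Suc \<open>k <= n\<close> by (intro step) (auto simp: xm_nonneg)
  then show ?thesis using Suc e by simp
 qed
 finally show ?case by (simp add: algebra_simps)
qed

text \<open>The square-root decay is essential. For the two ends of a bond it multiplies to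
  \<open>1 / (j + 1)\<close>, which turns \<open>j!\<close> into \<open>(j + 1)!\<close> in the
  exponential series and gains the factor \<open>1 / \<mu>\<close> in
  \<open>V2_bound\<close>.\<close>

lemma central_binomial_bound: "(2 * real i + 1) * (real ((2 * i) choose i))\<^sup>2 <= 16 ^ i"
proof (induction i)
 case (Suc i)
 let ?c = "real ((2 * i) choose i)"
 have "Suc i * ((2 * Suc i) choose Suc i) = 2 * (2 * i + 1) * ((2 * i) choose i)"
 proof -
  have "Suc i * ((2 * Suc i) choose Suc i) = (2 * Suc i) * (Suc (2 * i) choose i)"
   using Suc_times_binomial_eq[of "Suc (2 * i)" i] by simp
  also have "Suc i * (Suc (2 * i) choose i) = Suc (2 * i) * ((2 * i) choose i)"
   using binomial_absorb_comp[of "Suc (2 * i)" i] by simp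
  then have "(2 * Suc i) * (Suc (2 * i) choose i) = 2 * (2 * i + 1) * ((2 * i) choose i)" by simp
  finally show ?thesis .
 qed
 then have "real (Suc i) * real ((2 * Suc i) choose Suc i) = 2 * (2 * real i + 1) * ?c"
  by (metis (no_types, lifting) of_nat_1 of_nat_add of_nat_mult of_nat_numeral)
 then have e: "real ((2 * Suc i) choose Suc i) = 2 * (2 * real i + 1) * ?c / (real i + 1)"
  by (simp add: field_simps)
 have "(2 * real (Suc i) + 1) * (real ((2 * Suc i) choose Suc i))\<^sup>2
   = (4 * (2 * real i + 3) * (2 * real i + 1) / (real i + 1)\<^sup>2) * ((2 * real i + 1) * ?c\<^sup>2)"
  unfolding e by (simp add: power2_eq_square field_simps)
 also have "... <= 16 * 16 ^ i"
 proof (intro mult_mono Suc)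
  show "4 * (2 * real i + 3) * (2 * real i + 1) / (real i + 1)\<^sup>2 <= 16"
  proof (subst pos_divide_le_eq)
   show "4 * (2 * real i + 3) * (2 * real i + 1) <= 16 * (real i + 1)\<^sup>2"
    by (simp add: power2_eq_square algebra_simps)
  qed simp
 qed auto
 finally show ?case by simp
qed simp

lemma central_binomial_le: "real ((2 * i) choose i) <= 4 ^ i / sqrt (2 * real i + 1)"
proof -
 have "(real ((2 * i) choose i))\<^sup>2 <= (4 ^ i / sqrt (2 * real i + 1))\<^sup>2"
 proof -
  have s: "((4::real) ^ i)\<^sup>2 = 16 ^ i" by (simp add: power2_eq_square power_mult_distrib[symmetric])
  show ?thesis using central_binomial_bound[of i]
   unfolding power_divide s by (simp add: le_divide_eq mult.commute)
 qed
 then show ?thesis by (rule power2_le_imp_le) simp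
qed

lemma mz_abs: "k <= n ==> n >= 1 ==> \<bar>mz n k\<bar> <= 1"
 by (auto simp: mz_def abs_le_iff field_simps)

lemma mz_sq: "k <= n ==> n >= 1 ==> (mz n k)\<^sup>2 <= 1"
 using mz_abs by (simp add: abs_square_le_1)

text \<open>Semiclassically the hopping amplitude is \<open>sqrt (1 - m^2) / 2\<close>. Moving by at
  most \<open>m\<close> levels changes the square of \<open>mz\<close> by at most
  \<open>4 * m / n\<close>, and the difference between \<open>j\<close> and \<open>j + 1\<close> in
  the ladder coefficient costs another \<open>4 / n\<close>.\<close>

lemma xm_entry_bound:
 assumes k: "k <= n" "l <= n" and n: "n >= 1" and d: "\<bar>int k - int k0\<bar> <= int m" "\<bar>int l - int k0\<bar> <= int m" and k0: "k0 <= n"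
 shows "xm n k l <= sqrt (1 - (mz n k0)\<^sup>2 + 4 * (real m + 1) / n) / 2"
proof -
 define A where "A = 1 - (mz n k0)\<^sup>2 + 4 * (real m + 1) / n"
 have mz1: "\<bar>mz n j\<bar> <= 1" if "j <= n" for j using that n by (auto simp: mz_def abs_le_iff field_simps)
 have A0: "A >= 0" using mz1[OF k0] by (auto simp: A_def abs_square_le_1)
 have main: "sqrt ((real n - real j) * (real j + 1)) / n <= sqrt A / 2"
  if j: "j <= n" "\<bar>int j - int k0\<bar> <= int m" for j
 proof -
  have "4 * ((real n - real j) * (real j + 1)) / (real n)\<^sup>2 = 1 - (mz n j)\<^sup>2 + 4 * (real n - real j) / (real n)\<^sup>2"
   using n by (simp add: mz_def power2_eq_square field_simps)
  also have "... <= 1 - (mz n j)\<^sup>2 + 4 / n"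
   using n by (simp add: power2_eq_square field_simps)
  finally have 1: "4 * ((real n - real j) * (real j + 1)) / (real n)\<^sup>2 <= 1 - (mz n j)\<^sup>2 + 4 / n" .
  have 2: "- (mz n j)\<^sup>2 <= - (mz n k0)\<^sup>2 + 4 * real m / n"
  proof -
   have "(mz n k0)\<^sup>2 - (mz n j)\<^sup>2 = (mz n k0 - mz n j) * (mz n k0 + mz n j)"
    by (simp add: power2_eq_square algebra_simps)
   also have "... <= \<bar>mz n k0 - mz n j\<bar> * \<bar>mz n k0 + mz n j\<bar>" by (metis abs_ge_self abs_mult)
   also have "... <= \<bar>mz n k0 - mz n j\<bar> * 2"
    using mz1[OF k0] mz1[OF j(1)] by (intro mult_left_mono) auto
   also have "\<bar>mz n k0 - mz n j\<bar> = 2 * \<bar>real k0 - real j\<bar> / n"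
   proof -
    have "mz n k0 - mz n j = 2 * (real k0 - real j) / n"
     by (simp add: mz_def diff_divide_distrib[symmetric])
    then show ?thesis by (simp only: abs_divide abs_mult)
   qed
   also have "\<bar>real k0 - real j\<bar> <= real m" using j(2) by linarith
   then have "2 * \<bar>real k0 - real j\<bar> / n * 2 <= 4 * real m / n" using n by (simp add: field_simps)
   finally show ?thesis by simp
  qed
  have "4 * ((real n - real j) * (real j + 1)) / (real n)\<^sup>2 <= A"
   using 1 2 by (simp add: A_def add_divide_distrib distrib_left)
  then have "sqrt (4 * ((real n - real j) * (real j + 1)) / (real n)\<^sup>2) <= sqrt A" by simp
  then show ?thesis using n by (simp add: real_sqrt_divide real_sqrt_mult mult.commute)
 qed
 show ?thesis unfolding A_def[symmetric] xm_def using main[of k] main[of l] assms A0 by auto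
qed

definition mu :: "nat => nat => nat => real" where
 "mu n j k = mpow {..n} (xm n) j k k"

lemma mu_nonneg: "k <= n ==> mu n j k >= 0"
 unfolding mu_def
 by (rule fin_index.mpow_nonneg) (auto simp: fin_index_def xm_nonneg)

lemma mu_odd: 
 assumes k: "k <= n" and n: "n >= 1" and j: "odd j" shows "mu n j k = 0"
proof -
 have "mu n j k <= (sqrt (1 - (mz n k)\<^sup>2 + 4 * (real j + 1) / n) / 2) ^ j * wk j (int k - int k)"
  unfolding mu_def
 proof (rule mpow_xm_walk[where m=j])
  show "0 <= sqrt (1 - (mz n k)\<^sup>2 + 4 * (real j + 1) / n) / 2" using mz_sq[OF k n] by simp
  show "xm n k' l <= sqrt (1 - (mz n k)\<^sup>2 + 4 * (real j + 1) / n) / 2"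
   if "k' <= n" "l <= n" "\<bar>int k' - int k\<bar> <= int j" "\<bar>int l - int k\<bar> <= int j" for k' l
   by (rule xm_entry_bound) (use that k n in auto)
 qed (use k in auto)
 then show ?thesis using mu_nonneg[OF k, of j] wk_return(2)[OF j] by simp
qed

lemma mu_even:
 assumes k: "k <= n" and n: "n >= 1" and j: "j = 2 * i" and A: "A >= 1 - (mz n k)\<^sup>2 + 4 * (real j + 1) / n"
 shows "mu n j k <= A ^ i / sqrt (real j + 1)"
proof -
 have "(mz n k)\<^sup>2 <= 1" using k n by (rule mz_sq)
 then have A0: "A >= 0" using A by (smt (verit) divide_nonneg_nonneg of_nat_0_le_iff)
 have "mu n j k <= (sqrt A / 2) ^ j * wk j (int k - int k)"
  unfolding mu_def
 proof (rule mpow_xm_walk[where m=j])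
  fix k' l assume "k' <= n" "l <= n" "\<bar>int k' - int k\<bar> <= int j" "\<bar>int l - int k\<bar> <= int j"
  then have "xm n k' l <= sqrt (1 - (mz n k)\<^sup>2 + 4 * (real j + 1) / n) / 2"
   using k n by (intro xm_entry_bound) auto
  also have "... <= sqrt A / 2" using A by simp
  finally show "xm n k' l <= sqrt A / 2" .
 qed (use k A0 in auto)
 also have "(sqrt A / 2) ^ j = A ^ i / 4 ^ i"
  unfolding j power_divide power_mult using A0 by simp
 also have "real (wk j (int k - int k)) = real ((2 * i) choose i)" unfolding j using wk_return(1)[of i] by simp
 also have "A ^ i / 4 ^ i * real ((2 * i) choose i) <= A ^ i / 4 ^ i * (4 ^ i / sqrt (2 * real i + 1))"
  using A0 by (intro mult_left_mono central_binomial_le) auto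
 also have "... = A ^ i / sqrt (real j + 1)" by (simp add: j)
 finally show ?thesis .
qed

lemma mu_crude:
 assumes k: "k <= n" and n: "n >= 1"
 shows "mu n j k <= 2 ^ j"
proof -
 have "xm n k l <= 1" if "k <= n" "l <= n" for k l
 proof -
  have "sqrt ((real n - real i) * (real i + 1)) / n <= 1" if i: "i <= n" for i
  proof -
   have "(real n - real i) * (real i + 1) = real n * real i - real i * real i + real n - real i"
    by (simp add: algebra_simps)
   also have "... <= (real n)\<^sup>2"
   proof (cases "i = n")
    case False
    then have "real i + 1 <= real n" using i by linarith
    then have "(real n - real i) * (real i + 1) <= real n * real n" using i by (intro mult_mono) auto
    then show ?thesis by (simp add: power2_eq_square algebra_simps)
   qed simp
   finally have "sqrt ((real n - real i) * (real i + 1)) <= sqrt ((real n)\<^sup>2)" 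
    by (simp only: real_sqrt_le_iff)
   then show ?thesis using n by simp
  qed
  then show ?thesis using that by (auto simp: xm_def)
 qed
 then have "mu n j k <= 1 ^ j * real (wk j (int k - int k))"
  unfolding mu_def by (intro mpow_xm_walk[where m=j]) (use k in auto)
 also have "wk j d <= 2 ^ j" for d
 proof (induction j arbitrary: d)
  case (Suc j)
  have "wk (Suc j) d <= 2 ^ j + 2 ^ j" using Suc[of "d - 1"] Suc[of "d + 1"] by simp
  then show ?case by simp
 qed auto
 then have "1 ^ j * real (wk j (int k - int k)) <= 2 ^ j" by (metis mult_1 of_nat_le_iff of_nat_numeral of_nat_power power_one)
 finally show ?thesis .
qed

definition V2 :: "nat => real => nat => nat => real" where
 "V2 n c k l = mexp ({..n} \<times> {..n}) (%p q. c * (xm n (fst p) (fst q) * xm n (snd p) (snd q))) (k, l) (k, l)"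

lemma V2_sums:
 assumes "k <= n" "l <= n"
 shows "(%j. c ^ j / fact j * (mu n j k * mu n j l)) sums V2 n c k l"
proof -
 let ?I = "{..n}"
 interpret fin_index "?I \<times> ?I" by unfold_locales simp
 let ?A = "%p q. c * (xm n (fst p) (fst q) * xm n (snd p) (snd q))"
 have "mpow (?I \<times> ?I) ?A j p q = c ^ j * (mpow ?I (xm n) j (fst p) (fst q) * mpow ?I (xm n) j (snd p) (snd q))"
  if "p \<in> ?I \<times> ?I" "q \<in> ?I \<times> ?I" for j p q
  using that
 proof (induction j arbitrary: p)
  case 0
  then show ?case by (auto simp: mid_def prod_eq_iff)
 next
  case (Suc j)
  have "mpow (?I \<times> ?I) ?A (Suc j) p q = (\<Sum>r\<in>?I \<times> ?I. ?A p r * (c ^ j * (mpow ?I (xm n) j (fst r) (fst q) * mpow ?I (xm n) j (snd r) (snd q))))"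
   using Suc by (simp add: mmul_def)
  also have "... = c ^ Suc j * (\<Sum>r\<in>?I \<times> ?I. (xm n (fst p) (fst r) * mpow ?I (xm n) j (fst r) (fst q)) * (xm n (snd p) (snd r) * mpow ?I (xm n) j (snd r) (snd q)))"
   by (simp add: sum_distrib_left mult_ac)
  also have "(\<Sum>r\<in>?I \<times> ?I. (xm n (fst p) (fst r) * mpow ?I (xm n) j (fst r) (fst q)) * (xm n (snd p) (snd r) * mpow ?I (xm n) j (snd r) (snd q)))
    = mpow ?I (xm n) (Suc j) (fst p) (fst q) * mpow ?I (xm n) (Suc j) (snd p) (snd q)"
   by (simp add: mmul_def sum_product sum.cartesian_product split_beta)
  finally show ?case .
 qed
 then have "mpow (?I \<times> ?I) ?A j (k, l) (k, l) / fact j = c ^ j / fact j * (mu n j k * mu n j l)" for j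
  using assms by (simp add: mu_def)
 then show ?thesis using mexp_sums[of "(k, l)" "(k, l)" ?A] assms by (simp add: V2_def)
qed


text \<open>The series is cut at \<open>j = 80 * b'\<close>. Below the cut the walk stays where
  \<open>xm_entry_bound\<close> has error at most \<open>s\<close>, odd terms vanish, and two
  central binomials give \<open>\<mu> ^ j / (j + 1)!\<close>. Its sum is at most
  \<open>exp \<mu>\<close>, also after multiplication by \<open>\<mu>\<close>; the second claim
  records this gain.\<close>

lemma V2_bound:
 fixes b' s :: real
 assumes k: "k <= n" and l: "l <= n" and n: "n >= 1" and b: "b' >= 1" and s: "s >= 4 * (80 * b' + 1) / n" "s <= 1"
 defines "\<mu> \<equiv> 2 * b' * sqrt ((1 - (mz n k)\<^sup>2 + s) * (1 - (mz n l)\<^sup>2 + s))"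
 shows "V2 n (2 * b') k l <= 2 * exp \<mu>" "\<mu> * V2 n (2 * b') k l <= 2 * exp \<mu>"
proof -
 define Ak where "Ak = 1 - (mz n k)\<^sup>2 + s"
 define Al where "Al = 1 - (mz n l)\<^sup>2 + s"
 have s0: "s >= 0" using s(1) b by (smt (verit) divide_nonneg_nonneg of_nat_0_le_iff)
 have A: "0 <= Ak" "Ak <= 2" "0 <= Al" "Al <= 2"
  using mz_sq[OF k n] mz_sq[OF l n] s s0 zero_le_power2[of "mz n k"] zero_le_power2[of "mz n l"]
  unfolding Ak_def Al_def by linarith+
 have \<mu>: "\<mu> = 2 * b' * sqrt (Ak * Al)" by (simp add: \<mu>_def Ak_def Al_def)
 have \<mu>0: "\<mu> >= 0" using A b by (simp add: \<mu>)
 have "sqrt (Ak * Al) <= sqrt (2 * 2)" using A by (intro real_sqrt_le_mono mult_mono) auto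
 then have \<mu>4: "\<mu> <= 4 * b'" using b by (simp add: \<mu>)
 let ?t = "%j. (2 * b') ^ j / fact j * (mu n j k * mu n j l)"
 let ?main = "%j. \<mu> ^ j / fact (Suc j)"
 \<comment> \<open>Beyond the cut the two return weights are bounded crudely by
   \<open>4 ^ j\<close>. There \<open>1 <= exp (- 160 * b') * 9 ^ j\<close>, so these terms sum to
   at most \<open>exp (- 88 * b')\<close>.\<close>
 let ?tail = "%j. exp (- 160 * b') * ((72 * b') ^ j / fact j)"
 have trm: "?t j <= ?main j + ?tail j" for j
 proof (cases "real j <= 80 * b'")
  case True
  have "?t j <= ?main j"
  proof (cases "even j")
   case False
   then show ?thesis using mu_odd[OF k n False] \<mu>0 by simp
  next
   case True
   then obtain i where i: "j = 2 * i" by (metis evenE)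
   have "4 * (real j + 1) / n <= 4 * (80 * b' + 1) / n"
    using \<open>real j <= 80 * b'\<close> by (intro divide_right_mono) auto
   then have Aj: "Ak >= 1 - (mz n k)\<^sup>2 + 4 * (real j + 1) / n" "Al >= 1 - (mz n l)\<^sup>2 + 4 * (real j + 1) / n"
    using s(1) by (auto simp: Ak_def Al_def)
   have "mu n j k * mu n j l <= (Ak ^ i / sqrt (real j + 1)) * (Al ^ i / sqrt (real j + 1))"
    using mu_even[OF k n i Aj(1)] mu_even[OF l n i Aj(2)] mu_nonneg[OF k, of j] mu_nonneg[OF l, of j] A
    by (intro mult_mono) auto
   also have "... = (Ak * Al) ^ i / (real j + 1)" by (simp add: power_mult_distrib)
   also have "(Ak * Al) ^ i = sqrt (Ak * Al) ^ j" unfolding i power_mult using A by simp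
   finally have "?t j <= (2 * b') ^ j / fact j * (sqrt (Ak * Al) ^ j / (real j + 1))"
    using b by (intro mult_left_mono) auto
   also have "... = ?main j" by (simp add: \<mu> power_mult_distrib mult_ac add.commute)
   finally show ?thesis .
  qed
  moreover have "?tail j >= 0" using b by simp
  ultimately show ?thesis by linarith
 next
  case False
  have "?t j <= (2 * b') ^ j / fact j * (2 ^ j * 2 ^ j)"
   using mu_crude[OF k n, of j] mu_crude[OF l n, of j] mu_nonneg[OF k, of j] mu_nonneg[OF l, of j] b
   by (intro mult_left_mono mult_mono) auto
  also have "... = (2 * b' * (2 * 2)) ^ j / fact j"
   by (simp only: power_mult_distrib times_divide_eq_left)
  also have "2 * b' * (2 * 2) = 8 * b'" by simp
  also have "(8 * b') ^ j / fact j = 1 * ((8 * b') ^ j / fact j)" by simp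
  also have "... <= (exp (- 160 * b') * 9 ^ j) * ((8 * b') ^ j / fact j)"
  proof (rule mult_right_mono)
   have "exp (160 * b') <= exp (2 * real j)" using False by simp
   also have "... = exp 2 ^ j" using exp_of_nat_mult[of j "2::real"] by (simp add: mult.commute)
   also have "... <= 9 ^ j"
   proof (intro power_mono)
    have "exp (2::real) = exp 1 * exp 1" by (simp flip: exp_add)
    also have "... <= 3 * 3" by (intro mult_mono exp_le) auto
    finally show "exp (2::real) <= 9" by simp
   qed simp
   finally have "exp (160 * b') <= 9 ^ j" .
   then have "exp (- (160 * b')) * exp (160 * b') <= exp (- (160 * b')) * 9 ^ j" by (intro mult_left_mono) auto
   then show "1 <= exp (- 160 * b') * 9 ^ j" by (simp flip: exp_add)
  qed (use b in simp)
  also have "... = exp (- 160 * b') * ((9 * (8 * b')) ^ j / fact j)"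
   by (simp only: power_mult_distrib times_divide_eq_right mult.assoc)
  also have "9 * (8 * b') = 72 * b'" by simp
  finally have "?t j <= ?tail j" .
  moreover have "?main j >= 0" using \<mu>0 by (intro divide_nonneg_nonneg) auto
  ultimately show ?thesis by linarith
 qed
 have tail: "?tail sums (exp (- 160 * b') * exp (72 * b'))"
  using exp_converges[of "72 * b'"] by (intro sums_mult) (simp add: field_simps)
 have mle: "?main j <= \<mu> ^ j / fact j" for j
 proof (intro divide_left_mono mult_pos_pos)
  show "(fact j :: real) <= fact (Suc j)" by (rule fact_mono) simp
 qed (use \<mu>0 in auto)
 have ms: "summable ?main"
 proof (rule summable_comparison_test')
  show "summable (%j. \<mu> ^ j / fact j)" using summable_exp[of \<mu>] by (simp add: field_simps)
  show "norm (?main j) <= \<mu> ^ j / fact j" if "j >= 0" for j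
  proof -
   have "?main j >= 0" using \<mu>0 by (intro divide_nonneg_nonneg) auto
   then show ?thesis using mle[of j] by (simp only: real_norm_def abs_of_nonneg)
  qed
 qed
 have e: "(%j. \<mu> ^ j / fact j) sums exp \<mu>" using exp_converges[of \<mu>] by (simp add: field_simps)
 have m1: "suminf ?main <= exp \<mu>"
 proof -
  have "suminf ?main <= (\<Sum>j. \<mu> ^ j / fact j)"
   by (rule suminf_le[OF mle ms sums_summable[OF e]])
  then show ?thesis using sums_unique[OF e] by simp
 qed
 have m2: "\<mu> * suminf ?main <= exp \<mu>"
 proof -
  have "(%j. \<mu> ^ Suc j / fact (Suc j)) sums (exp \<mu> - 1)"
   using sums_split_initial_segment[OF e, of 1] by simp
  moreover have "(%j. \<mu> ^ Suc j / fact (Suc j)) = (%j. \<mu> * ?main j)" by (simp del: fact_Suc)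
  ultimately have "(%j. \<mu> * ?main j) sums (exp \<mu> - 1)" by simp
  then have "\<mu> * suminf ?main = exp \<mu> - 1"
   using sums_unique[of "%j. \<mu> * ?main j"] suminf_mult[OF ms, of \<mu>] by simp
  then show ?thesis by simp
 qed
 have tl: "exp (- 160 * b') * exp (72 * b') = exp (- 88 * b')" by (simp flip: exp_add)
 have V: "V2 n (2 * b') k l <= suminf ?main + exp (- 88 * b')"
 proof -
  have "V2 n (2 * b') k l <= suminf ?main + exp (- 160 * b') * exp (72 * b')"
   by (rule sums_le[OF trm V2_sums[OF k l] sums_add[OF summable_sums[OF ms] tail]])
  then show ?thesis by (simp only: tl)
 qed
 have e1: "exp (- 88 * b') <= 1" using b by simp
 have e\<mu>: "exp \<mu> >= 1" using \<mu>0 by simp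
 show "V2 n (2 * b') k l <= 2 * exp \<mu>" using V m1 e1 e\<mu> by linarith
 have "\<mu> * exp (- 88 * b') <= 4 * b' * exp (- 88 * b')" using \<mu>4 by (intro mult_right_mono) auto
 also have "... <= exp (4 * b') * exp (- 88 * b')"
 proof (intro mult_right_mono)
  show "4 * b' <= exp (4 * b')" using exp_ge_add_one_self[of "4 * b'"] by linarith
 qed simp
 also have "... <= 1" using b by (simp flip: exp_add)
 finally have "\<mu> * exp (- 88 * b') <= exp \<mu>" using e\<mu> by linarith
 moreover have "\<mu> * V2 n (2 * b') k l <= \<mu> * (suminf ?main + exp (- 88 * b'))"
  using V \<mu>0 by (intro mult_left_mono)
 ultimately show "\<mu> * V2 n (2 * b') k l <= 2 * exp \<mu>" using m2 by (simp add: distrib_left)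
qed

section \<open>Upper bound for the diagonal of the Gibbs matrix\<close>

definition Tn :: "nat => bool => site set" where
 "Tn N d = {r \<in> sites N. even (crd d r)}"

definition KD :: "nat => nat => real => bool => conf => conf => real" where
 "KD N n b d = (%sg ta. b * (\<Sum>r\<in>Tn N d. eop r (nbd N d r) (xm n) sg ta))"

definition Dg :: "nat => nat => real => conf => real" where
 "Dg N n b sg = b * (\<Sum>e\<in>edges N. if odd (crd (snd e) (fst e)) then mz n (sg (fst e)) * mz n (sg (nbd N (snd e) (fst e))) else 0)"

lemma finite_Tn [simp]: "finite (Tn N d)"
 by (simp add: Tn_def)

lemma eop_zm: "eop r r' (zm n) sg ta = (if sg = ta then mz n (sg r) * mz n (sg r') else 0)"
 by (auto simp: eop_def zm_def fun_eq_iff)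

lemma ham_split:
 "ham N n b sg ta = (if sg = ta then Dg N n b sg else 0) + (KD N n b False sg ta + KD N n b True sg ta)"
proof -
 let ?e = "%e. eop (fst e) (nbd N (snd e) (fst e))"
 have 1: "(\<Sum>e\<in>edges N. ?e e (ety n e) sg ta) = (\<Sum>e\<in>edges N. if odd (crd (snd e) (fst e)) then ?e e (zm n) sg ta else 0)
   + (\<Sum>e\<in>edges N. if even (crd (snd e) (fst e)) then ?e e (xm n) sg ta else 0)"
  unfolding sum.distrib[symmetric] by (intro sum.cong refl) (auto simp: ety_def)
 have 2: "(\<Sum>e\<in>edges N. if even (crd (snd e) (fst e)) then ?e e (xm n) sg ta else 0)
   = (\<Sum>r\<in>Tn N False. eop r (nbd N False r) (xm n) sg ta) + (\<Sum>r\<in>Tn N True. eop r (nbd N True r) (xm n) sg ta)"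
  unfolding sum_edges Tn_def fst_conv snd_conv by (simp add: sum.inter_filter)
 have 3: "(\<Sum>e\<in>edges N. if odd (crd (snd e) (fst e)) then ?e e (zm n) sg ta else 0) = (if sg = ta then (\<Sum>e\<in>edges N. if odd (crd (snd e) (fst e)) then mz n (sg (fst e)) * mz n (sg (nbd N (snd e) (fst e))) else 0) else 0)"
  by (auto simp: eop_zm intro!: sum.neutral sum.cong)
 show ?thesis unfolding hamr_def 1 2 3 KD_def Dg_def by (simp add: distrib_left)
qed

lemma KD_nonneg: "b >= 0 ==> sg \<in> confs N n ==> ta \<in> confs N n ==> KD N n b d sg ta >= 0"
 unfolding KD_def
 by (intro mult_nonneg_nonneg sum_nonneg)
  (auto simp: eop_def Tn_def intro!: mult_nonneg_nonneg xm_nonneg conf_le nbd_sites)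

text \<open>A hop moves both ends of one x-edge by one level, which changes \<open>mz\<close> by
  \<open>2 / n\<close> at each, and every site lies on one z-edge of either direction.\<close>

lemma Dg_jump:
 assumes N: "even N" "N >= 2" and b: "b >= 0" and st: "sg \<in> confs N n" "ta \<in> confs N n"
  and nz: "KD N n b False sg ta + KD N n b True sg ta ~= 0"
 shows "\<bar>Dg N n b sg - Dg N n b ta\<bar> <= 8 * b / n"
proof -
 have "\<exists>d. \<exists>r\<in>Tn N d. eop r (nbd N d r) (xm n) sg ta ~= 0"
 proof (rule ccontr)
  assume "~ ?thesis"
  then have "KD N n b d sg ta = 0" for d unfolding KD_def by (auto intro!: sum.neutral)
  with nz show False by simp
 qed
 then obtain d r where r: "r \<in> Tn N d" and e: "eop r (nbd N d r) (xm n) sg ta ~= 0" by blast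
 have rs: "r \<in> sites N" using r by (simp add: Tn_def)
 define r' where "r' = nbd N d r"
 have r's: "r' \<in> sites N" "r' ~= r" using rs N nbd_sites nbd_neq by (auto simp: r'_def)
 have ag: "sg s = ta s" if "s ~= r" "s ~= r'" for s
  using e that by (auto simp: eop_def r'_def split: if_splits)
 have xx: "xm n (sg r) (ta r) ~= 0" "xm n (sg r') (ta r') ~= 0"
  using e by (auto simp: eop_def r'_def split: if_splits)
 have mzd: "\<bar>mz n k - mz n l\<bar> <= 2 / n" if "xm n k l ~= 0" for k l
 proof -
  have "\<bar>real k - real l\<bar> <= 1" using that by (auto simp: xm_def split: if_splits)
  moreover have "mz n k - mz n l = 2 * (real k - real l) / n"
   by (simp add: mz_def diff_divide_distrib[symmetric])
  ultimately show ?thesis by (simp add: abs_mult divide_right_mono)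
 qed
 define w where "w = (%s. \<bar>mz n (sg s) - mz n (ta s)\<bar>)"
 have w0: "w s = 0" if "s ~: {r, r'}" for s using ag that by (simp add: w_def)
 have "(\<Sum>s\<in>sites N. w s) = (\<Sum>s\<in>{r, r'}. w s)"
  using rs r's w0 by (intro sum.mono_neutral_right) auto
 also have "... = w r + w r'" using r's by simp
 also have "... <= 2 / n + 2 / n" unfolding w_def using mzd xx by (intro add_mono) auto
 finally have W: "(\<Sum>s\<in>sites N. w s) <= 4 / n" by simp
 have m1: "\<bar>mz n (\<rho> s)\<bar> <= 1" if "\<rho> \<in> confs N n" "s \<in> sites N" for \<rho> s
 proof (cases "n = 0")
  case False
  then show ?thesis using mz_abs conf_le[OF that] by simp
 qed (simp add: mz_def)
 have "\<bar>Dg N n b sg - Dg N n b ta\<bar> = b * \<bar>\<Sum>e\<in>edges N. (if odd (crd (snd e) (fst e)) then 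
   mz n (sg (fst e)) * mz n (sg (nbd N (snd e) (fst e))) - mz n (ta (fst e)) * mz n (ta (nbd N (snd e) (fst e))) else 0)\<bar>"
 proof -
  have "Dg N n b sg - Dg N n b ta = b * (\<Sum>e\<in>edges N. (if odd (crd (snd e) (fst e)) then 
   mz n (sg (fst e)) * mz n (sg (nbd N (snd e) (fst e))) - mz n (ta (fst e)) * mz n (ta (nbd N (snd e) (fst e))) else 0))"
   unfolding Dg_def right_diff_distrib[symmetric] sum_subtractf[symmetric]
   by (intro arg_cong2[of _ _ _ _ times] refl sum.cong) auto
  then show ?thesis using b by (simp add: abs_mult)
 qed
 also have "... <= b * (\<Sum>e\<in>edges N. if even (crd (snd e) (fst e)) = False then w (fst e) + w (nbd N (snd e) (fst e)) else 0)"
 proof (intro mult_left_mono order_trans[OF sum_abs] sum_mono)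
  fix e assume "e \<in> edges N"
  then have s: "fst e \<in> sites N" by (simp add: edges_iff)
  let ?a = "mz n (sg (fst e))" and ?c = "mz n (sg (nbd N (snd e) (fst e)))" and ?a' = "mz n (ta (fst e))" and ?c' = "mz n (ta (nbd N (snd e) (fst e)))"
  have "\<bar>?a * ?c - ?a' * ?c'\<bar> = \<bar>(?a - ?a') * ?c + ?a' * (?c - ?c')\<bar>" by (simp add: algebra_simps)
  also have "... <= \<bar>?a - ?a'\<bar> * \<bar>?c\<bar> + \<bar>?a'\<bar> * \<bar>?c - ?c'\<bar>"
   by (rule order_trans[OF abs_triangle_ineq]) (simp add: abs_mult)
  also have "... <= \<bar>?a - ?a'\<bar> * 1 + 1 * \<bar>?c - ?c'\<bar>"
   using m1[OF st(1) nbd_sites[OF s]] m1[OF st(2) s] by (intro add_mono mult_left_mono mult_right_mono) auto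
  finally show "\<bar>if odd (crd (snd e) (fst e)) then ?a * ?c - ?a' * ?c' else 0\<bar>
   <= (if even (crd (snd e) (fst e)) = False then w (fst e) + w (nbd N (snd e) (fst e)) else 0)"
   by (simp add: w_def)
 qed (rule b)
 also have "... = b * (2 * (\<Sum>s\<in>sites N. w s))" using edge_sum[OF N(1), of False w] by simp
 also have "... <= b * (2 * (4 / n))" using W b by (intro mult_left_mono) auto
 also have "... = 8 * b / n" by simp
 finally show ?thesis .
qed

lemma Tn_cover:
 assumes N: "even N" and s: "s \<in> sites N" "s ~: Tn N d"
 obtains t where "t \<in> Tn N d" "s = nbd N d t"
proof -
 obtain t where t: "t \<in> sites N" "s = nbd N d t" using nbd_bij[of N d] s(1) by (metis bij_betw_imp_surj_on imageE)
 moreover have "even (crd d t)" using s t crd_nbd_parity[OF N, of d t] by (auto simp: Tn_def)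
 ultimately show ?thesis using that by (auto simp: Tn_def)
qed

text \<open>A configuration in the coordinates of a matching: one pair of levels for each x-edge of
  direction \<open>d\<close>. In these coordinates the hopping part acts on independent
  factors.\<close>

definition pr :: "nat => bool => conf => site => nat \<times> nat" where
 "pr N d sg = restrict (%r. (sg r, sg (nbd N d r))) (Tn N d)"

lemma pr_bij:
 assumes N: "even N"
 shows "bij_betw (pr N d) (confs N n) (PiE (Tn N d) (%_. {..n} \<times> {..n}))"
 unfolding bij_betw_def
proof
 show "inj_on (pr N d) (confs N n)"
 proof (rule inj_onI)
  fix sg ta assume st: "sg \<in> confs N n" "ta \<in> confs N n" and eq: "pr N d sg = pr N d ta"
  have t: "sg t = ta t & sg (nbd N d t) = ta (nbd N d t)" if "t \<in> Tn N d" for t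
   using fun_cong[OF eq, of t] that by (simp add: pr_def)
  show "sg = ta"
  proof (rule conf_eqI[OF st])
   fix s assume "s \<in> sites N"
   then show "sg s = ta s" using t Tn_cover[OF N, of s d] by (metis)
  qed
 qed
 show "pr N d ` confs N n = PiE (Tn N d) (%_. {..n} \<times> {..n})"
 proof
  show "pr N d ` confs N n <= PiE (Tn N d) (%_. {..n} \<times> {..n})"
  proof
   fix x assume "x \<in> pr N d ` confs N n"
   then obtain sg where s: "sg \<in> confs N n" "x = pr N d sg" by (metis imageE)
   show "x \<in> PiE (Tn N d) (%_. {..n} \<times> {..n})"
    unfolding s(2) pr_def PiE_iff using conf_le[OF s(1)] nbd_sites by (simp add: Tn_def)
  qed
  show "PiE (Tn N d) (%_. {..n} \<times> {..n}) <= pr N d ` confs N n"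
  proof
   fix x assume x: "x \<in> PiE (Tn N d) (%_. {..n} \<times> {..n})"
   define sg where "sg = (%s. if s \<in> Tn N d then fst (x s) else if s \<in> sites N then snd (x (inv_into (sites N) (nbd N d) s)) else undefined)"
   have inj: "inj_on (nbd N d) (sites N)" using nbd_bij by (rule bij_betw_imp_inj_on)
   have xt: "fst (x t) <= n" "snd (x t) <= n" if "t \<in> Tn N d" for t using x that by (auto simp: PiE_iff mem_Times_iff)
   have a: "sg t = fst (x t)" "sg (nbd N d t) = snd (x t)" if t: "t \<in> Tn N d" for t
   proof -
    have ts: "t \<in> sites N" "even (crd d t)" using t by (auto simp: Tn_def)
    have "nbd N d t ~: Tn N d" using ts crd_nbd_parity[OF N, of d t] by (simp add: Tn_def)
    then show "sg t = fst (x t)" "sg (nbd N d t) = snd (x t)"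
     using t ts nbd_sites[OF ts(1)] inv_into_f_f[OF inj ts(1)] by (simp_all add: sg_def)
   qed
   have "sg \<in> confs N n"
    unfolding confs_def PiE_iff
   proof (intro conjI ballI)
    fix s assume s: "s \<in> sites N"
    show "sg s \<in> {..n}"
    proof (cases "s \<in> Tn N d")
     case True then show ?thesis using a xt by simp
    next
     case False
     then obtain t where "t \<in> Tn N d" "s = nbd N d t" using Tn_cover[OF N s] by metis
     then show ?thesis using a xt by simp
    qed
   next
    show "sg \<in> extensional (sites N)" by (auto simp: extensional_def sg_def Tn_def)
   qed
   moreover have "pr N d sg = x"
   proof
    fix t show "pr N d sg t = x t"
     using x a[of t] by (cases "t \<in> Tn N d") (auto simp: pr_def PiE_iff extensional_def prod_eq_iff)
   qed
   ultimately show "x \<in> pr N d ` confs N n" by blast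
  qed
 qed
qed

text \<open>The x-edges of one direction share no site, so the exponential of their sum is the
  product of the exponentials of the single bonds.\<close>

lemma KD_factor:
 assumes N: "even N" "N >= 2" and s: "sg \<in> confs N n"
 shows "mexp (confs N n) (KD N n c d) sg sg = (\<Prod>r\<in>Tn N d. V2 n c (sg r) (sg (nbd N d r)))"
proof -
 let ?T = "Tn N d" and ?J = "{..n} \<times> {..n}"
 let ?P = "PiE ?T (%_. ?J)"
 define h where "h = (%p q. c * (xm n (fst p) (fst q) * xm n (snd p) (snd q)))"
 define A where "A = (%x y. \<Sum>t\<in>?T. h (x t) (y t) * (\<Prod>u\<in>?T - {t}. mid (x u) (y u)))"
 have fP: "fin_index ?P" by unfold_locales (intro finite_PiE, auto)
 have K: "KD N n c d sg ta = A (pr N d sg) (pr N d ta)" if st: "sg \<in> confs N n" "ta \<in> confs N n" for sg ta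
  unfolding KD_def A_def sum_distrib_left
 proof (intro sum.cong refl)
  fix t assume t: "t \<in> ?T"
  have ag: "(\<forall>s. s ~= t & s ~= nbd N d t --> sg s = ta s) \<longleftrightarrow> (\<forall>u\<in>?T - {t}. pr N d sg u = pr N d ta u)"
  proof
   assume L: "\<forall>s. s ~= t & s ~= nbd N d t --> sg s = ta s"
   show "\<forall>u\<in>?T - {t}. pr N d sg u = pr N d ta u"
   proof
    fix u assume u: "u \<in> ?T - {t}"
    have us: "u \<in> sites N" "even (crd d u)" and ts: "t \<in> sites N" "even (crd d t)" using u t by (auto simp: Tn_def)
    have "u ~= nbd N d t" "nbd N d u ~= t" using us ts crd_nbd_parity[OF N(1), of d] by metis+
    moreover have "nbd N d u ~= nbd N d t"
     using u us ts nbd_bij[of N d] by (metis Diff_iff bij_betw_imp_inj_on inj_onD insertI1)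
    ultimately show "pr N d sg u = pr N d ta u" using L u by (simp add: pr_def)
   qed
  next
   assume R: "\<forall>u\<in>?T - {t}. pr N d sg u = pr N d ta u"
   show "\<forall>s. s ~= t & s ~= nbd N d t --> sg s = ta s"
   proof (intro allI impI)
    fix s assume ne: "s ~= t & s ~= nbd N d t"
    show "sg s = ta s"
    proof (cases "s \<in> sites N")
     case True
     show ?thesis
     proof (cases "s \<in> ?T")
      case T: True
      then show ?thesis using R ne by (auto simp: pr_def)
     next
      case False
      then obtain u where u: "u \<in> ?T" "s = nbd N d u" using Tn_cover[OF N(1) True] by metis
      then have "u \<in> ?T - {t}" using ne by auto
      then show ?thesis using R u by (auto simp: pr_def)
     qed
    next
     case False
     then show ?thesis using st by (auto simp: confs_def PiE_def extensional_def)
    qed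
   qed
  qed
  have pm: "(\<Prod>u\<in>?T - {t}. mid (pr N d sg u) (pr N d ta u)) = (if \<forall>u\<in>?T - {t}. pr N d sg u = pr N d ta u then 1 else 0)"
  proof (cases "\<forall>u\<in>?T - {t}. pr N d sg u = pr N d ta u")
   case True
   then show ?thesis by (simp add: mid_def)
  next
   case False
   then obtain u where "u \<in> ?T - {t}" "pr N d sg u ~= pr N d ta u" by blast
   then have "(\<Prod>u\<in>?T - {t}. mid (pr N d sg u) (pr N d ta u)) = 0"
    by (intro prod_zero bexI[of _ u]) (auto simp: mid_def)
   then show ?thesis using False by auto
  qed
  show "c * eop t (nbd N d t) (xm n) sg ta = h (pr N d sg t) (pr N d ta t) * (\<Prod>u\<in>?T - {t}. mid (pr N d sg u) (pr N d ta u))"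
   unfolding pm eop_def ag using t by (auto simp: h_def pr_def)
 qed
 have "mexp (confs N n) (KD N n c d) sg sg = mexp (confs N n) (%sg ta. A (pr N d sg) (pr N d ta)) sg sg"
  by (rule mexp_cong[OF K s s])
 also have "... = mexp ?P A (pr N d sg) (pr N d sg)"
  by (rule fin_index.mexp_reindex[OF fP pr_bij[OF N(1)] s s])
 also have "... = (\<Prod>t\<in>?T. mexp ?J h (pr N d sg t) (pr N d sg t))"
  unfolding A_def using bij_betwE[OF pr_bij[OF N(1)]] s by (intro mexp_PiE_product) auto
 also have "... = (\<Prod>r\<in>?T. V2 n c (sg r) (sg (nbd N d r)))"
  by (intro prod.cong refl) (simp add: pr_def V2_def h_def)
 finally show ?thesis .
qed

lemma sop_comm:
 assumes "r \<in> sites N" "s \<in> sites N"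
 shows "mcomm (confs N n) (sop r X) (sop s X)"
proof (cases "r = s")
 case False
 then show ?thesis using assms by (auto simp: mcomm_def mmul_sop_diff)
qed (simp add: mcomm_refl)

lemma mcomm_cong:
 assumes "mcomm I A B" "!!i j. i \<in> I ==> j \<in> I ==> A i j = A' i j" "!!i j. i \<in> I ==> j \<in> I ==> B i j = B' i j"
 shows "mcomm I A' B'"
 using assms unfolding mcomm_def mmul_def by simp

text \<open>Both hopping parts are built from first components alone, and these commute with each
  other.\<close>

lemma KD_comm:
 assumes "N >= 2"
 shows "mcomm (confs N n) (KD N n c d) (KD N n c d')"
proof -
 have 1: "mcomm (confs N n) (eop r (nbd N d r) (xm n)) (eop s (nbd N d' s) (xm n))"
  if "r \<in> sites N" "s \<in> sites N" for r s
 proof (rule mcomm_cong)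
  let ?s = "%r. sop r (xm n)" and ?m = "mmul (confs N n)"
  have sn: "nbd N d r \<in> sites N" "nbd N d' s \<in> sites N" using that nbd_sites by auto
  show "mcomm (confs N n) (?m (?s r) (?s (nbd N d r))) (?m (?s s) (?s (nbd N d' s)))"
   by (intro mcomm_mmul mcomm_sym[OF mcomm_mmul] sop_comm that sn)
 qed (use that nbd_sites nbd_neq[OF _ assms] in \<open>auto simp: eop_eq_mmul[symmetric] not_sym\<close>)
 have 2: "mcomm (confs N n) (%sg ta. \<Sum>r\<in>Tn N d. eop r (nbd N d r) (xm n) sg ta) (%sg ta. \<Sum>r\<in>Tn N d'. eop r (nbd N d' r) (xm n) sg ta)"
  by (intro mcomm_sum mcomm_sym[OF mcomm_sum] 1) (auto simp: Tn_def)
 have "mcomm (confs N n) (msc c (%sg ta. \<Sum>r\<in>Tn N d. eop r (nbd N d r) (xm n) sg ta)) (msc c (%sg ta. \<Sum>r\<in>Tn N d'. eop r (nbd N d' r) (xm n) sg ta))"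
  by (rule mcomm_msc_right, rule mcomm_sym, rule mcomm_msc_right, rule mcomm_sym, rule 2)
 then show ?thesis by (simp add: KD_def msc_def)
qed

text \<open>The diagonal part is conjugated away; by \<open>Dg_jump\<close> this strengthens the
  hopping by \<open>exp (8 * b / n)\<close> at most. The horizontal and the vertical hopping
  commute, and Cauchy-Schwarz on a diagonal entry of their product separates them at the price of
  doubling the coupling, hence \<open>2 * b'\<close> and the root.\<close>

lemma gw_le_V2:
 assumes N: "even N" "N >= 2" and b: "b >= 0" and s: "sg \<in> confs N n"
 defines "b' \<equiv> exp (8 * b / n) * b"
 shows "gw N n b sg <= exp (Dg N n b sg) * sqrt ((\<Prod>r\<in>Tn N False. V2 n (2 * b') (sg r) (sg (nbd N False r)))
   * (\<Prod>r\<in>Tn N True. V2 n (2 * b') (sg r) (sg (nbd N True r))))"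
proof -
 interpret fin_index "confs N n" by (rule fin_index_confs)
 let ?I = "confs N n"
 let ?K = "%sg ta. KD N n b False sg ta + KD N n b True sg ta"
 have "gw N n b sg = mexp ?I (%sg ta. (if sg = ta then Dg N n b sg else 0) + ?K sg ta) sg sg"
  unfolding gw_def by (rule mexp_cong[OF ham_split s s])
 also have "... <= exp (Dg N n b sg) * mexp ?I (msc (exp (8 * b / n)) ?K) sg sg"
  using KD_nonneg[OF b] Dg_jump[OF N b] b s
  by (intro mexp_diag_plus_nonneg_le) auto
 also have "mexp ?I (msc (exp (8 * b / n)) ?K) sg sg = mexp ?I (%sg ta. KD N n b' False sg ta + KD N n b' True sg ta) sg sg"
  by (intro mexp_cong s) (simp add: msc_apply KD_def b'_def algebra_simps)
 also have "... = mmul ?I (mexp ?I (KD N n b' False)) (mexp ?I (KD N n b' True)) sg sg"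
  by (intro mexp_add KD_comm N s)
 also have "... <= sqrt (mexp ?I (KD N n (2 * b') False) sg sg * mexp ?I (KD N n (2 * b') True) sg sg)"
 proof (rule real_le_rsqrt)
  have sym: "msym ?I (KD N n b' d)" for d
   unfolding msym_def KD_def by (auto intro!: sum.cong eop_sym xm_sym)
  have dbl: "mexp ?I (KD N n (2 * b') d) sg sg = (\<Sum>\<rho>\<in>?I. (mexp ?I (KD N n b' d) sg \<rho>)\<^sup>2)" for d
  proof -
   have "mexp ?I (KD N n (2 * b') d) sg sg = mexp ?I (%sg ta. KD N n b' d sg ta + KD N n b' d sg ta) sg sg"
    by (intro mexp_cong s) (simp add: KD_def)
   also have "... = mmul ?I (mexp ?I (KD N n b' d)) (mexp ?I (KD N n b' d)) sg sg"
    by (intro mexp_add mcomm_refl s)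
   also have "... = (\<Sum>\<rho>\<in>?I. (mexp ?I (KD N n b' d) sg \<rho>)\<^sup>2)"
    unfolding mmul_def power2_eq_square using msym_mexp[OF sym, of d] s
    by (intro sum.cong refl) (auto simp: msym_def)
   finally show ?thesis .
  qed
  have "(mmul ?I (mexp ?I (KD N n b' False)) (mexp ?I (KD N n b' True)) sg sg)\<^sup>2
    = (\<Sum>\<rho>\<in>?I. mexp ?I (KD N n b' False) sg \<rho> * mexp ?I (KD N n b' True) sg \<rho>)\<^sup>2"
   unfolding mmul_def using msym_mexp[OF sym, of True] s
   by (intro arg_cong[of _ _ "%x. x\<^sup>2"] sum.cong refl) (auto simp: msym_def)
  also have "... <= mexp ?I (KD N n (2 * b') False) sg sg * mexp ?I (KD N n (2 * b') True) sg sg"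
   unfolding dbl by (rule Cauchy_Schwarz_ineq_sum)
  finally show "(mmul ?I (mexp ?I (KD N n b' False)) (mexp ?I (KD N n b' True)) sg sg)\<^sup>2 <= ..." .
 qed
 finally show ?thesis unfolding KD_factor[OF N s] by simp
qed


text \<open>The inequality of the means with its deficit, bounded below through
  \<open>(sqrt a + sqrt c)^2 <= 8\<close>. The deficit becomes the penalty for neighbours with
  different \<open>m^2\<close> on an x-edge.\<close>

lemma twice_geometric_mean_le:
 fixes a c :: real
 assumes "0 <= a" "a <= 2" "0 <= c" "c <= 2"
 shows "2 * sqrt (a * c) <= a + c - (a - c)\<^sup>2 / 8"
proof -
 define x where "x = sqrt a"
 define y where "y = sqrt c"
 have xy: "a = x\<^sup>2" "c = y\<^sup>2" "x >= 0" "y >= 0" using assms by (auto simp: x_def y_def)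
 have sq: "sqrt (a * c) = x * y" by (simp add: x_def y_def real_sqrt_mult)
 have "(x + y)\<^sup>2 <= 2 * (x\<^sup>2 + y\<^sup>2)" using zero_le_power2[of "x - y"] by (simp add: power2_eq_square algebra_simps)
 also have "... <= 8" using assms xy by simp
 finally have "(x - y)\<^sup>2 * (x + y)\<^sup>2 <= (x - y)\<^sup>2 * 8" by (intro mult_left_mono) auto
 moreover have "(x - y)\<^sup>2 * (x + y)\<^sup>2 = (a - c)\<^sup>2"
  unfolding xy by (simp add: power2_eq_square algebra_simps)
 moreover have "(x - y)\<^sup>2 = a + c - 2 * sqrt (a * c)"
  unfolding sq unfolding xy by (simp add: power2_eq_square algebra_simps)
 ultimately show ?thesis by simp
qed

definition bp :: "nat => real => real" where "bp n b = exp (8 * b / n) * b"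

text \<open>\<open>1 - m^2\<close> plus the error of \<open>xm_entry_bound\<close> at the cut-off of
  the series in \<open>V2_bound\<close>.\<close>

definition Am :: "nat => real => nat => real" where
 "Am n b k = 1 - (mz n k)\<^sup>2 + 4 * (80 * bp n b + 1) / n"

text \<open>A spin of order \<open>b^2\<close> keeps the corrections bounded per site: the
  strengthened coupling exceeds \<open>b\<close> by little, and its product with the error in
  \<open>Am\<close> stays below a constant although both grow with \<open>b\<close>.\<close>

lemma bp_bounds:
 assumes b: "b >= 1" and n: "real n >= 2000 * b\<^sup>2"
 shows "b <= bp n b" "bp n b <= b + 1/100" "4 * (80 * bp n b + 1) / n <= 1"
  "bp n b * (4 * (80 * bp n b + 1) / n) <= 7/10" "n >= 1"
proof -
 have bb: "b * b >= b" using b by simp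
 have n0: "real n > 0" using n b by (smt (verit) zero_less_power2 zero_le_power2)
 show "n >= 1" using n0 by simp
 define x where "x = 8 * b / n"
 have nb: "2000 * b * b <= real n" using n by (simp add: power2_eq_square)
 have x0: "x >= 0" using b n0 by (simp add: x_def)
 have bx: "b * x <= 1/250"
 proof -
  have "b * x = 8 * (b * b) / n" by (simp add: x_def)
  also have "... <= 1/250" using nb n0 by (simp add: divide_le_eq)
  finally show ?thesis .
 qed
 have x1: "x <= 1/250"
 proof -
  have "1 * x <= b * x" using b x0 by (intro mult_right_mono)
  then show ?thesis using bx by simp
 qed
 have "exp x <= 1 + x + x\<^sup>2" using x0 x1 by (intro exp_bound) auto
 moreover have "x\<^sup>2 <= x" using x0 x1 by (simp add: power2_eq_square mult_left_le)
 ultimately have ex: "exp x <= 1 + 2 * x" by linarith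
 show 1: "b <= bp n b" unfolding bp_def using b n0 by simp
 have "bp n b <= (1 + 2 * x) * b" unfolding bp_def x_def[symmetric] using ex b by (intro mult_right_mono) auto
 also have "... = b + 2 * (b * x)" by (simp add: algebra_simps)
 finally show 2: "bp n b <= b + 1/100" using bx by linarith
 have b101: "bp n b <= 101/100 * b" using 2 b by linarith
 have s: "4 * (80 * bp n b + 1) <= 328 * b"
 proof -
  have "320 * bp n b <= 3232 / 10 * b" using b101 by simp
  then have "320 * bp n b + 4 <= 328 * b" using b by simp
  then show ?thesis by simp
 qed
 have "4 * (80 * bp n b + 1) <= real n"
 proof -
  have "328 * b <= 2000 * (b * b)" using b bb by linarith
  then have "328 * b <= real n" using nb by (simp add: mult.assoc)
  then show ?thesis using s by linarith
 qed
 then show "4 * (80 * bp n b + 1) / n <= 1" using n0 by simp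
 have "bp n b * (4 * (80 * bp n b + 1)) <= (101/100 * b) * (328 * b)"
 proof (rule mult_mono[OF b101 s])
  show "0 <= 101 / 100 * b" using b by simp
  show "0 <= 4 * (80 * bp n b + 1)" using 1 b by (intro mult_nonneg_nonneg add_nonneg_nonneg) auto
 qed
 also have "... <= 7/10 * real n" using nb by simp
 finally show "bp n b * (4 * (80 * bp n b + 1) / n) <= 7/10" using n0 by (simp add: divide_le_eq)
qed

text \<open>The penalty on a horizontal edge. An even position is an x-edge, where the deficit of
  the geometric mean sees \<open>m^2\<close> only and is blind to the sign; an odd position is a
  z-edge and sees m itself. Penalties on vertical edges are given up, so that rows decouple.\<close>

definition ru :: "nat => real => nat => nat => nat => real" where
 "ru n b i k l = (if even i then exp (- (b / 16) * ((mz n k)\<^sup>2 - (mz n l)\<^sup>2)\<^sup>2)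
   else exp (- (b / 2) * (mz n k - mz n l)\<^sup>2))"

text \<open>x-edges contribute \<open>b * (1 - m^2)\<close> per site and z-edges
  \<open>b * m^2\<close>: the sum is \<open>b\<close> whatever m is, which is the classical
  degeneracy. Up to a constant per site only the penalties tell configurations apart. The parameter
  \<open>t\<close> lets a restricted set of configurations profit from a better hopping
  bound.\<close>

theorem gw_upper:
 assumes N: "even N" "N >= 2" and b: "b >= 1" and n: "real n >= 2000 * b\<^sup>2" and s: "sg \<in> confs N n" and t: "t > 0"
  and V: "!!d r. r \<in> Tn N d ==> V2 n (2 * bp n b) (sg r) (sg (nbd N d r))
    <= 2 * exp (2 * bp n b * sqrt (Am n b (sg r) * Am n b (sg (nbd N d r)))) * t"
 shows "gw N n b sg <= exp ((b + 2) * real (N * N)) * sqrt t ^ (N * N)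
   * (\<Prod>r\<in>sites N. ru n b (fst r) (sg r) (sg (nbd N False r)))"
proof -
 let ?b = "bp n b"
 note bb = bp_bounds[OF b n]
 define m where "m = (%r. mz n (sg r))"
 define A where "A = (%r. Am n b (sg r))"
 let ?s = "4 * (80 * ?b + 1) / n"
 have s0: "?s >= 0" using bb(1) b by simp
 have m1: "(m r)\<^sup>2 <= 1" if "r \<in> sites N" for r unfolding m_def using conf_le[OF s that] bb(5) by (rule mz_sq)
 have A: "0 <= A r" "A r <= 2" if "r \<in> sites N" for r
  using m1[OF that] s0 bb(3) zero_le_power2[of "m r"] unfolding A_def Am_def m_def by linarith+
 define Q where "Q = (\<Sum>r\<in>Tn N False. ((m r)\<^sup>2 - (m (nbd N False r))\<^sup>2)\<^sup>2)"
 define R where "R = (\<Sum>r\<in>sites N. if odd (fst r) then (m r - m (nbd N False r))\<^sup>2 else 0)"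
 have cT: "card (Tn N False) + card (Tn N True) = N * N"
 proof -
  have c: "real (card (Tn N d)) = real (N * N) / 2" for d
  proof -
   have "real (card (Tn N d)) = (\<Sum>r\<in>sites N. if even (crd d r) = True then 1/2 + 1/2 else 0)"
    unfolding Tn_def by (simp add: sum.inter_filter[symmetric])
   also have "... = (\<Sum>r\<in>sites N. 1/2)" by (rule edge_sum_dir[OF N(1), of d True "%_. 1/2"])
   finally show ?thesis by (simp add: card_sites)
  qed
  have "real (card (Tn N False) + card (Tn N True)) = real (N * N)" using c[of False] c[of True] by simp
  then show ?thesis by (simp only: of_nat_eq_iff)
 qed
 have sumA: "(\<Sum>r\<in>Tn N d. A r + A (nbd N d r)) = (\<Sum>r\<in>sites N. A r)" for d
  using edge_sum_dir[OF N(1), of d True A] unfolding Tn_def by (simp add: sum.inter_filter)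
 have V0: "V2 n (2 * ?b) (sg r) (sg (nbd N d r)) >= 0" if "r \<in> Tn N d" for d r
  unfolding V2_def
  using that conf_le[OF s] nbd_sites[of r N d] bb(1) b
  by (intro fin_index.mexp_nonneg0) (auto simp: fin_index_def Tn_def intro!: mult_nonneg_nonneg xm_nonneg)
 have P: "(\<Prod>r\<in>Tn N d. V2 n (2 * ?b) (sg r) (sg (nbd N d r))) <= (2 * t) ^ card (Tn N d) * exp (\<Sum>r\<in>Tn N d. 2 * ?b * sqrt (A r * A (nbd N d r)))" for d
 proof -
  have "(\<Prod>r\<in>Tn N d. V2 n (2 * ?b) (sg r) (sg (nbd N d r))) <= (\<Prod>r\<in>Tn N d. (2 * t) * exp (2 * ?b * sqrt (A r * A (nbd N d r))))"
   using V V0 by (intro prod_mono) (auto simp: A_def mult_ac)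
  also have "... = (2 * t) ^ card (Tn N d) * exp (\<Sum>r\<in>Tn N d. 2 * ?b * sqrt (A r * A (nbd N d r)))"
   by (simp add: prod.distrib exp_sum)
  finally show ?thesis .
 qed
 have AA: "2 * ?b * sqrt (A r * A (nbd N d r)) <= ?b * (A r + A (nbd N d r)) - ?b / 8 * ((m r)\<^sup>2 - (m (nbd N d r))\<^sup>2)\<^sup>2"
  if "r \<in> Tn N d" for r d
 proof -
  have rs: "r \<in> sites N" "nbd N d r \<in> sites N" using that nbd_sites by (auto simp: Tn_def)
  have "2 * sqrt (A r * A (nbd N d r)) <= A r + A (nbd N d r) - (A r - A (nbd N d r))\<^sup>2 / 8"
   by (intro twice_geometric_mean_le A rs)
  then have "?b * (2 * sqrt (A r * A (nbd N d r))) <= ?b * (A r + A (nbd N d r) - (A r - A (nbd N d r))\<^sup>2 / 8)"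
   using bb(1) b by (intro mult_left_mono) auto
  moreover have "(A r - A (nbd N d r))\<^sup>2 = ((m r)\<^sup>2 - (m (nbd N d r))\<^sup>2)\<^sup>2"
   by (simp add: A_def Am_def m_def power2_commute)
  ultimately show ?thesis by (simp add: right_diff_distrib mult_ac)
 qed
 have SF: "(\<Sum>r\<in>Tn N False. 2 * ?b * sqrt (A r * A (nbd N False r))) <= ?b * (\<Sum>r\<in>sites N. A r) - ?b / 8 * Q"
 proof -
  have "(\<Sum>r\<in>Tn N False. 2 * ?b * sqrt (A r * A (nbd N False r))) <= (\<Sum>r\<in>Tn N False. ?b * (A r + A (nbd N False r)) - ?b / 8 * ((m r)\<^sup>2 - (m (nbd N False r))\<^sup>2)\<^sup>2)"
   by (intro sum_mono AA)
  also have "... = ?b * (\<Sum>r\<in>Tn N False. A r + A (nbd N False r)) - ?b / 8 * Q"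
   unfolding Q_def by (simp only: sum_subtractf sum_distrib_left)
  finally show ?thesis by (simp only: sumA)
 qed
 have ST: "(\<Sum>r\<in>Tn N True. 2 * ?b * sqrt (A r * A (nbd N True r))) <= ?b * (\<Sum>r\<in>sites N. A r)"
 proof -
  have "(\<Sum>r\<in>Tn N True. 2 * ?b * sqrt (A r * A (nbd N True r))) <= (\<Sum>r\<in>Tn N True. ?b * (A r + A (nbd N True r)))"
  proof (intro sum_mono)
   fix r assume "r \<in> Tn N True"
   from AA[OF this] show "2 * ?b * sqrt (A r * A (nbd N True r)) <= ?b * (A r + A (nbd N True r))"
    using bb(1) b zero_le_power2[of "(m r)\<^sup>2 - (m (nbd N True r))\<^sup>2"]
    by (smt (verit) mult_nonneg_nonneg divide_nonneg_nonneg)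
  qed
  also have "... = ?b * (\<Sum>r\<in>Tn N True. A r + A (nbd N True r))" by (simp only: sum_distrib_left)
  finally show ?thesis by (simp only: sumA)
 qed
 have root: "sqrt ((\<Prod>r\<in>Tn N False. V2 n (2 * ?b) (sg r) (sg (nbd N False r))) * (\<Prod>r\<in>Tn N True. V2 n (2 * ?b) (sg r) (sg (nbd N True r))))
   <= sqrt (2 * t) ^ (N * N) * exp (?b * (\<Sum>r\<in>sites N. A r) - ?b / 16 * Q)"
 proof -
  let ?E = "?b * (\<Sum>r\<in>sites N. A r)"
  have "(\<Prod>r\<in>Tn N False. V2 n (2 * ?b) (sg r) (sg (nbd N False r))) * (\<Prod>r\<in>Tn N True. V2 n (2 * ?b) (sg r) (sg (nbd N True r)))
   <= ((2 * t) ^ card (Tn N False) * exp (?E - ?b / 8 * Q)) * ((2 * t) ^ card (Tn N True) * exp ?E)"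
  proof (intro mult_mono)
   show "(\<Prod>r\<in>Tn N False. V2 n (2 * ?b) (sg r) (sg (nbd N False r))) <= (2 * t) ^ card (Tn N False) * exp (?E - ?b / 8 * Q)"
    using P[of False] SF t by (smt (verit) exp_le_cancel_iff mult_left_mono zero_le_power)
   show "(\<Prod>r\<in>Tn N True. V2 n (2 * ?b) (sg r) (sg (nbd N True r))) <= (2 * t) ^ card (Tn N True) * exp ?E"
    using P[of True] ST t by (smt (verit) exp_le_cancel_iff mult_left_mono zero_le_power)
  qed (use V0 t in \<open>auto intro!: prod_nonneg\<close>)
  also have "... = (2 * t) ^ (N * N) * (exp (?E - ?b / 16 * Q))\<^sup>2"
  proof -
   have "exp (?E - ?b / 8 * Q) * exp ?E = (exp (?E - ?b / 16 * Q))\<^sup>2"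
    by (simp add: power2_eq_square flip: exp_add)
   moreover have "(2 * t) ^ card (Tn N False) * (2 * t) ^ card (Tn N True) = (2 * t) ^ (N * N)"
    by (simp only: cT[symmetric] power_add)
   moreover have "(x * u) * (y * v) = (x * y) * (u * v)" for x y u v :: real by simp
   ultimately show ?thesis by presburger
  qed
  finally have "sqrt ((\<Prod>r\<in>Tn N False. V2 n (2 * ?b) (sg r) (sg (nbd N False r))) * (\<Prod>r\<in>Tn N True. V2 n (2 * ?b) (sg r) (sg (nbd N True r))))
   <= sqrt ((2 * t) ^ (N * N) * (exp (?E - ?b / 16 * Q))\<^sup>2)" by (simp only: real_sqrt_le_iff)
  also have "... = sqrt (2 * t) ^ (N * N) * exp (?E - ?b / 16 * Q)"
   by (simp add: real_sqrt_mult real_sqrt_power power_mult_distrib)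
  finally show ?thesis .
 qed
 have D: "Dg N n b sg <= b * (\<Sum>r\<in>sites N. (m r)\<^sup>2) - b / 2 * R"
 proof -
  have "(\<Sum>e\<in>edges N. if odd (crd (snd e) (fst e)) then m (fst e) * m (nbd N (snd e) (fst e)) else 0)
   <= (\<Sum>e\<in>edges N. (if even (crd (snd e) (fst e)) = False then (m (fst e))\<^sup>2 / 2 + (m (nbd N (snd e) (fst e)))\<^sup>2 / 2 else 0)
     - (if ~ snd e & odd (fst (fst e)) then (m (fst e) - m (nbd N False (fst e)))\<^sup>2 / 2 else 0))"
  proof (intro sum_mono)
   fix e assume "e \<in> edges N"
   have "x * y = x\<^sup>2 / 2 + y\<^sup>2 / 2 - (x - y)\<^sup>2 / 2" "x * y <= x\<^sup>2 / 2 + y\<^sup>2 / 2" for x y :: real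
    using zero_le_power2[of "x - y"] by (simp_all add: power2_eq_square field_simps)
   note this[of "m (fst e)" "m (nbd N (snd e) (fst e))"]
   then show "(if odd (crd (snd e) (fst e)) then m (fst e) * m (nbd N (snd e) (fst e)) else 0)
    <= (if even (crd (snd e) (fst e)) = False then (m (fst e))\<^sup>2 / 2 + (m (nbd N (snd e) (fst e)))\<^sup>2 / 2 else 0)
     - (if ~ snd e & odd (fst (fst e)) then (m (fst e) - m (nbd N False (fst e)))\<^sup>2 / 2 else 0)"
    by (cases "snd e") (auto simp: crd_def)
  qed
  also have "... = (\<Sum>r\<in>sites N. (m r)\<^sup>2) - R / 2"
  proof -
   have "(\<Sum>e\<in>edges N. if ~ snd e & odd (fst (fst e)) then (m (fst e) - m (nbd N False (fst e)))\<^sup>2 / 2 else 0) = R / 2"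
    unfolding sum_edges R_def sum_divide_distrib by (simp, intro sum.cong) auto
   then show ?thesis
    unfolding sum_subtractf edge_sum[OF N(1), of False "%r. (m r)\<^sup>2 / 2"] by (simp add: sum_divide_distrib[symmetric])
  qed
  finally have "b * (\<Sum>e\<in>edges N. if odd (crd (snd e) (fst e)) then m (fst e) * m (nbd N (snd e) (fst e)) else 0)
   <= b * ((\<Sum>r\<in>sites N. (m r)\<^sup>2) - R / 2)" using b by (intro mult_left_mono) auto
  then show ?thesis unfolding Dg_def m_def by (simp add: right_diff_distrib)
 qed
 \<comment> \<open>The corrections of 1/100 and 7/10 fit into one unit per site; the second unit in
   \<open>b + 2\<close> pays for the factor \<open>sqrt 2\<close> per site.\<close>
 have expo: "?b * (\<Sum>r\<in>sites N. A r) + b * (\<Sum>r\<in>sites N. (m r)\<^sup>2) <= (b + 1) * real (N * N)"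
 proof -
  have "?b * (\<Sum>r\<in>sites N. A r) + b * (\<Sum>r\<in>sites N. (m r)\<^sup>2) = (\<Sum>r\<in>sites N. ?b * A r + b * (m r)\<^sup>2)"
   by (simp add: sum.distrib sum_distrib_left)
  also have "... <= (\<Sum>r\<in>sites N. b + 1)"
  proof (intro sum_mono)
   fix r assume r: "r \<in> sites N"
   have "?b * A r = ?b - ?b * (m r)\<^sup>2 + ?b * ?s" by (simp add: A_def Am_def m_def algebra_simps)
   moreover have "b * (m r)\<^sup>2 <= ?b * (m r)\<^sup>2" using bb(1) by (intro mult_right_mono) auto
   ultimately show "?b * A r + b * (m r)\<^sup>2 <= b + 1" using bb(2,4) by linarith
  qed
  also have "... = (b + 1) * real (N * N)" by (simp add: card_sites)
  finally show ?thesis .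
 qed
 have U: "(\<Prod>r\<in>sites N. ru n b (fst r) (sg r) (sg (nbd N False r))) = exp (- b / 16 * Q - b / 2 * R)"
 proof -
  have "(\<Prod>r\<in>sites N. ru n b (fst r) (sg r) (sg (nbd N False r)))
    = (\<Prod>r\<in>sites N. exp ((if even (crd False r) then - b / 16 * ((m r)\<^sup>2 - (m (nbd N False r))\<^sup>2)\<^sup>2 else 0)
      + (if odd (fst r) then - b / 2 * (m r - m (nbd N False r))\<^sup>2 else 0)))"
   by (intro prod.cong refl) (simp add: ru_def m_def crd_def)
  also have "... = exp ((\<Sum>r\<in>sites N. if even (crd False r) then - b / 16 * ((m r)\<^sup>2 - (m (nbd N False r))\<^sup>2)\<^sup>2 else 0)
    + (\<Sum>r\<in>sites N. if odd (fst r) then - b / 2 * (m r - m (nbd N False r))\<^sup>2 else 0))"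
   by (simp only: exp_sum[OF finite_sites] sum.distrib[symmetric])
  also have "(\<Sum>r\<in>sites N. if even (crd False r) then - b / 16 * ((m r)\<^sup>2 - (m (nbd N False r))\<^sup>2)\<^sup>2 else 0) = - b / 16 * Q"
   unfolding Q_def Tn_def sum_distrib_left by (rule sum.inter_filter[symmetric]) simp
  also have "(\<Sum>r\<in>sites N. if odd (fst r) then - b / 2 * (m r - m (nbd N False r))\<^sup>2 else 0) = - b / 2 * R"
   unfolding R_def sum_distrib_left by (intro sum.cong) auto
  finally show ?thesis by simp
 qed
 have Q0: "Q >= 0" unfolding Q_def by (intro sum_nonneg) auto
 have "gw N n b sg <= exp (b * (\<Sum>r\<in>sites N. (m r)\<^sup>2) - b / 2 * R) * (sqrt (2 * t) ^ (N * N) * exp (?b * (\<Sum>r\<in>sites N. A r) - ?b / 16 * Q))"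
  using gw_le_V2[OF N, of b sg n] b s root D
  by (intro order_trans[OF gw_le_V2[OF N _ s]] mult_mono) (auto simp: bp_def intro!: mult_nonneg_nonneg prod_nonneg V0[unfolded bp_def])
 also have "... = sqrt 2 ^ (N * N) * sqrt t ^ (N * N) * exp ((?b * (\<Sum>r\<in>sites N. A r) + b * (\<Sum>r\<in>sites N. (m r)\<^sup>2)) + (- ?b / 16 * Q - b / 2 * R))"
  by (simp add: real_sqrt_mult power_mult_distrib exp_add[symmetric] exp_diff[symmetric] mult_ac) (simp add: algebra_simps)?
 also have "... <= sqrt 2 ^ (N * N) * sqrt t ^ (N * N) * exp ((b + 1) * real (N * N) + (- b / 16 * Q - b / 2 * R))"
 proof (intro mult_left_mono)
  have "b / 16 * Q <= ?b / 16 * Q" using bb(1) Q0 by (intro mult_right_mono) auto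
  then show "exp ((?b * (\<Sum>r\<in>sites N. A r) + b * (\<Sum>r\<in>sites N. (m r)\<^sup>2)) + (- ?b / 16 * Q - b / 2 * R)) <= exp ((b + 1) * real (N * N) + (- b / 16 * Q - b / 2 * R))"
   using expo by simp
 qed (use t in auto)
 also have "... = sqrt 2 ^ (N * N) * exp ((b + 1) * real (N * N)) * sqrt t ^ (N * N) * exp (- b / 16 * Q - b / 2 * R)"
  by (simp only: exp_add mult_ac)
 also have "... <= exp (real (N * N)) * exp ((b + 1) * real (N * N)) * sqrt t ^ (N * N) * exp (- b / 16 * Q - b / 2 * R)"
 proof (intro mult_right_mono)
  have "sqrt 2 <= 1 + (1::real)" by (rule real_le_lsqrt) auto
  also have "... <= exp 1" by (rule exp_ge_add_one_self)
  finally have "sqrt 2 ^ (N * N) <= exp 1 ^ (N * N)" by (intro power_mono) auto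
  then show "sqrt 2 ^ (N * N) <= exp (real (N * N))" using exp_of_nat_mult[of "N * N" "1::real"] by simp
 qed (use t in auto)
 also have "exp (real (N * N)) * exp ((b + 1) * real (N * N)) = exp ((b + 2) * real (N * N))"
  by (simp add: algebra_simps flip: exp_add)
 finally show ?thesis unfolding U .
qed

section \<open>Rows and one-dimensional sums\<close>

lemma row_power:
 fixes h :: "nat => nat => nat => real"
 shows "(\<Sum>sg\<in>confs N n. \<Prod>r\<in>sites N. h (fst r) (sg r) (sg (nbd N False r)))
  = (\<Sum>x\<in>PiE {..<N} (%_. {..n}). \<Prod>i<N. h i (x i) (x (Suc i mod N))) ^ N"
proof -
 let ?X = "PiE {..<N} (%_. {..n})"
 define R where "R = (%x. \<Prod>i<N. h i (x i) (x (Suc i mod N)))"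
 define f where "f = (%y s. if s \<in> sites N then y (snd s) (fst s) else (undefined::nat))"
 have b: "bij_betw f (PiE {..<N} (%_. ?X)) (confs N n)"
 proof (rule bij_betwI[where g="%sg. restrict (%j. restrict (%i. sg (i, j)) {..<N}) {..<N}"])
  show "f \<in> PiE {..<N} (%_. ?X) \<rightarrow> confs N n"
  proof
   fix y assume y: "y \<in> PiE {..<N} (%_. ?X)"
   have "y j i <= n" if "j < N" "i < N" for i j
    using PiE_mem[OF y, of j] PiE_mem[of "y j" "{..<N}" "%_. {..n}" i] that by simp
   then show "f y \<in> confs N n"
    unfolding confs_def PiE_iff f_def by (auto simp: extensional_def sites_fst_lt)
  qed
  show "(%sg. restrict (%j. restrict (%i. sg (i, j)) {..<N}) {..<N}) \<in> confs N n \<rightarrow> PiE {..<N} (%_. ?X)"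
  proof
   fix sg assume s: "sg \<in> confs N n"
   have "sg (i, j) <= n" if "i < N" "j < N" for i j using conf_le[OF s, of "(i, j)"] that by (simp add: sites_def)
   then show "restrict (%j. restrict (%i. sg (i, j)) {..<N}) {..<N} \<in> PiE {..<N} (%_. ?X)"
    by (auto simp: PiE_iff)
  qed
  show "restrict (%j. restrict (%i. f y (i, j)) {..<N}) {..<N} = y" if y: "y \<in> PiE {..<N} (%_. ?X)" for y
  proof
   fix j show "restrict (%j. restrict (%i. f y (i, j)) {..<N}) {..<N} j = y j"
   proof (cases "j < N")
    case True
    have yj: "y j \<in> ?X" using PiE_mem[OF y, of j] True by simp
    show ?thesis
    proof
     fix i show "restrict (%j. restrict (%i. f y (i, j)) {..<N}) {..<N} j i = y j i"
      using True PiE_arb[OF yj, of i] by (cases "i < N") (auto simp: f_def sites_def)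
    qed
   next
    case False
    then show ?thesis using PiE_arb[OF y, of j] by simp
   qed
  qed
  show "f (restrict (%j. restrict (%i. sg (i, j)) {..<N}) {..<N}) = sg" if s: "sg \<in> confs N n" for sg
  proof
   fix r show "f (restrict (%j. restrict (%i. sg (i, j)) {..<N}) {..<N}) r = sg r"
    using s by (cases "r \<in> sites N") (auto simp: f_def sites_fst_lt confs_def PiE_def extensional_def)
  qed
 qed
 have "(\<Sum>x\<in>?X. R x) ^ N = (\<Prod>j<N. \<Sum>x\<in>?X. R x)" by simp
 also have "... = (\<Sum>y\<in>PiE {..<N} (%_. ?X). \<Prod>j<N. R (y j))"
  by (rule prod_sum_PiE) (auto intro!: finite_PiE)
 also have "... = (\<Sum>y\<in>PiE {..<N} (%_. ?X). \<Prod>r\<in>sites N. h (fst r) (f y r) (f y (nbd N False r)))"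
 proof (intro sum.cong refl)
  fix y assume "y \<in> PiE {..<N} (%_. ?X)"
  have "(\<Prod>r\<in>sites N. h (fst r) (f y r) (f y (nbd N False r)))
    = (\<Prod>r\<in>sites N. h (fst r) (y (snd r) (fst r)) (y (snd r) (Suc (fst r) mod N)))"
  proof (intro prod.cong refl)
   fix r assume r: "r \<in> sites N"
   then show "h (fst r) (f y r) (f y (nbd N False r)) = h (fst r) (y (snd r) (fst r)) (y (snd r) (Suc (fst r) mod N))"
    using nbd_sites[OF r, of False] by (simp add: f_def nbd_def nb1_def)
  qed
  also have "... = (\<Prod>i<N. \<Prod>j<N. h i (y j i) (y j (Suc i mod N)))"
   unfolding sites_def by (simp add: prod.cartesian_product split_beta)
  also have "... = (\<Prod>j<N. R (y j))" unfolding R_def by (rule prod.swap)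
  finally show "(\<Prod>j<N. R (y j)) = (\<Prod>r\<in>sites N. h (fst r) (f y r) (f y (nbd N False r)))" by simp
 qed
 also have "... = (\<Sum>sg\<in>confs N n. \<Prod>r\<in>sites N. h (fst r) (sg r) (sg (nbd N False r)))"
  by (rule sum.reindex_bij_betw[OF b])
 finally show ?thesis by (simp add: R_def)
qed

lemma ru_range: "b >= 0 ==> 0 <= ru n b i k l" "b >= 0 ==> ru n b i k l <= 1"
 by (auto simp: ru_def)

text \<open>The penalties couple horizontal neighbours only and the pattern depends on the
  horizontal coordinate only, so the sum over configurations is the N-th power of a sum over a
  single row.\<close>

lemma LF_le_row:
 assumes N: "even N" "N >= 2" and b: "b >= 1" and n: "real n >= 2000 * b\<^sup>2" and t: "t > 0"
  and V: "!!sg d r. sg \<in> confs N n ==> (\<forall>s\<in>sites N. lf ep n (g (fst s)) (sg s) ~= 0) ==> r \<in> Tn N d ==>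
    V2 n (2 * bp n b) (sg r) (sg (nbd N d r))
    <= 2 * exp (2 * bp n b * sqrt (Am n b (sg r) * Am n b (sg (nbd N d r)))) * t"
 shows "LF N n b ep (%s. g (fst s)) <= exp ((b + 2) * real (N * N)) * sqrt t ^ (N * N)
   * (\<Sum>x\<in>PiE {..<N} (%_. {..n}). \<Prod>i<N. lf ep n (g i) (x i) * ru n b i (x i) (x (Suc i mod N))) ^ N"
proof -
 let ?C = "exp ((b + 2) * real (N * N)) * sqrt t ^ (N * N)"
 have "LF N n b ep (%s. g (fst s)) <= (\<Sum>sg\<in>confs N n. ?C * (\<Prod>r\<in>sites N. lf ep n (g (fst r)) (sg r) * ru n b (fst r) (sg r) (sg (nbd N False r))))"
  unfolding LF_def fw_def
 proof (rule sum_mono)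
  fix sg assume s: "sg \<in> confs N n"
  have nn: "(\<Prod>r\<in>sites N. lf ep n (g (fst r)) (sg r)) >= 0" by (intro prod_nonneg) (auto simp: lf_range)
  show "gw N n b sg * (\<Prod>s\<in>sites N. lf ep n (g (fst s)) (sg s))
   <= ?C * (\<Prod>r\<in>sites N. lf ep n (g (fst r)) (sg r) * ru n b (fst r) (sg r) (sg (nbd N False r)))"
  proof (cases "\<forall>s\<in>sites N. lf ep n (g (fst s)) (sg s) ~= 0")
   case True
   have "gw N n b sg <= ?C * (\<Prod>r\<in>sites N. ru n b (fst r) (sg r) (sg (nbd N False r)))"
    by (rule gw_upper[OF N b n s t V[OF s True]])
   from mult_right_mono[OF this nn] show ?thesis by (simp add: prod.distrib mult_ac)
  next
   case False
   then have z: "(\<Prod>s\<in>sites N. lf ep n (g (fst s)) (sg s)) = 0" by (intro prod_zero) auto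
   have "?C * (\<Prod>r\<in>sites N. lf ep n (g (fst r)) (sg r) * ru n b (fst r) (sg r) (sg (nbd N False r))) >= 0"
    using t b by (intro mult_nonneg_nonneg prod_nonneg) (auto simp: lf_range ru_range)
   then show ?thesis unfolding z by (simp only: mult_zero_right)
  qed
 qed
 also have "... = ?C * (\<Sum>x\<in>PiE {..<N} (%_. {..n}). \<Prod>i<N. lf ep n (g i) (x i) * ru n b i (x i) (x (Suc i mod N))) ^ N"
  unfolding sum_distrib_left[symmetric]
  using row_power[where h="%i k l. lf ep n (g i) k * ru n b i k l" and N=N and n=n] by simp
 finally show ?thesis .
qed

theorem LF_mismatch_upper:
 assumes N: "even N" "N >= 2" and b: "b >= 1" and n: "real n >= 2000 * b\<^sup>2" and ep: "0 < ep" "ep <= 1/8"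
 shows "LF N n b ep (%s. g (fst s)) <= exp ((b + 2) * real (N * N)) * ((real n + 1) ^ N * exp (- b / 32) ^ nmis mism N g) ^ N"
proof -
 note bb = bp_bounds[OF b n]
 have "LF N n b ep (%s. g (fst s)) <= exp ((b + 2) * real (N * N)) * sqrt 1 ^ (N * N)
   * (\<Sum>x\<in>PiE {..<N} (%_. {..n}). \<Prod>i<N. lf ep n (g i) (x i) * ru n b i (x i) (x (Suc i mod N))) ^ N"
 proof (rule LF_le_row[OF N b n])
  fix sg d r assume s: "sg \<in> confs N n" and r: "r \<in> Tn N d"
  have "sg r <= n" "sg (nbd N d r) <= n" using conf_le[OF s] r nbd_sites by (auto simp: Tn_def)
  then show "V2 n (2 * bp n b) (sg r) (sg (nbd N d r)) <= 2 * exp (2 * bp n b * sqrt (Am n b (sg r) * Am n b (sg (nbd N d r)))) * 1"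
   unfolding Am_def using V2_bound(1)[of "sg r" n "sg (nbd N d r)" "bp n b" "4 * (80 * bp n b + 1) / n"] bb b by simp
 qed simp
 also have "... <= exp ((b + 2) * real (N * N)) * 1 * ((real n + 1) ^ N * exp (- b / 32) ^ nmis mism N g) ^ N"
 proof (intro mult_mono[OF _ power_mono])
  have "(\<Sum>x\<in>PiE {..<N} (%_. {..n}). \<Prod>i<N. lf ep n (g i) (x i) * ru n b i (x i) (x (Suc i mod N)))
   <= (\<Sum>x\<in>PiE {..<N} (%_. {..n}). exp (- b / 32) ^ nmis mism N g)"
  proof (rule sum_mono)
   fix x assume x: "x \<in> PiE {..<N} (%_. {..n})"
   have pos: "0 <= lf ep n (g i) (x i)" "0 <= ru n b i (x i) (x (Suc i mod N))" for i using b by (auto simp: lf_range ru_range)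
   show "(\<Prod>i<N. lf ep n (g i) (x i) * ru n b i (x i) (x (Suc i mod N))) <= exp (- b / 32) ^ nmis mism N g"
   proof (cases "\<exists>i<N. lf ep n (g i) (x i) = 0")
    case True
    then have z: "(\<Prod>i<N. lf ep n (g i) (x i) * ru n b i (x i) (x (Suc i mod N))) = 0" by (intro prod_zero) auto
    show ?thesis unfolding z by simp
   next
    case False
    have "(\<Prod>i<N. lf ep n (g i) (x i) * ru n b i (x i) (x (Suc i mod N))) <= (\<Prod>i<N. exp (- b / 32) ^ mis mism N g i)"
    proof (intro prod_mono conjI mult_nonneg_nonneg pos)
     fix i assume i: "i \<in> {..<N}"
     define u where "u = mz n (x i)"
     define v where "v = mz n (x (Suc i mod N))"
     have Sn: "Suc i mod N < N" using N by simp
     have le: "x i <= n" "x (Suc i mod N) <= n" using PiE_mem[OF x] i Sn by auto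
     have uv: "\<bar>u\<bar> <= 1" "\<bar>v\<bar> <= 1" unfolding u_def v_def using mz_abs[OF _ bb(5)] le by auto
     have "ru n b i (x i) (x (Suc i mod N)) <= exp (- b / 32) ^ mis mism N g i"
     proof (cases "mism (g (i mod N)) (g (Suc i mod N))")
      case True
      have l: "lf ep n (g i) (x i) ~= 0" "lf ep n (g (Suc i mod N)) (x (Suc i mod N)) ~= 0" using False i Sn by auto
      have "(u\<^sup>2 >= 7/8 & v\<^sup>2 <= 1/8) \<or> (u\<^sup>2 <= 1/8 & v\<^sup>2 >= 7/8)"
       using True l i ep unfolding mism_def u_def v_def by (auto simp: lf_def split: if_splits)
      \<comment> \<open>A gap of 3/4 in \<open>m^2\<close> costs \<open>(9/16) * (b/16)\<close> in
        the exponent on an x-edge. On a z-edge the gap in m itself is at least 3/8, which costs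
        \<open>(9/64) * (b/2)\<close>. Both exceed \<open>b / 32\<close>.\<close>
      then have "\<bar>u\<^sup>2 - v\<^sup>2\<bar> >= 3/4" by auto
      then have "(3/4)\<^sup>2 <= \<bar>u\<^sup>2 - v\<^sup>2\<bar>\<^sup>2" by (intro power_mono) auto
      then have q: "(u\<^sup>2 - v\<^sup>2)\<^sup>2 >= 9/16" by (simp add: power2_eq_square)
      have "(u\<^sup>2 - v\<^sup>2)\<^sup>2 = (u - v)\<^sup>2 * (u + v)\<^sup>2" by (simp add: power2_eq_square algebra_simps)
      also have "... <= (u - v)\<^sup>2 * 4"
      proof (intro mult_left_mono)
       have "\<bar>u + v\<bar> <= 2" using uv by linarith
       then have "\<bar>u + v\<bar>\<^sup>2 <= 2\<^sup>2" by (intro power_mono) auto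
       then show "(u + v)\<^sup>2 <= 4" by simp
      qed simp
      finally have q2: "(u - v)\<^sup>2 >= 9/64" using q by simp
      have "ru n b i (x i) (x (Suc i mod N)) <= exp (- b / 32)"
       using b mult_left_mono[OF q, of "b / 16"] mult_left_mono[OF q2, of "b / 2"]
       unfolding ru_def u_def[symmetric] v_def[symmetric] by (cases "even i") simp_all
      then show ?thesis using True by (simp add: mis_def)
     next
      case False
      then show ?thesis using b by (simp add: mis_def ru_range)
     qed
     moreover have "lf ep n (g i) (x i) * ru n b i (x i) (x (Suc i mod N)) <= 1 * ru n b i (x i) (x (Suc i mod N))"
      using b by (intro mult_right_mono) (auto simp: lf_range ru_range)
     ultimately show "lf ep n (g i) (x i) * ru n b i (x i) (x (Suc i mod N)) <= exp (- b / 32) ^ mis mism N g i" by simp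
    qed
    also have "... = exp (- b / 32) ^ nmis mism N g" by (simp add: nmis_def power_sum)
    finally show ?thesis .
   qed
  qed
  also have "... = (real n + 1) ^ N * exp (- b / 32) ^ nmis mism N g" by (simp add: card_PiE add.commute)
  finally show "(\<Sum>x\<in>PiE {..<N} (%_. {..n}). \<Prod>i<N. lf ep n (g i) (x i) * ru n b i (x i) (x (Suc i mod N)))
   <= (real n + 1) ^ N * exp (- b / 32) ^ nmis mism N g" .
 next
  show nn: "0 <= (\<Sum>x\<in>PiE {..<N} (%_. {..n}). \<Prod>i<N. lf ep n (g i) (x i) * ru n b i (x i) (x (Suc i mod N)))"
   by (intro sum_nonneg prod_nonneg mult_nonneg_nonneg) (use b in \<open>simp_all add: lf_range ru_range\<close>)
  show "0 <= (\<Sum>x\<in>PiE {..<N} (%_. {..n}). \<Prod>i<N. lf ep n (g i) (x i) * ru n b i (x i) (x (Suc i mod N))) ^ N"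
   by (intro zero_le_power nn)
 qed simp_all
 finally show ?thesis by simp
qed

lemma sum_PiE_insert:
 assumes "a ~: A"
 shows "(\<Sum>x\<in>PiE (insert a A) (%_. S). F x) = (\<Sum>x\<in>PiE A (%_. S). \<Sum>y\<in>S. F (x(a := y)))"
proof -
 have "(\<Sum>x\<in>PiE (insert a A) (%_. S). F x) = (\<Sum>p\<in>S \<times> PiE A (%_. S). F ((snd p)(a := fst p)))"
  unfolding PiE_insert_eq using inj_combinator[OF assms, of "%_. S"] by (subst sum.reindex) (auto simp: split_beta)
 also have "... = (\<Sum>y\<in>S. \<Sum>x\<in>PiE A (%_. S). F (x(a := y)))"
  by (simp add: sum.cartesian_product split_beta)
 also have "... = (\<Sum>x\<in>PiE A (%_. S). \<Sum>y\<in>S. F (x(a := y)))" by (rule sum.swap)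
 finally show ?thesis .
qed

text \<open>Summing out the last vertex costs \<open>c m\<close> each time; at the end the first
  vertex is free and costs \<open>card S\<close>.\<close>

lemma chain_sum:
 fixes v :: "nat => 'a => 'a => real" and c :: "nat => real"
 assumes S: "finite S" and v: "!!i k l. v i k l >= 0"
  and c: "!!i k. k \<in> S ==> (\<Sum>l\<in>S. v i k l) <= c i"
 shows "(\<Sum>x\<in>PiE {..<Suc m} (%_. S). \<Prod>i<m. v i (x i) (x (Suc i))) <= real (card S) * (\<Prod>i<m. c i)"
proof (induction m)
 case 0
 have "card (PiE {..<Suc 0} (%_. S)) = card S" by (simp add: card_PiE)
 then show ?case by simp
next
 case (Suc m)
 show ?case
 proof (cases "S = {}")
  case True
  then have "PiE {..<Suc (Suc m)} (%_. S) = {}" by (auto simp: PiE_eq_empty_iff)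
  then show ?thesis using True by simp
 next
  case False
  then obtain k0 where "k0 \<in> S" by blast
  then have c0: "c i >= 0" for i using c[of k0 i] v sum_nonneg[of S "v i k0"] by force
  have "(\<Sum>x\<in>PiE {..<Suc (Suc m)} (%_. S). \<Prod>i<Suc m. v i (x i) (x (Suc i)))
   = (\<Sum>x\<in>PiE {..<Suc m} (%_. S). \<Sum>y\<in>S. (\<Prod>i<m. v i (x i) (x (Suc i))) * v m (x m) y)"
   unfolding lessThan_Suc[of "Suc m"]
   by (subst sum_PiE_insert) (auto intro!: sum.cong prod.cong)
  also have "... = (\<Sum>x\<in>PiE {..<Suc m} (%_. S). (\<Prod>i<m. v i (x i) (x (Suc i))) * (\<Sum>y\<in>S. v m (x m) y))"
   by (simp add: sum_distrib_left)
  also have "... <= (\<Sum>x\<in>PiE {..<Suc m} (%_. S). (\<Prod>i<m. v i (x i) (x (Suc i))) * c m)"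
  proof (intro sum_mono mult_left_mono c prod_nonneg)
   show "x m \<in> S" if "x \<in> PiE {..<Suc m} (%_. S)" for x using PiE_mem[OF that, of m] by simp
  qed (use v in auto)
  also have "... = (\<Sum>x\<in>PiE {..<Suc m} (%_. S). \<Prod>i<m. v i (x i) (x (Suc i))) * c m"
   by (simp add: sum_distrib_right)
  also have "... <= (real (card S) * (\<Prod>i<m. c i)) * c m"
   using Suc c0 by (intro mult_right_mono) auto
  finally show ?thesis by (simp add: mult_ac)
 qed
qed

text \<open>From \<open>y^2 >= 2 * y - 1\<close> the Gaussian is dominated by a geometric series on
  either side of \<open>k\<close>.\<close>

lemma gauss_sum:
 fixes a :: real
 assumes a: "a > 0" and k: "k <= n"
 shows "(\<Sum>l\<le>n. exp (- (a * (real k - real l))\<^sup>2)) <= 6 * (1 + 1 / (2 * a))"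
proof -
 define q where "q = exp (- (2 * a))"
 have q: "0 < q" "q < 1" using a by (auto simp: q_def)
 have pt: "exp (- (a * x)\<^sup>2) <= 3 * q ^ d" if "\<bar>x\<bar> = real d" for x d
 proof -
  have "(a * x)\<^sup>2 = (a * real d)\<^sup>2" using that by (metis power2_abs abs_mult power_mult_distrib)
  moreover have "(a * real d)\<^sup>2 >= 2 * (a * real d) - 1"
   using zero_le_power2[of "a * real d - 1"] by (simp add: power2_eq_square algebra_simps)
  ultimately have "exp (- (a * x)\<^sup>2) <= exp (1 + real d * (- (2 * a)))" by (simp add: mult_ac)
  also have "... = exp 1 * q ^ d" unfolding q_def exp_add exp_of_nat_mult ..
  also have "... <= 3 * q ^ d" using exp_le q by (intro mult_right_mono) auto
  finally show ?thesis .
 qed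
 have geo: "(\<Sum>d<M. q ^ d) <= 1 / (1 - q)" for M
 proof -
  have "(\<Sum>d<M. q ^ d) = (1 - q ^ M) / (1 - q)" using q by (subst sum_gp_strict) auto
  also have "... <= 1 / (1 - q)" using q by (intro divide_right_mono) auto
  finally show ?thesis .
 qed
 have "(\<Sum>l\<le>n. exp (- (a * (real k - real l))\<^sup>2)) <= (\<Sum>l\<in>{..k} \<union> {Suc k..n}. exp (- (a * (real k - real l))\<^sup>2))"
  using k by (intro sum_mono2) auto
 also have "... = (\<Sum>l\<le>k. exp (- (a * (real k - real l))\<^sup>2)) + (\<Sum>l\<in>{Suc k..n}. exp (- (a * (real k - real l))\<^sup>2))"
  by (intro sum.union_disjoint) auto
 also have "(\<Sum>l\<le>k. exp (- (a * (real k - real l))\<^sup>2)) = (\<Sum>d<Suc k. exp (- (a * real d)\<^sup>2))"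
  by (rule sum.reindex_bij_witness[of _ "%d. k - d" "%l. k - l"]) (auto simp: of_nat_diff)
 also have "(\<Sum>l\<in>{Suc k..n}. exp (- (a * (real k - real l))\<^sup>2)) = (\<Sum>d<n - k. exp (- (a * (- (real d + 1)))\<^sup>2))"
  by (rule sum.reindex_bij_witness[of _ "%d. d + Suc k" "%l. l - Suc k"]) (auto simp: of_nat_diff algebra_simps)
 also have "(\<Sum>d<Suc k. exp (- (a * real d)\<^sup>2)) <= (\<Sum>d<Suc k. 3 * q ^ d)" by (intro sum_mono pt) simp
 also have "(\<Sum>d<n - k. exp (- (a * (- (real d + 1)))\<^sup>2)) <= (\<Sum>d<n - k. 3 * q ^ d)"
 proof (intro sum_mono)
  fix d
  have "exp (- (a * (- (real d + 1)))\<^sup>2) <= 3 * q ^ Suc d" by (rule pt) simp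
  also have "... <= 3 * q ^ d" using q by (simp add: mult_left_le_one_le)
  finally show "exp (- (a * (- (real d + 1)))\<^sup>2) <= 3 * q ^ d" .
 qed
 also have "(\<Sum>d<Suc k. 3 * q ^ d) + (\<Sum>d<n - k. 3 * q ^ d) <= 3 * (1 / (1 - q)) + 3 * (1 / (1 - q))"
  unfolding sum_distrib_left[symmetric] using geo[of "Suc k"] geo[of "n - k"] by simp
 also have "... = 6 * (1 / (1 - q))" by simp
 also have "1 / (1 - q) <= 1 + 1 / (2 * a)"
 proof -
  have "q * (1 + 2 * a) <= q * exp (2 * a)" using q exp_ge_add_one_self[of "2 * a"] by (intro mult_left_mono) auto
  also have "... = 1" by (simp add: q_def flip: exp_add)
  finally have "q * (1 + 2 * a) <= 1" .
  then have "2 * a <= (1 + 2 * a) * (1 - q)" by (simp add: algebra_simps)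
  then have "1 / (1 - q) <= (1 + 2 * a) / (2 * a)" using a q by (simp add: field_simps)
  also have "... = 1 + 1 / (2 * a)" using a by (simp add: field_simps)
  finally show ?thesis .
 qed
 finally show ?thesis by simp
qed

lemma mz_flip: "l <= n ==> mz n (n - l) = - mz n l"
 by (cases "n = 0") (auto simp: mz_def of_nat_diff field_simps)

lemma mz_diff: "mz n k - mz n l = 2 * (real k - real l) / n"
 by (simp add: mz_def diff_divide_distrib[symmetric])

text \<open>On a z-edge the penalty is already a Gaussian in the difference. On an x-edge both signs
  of m are allowed; away from the equator one factor of \<open>u^2 - v^2 = (u - v) * (u + v)\<close>
  is at least \<open>2 * sqrt ep\<close> in size, and the other one gives a Gaussian centred at
  \<open>k\<close> or at the opposite level \<open>n - k\<close>. Hence two sums of width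
  \<open>n / sqrt (ep * b)\<close>.\<close>

lemma ru_bad_sum:
 assumes b: "b >= 1" and n: "real n >= 2000 * b\<^sup>2" and ep: "0 < ep" "ep <= 1/8" and k: "k <= n" "(mz n k)\<^sup>2 >= ep"
 shows "(\<Sum>l | l <= n & ep < (mz n l)\<^sup>2 & (mz n l)\<^sup>2 < 1 - ep. ru n b i k l) <= 18 * real n / sqrt (ep * b)"
proof -
 have n1: "n >= 1" by (rule bp_bounds(5)[OF b n])
 have b1: "1 <= b\<^sup>2" using b by simp
 have bn: "b <= real n" using n b self_le_power[of b 2] by simp
 have sb: "sqrt (ep * b) <= real n"
 proof -
  have "sqrt (ep * b) <= sqrt (b * b)" using ep b by (intro real_sqrt_le_mono mult_right_mono) auto
  then show ?thesis using b bn by simp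
 qed
 have se: "sqrt (ep * b) > 0" using ep b by simp
 let ?a = "sqrt (ep * b) / n"
 have a: "?a > 0" using se n1 by simp
 have G: "(\<Sum>l\<le>n. exp (- (?a * (real k' - real l))\<^sup>2)) <= 9 * real n / sqrt (ep * b)" if "k' <= n" for k'
 proof -
  have "6 * (1 + 1 / (2 * ?a)) = 6 + 3 * real n / sqrt (ep * b)" using se n1 by (simp add: field_simps)
  also have "6 <= 6 * real n / sqrt (ep * b)" using sb se by (simp add: field_simps)
  finally show ?thesis using gauss_sum[OF a that] by (simp add: field_simps)
 qed
 have ga: "exp (- (b * ep / 4) * (mz n k - mz n l)\<^sup>2) = exp (- (?a * (real k - real l))\<^sup>2)" for l
 proof -
  have "(b * ep / 4) * (mz n k - mz n l)\<^sup>2 = (?a * (real k - real l))\<^sup>2"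
   unfolding mz_diff power_divide power_mult_distrib using ep b by simp
  then show ?thesis by simp
 qed
 show ?thesis
 proof (cases "even i")
  case False
  have "(\<Sum>l | l <= n & ep < (mz n l)\<^sup>2 & (mz n l)\<^sup>2 < 1 - ep. ru n b i k l) <= (\<Sum>l\<le>n. ru n b i k l)"
   using b by (intro sum_mono2) (auto simp: ru_range)
  also have "... <= (\<Sum>l\<le>n. exp (- (?a * (real k - real l))\<^sup>2))"
  proof (intro sum_mono)
   fix l
   have "b * ep / 4 <= b / 2" using b ep by (simp add: field_simps)
   then have "(b * ep / 4) * (mz n k - mz n l)\<^sup>2 <= (b / 2) * (mz n k - mz n l)\<^sup>2" by (intro mult_right_mono) auto
   then show "ru n b i k l <= exp (- (?a * (real k - real l))\<^sup>2)" unfolding ga[symmetric] ru_def using False by simp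
  qed
  also have "... <= 9 * real n / sqrt (ep * b)" by (rule G[OF k(1)])
  also have "... <= 18 * real n / sqrt (ep * b)" using se by (intro divide_right_mono) auto
  finally show ?thesis .
 next
  case True
  have "(\<Sum>l | l <= n & ep < (mz n l)\<^sup>2 & (mz n l)\<^sup>2 < 1 - ep. ru n b i k l)
   <= (\<Sum>l | l <= n & ep < (mz n l)\<^sup>2 & (mz n l)\<^sup>2 < 1 - ep. exp (- (?a * (real k - real l))\<^sup>2) + exp (- (?a * (real k - real (n - l)))\<^sup>2))"
  proof (intro sum_mono)
   fix l assume "l \<in> {l. l <= n & ep < (mz n l)\<^sup>2 & (mz n l)\<^sup>2 < 1 - ep}"
   then have l: "l <= n" "(mz n l)\<^sup>2 >= ep" by auto
   define u where "u = mz n k"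
   define v where "v = mz n l"
   have uv: "u\<^sup>2 >= ep" "v\<^sup>2 >= ep" using k l by (auto simp: u_def v_def)
   have prodq: "(u\<^sup>2 - v\<^sup>2)\<^sup>2 = (u - v)\<^sup>2 * (u + v)\<^sup>2" by (simp add: power2_eq_square algebra_simps)
   have uvm: "\<bar>u * v\<bar> >= ep"
   proof -
    have "ep * ep <= u\<^sup>2 * v\<^sup>2" using uv ep by (intro mult_mono) auto
    then have "ep\<^sup>2 <= \<bar>u * v\<bar>\<^sup>2" by (simp add: power2_eq_square mult_ac)
    then show ?thesis by (rule power2_le_imp_le) simp
   qed
   have "ru n b i k l <= exp (- (b * ep / 4) * (u - v)\<^sup>2) \<or> ru n b i k l <= exp (- (b * ep / 4) * (u + v)\<^sup>2)"
   proof (cases "u * v >= 0")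
    case True
    then have "(u + v)\<^sup>2 >= 4 * ep" using uv uvm by (simp add: power2_eq_square algebra_simps)
    then have "(u - v)\<^sup>2 * (4 * ep) <= (u\<^sup>2 - v\<^sup>2)\<^sup>2" unfolding prodq by (intro mult_left_mono) auto
    then have "(b / 16) * ((u - v)\<^sup>2 * (4 * ep)) <= (b / 16) * (u\<^sup>2 - v\<^sup>2)\<^sup>2" using b by (intro mult_left_mono) auto
    then have "ru n b i k l <= exp (- (b * ep / 4) * (u - v)\<^sup>2)"
     unfolding ru_def u_def[symmetric] v_def[symmetric] using \<open>even i\<close> by (simp add: mult_ac)
    then show ?thesis ..
   next
    case False
    then have "(u - v)\<^sup>2 >= 4 * ep" using uv uvm by (simp add: power2_eq_square algebra_simps)
    then have "(4 * ep) * (u + v)\<^sup>2 <= (u\<^sup>2 - v\<^sup>2)\<^sup>2" unfolding prodq by (intro mult_right_mono) auto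
    then have "(b / 16) * ((4 * ep) * (u + v)\<^sup>2) <= (b / 16) * (u\<^sup>2 - v\<^sup>2)\<^sup>2" using b by (intro mult_left_mono) auto
    then have "ru n b i k l <= exp (- (b * ep / 4) * (u + v)\<^sup>2)"
     unfolding ru_def u_def[symmetric] v_def[symmetric] using \<open>even i\<close> by (simp add: mult_ac)
    then show ?thesis ..
   qed
   moreover have "exp (- (b * ep / 4) * (u + v)\<^sup>2) = exp (- (?a * (real k - real (n - l)))\<^sup>2)"
    unfolding ga[symmetric] u_def v_def mz_flip[OF l(1)] by simp
   moreover have "exp (- (b * ep / 4) * (u - v)\<^sup>2) = exp (- (?a * (real k - real l))\<^sup>2)"
    unfolding ga[symmetric] u_def v_def by simp
   ultimately show "ru n b i k l <= exp (- (?a * (real k - real l))\<^sup>2) + exp (- (?a * (real k - real (n - l)))\<^sup>2)"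
    by (smt (verit) exp_ge_zero)
  qed
  also have "... <= (\<Sum>l\<le>n. exp (- (?a * (real k - real l))\<^sup>2) + exp (- (?a * (real k - real (n - l)))\<^sup>2))"
   by (intro sum_mono2) (auto intro: add_nonneg_nonneg)
  also have "... = (\<Sum>l\<le>n. exp (- (?a * (real k - real l))\<^sup>2)) + (\<Sum>l\<le>n. exp (- (?a * (real k - real (n - l)))\<^sup>2))"
   by (rule sum.distrib)
  also have "(\<Sum>l\<le>n. exp (- (?a * (real k - real (n - l)))\<^sup>2)) = (\<Sum>l\<le>n. exp (- (?a * (real k - real l))\<^sup>2))"
   by (rule sum.reindex_bij_witness[of _ "%l. n - l" "%l. n - l"]) auto
  also have "(\<Sum>l\<le>n. exp (- (?a * (real k - real l))\<^sup>2)) + (\<Sum>l\<le>n. exp (- (?a * (real k - real l))\<^sup>2)) <= 9 * real n / sqrt (ep * b) + 9 * real n / sqrt (ep * b)"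
   by (intro add_mono G k)
  also have "... = 18 * real n / sqrt (ep * b)" by simp
  finally show ?thesis .
 qed
qed

text \<open>Being bad is used twice. \<open>m^2 < 1 - ep\<close> keeps the transverse part long, so
  the hopping factor gains \<open>1 / sqrt (ep * b)\<close> per site; \<open>m^2 > ep\<close> makes
  the Gaussian sum along the row give \<open>n / sqrt (ep * b)\<close>. Their product has the same
  dependence on \<open>n / b\<close> as the lower bound of the partition function, so only constants
  are left to be compared with its entropy factor.\<close>

theorem LF_bad_upper:
 assumes N: "even N" "N >= 2" and b: "b >= 1" and n: "real n >= 2000 * b\<^sup>2" and ep: "0 < ep" "ep <= 1/8"
 shows "LF N n b ep (%_. LB) <= exp ((b + 2) * real (N * N)) * (18 * real n / (ep * b)) ^ (N * N) * sqrt b ^ N"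
proof -
 note bb = bp_bounds[OF b n]
 \<comment> \<open>Both ends satisfy \<open>1 - m^2 > ep\<close>, so
   \<open>\<mu> >= 2 * b * ep\<close>, and \<open>\<mu> * V2 <= 2 * exp \<mu>\<close> saves this
   factor on every x-edge.\<close>
 let ?t = "1 / (2 * (b * ep))"
 have t: "?t > 0" using b ep by simp
 define S where "S = {l. l <= n & ep < (mz n l)\<^sup>2 & (mz n l)\<^sup>2 < 1 - ep}"
 have fS: "finite S" by (simp add: S_def)
 have "LF N n b ep (%s. (%_. LB) (fst s)) <= exp ((b + 2) * real (N * N)) * sqrt ?t ^ (N * N)
   * (\<Sum>x\<in>PiE {..<N} (%_. {..n}). \<Prod>i<N. lf ep n ((%_. LB) i) (x i) * ru n b i (x i) (x (Suc i mod N))) ^ N"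
 proof (rule LF_le_row[OF N b n t])
  fix sg d r assume s: "sg \<in> confs N n" and r: "r \<in> Tn N d" and nz: "\<forall>s\<in>sites N. lf ep n LB (sg s) ~= 0"
  have rs: "r \<in> sites N" "nbd N d r \<in> sites N" using r nbd_sites by (auto simp: Tn_def)
  have le: "sg r <= n" "sg (nbd N d r) <= n" using conf_le[OF s] rs by auto
  have "(mz n (sg r))\<^sup>2 < 1 - ep" "(mz n (sg (nbd N d r)))\<^sup>2 < 1 - ep"
   using nz rs by (auto simp: lf_def)
  moreover have s0: "4 * (80 * bp n b + 1) / n >= 0" using bb(1) b by simp
  ultimately have A: "ep <= Am n b (sg r)" "ep <= Am n b (sg (nbd N d r))" unfolding Am_def by auto
  define \<mu> where "\<mu> = 2 * bp n b * sqrt (Am n b (sg r) * Am n b (sg (nbd N d r)))"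
  have "sqrt (ep * ep) <= sqrt (Am n b (sg r) * Am n b (sg (nbd N d r)))"
   using A ep by (intro real_sqrt_le_mono mult_mono) auto
  then have "2 * b * ep <= \<mu>" unfolding \<mu>_def using bb(1) b ep by (intro mult_mono) auto
  then have le1: "(2 * b * ep) * V2 n (2 * bp n b) (sg r) (sg (nbd N d r)) <= \<mu> * V2 n (2 * bp n b) (sg r) (sg (nbd N d r))"
   unfolding V2_def using le bb(1) b
   by (intro mult_right_mono fin_index.mexp_nonneg0) (auto simp: fin_index_def intro!: mult_nonneg_nonneg xm_nonneg)
  also have "... <= 2 * exp \<mu>" unfolding \<mu>_def Am_def
   using V2_bound(2)[of "sg r" n "sg (nbd N d r)" "bp n b" "4 * (80 * bp n b + 1) / n"] bb b le by simp
  finally show "V2 n (2 * bp n b) (sg r) (sg (nbd N d r))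
    <= 2 * exp (2 * bp n b * sqrt (Am n b (sg r) * Am n b (sg (nbd N d r)))) * ?t"
   unfolding \<mu>_def[symmetric] using b ep by (simp add: field_simps)
 qed
 also have "(\<Sum>x\<in>PiE {..<N} (%_. {..n}). \<Prod>i<N. lf ep n ((%_. LB) i) (x i) * ru n b i (x i) (x (Suc i mod N)))
   <= (18 * real n / sqrt (ep * b)) ^ N * sqrt b"
 proof -
  obtain m where m: "N = Suc m" using N by (cases N) auto
  have "(\<Sum>x\<in>PiE {..<N} (%_. {..n}). \<Prod>i<N. lf ep n LB (x i) * ru n b i (x i) (x (Suc i mod N)))
    = (\<Sum>x\<in>PiE {..<N} (%_. S). \<Prod>i<N. lf ep n LB (x i) * ru n b i (x i) (x (Suc i mod N)))"
  proof (rule sum.mono_neutral_right)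
   show "finite (PiE {..<N} (%_. {..n}))" by (intro finite_PiE) auto
   show "PiE {..<N} (%_. S) <= PiE {..<N} (%_. {..n})" by (intro PiE_mono) (auto simp: S_def)
   show "\<forall>x\<in>PiE {..<N} (%_. {..n}) - PiE {..<N} (%_. S). (\<Prod>i<N. lf ep n LB (x i) * ru n b i (x i) (x (Suc i mod N))) = 0"
   proof
    fix x assume x: "x \<in> PiE {..<N} (%_. {..n}) - PiE {..<N} (%_. S)"
    then obtain i where i: "i < N" "x i ~: S" by (auto simp: PiE_iff)
    have "x i <= n" using x i PiE_mem[of x "{..<N}" "%_. {..n}" i] by simp
    then have "lf ep n LB (x i) = 0" using i by (auto simp: S_def lf_def)
    then show "(\<Prod>i<N. lf ep n LB (x i) * ru n b i (x i) (x (Suc i mod N))) = 0"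
     using i(1) by (intro prod_zero) auto
   qed
  qed
  also have "... <= (\<Sum>x\<in>PiE {..<Suc m} (%_. S). \<Prod>i<m. ru n b i (x i) (x (Suc i)))"
   unfolding m
  proof (intro sum_mono)
   fix x
   have "(\<Prod>i<Suc m. lf ep n LB (x i) * ru n b i (x i) (x (Suc i mod Suc m))) <= (\<Prod>i<Suc m. if i < m then ru n b i (x i) (x (Suc i)) else 1)"
   proof (intro prod_mono conjI)
    fix i assume i: "i \<in> {..<Suc m}"
    show "0 <= lf ep n LB (x i) * ru n b i (x i) (x (Suc i mod Suc m))" using b by (simp add: lf_range ru_range)
    have "lf ep n LB (x i) * ru n b i (x i) (x (Suc i mod Suc m)) <= 1 * ru n b i (x i) (x (Suc i mod Suc m))"
     using b by (intro mult_right_mono) (auto simp: lf_range ru_range)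
    also have "... <= (if i < m then ru n b i (x i) (x (Suc i)) else 1)" using b by (auto simp: ru_range)
    finally show "lf ep n LB (x i) * ru n b i (x i) (x (Suc i mod Suc m)) <= (if i < m then ru n b i (x i) (x (Suc i)) else 1)" .
   qed
   then show "(\<Prod>i<Suc m. lf ep n LB (x i) * ru n b i (x i) (x (Suc i mod Suc m))) <= (\<Prod>i<m. ru n b i (x i) (x (Suc i)))"
    by simp
  qed
  also have "... <= card S * (\<Prod>i<m. 18 * real n / sqrt (ep * b))"
  proof (rule chain_sum[OF fS])
   show "0 <= ru n b i k l" for i k l using b by (simp add: ru_range)
   show "(\<Sum>l\<in>S. ru n b i k l) <= 18 * real n / sqrt (ep * b)" if "k \<in> S" for i k
    unfolding S_def using that by (intro ru_bad_sum[OF b n ep]) (auto simp: S_def)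
  qed
  also have "... = card S * (18 * real n / sqrt (ep * b)) ^ m" by simp
  \<comment> \<open>The free first vertex has at most \<open>18 * n\<close> values. Written as one
    more row factor times \<open>sqrt b\<close>, it completes the power \<open>N\<close> and leaves
    a single \<open>sqrt b\<close> per row.\<close>
  also have "... <= ((18 * real n / sqrt (ep * b)) * sqrt b) * (18 * real n / sqrt (ep * b)) ^ m"
  proof (intro mult_right_mono)
   have "card S <= card {..n}" by (intro card_mono) (auto simp: S_def)
   then have "real (card S) <= real n + 1" by simp
   also have "... <= 18 * n" using bb(5) by simp
   also have "... <= 18 * real n / sqrt (ep * b) * sqrt b"
   proof -
    have "sqrt (ep * b) <= sqrt b" using ep b by simp
    moreover have "sqrt (ep * b) > 0" using ep b by simp
    ultimately have "18 * real n * sqrt (ep * b) <= 18 * real n * sqrt b" by (intro mult_left_mono) auto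
    then show ?thesis using \<open>sqrt (ep * b) > 0\<close> by (simp only: times_divide_eq_left pos_le_divide_eq)
   qed
   finally show "real (card S) <= 18 * real n / sqrt (ep * b) * sqrt b" .
  qed (use b ep in auto)
  also have "... = (18 * real n / sqrt (ep * b)) ^ N * sqrt b" by (simp add: m)
  finally show ?thesis by simp
 qed
 then have "exp ((b + 2) * real (N * N)) * sqrt ?t ^ (N * N)
   * (\<Sum>x\<in>PiE {..<N} (%_. {..n}). \<Prod>i<N. lf ep n ((%_. LB) i) (x i) * ru n b i (x i) (x (Suc i mod N))) ^ N
   <= exp ((b + 2) * real (N * N)) * sqrt ?t ^ (N * N) * ((18 * real n / sqrt (ep * b)) ^ N * sqrt b) ^ N"
  using b t by (intro mult_left_mono power_mono sum_nonneg prod_nonneg mult_nonneg_nonneg) (auto simp: lf_range ru_range)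
 also have "... = exp ((b + 2) * real (N * N)) * (sqrt ?t * (18 * real n / sqrt (ep * b))) ^ (N * N) * sqrt b ^ N"
 proof -
  have "((18 * real n / sqrt (ep * b)) ^ N * sqrt b) ^ N = (18 * real n / sqrt (ep * b)) ^ (N * N) * sqrt b ^ N"
   by (simp only: power_mult_distrib power_mult)
  moreover have "(sqrt ?t * (18 * real n / sqrt (ep * b))) ^ (N * N) = sqrt ?t ^ (N * N) * (18 * real n / sqrt (ep * b)) ^ (N * N)"
   by (rule power_mult_distrib)
  ultimately show ?thesis by (simp only: mult_ac)
 qed
 also have "... <= exp ((b + 2) * real (N * N)) * (18 * real n / (ep * b)) ^ (N * N) * sqrt b ^ N"
 proof (intro mult_right_mono mult_left_mono power_mono)
  have "sqrt ?t <= 1 / sqrt (ep * b)"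
  proof -
   have "?t <= 1 / (ep * b)" using b ep by (simp add: field_simps)
   then have "sqrt ?t <= sqrt (1 / (ep * b))" by (simp only: real_sqrt_le_iff)
   then show ?thesis by (simp only: real_sqrt_divide real_sqrt_one)
  qed
  then have "sqrt ?t * (18 * real n / sqrt (ep * b)) <= (1 / sqrt (ep * b)) * (18 * real n / sqrt (ep * b))"
   using b ep by (intro mult_right_mono) auto
  also have "... = 18 * real n / (sqrt (ep * b) * sqrt (ep * b))" by simp
  also have "sqrt (ep * b) * sqrt (ep * b) = ep * b" using b ep by simp
  finally show "sqrt ?t * (18 * real n / sqrt (ep * b)) <= 18 * real n / (ep * b)" .
 qed (use b ep t in auto)
 finally show ?thesis by simp
qed

section \<open>Trial states and the lower bound for the partition function\<close>

lemma mmul_sop_product: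
 assumes r: "r \<in> sites N" and s: "sg \<in> confs N n"
 shows "mmul (confs N n) (sop r X) (%sg _. \<Prod>s\<in>sites N. u s (sg s)) sg ta
  = (\<Prod>s\<in>sites N. (u(r := mv {..n} X (u r))) s (sg s))"
proof -
 have "(\<Prod>s\<in>sites N. u s ((sg(r := k)) s)) = u r k * (\<Prod>s\<in>sites N - {r}. u s (sg s))" for k
  using r by (subst prod.remove[of _ r]) auto
 then have "mmul (confs N n) (sop r X) (%sg _. \<Prod>s\<in>sites N. u s (sg s)) sg ta
   = mv {..n} X (u r) (sg r) * (\<Prod>s\<in>sites N - {r}. u s (sg s))"
  unfolding mmul_sop[OF r s] mv_def by (simp add: sum_distrib_right mult.assoc)
 also have "... = (\<Prod>s\<in>sites N. (u(r := mv {..n} X (u r))) s (sg s))"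
  using r by (subst prod.remove[of _ r]) auto
 finally show ?thesis .
qed

lemma product_inner: "(\<Sum>sg\<in>confs N n. (\<Prod>s\<in>sites N. u s (sg s)) * (\<Prod>s\<in>sites N. v s (sg s))) = (\<Prod>s\<in>sites N. \<Sum>k\<le>n. u s k * v s k :: real)"
 unfolding confs_def prod.distrib[symmetric] by (rule prod_sum_PiE[symmetric]) auto

lemma qf_eop_product:
 assumes r: "r \<in> sites N" "r' \<in> sites N" "r ~= r'" and unit: "!!s. s \<in> sites N ==> (\<Sum>k\<le>n. (u s k)\<^sup>2) = 1"
 shows "qf (confs N n) (eop r r' X) (%sg. \<Prod>s\<in>sites N. u s (sg s)) = qf {..n} X (u r) * qf {..n} X (u r')"
proof -
 let ?I = "confs N n"
 let ?u1 = "u(r' := mv {..n} X (u r'))"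
 let ?u2 = "?u1(r := mv {..n} X (u r))"
 have u2: "mmul ?I (eop r r' X) (%sg _. \<Prod>s\<in>sites N. u s (sg s)) sg ta = (\<Prod>s\<in>sites N. ?u2 s (sg s))" if s: "sg \<in> ?I" for sg ta
 proof -
  have "mmul ?I (eop r r' X) (%sg _. \<Prod>s\<in>sites N. u s (sg s)) sg ta
    = mmul ?I (mmul ?I (sop r X) (sop r' X)) (%sg _. \<Prod>s\<in>sites N. u s (sg s)) sg ta"
   by (rule mmul_cong) (use eop_eq_mmul[OF r s] in auto)
  also have "... = mmul ?I (sop r X) (%sg _. \<Prod>s\<in>sites N. ?u1 s (sg s)) sg ta"
   unfolding mmul_assoc by (rule mmul_cong) (use mmul_sop_product[OF r(2)] in auto)
  also have "... = (\<Prod>s\<in>sites N. ?u2 s (sg s))"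
   using mmul_sop_product[OF r(1) s, of X ?u1] r(3) by simp
  finally show ?thesis .
 qed
 have "qf ?I (eop r r' X) (%sg. \<Prod>s\<in>sites N. u s (sg s))
   = (\<Sum>sg\<in>?I. (\<Prod>s\<in>sites N. u s (sg s)) * mmul ?I (eop r r' X) (%sg _. \<Prod>s\<in>sites N. u s (sg s)) sg undefined)"
  unfolding qf_def mmul_def by (simp add: sum_distrib_left mult.assoc)
 also have "... = (\<Sum>sg\<in>?I. (\<Prod>s\<in>sites N. u s (sg s)) * (\<Prod>s\<in>sites N. ?u2 s (sg s)))"
  by (intro sum.cong refl) (simp only: u2)
 also have "... = (\<Prod>s\<in>sites N. \<Sum>k\<le>n. u s k * ?u2 s k)" by (rule product_inner)
 also have "... = (\<Sum>k\<le>n. u r k * ?u2 r k) * ((\<Sum>k\<le>n. u r' k * ?u2 r' k) * (\<Prod>s\<in>sites N - {r} - {r'}. \<Sum>k\<le>n. u s k * ?u2 s k))"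
  using r by (simp add: prod.remove[of _ r] prod.remove[of _ r'])
 also have "(\<Prod>s\<in>sites N - {r} - {r'}. \<Sum>k\<le>n. u s k * ?u2 s k) = 1"
  using unit by (intro prod.neutral) (auto simp: power2_eq_square)
 finally show ?thesis using r(3) by (simp add: qf_def mv_def sum_distrib_left mult.assoc)
qed

text \<open>\<open>inj\<close> and \<open>disj\<close> make the supports of the trial states
  disjoint sets of configurations, so their Jensen bounds add up inside one trace. In a product
  state the energy of an edge is a product of two one-site means.\<close>

theorem Zr_ge_product_states:
 fixes w :: "'k => nat => real"
 assumes A: "finite A" and N: "N >= 2" and b: "b >= 0"
  and inj: "!!a a'. a \<in> A ==> a' \<in> A ==> a ~= a' ==> \<exists>r\<in>sites N. \<kappa> a r ~= \<kappa> a' r"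
  and disj: "!!i j k. w i k ~= 0 ==> w j k ~= 0 ==> i = j"
  and unit: "!!a r. a \<in> A ==> r \<in> sites N ==> (\<Sum>k\<le>n. (w (\<kappa> a r) k)\<^sup>2) = 1"
 shows "(\<Sum>a\<in>A. exp (b * (\<Sum>e\<in>edges N. qf {..n} (ety n e) (w (\<kappa> a (fst e))) *
    qf {..n} (ety n e) (w (\<kappa> a (nbd N (snd e) (fst e))))))) <= Zr N n b"
proof -
 let ?I = "confs N n"
 interpret fin_index ?I by (rule fin_index_confs)
 define U where "U = (%a. {sg \<in> ?I. \<forall>r\<in>sites N. w (\<kappa> a r) (sg r) ~= 0})"
 have "exp (b * (\<Sum>e\<in>edges N. qf {..n} (ety n e) (w (\<kappa> a (fst e))) * qf {..n} (ety n e) (w (\<kappa> a (nbd N (snd e) (fst e))))))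
   <= (\<Sum>sg\<in>U a. gw N n b sg)" if a: "a \<in> A" for a
 proof -
  define \<psi> where "\<psi> = (%sg. \<Prod>s\<in>sites N. w (\<kappa> a s) (sg s))"
  have s1: "(\<Sum>sg\<in>?I. (\<psi> sg)\<^sup>2) = 1"
   using product_inner[where u="%s. w (\<kappa> a s)" and v="%s. w (\<kappa> a s)" and N=N and n=n] unit[OF a] unfolding \<psi>_def by (simp add: power2_eq_square)
  have "qf ?I (ham N n b) \<psi> = b * (\<Sum>e\<in>edges N. qf ?I (eop (fst e) (nbd N (snd e) (fst e)) (ety n e)) \<psi>)"
  proof -
   have "qf ?I (ham N n b) \<psi> = (\<Sum>sg\<in>?I. \<Sum>ta\<in>?I. \<Sum>e\<in>edges N. b * (\<psi> sg * eop (fst e) (nbd N (snd e) (fst e)) (ety n e) sg ta * \<psi> ta))"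
    unfolding qf_def hamr_def by (simp add: sum_distrib_left sum_distrib_right mult_ac)
   also have "... = (\<Sum>sg\<in>?I. \<Sum>e\<in>edges N. \<Sum>ta\<in>?I. b * (\<psi> sg * eop (fst e) (nbd N (snd e) (fst e)) (ety n e) sg ta * \<psi> ta))"
    by (intro sum.cong refl sum.swap)
   also have "... = (\<Sum>e\<in>edges N. \<Sum>sg\<in>?I. \<Sum>ta\<in>?I. b * (\<psi> sg * eop (fst e) (nbd N (snd e) (fst e)) (ety n e) sg ta * \<psi> ta))"
    by (rule sum.swap)
   finally show ?thesis unfolding qf_def by (simp add: sum_distrib_left)
  qed
  also have "... = b * (\<Sum>e\<in>edges N. qf {..n} (ety n e) (w (\<kappa> a (fst e))) * qf {..n} (ety n e) (w (\<kappa> a (nbd N (snd e) (fst e)))))"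
  proof (intro arg_cong[of _ _ "%x. b * x"] sum.cong refl)
   fix e assume "e \<in> edges N"
   then have r: "fst e \<in> sites N" "nbd N (snd e) (fst e) \<in> sites N" "fst e ~= nbd N (snd e) (fst e)"
    using nbd_sites[of "fst e" N "snd e"] nbd_neq[OF _ N, of "fst e" "snd e"] by (auto simp: edges_iff simp del: split_paired_All)
   show "qf ?I (eop (fst e) (nbd N (snd e) (fst e)) (ety n e)) \<psi> = qf {..n} (ety n e) (w (\<kappa> a (fst e))) * qf {..n} (ety n e) (w (\<kappa> a (nbd N (snd e) (fst e))))"
    unfolding \<psi>_def by (rule qf_eop_product[OF r]) (rule unit[OF a])
  qed
  finally have q: "qf ?I (ham N n b) \<psi> = b * (\<Sum>e\<in>edges N. qf {..n} (ety n e) (w (\<kappa> a (fst e))) * qf {..n} (ety n e) (w (\<kappa> a (nbd N (snd e) (fst e)))))" .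
  have "qf ?I (mexp ?I (ham N n b)) \<psi> >= 1 * exp (qf ?I (ham N n b) \<psi> / 1)"
   by (rule qf_mexp_jensen[OF msym_ham s1]) simp
  moreover have "qf ?I (mexp ?I (ham N n b)) \<psi> <= (\<Sum>sg\<in>?I. (\<psi> sg)\<^sup>2) * (\<Sum>sg\<in>U a. mexp ?I (ham N n b) sg sg)"
  proof (rule qf_mexp_le_block_trace[OF msym_ham])
   show "\<psi> i = 0" if "i \<in> ?I - U a" for i
    unfolding \<psi>_def using that by (intro prod_zero) (auto simp: U_def)
  qed (auto simp: U_def)
  ultimately show ?thesis unfolding s1 q by (simp add: gw_def)
 qed
 then have "(\<Sum>a\<in>A. exp (b * (\<Sum>e\<in>edges N. qf {..n} (ety n e) (w (\<kappa> a (fst e))) * qf {..n} (ety n e) (w (\<kappa> a (nbd N (snd e) (fst e)))))))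
   <= (\<Sum>a\<in>A. \<Sum>sg\<in>U a. gw N n b sg)" by (rule sum_mono)
 also have "... = (\<Sum>sg\<in>(\<Union>a\<in>A. U a). gw N n b sg)"
 proof (rule sum.UNION_disjoint[symmetric, OF A])
  show "\<forall>a\<in>A. \<forall>a'\<in>A. a ~= a' --> U a \<inter> U a' = {}"
  proof (intro ballI impI)
   fix a a' assume "a \<in> A" "a' \<in> A" "a ~= a'"
   from inj[OF this] obtain r where "r \<in> sites N" "\<kappa> a r ~= \<kappa> a' r" by blast
   then show "U a \<inter> U a' = {}" unfolding U_def using disj by fast
  qed
 qed (auto simp: U_def)
 also have "... <= Zr N n b" unfolding Zr_sum by (intro sum_mono2) (auto simp: U_def gw_nonneg[OF b])
 finally show ?thesis .
qed

lemma xm_coeff_ge: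
 assumes n: "n >= 1" and l: "l <= n" and \<rho>: "0 <= \<rho>" "\<rho>\<^sup>2 <= 1 - (mz n l)\<^sup>2"
 shows "\<rho> / 2 <= sqrt ((real n - real l + 1) * real l) / n" "\<rho> / 2 <= sqrt ((real n - real l) * (real l + 1)) / n"
proof -
 have nn: "(real n)\<^sup>2 > 0" using n by simp
 have "1 - (mz n l)\<^sup>2 = 4 * (real l * (real n - real l)) / (real n)\<^sup>2"
  using n unfolding mz_def by (simp add: power_divide field_simps power2_eq_square)
 then have "\<rho>\<^sup>2 * (real n)\<^sup>2 <= 4 * (real l * (real n - real l))" using \<rho>(2) nn by (simp add: pos_le_divide_eq)
 then have e: "(\<rho> / 2 * n)\<^sup>2 <= real l * (real n - real l)" by (simp add: power_mult_distrib power_divide)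
 have "real l * (real n - real l) <= (real n - real l + 1) * real l" "real l * (real n - real l) <= (real n - real l) * (real l + 1)"
  using l by (auto simp: algebra_simps)
 with e have "\<rho> / 2 * n <= sqrt ((real n - real l + 1) * real l)" "\<rho> / 2 * n <= sqrt ((real n - real l) * (real l + 1))"
  by (meson order_trans real_le_rsqrt)+
 then show "\<rho> / 2 <= sqrt ((real n - real l + 1) * real l) / n" "\<rho> / 2 <= sqrt ((real n - real l) * (real l + 1)) / n"
  using n by (auto simp: pos_le_divide_eq)
qed

text \<open>\<open>rec\<close> makes \<open>v\<close>, on its support, at least an eigenvector of
  the path with eigenvalue \<open>2 * c\<close>, while the entries of \<open>xm\<close> between
  points of the support are at least \<open>\<rho> / 2\<close>.\<close>

lemma qf_xm_ge:
 assumes n: "n >= 1" and v: "!!k. v k >= 0" and \<rho>: "0 <= \<rho>" "!!k. v k ~= 0 ==> k <= n & \<rho>\<^sup>2 <= 1 - (mz n k)\<^sup>2"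
  and rec: "!!k. v k ~= 0 ==> 2 * c * v k <= v (Suc k) + (case k of 0 => 0 | Suc j => v j)"
 shows "\<rho> * c * (\<Sum>k\<le>n. (v k)\<^sup>2) <= qf {..n} (xm n) v"
proof -
 have "\<rho> * c * (\<Sum>k\<le>n. (v k)\<^sup>2) = (\<Sum>k\<le>n. v k * (\<rho> * c * v k))" by (simp add: sum_distrib_left power2_eq_square mult_ac)
 also have "... <= (\<Sum>k\<le>n. v k * (\<Sum>l\<le>n. xm n k l * v l))"
 proof (intro sum_mono)
  fix k assume k: "k \<in> {..n}"
  have "\<rho> * c * v k <= (\<Sum>l\<le>n. xm n k l * v l)" if vk: "v k ~= 0"
  proof -
   have "\<rho> / 2 * v (Suc k) <= sqrt ((real n - real k) * (real k + 1)) / n * v (Suc k)"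
   proof (cases "v (Suc k) = 0")
    case False
    then show ?thesis using xm_coeff_ge(1)[OF n, of "Suc k" \<rho>] \<rho> v by (intro mult_right_mono) (auto simp: add.commute)
   qed simp
   moreover have "\<rho> / 2 * (case k of 0 => 0 | Suc j => v j) <= (case k of 0 => 0 | Suc j => sqrt ((real n - real j) * (real j + 1)) / n * v j)"
   proof (cases k)
    case (Suc j)
    show ?thesis
    proof (cases "v j = 0")
     case False
     then have "\<rho> / 2 * v j <= sqrt ((real n - real j) * (real j + 1)) / n * v j"
      using xm_coeff_ge(2)[OF n, of j \<rho>] \<rho> v by (intro mult_right_mono) auto
     then show ?thesis by (simp only: Suc nat.case)
    qed (simp add: Suc)
   qed simp
   moreover have "\<rho> / 2 * (2 * c * v k) <= \<rho> / 2 * (v (Suc k) + (case k of 0 => 0 | Suc j => v j))"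
    using rec[OF vk] \<rho> by (intro mult_left_mono) auto
   moreover have "\<rho> / 2 * (2 * c * v k) = \<rho> * c * v k" by simp
   moreover have "(\<Sum>l\<le>n. xm n k l * v l) = sqrt ((real n - real k) * (real k + 1)) / n * v (Suc k)
    + (case k of 0 => 0 | Suc j => sqrt ((real n - real j) * (real j + 1)) / n * v j)" using sum_xm[of k n v] k by simp
   ultimately show ?thesis unfolding distrib_left[of "\<rho> / 2"] by linarith
  qed
  then show "v k * (\<rho> * c * v k) <= v k * (\<Sum>l\<le>n. xm n k l * v l)" using v by (cases "v k = 0") (auto intro: mult_left_mono)
 qed
 finally show ?thesis by (simp add: qf_def sum_distrib_left mult_ac)
qed

lemma qf_zm_ge:
 assumes "!!k. v k ~= 0 ==> lo <= mz n k"
 shows "lo * (\<Sum>k\<le>n. (v k)\<^sup>2) <= qf {..n} (zm n) v"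
proof -
 have "qf {..n} (zm n) v = (\<Sum>k\<le>n. mz n k * (v k)\<^sup>2)"
  unfolding qf_def zm_def by (intro sum.cong refl) (simp add: if_distrib if_distribR sum.delta power2_eq_square mult_ac cong: if_cong)
 moreover have "lo * (v k)\<^sup>2 <= mz n k * (v k)\<^sup>2" for k using assms by (cases "v k = 0") (auto intro: mult_right_mono)
 ultimately show ?thesis by (simp add: sum_distrib_left sum_mono)
qed

text \<open>The ground state of a particle in a box of \<^term>\<open>L\<close> sites starting at \<^term>\<open>a\<close>.\<close>

definition win :: "nat => nat => nat => real" where
 "win a L k = (if a <= k & k < a + L then sin ((real k - real a + 1) * (pi / (real L + 1))) else 0)"

lemma win_pos: "a <= k ==> k < a + L ==> win a L k > 0"
proof -
 assume k: "a <= k" "k < a + L"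
 have "(real k - real a + 1) / (real L + 1) * pi < 1 * pi"
  using k by (intro mult_strict_right_mono) (auto simp: field_simps)
 then show ?thesis unfolding win_def using k by (auto intro!: sin_gt_zero simp: mult_ac)
qed

lemma win_nonzero: "win a L k ~= 0 \<longleftrightarrow> a <= k & k < a + L"
 using win_pos[of a k L] by (auto simp: win_def)

lemma win_nonneg: "win a L k >= 0"
 using win_pos[of a k L] by (cases "a <= k & k < a + L") (auto simp: win_def)

lemma win_rec:
 assumes k: "a <= k" "k < a + L"
 shows "win a L (Suc k) + (case k of 0 => 0 | Suc j => win a L j) = 2 * cos (pi / (real L + 1)) * win a L k"
proof -
 let ?t = "pi / (real L + 1)"
 have 1: "win a L (Suc k) = sin ((real k - real a + 1) * ?t + ?t)"
 proof (cases "Suc k < a + L")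
  case True
  moreover have "(real (Suc k) - real a + 1) * ?t = (real k - real a + 1) * ?t + ?t" by (simp add: algebra_simps add_divide_distrib)
  ultimately show ?thesis using k by (simp add: win_def)
 next
  \<comment> \<open>Just past the window the sine has argument pi and vanishes, in agreement with
    the cut-off; on the left the same happens with argument 0.\<close>
  case False
  then have "real k - real a + 1 = real L" using k by linarith
  then have "(real k - real a + 1) * ?t + ?t = (real L + 1) * ?t" by (simp only: distrib_right mult_1_left)
  also have "... = pi" by simp
  finally show ?thesis using False k by (simp add: win_def)
 qed
 have 2: "(case k of 0 => 0 | Suc j => win a L j) = sin ((real k - real a + 1) * ?t - ?t)"
 proof (cases "k = a")
  case True
  then show ?thesis by (cases k) (auto simp: win_def)
 next
  case False
  then obtain j where j: "k = Suc j" "a <= j" using k by (cases k) auto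
  have "(real j - real a + 1) * t = (real k - real a + 1) * t - t" for t using j by (simp add: algebra_simps)
  from this[of ?t] show ?thesis using j k by (simp add: win_def)
 qed
 show ?thesis unfolding 1 2 sin_add sin_diff using k by (simp add: win_def)
qed

text \<open>A converse to the inequality of the means: away from 0 the deficit is only quadratic in
  \<open>A - C\<close>, because \<open>(sqrt A + sqrt C)^2 >= 1\<close>.\<close>

lemma sqrt_mult_ge:
 fixes A C :: real
 assumes "A >= 1/2" "C >= 1/2"
 shows "(A + C) / 2 - (A - C)\<^sup>2 / 2 <= sqrt A * sqrt C"
proof -
 define x where "x = sqrt A"
 define y where "y = sqrt C"
 have xy: "A = x\<^sup>2" "C = y\<^sup>2" "x >= 0" "y >= 0" using assms by (auto simp: x_def y_def)
 have "1 <= (x + y)\<^sup>2" using assms mult_nonneg_nonneg[OF xy(3,4)] unfolding xy by (simp add: power2_eq_square algebra_simps)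
 then have "(x - y)\<^sup>2 * 1 <= (x - y)\<^sup>2 * (x + y)\<^sup>2" by (intro mult_left_mono) auto
 also have "... = (A - C)\<^sup>2" unfolding xy by (simp add: power2_eq_square algebra_simps)
 finally have "(x - y)\<^sup>2 <= (A - C)\<^sup>2" by simp
 moreover have "(A + C) / 2 - x * y = (x - y)\<^sup>2 / 2" unfolding xy by (simp add: power2_eq_square field_simps)
 ultimately show ?thesis unfolding x_def[symmetric] y_def[symmetric] by linarith
qed

text \<open>A window of about \<open>sqrt b\<close> levels has \<open>\<theta>^2\<close> of order
  \<open>1 / b\<close>, so localising a spin in it costs a bounded amount of energy. All windows lie
  just above the equator, with \<open>0 <= m <= b^(-1/4)\<close>: there \<open>1 - m^2\<close>
  varies by at most \<open>1 / sqrt b\<close>, and x-edges lose only the square of this, even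
  between plaquettes with unrelated values. Values on one z-plaquette must agree up to
  \<open>1 / sqrt b\<close>, which leaves about \<open>b^(1/4)\<close> choices of a common group for
  each z-plaquette and about \<open>n / b\<close> windows inside it for each site. The first number
  is the entropy that bad patterns cannot match.\<close>

theorem Zr_lower:
 assumes N: "even N" "N >= 2" and b: "b >= 36" and n: "real n >= 2000 * b\<^sup>2"
 shows "exp ((b - 36) * real (N * N)) * (sqrt (sqrt b) / 2) ^ ((N div 2) * (N div 2)) * (real n / (8 * b)) ^ (N * N) <= Zr N n b"
proof -
 define h where "h = N div 2"
 define L where "L = nat \<lceil>sqrt b\<rceil>"
 \<comment> \<open>A window covers \<open>d = 2 * L / n\<close> in m, so \<open>X\<close> windows
   cover \<open>1 / sqrt b\<close>; with \<open>T <= X\<close> windows in a group, \<open>Q\<close>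
   groups stay below \<open>1 / s = b^(-1/4)\<close>.\<close>
 define X where "X = real n / (2 * real L * sqrt b)"
 define T where "T = nat \<lfloor>X\<rfloor>"
 define s where "s = sqrt (sqrt b)"
 define Q where "Q = nat \<lfloor>s\<rfloor>"
 define \<theta> where "\<theta> = pi / (real L + 1)"
 define d where "d = 2 * real L / n"
 \<comment> \<open>The least level with \<open>mz >= 0\<close>.\<close>
 define k0 where "k0 = (n + 1) div 2"
 define a where "a = (%i. k0 + i * L)"
 define lo where "lo = (%i::nat. real i * d)"
 define hi where "hi = (%i::nat. (real i + 1) * d)"
 have Nh: "N = 2 * h" using N by (simp add: h_def)
 have sb: "sqrt b >= 6" by (rule real_le_rsqrt) (use b in simp)
 have sbb: "sqrt b * sqrt b = b" using b by simp
 have sb1: "sqrt b <= b" using sb sbb mult_right_mono[of 1 "sqrt b" "sqrt b"] by linarith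
 have s2: "s >= 2" unfolding s_def by (rule real_le_rsqrt) (use sb in simp)
 have ss: "s * s = sqrt b" unfolding s_def using sb by simp
 have nb: "2000 * (b * b) <= real n" using n by (simp add: power2_eq_square)
 have bb: "b * 1 <= b * b" using b by (intro mult_left_mono) auto
 have n1: "n >= 1" using nb bb b by (cases n) auto
 have "real L = of_int \<lceil>sqrt b\<rceil>" using sb by (simp add: L_def)
 then have L: "sqrt b <= L" "L <= 2 * sqrt b" "L >= 1" using sb by linarith+
 have T: "real n / (8 * b) <= T" "T <= X"
 proof -
  have "2 * real L * sqrt b <= 2 * (2 * sqrt b) * sqrt b" using L sb b by (intro mult_right_mono mult_left_mono) auto
  then have "2 * real L * sqrt b <= 4 * b" using sbb by simp
  then have X: "real n / (4 * b) <= X" unfolding X_def using L sb b by (intro divide_left_mono mult_pos_pos) auto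
  have "8 * b <= real n" using nb bb b by linarith
  then have "1 <= real n / (8 * b)" using b by (simp add: field_simps)
  moreover have "real n / (4 * b) = 2 * (real n / (8 * b))" using b by simp
  ultimately have X1: "real n / (8 * b) + 1 <= X" "X >= 0" using X by linarith+
  then have "real T = of_int \<lfloor>X\<rfloor>" by (simp add: T_def)
  then show "real n / (8 * b) <= T" "T <= X" using X1 by linarith+
 qed
 have "real Q = of_int \<lfloor>s\<rfloor>" using s2 by (simp add: Q_def)
 then have Q: "s / 2 <= Q" "Q <= s" using s2 by linarith+
 have d0: "d > 0" using L n1 by (simp add: d_def)
 have d1: "d <= 1 / (2 * b)"
 proof -
  have "2 * real L * (2 * b) <= 2 * (2 * b) * (2 * b)" using L sb1 b by (intro mult_right_mono) auto
  then have "2 * real L * (2 * b) <= n" using nb by linarith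
  then show ?thesis unfolding d_def using b n1 by (simp add: field_simps)
 qed
 have dT: "d * T <= 1 / sqrt b"
 proof -
  have "d * T <= d * X" using T d0 by (intro mult_left_mono) auto
  also have "... = 1 / sqrt b" unfolding d_def X_def using L n1 by (simp add: field_simps)
  finally show ?thesis .
 qed
 have lohi: "0 <= lo i" "lo i <= hi i" "hi i >= 0" for i using d0 by (auto simp: lo_def hi_def distrib_right)
 have hi1: "hi i <= 1 / s" if "i < Q * T" for i
 proof -
  have "i + 1 <= Q * T" using that by simp
  then have "real i + 1 <= real Q * real T" by (metis of_nat_1 of_nat_add of_nat_le_iff of_nat_mult)
  then have "hi i <= real Q * real T * d" unfolding hi_def using d0 by (intro mult_right_mono) auto
  also have "... = real Q * (d * T)" by simp
  also have "... <= s * (1 / sqrt b)" using Q dT s2 d0 by (intro mult_mono) auto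
  also have "... = 1 / s" unfolding ss[symmetric] using s2 by simp
  finally show ?thesis .
 qed
 have hi2: "(hi i)\<^sup>2 <= 1 / sqrt b" if "i < Q * T" for i
 proof -
  have "hi i * hi i <= (1 / s) * (1 / s)" using hi1[OF that] lohi s2 by (intro mult_mono) auto
  then show ?thesis by (simp add: power2_eq_square ss)
 qed
 have sq6: "1 / sqrt b <= 1 / 6" using sb b by (intro divide_left_mono) auto
 have hilo: "(hi i)\<^sup>2 <= (lo i)\<^sup>2 + 1 / b" if "i < Q * T" for i
 proof -
  have h1: "hi i <= 1" using hi1[OF that] s2 by (smt (verit) divide_le_eq_1)
  have "(hi i)\<^sup>2 - (lo i)\<^sup>2 = d * (hi i + lo i)" by (simp add: hi_def lo_def power2_eq_square algebra_simps)
  also have "... <= 1 / (2 * b) * 2" using d0 d1 h1 lohi[of i] b by (intro mult_mono) auto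
  finally show ?thesis by simp
 qed
 have blk: "lo i <= mz n k" "mz n k <= hi i" "k <= n" if i: "i < Q * T" and k: "a i <= k" "k < a i + L" for i k
 proof -
  have "n + 2 * (i * L) <= 2 * k" "2 * k <= n + 2 * (i * L + L)" using k L(3) unfolding a_def k0_def by auto
  then have kk: "real n + 2 * (real i * real L) <= 2 * real k" "2 * real k <= real n + 2 * (real i * real L + real L)"
   by (metis (mono_tags) of_nat_add of_nat_le_iff of_nat_mult of_nat_numeral)+
  show "lo i <= mz n k" unfolding lo_def d_def mz_def using kk(1) n1 by (simp add: field_simps)
  have "hi i = 2 * (real i * real L + real L) / n" unfolding hi_def d_def by (simp add: algebra_simps)
  then show h: "mz n k <= hi i" unfolding mz_def using kk(2) by (simp only:) (intro divide_right_mono, auto)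
  have "1 / s <= 1" using s2 by simp
  then have "mz n k <= 1" using h hi1[OF i] by linarith
  then show "k <= n" using n1 by (simp add: mz_def field_simps)
 qed
 define S where "S = (%i. \<Sum>k\<le>n. (win (a i) L k)\<^sup>2)"
 define v where "v = (%i k. win (a i) L k / sqrt (S i))"
 have S: "S i > 0" if i: "i < Q * T" for i
 proof -
  have "a i <= n" using blk(3)[OF i, of "a i"] L by simp
  moreover have "win (a i) L (a i) > 0" using L by (intro win_pos) auto
  ultimately show ?thesis unfolding S_def by (intro sum_pos2[of _ "a i"]) auto
 qed
 have unit: "(\<Sum>k\<le>n. (v i k)\<^sup>2) = 1" if i: "i < Q * T" for i
 proof -
  have "(\<Sum>k\<le>n. (v i k)\<^sup>2) = S i / S i"
   unfolding v_def S_def[of] power_divide using S[OF i] by (simp add: sum_divide_distrib[symmetric] S_def)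
  then show ?thesis using S[OF i] by simp
 qed
 have vnz: "a i <= k & k < a i + L" if "v i k ~= 0" for i k using that unfolding v_def by (auto simp: win_nonzero[symmetric])
 have disj: "i = j" if "v i k ~= 0" "v j k ~= 0" for i j k
 proof -
  have "(k - k0) div L = i" "(k - k0) div L = j" using vnz[OF that(1)] vnz[OF that(2)] unfolding a_def
   by (auto intro!: div_nat_eqI simp: mult.commute)
  then show ?thesis by simp
 qed
 have th: "0 < \<theta>" "\<theta> <= pi / 2" "\<theta>\<^sup>2 <= 16 / b"
 proof -
  show "0 < \<theta>" by (simp add: \<theta>_def)
  show "\<theta> <= pi / 2" unfolding \<theta>_def using L(3) by (intro divide_left_mono) auto
  have "\<theta> <= 4 / sqrt b" unfolding \<theta>_def using L sb b pi_less_4 by (intro frac_le) auto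
  then have "\<theta>\<^sup>2 <= (4 / sqrt b)\<^sup>2" using \<open>0 < \<theta>\<close> by (intro power_mono) auto
  then show "\<theta>\<^sup>2 <= 16 / b" using b by (simp add: power_divide)
 qed
 have c0: "cos \<theta> >= 0" using th by (intro cos_ge_zero) auto
 have c1: "1 - (cos \<theta>)\<^sup>2 <= 16 / b"
 proof -
  have "(sin \<theta>)\<^sup>2 <= \<theta>\<^sup>2" using sin_x_le_x[of \<theta>] sin_ge_zero[of \<theta>] th pi_gt_zero by (intro power_mono) auto
  then show ?thesis using th(3) sin_cos_squared_add[of \<theta>] by linarith
 qed
 have xmean: "sqrt (1 - (hi i)\<^sup>2) * cos \<theta> <= qf {..n} (xm n) (v i)" if i: "i < Q * T" for i
 proof -
  have "(hi i)\<^sup>2 <= 1" using hi2[OF i] sq6 by linarith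
  then have "sqrt (1 - (hi i)\<^sup>2) * cos \<theta> * (\<Sum>k\<le>n. (v i k)\<^sup>2) <= qf {..n} (xm n) (v i)"
  proof (intro qf_xm_ge[OF n1])
   show "0 <= v i k" for k unfolding v_def using S[OF i] by (simp add: win_nonneg)
   fix k assume k: "v i k ~= 0"
   note B = blk[OF i, of k] vnz[OF k]
   have "(mz n k)\<^sup>2 <= (hi i)\<^sup>2" using B lohi[of i] by (intro power_mono) auto
   then show "k <= n & (sqrt (1 - (hi i)\<^sup>2))\<^sup>2 <= 1 - (mz n k)\<^sup>2" using B \<open>(hi i)\<^sup>2 <= 1\<close> by simp
   have "v i (Suc k) + (case k of 0 => 0 | Suc j => v i j) = (win (a i) L (Suc k) + (case k of 0 => 0 | Suc j => win (a i) L j)) / sqrt (S i)"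
    unfolding v_def by (cases k) (auto simp: add_divide_distrib)
   also have "... = 2 * cos \<theta> * v i k" using win_rec[of "a i" k L] B unfolding v_def \<theta>_def by simp
   finally show "2 * cos \<theta> * v i k <= v i (Suc k) + (case k of 0 => 0 | Suc j => v i j)" by simp
  qed auto
  then show ?thesis unfolding unit[OF i] by simp
 qed
 have zmean: "lo i <= qf {..n} (zm n) (v i)" if i: "i < Q * T" for i
  using qf_zm_ge[of "v i" "lo i" n] blk[OF i] vnz[of i] unit[OF i] by simp
 \<comment> \<open>z-edges are based at odd coordinates, hence the shift by one: \<open>p\<close>
   labels the z-plaquette of a site. A trial state chooses a group for each z-plaquette and a window
   inside the group for each site, and \<open>\<kappa>\<close> encodes the two choices in base
   \<open>T\<close>.\<close>
 define p where "p = (%r::site. (((fst r + 1) mod N) div 2, ((snd r + 1) mod N) div 2))"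
 define A where "A = PiE (sites h) (%_. {..<Q}) \<times> PiE (sites N) (%_. {..<T})"
 define \<kappa> where "\<kappa> = (%(a :: (site => nat) \<times> (site => nat)) r. fst a (p r) * T + snd a r)"
 have ps: "p r \<in> sites h" if "r \<in> sites N" for r
  using N Nh by (auto simp: p_def sites_def less_mult_imp_div_less mult.commute)
 have Am: "fst x (p r) < Q" "snd x r < T" if "x \<in> A" "r \<in> sites N" for x r
  using that ps[OF that(2)] unfolding A_def by (auto simp: mem_Times_iff PiE_iff)
 have kQT: "\<kappa> x r < Q * T" if "x \<in> A" "r \<in> sites N" for x r
 proof -
  have "\<kappa> x r < (fst x (p r) + 1) * T" unfolding \<kappa>_def using Am[OF that] by simp
  also have "... <= Q * T" using Am(1)[OF that] by (intro mult_right_mono) auto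
  finally show ?thesis .
 qed
 have fA: "finite A" unfolding A_def by (intro finite_cartesian_product finite_PiE) auto
 have "card A = Q ^ (h * h) * T ^ (N * N)"
  unfolding A_def by (simp add: card_cartesian_product card_PiE card_sites)
 then have cA: "real (card A) = real Q ^ (h * h) * real T ^ (N * N)" by simp
 have inj: "\<exists>r\<in>sites N. \<kappa> x r ~= \<kappa> y r" if xy: "x \<in> A" "y \<in> A" "x ~= y" for x y
 proof (rule ccontr)
  assume "~ ?thesis"
  then have eq: "\<kappa> x r = \<kappa> y r" if "r \<in> sites N" for r using that by blast
  have dm: "fst x (p r) = fst y (p r) & snd x r = snd y r" if r: "r \<in> sites N" for r
  proof -
   have "\<kappa> x r div T = fst x (p r)" "\<kappa> x r mod T = snd x r" "\<kappa> y r div T = fst y (p r)" "\<kappa> y r mod T = snd y r"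
    unfolding \<kappa>_def using Am[OF xy(1) r] Am[OF xy(2) r] by auto
   then show ?thesis using eq[OF r] by simp
  qed
  have "snd x = snd y" using xy dm by (intro PiE_ext[of _ "sites N" "%_. {..<T}"]) (auto simp: A_def mem_Times_iff)
  moreover have "fst x = fst y"
  proof (rule PiE_ext[of _ "sites h" "%_. {..<Q}"])
   fix q assume q: "q \<in> sites h"
   define r where "r = ((2 * fst q + N - 1) mod N, (2 * snd q + N - 1) mod N)"
   have e: "((2 * t + N - 1) mod N + 1) mod N div 2 = t" if "t < h" for t
   proof -
    have "((2 * t + N - 1) mod N + 1) mod N = (2 * t + N) mod N" using N(2) by (simp add: mod_Suc_eq)
    then show ?thesis using that Nh by simp
   qed
   have "r \<in> sites N" using N by (auto simp: r_def sites_def)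
   moreover have "p r = q" using e[of "fst q"] e[of "snd q"] sites_fst_lt[OF q] by (simp add: p_def r_def prod_eq_iff)
   ultimately show "fst x q = fst y q" using dm[of r] by simp
  qed (use xy in \<open>auto simp: A_def mem_Times_iff\<close>)
  ultimately show False using xy(3) by (simp add: prod_eq_iff)
 qed
 \<comment> \<open>On an x-edge the loss is \<open>16 / b\<close> from the cosine of the window,
   \<open>1 / b\<close> from its width and \<open>1 / (2 * b)\<close> from the geometric mean; a
   z-edge loses less. With two edges per site and the factor \<open>b\<close>, the bound
   \<open>18 / b\<close> becomes the 36 in the exponent.\<close>
 have edge: "(if even (crd (snd e) (fst e)) = True then (1/2 - (lo (\<kappa> x (fst e)))\<^sup>2 / 2) + (1/2 - (lo (\<kappa> x (nbd N (snd e) (fst e))))\<^sup>2 / 2) else 0)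
   + (if even (crd (snd e) (fst e)) = False then (lo (\<kappa> x (fst e)))\<^sup>2 / 2 + (lo (\<kappa> x (nbd N (snd e) (fst e))))\<^sup>2 / 2 else 0) - 18 / b
   <= qf {..n} (ety n e) (v (\<kappa> x (fst e))) * qf {..n} (ety n e) (v (\<kappa> x (nbd N (snd e) (fst e))))"
  if x: "x \<in> A" and e: "e \<in> edges N" for x e
 proof -
  define r where "r = fst e"
  define r' where "r' = nbd N (snd e) r"
  define i where "i = \<kappa> x r"
  define j where "j = \<kappa> x r'"
  have rs: "r \<in> sites N" "r' \<in> sites N" using e nbd_sites[of r N "snd e"] by (simp_all add: r_def r'_def edges_iff)
  have ij: "i < Q * T" "j < Q * T" using kQT[OF x] rs by (auto simp: i_def j_def)
  show ?thesis unfolding r_def[symmetric] r'_def[symmetric] i_def[symmetric] j_def[symmetric]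
  proof (cases "even (crd (snd e) r)")
   case True
   define B where "B = 1 - (hi i)\<^sup>2"
   define C where "C = 1 - (hi j)\<^sup>2"
   have BC: "B >= 1/2" "C >= 1/2" "B <= 1" "C <= 1" "1 - (lo i)\<^sup>2 - 1 / b <= B" "1 - (lo j)\<^sup>2 - 1 / b <= C"
    using hi2[OF ij(1)] hi2[OF ij(2)] sq6 hilo[OF ij(1)] hilo[OF ij(2)] by (auto simp: B_def C_def)
   have "\<bar>B - C\<bar> <= 1 / sqrt b" using hi2[OF ij(1)] hi2[OF ij(2)] zero_le_power2[of "hi i"] zero_le_power2[of "hi j"]
    unfolding B_def C_def by linarith
   then have "\<bar>B - C\<bar>\<^sup>2 <= (1 / sqrt b)\<^sup>2" by (intro power_mono) auto
   then have BC2: "(B - C)\<^sup>2 <= 1 / b" using b by (simp add: power_divide)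
   have p1: "sqrt B * sqrt C <= 1 * 1" using BC by (intro mult_mono) auto
   have "sqrt B * sqrt C * (1 - (cos \<theta>)\<^sup>2) <= 1 * (16 / b)"
    using p1 c1 BC abs_square_le_1[of "cos \<theta>"] by (intro mult_mono) (auto simp: abs_le_iff)
   then have "sqrt B * sqrt C - 16 / b <= (sqrt B * cos \<theta>) * (sqrt C * cos \<theta>)" by (simp add: algebra_simps power2_eq_square)
   also have "... <= qf {..n} (xm n) (v i) * qf {..n} (xm n) (v j)"
    using xmean[OF ij(1)] xmean[OF ij(2)] BC c0 unfolding B_def[symmetric] C_def[symmetric]
    by (intro mult_mono) (auto intro: order_trans[OF _ xmean[OF ij(1), folded B_def]])
   finally have "sqrt B * sqrt C - 16 / b <= qf {..n} (xm n) (v i) * qf {..n} (xm n) (v j)" .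
   then have X: "sqrt B * sqrt C - 16 * (1 / b) <= qf {..n} (xm n) (v i) * qf {..n} (xm n) (v j)" by simp
   have g: "1/2 - l / 2 + (1/2 - m / 2) - 18 * y <= P"
    if "z - 16 * y <= P" "(B + C) / 2 - q / 2 <= z" "q <= y" "1 - l - y <= B" "1 - m - y <= C" "0 <= y" for l m y P z q :: real
   proof -
    have "2 * P >= 2 * z - 32 * y" "2 * z >= B + C - q" "B + C >= 2 - l - m - 2 * y" using that by (simp_all add: field_simps)
    then have "2 - l - m - 36 * y <= 2 * P" using that(3,6) by linarith
    then show ?thesis by simp
   qed
   have "1/2 - (lo i)\<^sup>2 / 2 + (1/2 - (lo j)\<^sup>2 / 2) - 18 / b <= qf {..n} (xm n) (v i) * qf {..n} (xm n) (v j)"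
    using g[OF X sqrt_mult_ge[OF BC(1,2)] BC2 BC(5,6)] b by simp
   then show "(if even (crd (snd e) r) = True then (1/2 - (lo i)\<^sup>2 / 2) + (1/2 - (lo j)\<^sup>2 / 2) else 0)
    + (if even (crd (snd e) r) = False then (lo i)\<^sup>2 / 2 + (lo j)\<^sup>2 / 2 else 0) - 18 / b <= qf {..n} (ety n e) (v i) * qf {..n} (ety n e) (v j)"
    using True by (simp add: ety_def r_def)
  next
   case False
   \<comment> \<open>For odd \<open>y\<close> the positions \<open>y\<close> and
     \<open>y + 1\<close> carry the same plaquette label, also across the seam of the torus.\<close>
   have half: "(y + 1) mod N div 2 = ((y + 1) mod N + 1) mod N div 2" if y: "odd y" for y
   proof -
    have "even ((y + 1) mod N)" using y even_mod_even[OF N(1), of "y + 1"] by simp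
    moreover have "(y + 1) mod N < N" using N by simp
    ultimately have "(y + 1) mod N + 1 < N" using N(1) by (metis Suc_eq_plus1 Suc_lessI even_Suc)
    then show ?thesis using \<open>even ((y + 1) mod N)\<close> by simp
   qed
   have "p r = p r'" unfolding p_def r'_def nbd_def nb1_def nb2_def
    using False half[of "fst r"] half[of "snd r"] by (cases "snd e") (auto simp: crd_def)
   then have "lo i - lo j = (real (snd x r) - real (snd x r')) * d"
    unfolding lo_def i_def j_def \<kappa>_def by (simp add: algebra_simps)
   moreover have "\<bar>real (snd x r) - real (snd x r')\<bar> <= T" using Am(2)[OF x rs(1)] Am(2)[OF x rs(2)] by linarith
   ultimately have "\<bar>lo i - lo j\<bar> <= T * d" using d0 by (simp add: abs_mult mult_right_mono)
   then have "\<bar>lo i - lo j\<bar> <= 1 / sqrt b" using dT by (simp add: mult.commute)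
   then have "\<bar>lo i - lo j\<bar>\<^sup>2 <= (1 / sqrt b)\<^sup>2" by (intro power_mono) auto
   then have l2: "(lo i - lo j)\<^sup>2 <= 1 / b" using b by (simp add: power_divide)
   have "(lo i)\<^sup>2 / 2 + (lo j)\<^sup>2 / 2 = lo i * lo j + (lo i - lo j)\<^sup>2 / 2" by (simp add: power2_eq_square field_simps)
   moreover have "lo i * lo j <= qf {..n} (zm n) (v i) * qf {..n} (zm n) (v j)"
    using zmean[OF ij(1)] zmean[OF ij(2)] lohi(1)[of i] lohi(1)[of j] by (intro mult_mono) auto
   moreover have "18 / b = 18 * (1 / b)" "1 / b >= 0" using b by simp_all
   ultimately have "(lo i)\<^sup>2 / 2 + (lo j)\<^sup>2 / 2 - 18 / b <= qf {..n} (zm n) (v i) * qf {..n} (zm n) (v j)" using l2 by linarith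
   then show "(if even (crd (snd e) r) = True then (1/2 - (lo i)\<^sup>2 / 2) + (1/2 - (lo j)\<^sup>2 / 2) else 0)
    + (if even (crd (snd e) r) = False then (lo i)\<^sup>2 / 2 + (lo j)\<^sup>2 / 2 else 0) - 18 / b <= qf {..n} (ety n e) (v i) * qf {..n} (ety n e) (v j)"
    using False by (simp add: ety_def r_def)
  qed
 qed
 have tot: "(b - 36) * real (N * N) <= b * (\<Sum>e\<in>edges N. qf {..n} (ety n e) (v (\<kappa> x (fst e))) * qf {..n} (ety n e) (v (\<kappa> x (nbd N (snd e) (fst e)))))"
  if x: "x \<in> A" for x
 proof -
  have "(\<Sum>e\<in>edges N. (if even (crd (snd e) (fst e)) = True then (1/2 - (lo (\<kappa> x (fst e)))\<^sup>2 / 2) + (1/2 - (lo (\<kappa> x (nbd N (snd e) (fst e))))\<^sup>2 / 2) else 0)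
   + (if even (crd (snd e) (fst e)) = False then (lo (\<kappa> x (fst e)))\<^sup>2 / 2 + (lo (\<kappa> x (nbd N (snd e) (fst e))))\<^sup>2 / 2 else 0) - 18 / b)
   <= (\<Sum>e\<in>edges N. qf {..n} (ety n e) (v (\<kappa> x (fst e))) * qf {..n} (ety n e) (v (\<kappa> x (nbd N (snd e) (fst e)))))"
   by (intro sum_mono edge[OF x])
  then have "real (N * N) - real (card (edges N)) * (18 / b) <= (\<Sum>e\<in>edges N. qf {..n} (ety n e) (v (\<kappa> x (fst e))) * qf {..n} (ety n e) (v (\<kappa> x (nbd N (snd e) (fst e)))))"
   unfolding sum.distrib sum_subtractf edge_sum[OF N(1), where w="%r. 1/2 - (lo (\<kappa> x r))\<^sup>2 / 2"] edge_sum[OF N(1), where w="%r. (lo (\<kappa> x r))\<^sup>2 / 2"]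
   by (simp add: sum_subtractf card_sites sum_divide_distrib[symmetric])
  moreover have "real (card (edges N)) = 2 * real (N * N)" by (simp add: edges_def card_cartesian_product card_sites)
  ultimately have "b * (real (N * N) - 2 * real (N * N) * (18 / b)) <= b * (\<Sum>e\<in>edges N. qf {..n} (ety n e) (v (\<kappa> x (fst e))) * qf {..n} (ety n e) (v (\<kappa> x (nbd N (snd e) (fst e)))))"
   using b by (intro mult_left_mono) auto
  then show ?thesis using b by (simp add: algebra_simps)
 qed
 have "exp ((b - 36) * real (N * N)) * (s / 2) ^ (h * h) * (real n / (8 * b)) ^ (N * N)
   <= exp ((b - 36) * real (N * N)) * real Q ^ (h * h) * real T ^ (N * N)"
  using Q T s2 b by (intro mult_mono power_mono mult_nonneg_nonneg) auto
 also have "... = (\<Sum>x\<in>A. exp ((b - 36) * real (N * N)))" by (simp add: cA)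
 also have "... <= (\<Sum>x\<in>A. exp (b * (\<Sum>e\<in>edges N. qf {..n} (ety n e) (v (\<kappa> x (fst e))) * qf {..n} (ety n e) (v (\<kappa> x (nbd N (snd e) (fst e)))))))"
  using tot by (intro sum_mono) simp
 also have "... <= Zr N n b"
  by (rule Zr_ge_product_states[OF fA N(2) _ inj disj]) (use b unit kQT in auto)
 finally show ?thesis unfolding s_def h_def .
qed

section \<open>Rates for bad spins and for mismatches\<close>

lemma bad_rate:
 assumes N: "N = 2 * h" "h > 0" and b: "b >= 36" and n: "real n >= 2000 * b\<^sup>2" and ep: "0 < ep" "ep <= 1/8" and \<kappa>: "\<kappa> > 0"
  and K: "4 * (exp 38 * 144 / (ep * \<kappa>)) ^ 4 <= sqrt (sqrt b)" and h: "b <= 2 ^ h"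
 shows "LF N n b ep (%_. LB) <= Zr N n b * \<kappa> ^ (N * N)"
proof -
 \<comment> \<open>38 = 36 + 2 is the gap between the exponents of the lower and upper bounds, and
   144 = 8 * 18 compares their factors \<open>n / (8 * b)\<close> and
   \<open>18 * n / (ep * b)\<close>.\<close>
 define K where "K = exp 38 * 144 / (ep * \<kappa>)"
 define E where "E = exp ((b - 36) * real (N * N))"
 define X where "X = real n / (8 * b)"
 have pos: "K > 0" "E > 0" "X >= 0" using ep \<kappa> b by (auto simp: K_def E_def X_def)
 have eN: "even N" "N >= 2" using N by auto
 have e1: "exp ((b + 2) * real (N * N)) = E * exp 38 ^ (N * N)"
  unfolding E_def exp_of_nat_mult[symmetric] exp_add[symmetric] by (simp add: algebra_simps)
 have e2: "18 * real n / (ep * b) = X * (144 / ep)" using b ep by (simp add: X_def field_simps)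
 have e3: "exp 38 * (144 / ep) = K * \<kappa>" using \<kappa> by (simp add: K_def)
 \<comment> \<open>One factor \<open>sqrt b\<close> per row amounts to \<open>b ^ h\<close> in all,
   a boundary term that \<open>2 ^ (h * h)\<close> absorbs on a large torus.\<close>
 have e4: "sqrt b ^ N <= 2 ^ (h * h)"
 proof -
  have "sqrt b ^ N = b ^ h" using b by (simp add: N power_mult)
  also have "... <= (2 ^ h) ^ h" using h b by (intro power_mono) auto
  finally show ?thesis by (simp add: power_mult)
 qed
 \<comment> \<open>There are four sites to each z-plaquette, so the constant per site enters with
   its fourth power against the gain \<open>sqrt (sqrt b) / 2\<close>.\<close>
 have e5: "K ^ (N * N) * 2 ^ (h * h) <= (sqrt (sqrt b) / 2) ^ (h * h)"
 proof -
  have "K ^ (N * N) = (K ^ 4) ^ (h * h)" by (simp add: N power_mult[symmetric] mult_ac)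
  then have "K ^ (N * N) * 2 ^ (h * h) = (2 * K ^ 4) ^ (h * h)" by (simp add: power_mult_distrib mult_ac)
  also have "... <= (sqrt (sqrt b) / 2) ^ (h * h)" using K pos by (intro power_mono) (auto simp: K_def[symmetric])
  finally show ?thesis .
 qed
 have "LF N n b ep (%_. LB) <= exp ((b + 2) * real (N * N)) * (18 * real n / (ep * b)) ^ (N * N) * sqrt b ^ N"
  by (rule LF_bad_upper[OF eN _ n ep]) (use b in simp)
 also have "... <= exp ((b + 2) * real (N * N)) * (18 * real n / (ep * b)) ^ (N * N) * 2 ^ (h * h)"
  using e4 b ep by (intro mult_left_mono) auto
 also have "... = E * X ^ (N * N) * (exp 38 * (144 / ep)) ^ (N * N) * 2 ^ (h * h)"
  unfolding e1 e2 power_mult_distrib by (simp only: mult_ac)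
 also have "... = E * X ^ (N * N) * \<kappa> ^ (N * N) * (K ^ (N * N) * 2 ^ (h * h))"
  unfolding e3 power_mult_distrib by (simp only: mult_ac)
 also have "... <= E * X ^ (N * N) * \<kappa> ^ (N * N) * (sqrt (sqrt b) / 2) ^ (h * h)"
  using e5 pos \<kappa> by (intro mult_left_mono) auto
 also have "... = E * (sqrt (sqrt b) / 2) ^ ((N div 2) * (N div 2)) * X ^ (N * N) * \<kappa> ^ (N * N)" by (simp add: N)
 also have "... <= Zr N n b * \<kappa> ^ (N * N)"
  unfolding E_def X_def using Zr_lower[OF eN b n] \<kappa> by (intro mult_right_mono) auto
 finally show ?thesis .
qed

text \<open>The upper bound here is too large by a factor \<open>exp 38 * 16 * b\<close> per site, a
  power of \<open>b\<close>. Since at least every fourth bond along a row is a mismatch, a mismatch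
  has to pay for at most four sites, and \<open>exp (- b / 32)\<close> affords this.\<close>

lemma mismatch_rate:
 assumes N: "even N" "N >= 2" and b: "b >= 36" and n: "real n >= 2000 * b\<^sup>2" and ep: "0 < ep" "ep <= 1/8" and \<kappa>: "\<kappa> > 0"
  and K: "(exp 38 * 16 * b) ^ 4 * exp (- b / 32) <= \<kappa>" and k: "N <= 4 * nmis mism N g"
 shows "LF N n b ep (%s. g (fst s)) <= Zr N n b * (\<kappa> ^ N) ^ nmis mism N g"
proof -
 define k where "k = nmis mism N g"
 define E where "E = exp ((b - 36) * real (N * N))"
 define X where "X = real n / (8 * b)"
 define D where "D = exp 38 * 16 * b"
 define c where "c = exp (- b / 32)"
 have n1: "real n >= 1" using n b self_le_power[of b 2] by simp
 have "1 * 1 * 1 <= D" unfolding D_def using b by (intro mult_mono) auto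
 then have pos: "D >= 1" "E > 0" "X >= 0" "c > 0" using b by (auto simp: c_def E_def X_def)
 have e1: "exp ((b + 2) * real (N * N)) = E * exp 38 ^ (N * N)"
  unfolding E_def exp_of_nat_mult[symmetric] exp_add[symmetric] by (simp add: algebra_simps)
 have "real n + 1 <= X * (16 * b)" using n1 b by (simp add: X_def)
 then have e2: "(real n + 1) ^ (N * N) <= (X * (16 * b)) ^ (N * N)" by (intro power_mono) auto
 have s1: "1 <= sqrt (sqrt b) / 2"
 proof -
  have "sqrt b >= 2\<^sup>2" by (rule real_le_rsqrt) (use b in simp)
  then have "sqrt (sqrt b) >= 2" by (rule real_le_rsqrt)
  then show ?thesis by simp
 qed
 have "LF N n b ep (%s. g (fst s)) <= exp ((b + 2) * real (N * N)) * ((real n + 1) ^ N * c ^ k) ^ N"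
  unfolding c_def k_def by (rule LF_mismatch_upper[OF N _ n ep]) (use b in simp)
 also have "... = E * exp 38 ^ (N * N) * (real n + 1) ^ (N * N) * c ^ (k * N)"
  unfolding e1 by (simp only: power_mult_distrib power_mult[symmetric] mult.assoc)
 also have "... <= E * exp 38 ^ (N * N) * (X * (16 * b)) ^ (N * N) * c ^ (k * N)"
  using e2 pos by (intro mult_right_mono mult_left_mono) auto
 also have "... = E * X ^ (N * N) * (D ^ (N * N) * c ^ (k * N))"
  unfolding D_def power_mult_distrib by (simp only: mult_ac)
 also have "... <= E * X ^ (N * N) * (\<kappa> ^ N) ^ k"
 proof -
  have "N * N <= 4 * k * N" using k by (simp add: k_def)
  then have "D ^ (N * N) * c ^ (k * N) <= D ^ (4 * (k * N)) * c ^ (k * N)"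
   using pos by (intro mult_right_mono power_increasing) (auto simp: mult.assoc)
  also have "... = (D ^ 4 * c) ^ (k * N)" by (simp only: power_mult power_mult_distrib)
  also have "... <= \<kappa> ^ (k * N)" using K pos unfolding D_def c_def by (intro power_mono) auto
  also have "... = (\<kappa> ^ N) ^ k" by (simp add: power_mult[symmetric] mult.commute)
  finally show ?thesis using pos by (intro mult_left_mono) auto
 qed
 also have "... <= (E * (sqrt (sqrt b) / 2) ^ ((N div 2) * (N div 2)) * X ^ (N * N)) * (\<kappa> ^ N) ^ k"
 proof (rule mult_right_mono)
  have "E * 1 * X ^ (N * N) <= E * (sqrt (sqrt b) / 2) ^ ((N div 2) * (N div 2)) * X ^ (N * N)"
   using pos s1 by (intro mult_right_mono mult_left_mono one_le_power) auto
  then show "E * X ^ (N * N) <= E * (sqrt (sqrt b) / 2) ^ ((N div 2) * (N div 2)) * X ^ (N * N)" by simp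
 qed (use \<kappa> in auto)
 also have "... <= Zr N n b * (\<kappa> ^ N) ^ k"
  unfolding E_def X_def using Zr_lower[OF N b n] \<kappa> by (intro mult_right_mono) auto
 finally show ?thesis by (simp add: k_def)
qed

theorem pattern_bounds:
 assumes ep: "0 < ep" "ep <= 1/8" and \<kappa>: "\<kappa> > 0"
 obtains b0 where "b0 >= 36" "!!b n. b >= b0 ==> real n >= 2000 * b\<^sup>2 ==> \<exists>N0. \<forall>N\<ge>N0. even N --> (\<forall>f.
   LF N n b ep f <= Zr N n b * \<kappa> ^ card {s \<in> sites N. f s = LB} &
   LF N n b ep f <= Zr N n b * \<kappa> ^ nvert N f & LF N n b ep f <= Zr N n b * \<kappa> ^ nhor N f)"
proof
 define K where "K = 4 * (exp 38 * 144 / (ep * \<kappa>)) ^ 4"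
 define M where "M = (exp 38 * 16) ^ 4 * 160 ^ 5 / (\<kappa>::real)"
 define b0 where "b0 = max 36 (max (K ^ 4) M)"
 show "b0 >= 36" by (simp add: b0_def)
 fix b n assume "b >= b0" and n: "real n >= 2000 * b\<^sup>2"
 then have b: "b >= 36" "b >= K ^ 4" "b >= M" by (auto simp: b0_def)
 have K: "K <= sqrt (sqrt b)"
 proof -
  have "(K\<^sup>2)\<^sup>2 <= b" using b(2) by (simp add: power_mult[symmetric])
  then show ?thesis by (intro real_le_rsqrt)
 qed
 have R: "(exp 38 * 16 * b) ^ 4 * exp (- b / 32) <= \<kappa>"
 proof -
  \<comment> \<open>The fifth power does more than cancel \<open>b ^ 4\<close>: it leaves a factor
    \<open>1 / b\<close>, which makes the product as small as desired.\<close>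
  have "(b / 160) ^ 5 <= exp (b / 160) ^ 5" using exp_ge_add_one_self[of "b / 160"] b by (intro power_mono order_trans[OF _ exp_ge_add_one_self]) auto
  also have "... = exp (b / 32)" by (simp add: exp_of_nat_mult[symmetric])
  finally have "(b / 160) ^ 5 * exp (- b / 32) <= exp (b / 32) * exp (- b / 32)" by (intro mult_right_mono) auto
  also have "... = 1" by (simp add: exp_add[symmetric])
  finally have *: "b ^ 5 * exp (- b / 32) <= 160 ^ 5" by (simp add: power_divide)
  have "b * ((exp 38 * 16 * b) ^ 4 * exp (- b / 32)) = (exp 38 * 16) ^ 4 * (b ^ 5 * exp (- b / 32))"
   by (simp add: power_mult_distrib power_Suc[of b 4, simplified] mult_ac)
  also have "... <= (exp 38 * 16) ^ 4 * 160 ^ 5" by (intro mult_left_mono *) auto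
  also have "... = M * \<kappa>" using \<kappa> by (simp add: M_def)
  also have "... <= b * \<kappa>" using b \<kappa> by (intro mult_right_mono) auto
  finally show ?thesis using b by simp
 qed
 define q where "q = nat \<lceil>b\<rceil>"
 show "\<exists>N0. \<forall>N\<ge>N0. even N --> (\<forall>f.
   LF N n b ep f <= Zr N n b * \<kappa> ^ card {s \<in> sites N. f s = LB} &
   LF N n b ep f <= Zr N n b * \<kappa> ^ nvert N f & LF N n b ep f <= Zr N n b * \<kappa> ^ nhor N f)"
 \<comment> \<open>With \<open>N = 2 * h\<close> this ensures \<open>h >= 4\<close> for the ring
   argument and \<open>b <= 2 ^ h\<close> for \<open>bad_rate\<close>.\<close>
 proof (intro exI[of _ "2 * (q + 4)"] allI impI)
  fix N f assume N: "N >= 2 * (q + 4)" "even N"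
  then obtain h where h: "N = 2 * h" by blast
  have h4: "h >= 4" "q <= h" using N h by auto
  have "b <= real q" unfolding q_def using b by linarith
  also have "... <= real h" using h4 by simp
  also have "... <= 2 ^ h" using less_exp[of h] by (metis less_imp_le of_nat_le_iff of_nat_numeral of_nat_power)
  finally have "b <= 2 ^ h" .
  then have "LF N n b ep (%_. LB) <= Zr N n b * \<kappa> ^ (N * N)"
   using h4 K by (intro bad_rate[OF h _ b(1) n ep \<kappa>]) (auto simp: K_def)
  then have 1: "LF N n b ep f <= Zr N n b * \<kappa> ^ card {s \<in> sites N. f s = LB}"
   using h4 b by (intro LF_bad_bound[OF h _ _ \<kappa>]) auto
  have b0: "b >= 0" and N2: "N >= 2" using b h h4 by auto
  note 2 = LF_mismatch_bound[OF h h4(1) b0 \<kappa> mismatch_rate[OF N(2) N2 b(1) n ep \<kappa> R]]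
  show "LF N n b ep f <= Zr N n b * \<kappa> ^ card {s \<in> sites N. f s = LB} &
   LF N n b ep f <= Zr N n b * \<kappa> ^ nvert N f & LF N n b ep f <= Zr N n b * \<kappa> ^ nhor N f"
   using 1 2 by blast
 qed
qed

subsection \<open>Minimal cuts of the grid are connected through plaquettes\<close>

type_synonym edge = "site \<times> bool"

definition plaq :: "site => edge set" where
 "plaq s = {(s, False), (s, True), ((Suc (fst s), snd s), True), ((fst s, Suc (snd s)), False)}"

text \<open>The two plaquettes that contain \<open>e\<close>. On the border the natural subtraction
  truncates and the two coincide.\<close>

definition nbrs :: "edge => edge set" where
 "nbrs e = plaq (fst e) \<union> plaq (if snd e then (fst (fst e) - 1, snd (fst e)) else (fst (fst e), snd (fst e) - 1))"

definition stp :: "edge => site" where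
 "stp e = (if snd e then (fst (fst e), Suc (snd (fst e))) else (Suc (fst (fst e)), snd (fst e)))"

text \<open>Edges across the seam are dropped, which leaves a planar grid. There every edge set that
  meets each plaquette evenly is a cut, whereas the torus has cycles that wind around it.\<close>

definition gedges :: "nat => edge set" where
 "gedges N = {e. fst e \<in> sites N & stp e \<in> sites N}"

definition cut :: "nat => site set => edge set" where
 "cut N A = {e \<in> gedges N. (fst e \<in> A) ~= (stp e \<in> A)}"

definition ndist :: "nat => nat => nat" where
 "ndist x y = (x - y) + (y - x)"

definition sdist :: "site => site => nat" where
 "sdist s t = max (ndist (fst s) (fst t)) (ndist (snd s) (snd t))"

lemma plaq_nbrs: "e \<in> plaq s ==> plaq s <= nbrs e"
 unfolding nbrs_def plaq_def by auto

lemma card_nbrs: "card (nbrs e) <= 8"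
proof -
 have c: "card (plaq s) <= 4" for s unfolding plaq_def
  using card_length[of "[(s, False), (s, True), ((Suc (fst s), snd s), True), ((fst s, Suc (snd s)), False)]"] by simp
 have "card (plaq s \<union> plaq t) <= 8" for s t using card_Un_le[of "plaq s" "plaq t"] c[of s] c[of t] by linarith
 then show ?thesis unfolding nbrs_def by blast
qed

lemma finite_nbrs: "finite (nbrs e)"
 by (simp add: nbrs_def plaq_def)

lemma nbrs_dist: "e' \<in> nbrs e ==> sdist (fst e') c <= Suc (sdist (fst e) c)"
proof -
 assume "e' \<in> nbrs e"
 then have "fst (fst e') <= Suc (fst (fst e)) & fst (fst e) <= Suc (fst (fst e')) & snd (fst e') <= Suc (snd (fst e)) & snd (fst e) <= Suc (snd (fst e'))"
  by (auto simp: nbrs_def plaq_def split: if_splits)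
 then show ?thesis unfolding sdist_def ndist_def by linarith
qed

lemma finite_gedges: "finite (gedges N)"
 by (rule finite_subset[of _ "sites N \<times> UNIV"]) (auto simp: gedges_def mem_Times_iff)

fun hpot :: "edge set => nat => bool" where
 "hpot P 0 = False"
| "hpot P (Suc i) = (hpot P i ~= (((i, 0), False) \<in> P))"

fun pot :: "edge set => nat => nat => bool" where
 "pot P i 0 = hpot P i"
| "pot P i (Suc j) = (pot P i j ~= (((i, j), True) \<in> P))"

text \<open>A discrete Poincare lemma modulo 2: integrate along the bottom row and then upwards;
  evenness on plaquettes makes the result independent of the path.\<close>

lemma pot_coboundary:
 assumes ev: "!!s. Suc (fst s) < N ==> Suc (snd s) < N ==>
   (((s, False) \<in> P) ~= (((fst s, Suc (snd s)), False) \<in> P)) = (((s, True) \<in> P) ~= (((Suc (fst s), snd s), True) \<in> P))"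
  and e: "e \<in> gedges N"
 shows "(e \<in> P) = (pot P (fst (fst e)) (snd (fst e)) ~= pot P (fst (stp e)) (snd (stp e)))"
proof -
 obtain i j d where ed: "e = ((i, j), d)" by (metis surj_pair)
 have h: "(((i, j), False) \<in> P) = (pot P i j ~= pot P (Suc i) j)" if "Suc i < N" "j < N" for i j
  using that(2)
 proof (induction j)
  case (Suc j)
  then show ?case using ev[of "(i, j)"] that(1) by auto
 qed auto
 show ?thesis using e h[of i j] by (cases d) (auto simp: ed stp_def gedges_def sites_def)
qed

text \<open>The component \<open>P\<close> of \<open>e0\<close> contains all or none of the cut
  edges of a plaquette, so it meets each plaquette evenly and is itself the cut of a set
  \<open>f\<close>. According to whether \<open>f\<close> separates \<open>r\<close> from
  \<open>r'\<close>, either \<open>P\<close> or the rest of the cut is a separating cut, and it is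
  smaller unless \<open>P\<close> is everything.\<close>

lemma minimal_cut_connected:
 assumes rA: "r \<in> A" "r' ~: A" and AB: "cut N A <= B"
  and min: "!!A'. r \<in> A' ==> r' ~: A' ==> cut N A' <= B ==> card (cut N A) <= card (cut N A')"
  and e0: "e0 \<in> cut N A" and e1: "e1 \<in> cut N A"
 shows "(%a b. b \<in> nbrs a & b \<in> cut N A)\<^sup>*\<^sup>* e0 e1"
proof -
 define P where "P = {e. (%a b. b \<in> nbrs a & b \<in> cut N A)\<^sup>*\<^sup>* e0 e}"
 have PA: "P <= cut N A" unfolding P_def using e0 by (auto elim: rtranclp.cases)
 have cl: "e' \<in> P" if "e \<in> P" "e \<in> plaq s" "e' \<in> plaq s" "e' \<in> cut N A" for e e' s
  using that plaq_nbrs[of e s] unfolding P_def by (auto intro: rtranclp.rtrancl_into_rtrancl)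
 have ev: "(((s, False) \<in> P) ~= (((fst s, Suc (snd s)), False) \<in> P)) = (((s, True) \<in> P) ~= (((Suc (fst s), snd s), True) \<in> P))"
  if s: "Suc (fst s) < N" "Suc (snd s) < N" for s
 proof (cases "P \<inter> plaq s = {}")
  case True
  then show ?thesis unfolding plaq_def by blast
 next
  case False
  then obtain e where "e \<in> P" "e \<in> plaq s" by blast
  then have *: "e' \<in> P \<longleftrightarrow> e' \<in> cut N A" if "e' \<in> plaq s" for e' using cl[of e s e'] PA that by blast
  have m: "(s, False) \<in> plaq s" "(s, True) \<in> plaq s" "((Suc (fst s), snd s), True) \<in> plaq s" "((fst s, Suc (snd s)), False) \<in> plaq s"
   by (auto simp: plaq_def)
  show ?thesis unfolding *[OF m(1)] *[OF m(2)] *[OF m(3)] *[OF m(4)]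
   using s by (simp add: cut_def gedges_def stp_def sites_def mem_Times_iff) blast
 qed
 define f where "f = (%s. pot P (fst s) (snd s) ~= pot P (fst r) (snd r))"
 have cob: "e \<in> P \<longleftrightarrow> f (fst e) ~= f (stp e)" if "e \<in> gedges N" for e
  using pot_coboundary[OF ev that] unfolding f_def by blast
 have fr: "~ f r" by (simp add: f_def)
 have fin: "finite (cut N A)" using finite_gedges by (rule rev_finite_subset) (auto simp: cut_def)
 have eP: "e0 \<in> P" by (simp add: P_def)
 have "P = cut N A"
 proof (rule ccontr)
  assume "P ~= cut N A"
  then have lt: "card P < card (cut N A)" using psubset_card_mono[OF fin, of P] PA by blast
  show False
  proof (cases "f r'")
   case True
   have "cut N {s. ~ f s} = P"
   proof (rule set_eqI)
    fix e show "e \<in> cut N {s. ~ f s} \<longleftrightarrow> e \<in> P" using cob[of e] PA unfolding cut_def by blast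
   qed
   then show False using min[of "{s. ~ f s}"] True fr PA AB lt by auto
  next
   case False
   have c: "cut N {s. (s \<in> A) ~= f s} = cut N A - P" 
   proof (rule set_eqI)
    fix e
    have "e \<in> P ==> (fst e \<in> A) ~= (stp e \<in> A)" using PA unfolding cut_def by blast
    then show "e \<in> cut N {s. (s \<in> A) ~= f s} \<longleftrightarrow> e \<in> cut N A - P" using cob[of e] by (simp add: cut_def) blast
   qed
   have "card (cut N A - P) < card (cut N A)" using eP PA e0 fin by (intro psubset_card_mono) auto
   then show False using min[of "{s. (s \<in> A) ~= f s}"] False fr rA AB c by auto
  qed
 qed
 then show ?thesis using e1 by (auto simp: P_def)
qed

lemma constant_on_line:
 fixes g :: "nat => bool"
 assumes "!!j. Suc j < N ==> g j = g (Suc j)" "i < N"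
 shows "g i = g 0"
 using assms(2)
proof (induction i)
 case (Suc i)
 then show ?case using assms(1)[of i] by auto
qed simp

text \<open>The complement of a box of side less than \<open>N\<close> is covered by full rows and columns.\<close>

lemma cut_escapes:
 assumes r: "r \<in> sites N" "r' \<in> sites N" "r \<in> A" "r' ~: A" and c: "c \<in> sites N"
  and d: "d <= sdist r c" "d <= sdist r' c"
 shows "\<exists>e\<in>cut N A. (d - 1) div 2 <= sdist (fst e) c"
proof (rule ccontr)
 assume "~ ?thesis"
 then have far: "sdist (fst e) c < (d - 1) div 2" if "e \<in> cut N A" for e using that by force
 define m where "m = (d - 1) div 2"
 define out where "out = (%x y::nat. m < ndist x y)"
 have eq: "(fst e \<in> A) = (stp e \<in> A)" if "e \<in> gedges N" "sdist (fst e) c >= m" for e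
  using far[of e] that by (auto simp: cut_def m_def)
 have "sdist r c < N" using r(1) c by (auto simp: sdist_def ndist_def sites_def)
 then have dN: "2 * m + 1 < N \<or> d = 0" using d unfolding m_def by linarith
 have d0: "d > 0"
 proof (rule ccontr)
  assume "~ d > 0"
  then have "cut N A = {}" using far by force
  then have e: "(fst e \<in> A) = (stp e \<in> A)" if "e \<in> gedges N" for e using that unfolding cut_def by blast
  have "((x, y) \<in> A) = ((0, 0) \<in> A)" if "x < N" "y < N" for x y
  proof -
   have "((x, y) \<in> A) = ((x, 0) \<in> A)"
    by (rule constant_on_line[of N "%j. (x, j) \<in> A"]) (use that e[of "((x, _), True)"] in \<open>auto simp: gedges_def stp_def sites_def\<close>)
   also have "... = ((0, 0) \<in> A)"
    by (rule constant_on_line[of N "%i. (i, 0) \<in> A"]) (use that e[of "((_, 0), False)"] in \<open>auto simp: gedges_def stp_def sites_def\<close>)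
   finally show ?thesis .
  qed
  then show False using r by (metis prod.collapse sites_fst_lt)
 qed
 have ex: "\<exists>x<N. out x y" if "y < N" for y
 proof -
  have "out 0 y \<or> out (N - 1) y" using dN d0 that unfolding out_def ndist_def by linarith
  then show ?thesis using that by (metis diff_less gr_implies_not0 not_gr_zero zero_less_one)
 qed
 have col: "((x, y) \<in> A) = ((x, y') \<in> A)" if x: "x < N" "out x (fst c)" and y: "y < N" "y' < N" for x y y'
 proof -
  have "((x, j) \<in> A) = ((x, Suc j) \<in> A)" if "Suc j < N" for j
   using eq[of "((x, j), True)"] x that by (auto simp: gedges_def stp_def sites_def sdist_def ndist_def out_def)
  from constant_on_line[of N "%j. (x, j) \<in> A", OF this] y show ?thesis by blast
 qed
 have row: "((x, y) \<in> A) = ((x', y) \<in> A)" if y: "y < N" "out y (snd c)" and x: "x < N" "x' < N" for x x' y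
 proof -
  have "((j, y) \<in> A) = ((Suc j, y) \<in> A)" if "Suc j < N" for j
   using eq[of "((j, y), False)"] y that by (auto simp: gedges_def stp_def sites_def sdist_def ndist_def out_def)
  from constant_on_line[of N "%j. (j, y) \<in> A", OF this] x show ?thesis by blast
 qed
 obtain X where X: "X < N" "out X (fst c)" using ex sites_fst_lt[OF c] by blast
 obtain Y where Y: "Y < N" "out Y (snd c)" using ex sites_fst_lt[OF c] by blast
 have "(s \<in> A) = ((X, Y) \<in> A)" if s: "s \<in> sites N" "d <= sdist s c" for s
 proof -
  note l = sites_fst_lt[OF s(1)]
  have "out (fst s) (fst c) \<or> out (snd s) (snd c)" using s(2) d0 unfolding out_def sdist_def m_def by linarith
  then have "((fst s, snd s) \<in> A) = ((X, Y) \<in> A)"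
  proof
   assume "out (fst s) (fst c)"
   then show ?thesis using col[OF l(1) _ l(2) Y(1)] row[OF Y l(1) X(1)] by blast
  next
   assume "out (snd s) (snd c)"
   then show ?thesis using row[OF l(2) _ l(1) X(1)] col[OF X l(2) Y(1)] by blast
  qed
  then show ?thesis by simp
 qed
 then show False using r d by blast
qed

fun walks :: "nat => edge => edge list set" where
 "walks 0 e = {[e]}"
| "walks (Suc k) e = (\<Union>e'\<in>nbrs e. (#) e ` walks k e')"

lemma finite_walks: "finite (walks k e)"
 by (induction k arbitrary: e) (auto simp: finite_nbrs)

lemma card_walks: "card (walks k e) <= 8 ^ k"
proof (induction k arbitrary: e)
 case (Suc k)
 have "card (walks (Suc k) e) <= (\<Sum>e'\<in>nbrs e. card ((#) e ` walks k e'))" by (simp add: card_UN_le finite_nbrs)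
 also have "... <= (\<Sum>e'\<in>nbrs e. 8 ^ k)"
  using Suc by (intro sum_mono order_trans[OF card_image_le]) (auto simp: finite_walks)
 also have "... <= 8 * 8 ^ k" using card_nbrs[of e] by simp
 finally show ?case by simp
qed simp

lemma walks_length: "c \<in> walks k e ==> length c = Suc k & e \<in> set c"
 by (induction k arbitrary: e c) auto

lemma path_walks:
 assumes "rtrancl_path R x ys y" "k <= length ys" "!!a b. R a b ==> b \<in> nbrs a"
 shows "take (Suc k) (x # ys) \<in> walks k x"
 using assms
proof (induction arbitrary: k rule: rtrancl_path.induct)
 case (step x y ys z)
 show ?case
 proof (cases k)
  case (Suc k')
  then have "take (Suc k') (y # ys) \<in> walks k' y" using step by (intro step.IH) auto
  then show ?thesis unfolding Suc using step.prems(2)[OF step.hyps(1)] by auto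
 qed simp
qed simp

lemma path_dist:
 assumes "rtrancl_path R x ys y" "!!a b. R a b ==> b \<in> nbrs a"
 shows "sdist (fst y) c <= sdist (fst x) c + length ys"
 using assms
proof (induction rule: rtrancl_path.induct)
 case (step x y ys z)
 then show ?case using nbrs_dist[of y x c] by fastforce
qed simp

text \<open>A minimal cut is connected, and by \<open>cut_escapes\<close> it reaches from any of its
  edges about half as far as the nearer of \<open>r\<close> and \<open>r'\<close>. Hence a simple
  path of that length starts there. That the length grows with the distance is what makes the sum
  over starting edges converge uniformly in \<open>N\<close>.\<close>

theorem separating_walk:
 assumes r: "r \<in> sites N" "r' \<in> sites N" and A: "r \<in> A" "r' ~: A" and AB: "cut N A <= B"
 shows "\<exists>e\<in>gedges N. \<exists>c\<in>walks ((min (sdist r (fst e)) (sdist r' (fst e)) - 1) div 2) e. distinct c & set c <= B \<inter> gedges N"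
proof -
 obtain A where A: "r \<in> A" "r' ~: A" "cut N A <= B"
  and min: "!!A'. r \<in> A' ==> r' ~: A' ==> cut N A' <= B ==> card (cut N A) <= card (cut N A')"
  using ex_has_least_nat[of "%A. r \<in> A & r' ~: A & cut N A <= B" A "%A. card (cut N A)"] A AB by metis
 obtain e0 where e0: "e0 \<in> cut N A" using cut_escapes[OF r A(1,2) r(1), of 0] by auto
 define k where "k = (min (sdist r (fst e0)) (sdist r' (fst e0)) - 1) div 2"
 have g: "e0 \<in> gedges N" "fst e0 \<in> sites N" using e0 by (auto simp: cut_def gedges_def)
 obtain e1 where e1: "e1 \<in> cut N A" "k <= sdist (fst e1) (fst e0)"
  using cut_escapes[OF r A(1,2) g(2), of "min (sdist r (fst e0)) (sdist r' (fst e0))"] unfolding k_def by auto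
 let ?R = "%a b. b \<in> nbrs a & b \<in> cut N A"
 obtain xs where "rtrancl_path ?R e0 xs e1"
  using minimal_cut_connected[OF A min e0 e1(1)] unfolding rtranclp_eq_rtrancl_path by blast
 then obtain ys where p: "rtrancl_path ?R e0 ys e1" "distinct (e0 # ys)" by (rule rtrancl_path_distinct)
 have ys: "set ys <= cut N A" using p(1) by (induction rule: rtrancl_path.induct) auto
 have "sdist (fst e1) (fst e0) <= sdist (fst e0) (fst e0) + length ys" by (rule path_dist[OF p(1)]) simp
 moreover have "sdist (fst e0) (fst e0) = 0" by (simp add: sdist_def ndist_def)
 ultimately have "k <= length ys" using e1(2) by linarith
 then have "take (Suc k) (e0 # ys) \<in> walks k e0" by (intro path_walks[OF p(1)]) auto
 moreover have "distinct (take (Suc k) (e0 # ys))" using p(2) by (rule distinct_take)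
 moreover have "set (take (Suc k) (e0 # ys)) <= B \<inter> gedges N"
  using set_take_subset[of "Suc k" "e0 # ys"] ys e0 A(3) by (auto simp: cut_def)
 ultimately show ?thesis using g(1) unfolding k_def by blast
qed

section \<open>The Peierls argument\<close>

definition ltr :: "real => nat => nat => letter" where
 "ltr ep n k = (if (mz n k)\<^sup>2 >= 1 - ep then L1 else if (mz n k)\<^sup>2 <= ep then L0 else LB)"

lemma lf_ltr: "lf ep n (ltr ep n k) k = 1"
 by (auto simp: lf_def ltr_def)

lemma sum_mis_ge:
 assumes "X <= sites N" "!!s. s \<in> X ==> mism (f s) (f (nbd N d s))"
 shows "card X <= (if d then nvert N f else nhor N f)"
proof -
 have "card X = (\<Sum>s\<in>X. if mism (f s) (f (nbd N d s)) then 1 else 0)" using assms(2) by simp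
 also have "... <= (\<Sum>s\<in>sites N. if mism (f s) (f (nbd N d s)) then 1 else 0)" using assms(1) by (intro sum_mono2) auto
 also have "... = (\<Sum>i<N. \<Sum>j<N. if mism (f (i, j)) (f (nbd N d (i, j))) then 1 else 0)"
  unfolding sites_def by (simp add: sum.cartesian_product split_beta)
 also have "... = (if d then nvert N f else nhor N f)"
 proof (cases d)
  case False
  then show ?thesis unfolding nhor_def nmis_def mis_def nbd_def nb1_def by (simp, subst sum.swap) simp
 qed (simp add: nvert_def nmis_def mis_def nbd_def nb2_def)
 finally show ?thesis .
qed

lemma stp_nbd: "e \<in> gedges N ==> stp e = nbd N (snd e) (fst e)"
 by (auto simp: gedges_def stp_def nbd_def nb1_def nb2_def sites_def)

lemma stp_inj: "stp e = stp e' ==> snd e = snd e' ==> e = e'"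
 by (cases e, cases e') (auto simp: stp_def prod_eq_iff split: if_splits)

text \<open>Two different letters are a mismatch unless one of them is \<open>LB\<close>, and a site
  lies on at most four edges of the grid.\<close>

lemma bad_edge_count:
 assumes F: "F <= gedges N" and bad: "!!e. e \<in> F ==> g (fst e) ~= g (stp e) & g (fst e) ~= LI & g (stp e) ~= LI"
 shows "card F <= 4 * card {s \<in> sites N. g s = LB} + nvert N g + nhor N g"
proof -
 let ?S = "{s \<in> sites N. g s = LB}"
 define H where "H = (%d. {e \<in> F. snd e = d & mism (g (fst e)) (g (stp e))})"
 have fF: "finite F" using F finite_gedges by (rule finite_subset)
 have "F <= {e \<in> F. fst e \<in> ?S} \<union> {e \<in> F. stp e \<in> ?S} \<union> H True \<union> H False"
 proof
  fix e assume e: "e \<in> F"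
  then have "fst e \<in> sites N" "stp e \<in> sites N" using F by (auto simp: gedges_def)
  then show "e \<in> {e \<in> F. fst e \<in> ?S} \<union> {e \<in> F. stp e \<in> ?S} \<union> H True \<union> H False"
   using bad[OF e] e unfolding H_def mism_def by (cases "g (fst e)"; cases "g (stp e)"; cases "snd e") simp_all
 qed
 then have "card F <= card ({e \<in> F. fst e \<in> ?S} \<union> {e \<in> F. stp e \<in> ?S} \<union> H True \<union> H False)"
  using fF by (intro card_mono) (auto simp: H_def)
 also have "... <= card {e \<in> F. fst e \<in> ?S} + card {e \<in> F. stp e \<in> ?S} + card (H True) + card (H False)"
  by (intro order_trans[OF card_Un_le] add_mono order_refl)
 also have "card {e \<in> F. fst e \<in> ?S} <= card (?S \<times> (UNIV::bool set))" by (intro card_mono) (auto simp: mem_Times_iff)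
 also have "card {e \<in> F. stp e \<in> ?S} <= card (?S \<times> (UNIV::bool set))"
 proof (rule card_inj_on_le[of "%e. (stp e, snd e)"])
  show "inj_on (%e. (stp e, snd e)) {e \<in> F. stp e \<in> ?S}" by (rule inj_onI) (rule stp_inj, auto)
 qed auto
 also have H: "card (H d) <= (if d then nvert N g else nhor N g)" for d
 proof -
  have "card (H d) = card (fst ` H d)" by (intro card_image[symmetric]) (auto simp: H_def inj_on_def prod_eq_iff)
  also have "... <= (if d then nvert N g else nhor N g)"
  proof (rule sum_mis_ge)
   show "fst ` H d <= sites N" using F by (auto simp: H_def gedges_def)
   fix s assume "s \<in> fst ` H d"
   then obtain e where e: "e \<in> H d" "s = fst e" by (rule imageE)
   then show "mism (g s) (g (nbd N d s))" using stp_nbd[of e N] F by (auto simp: H_def)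
  qed
  finally show ?thesis .
 qed
 finally show ?thesis using H[of True] H[of False] by (simp add: card_cartesian_product)
qed

text \<open>The sixth power is the sum 4 + 1 + 1 of the weights in \<open>bad_edge_count\<close>:
  the largest of the three counts is at least a sixth of the number of bad edges, so its bound
  yields one factor \<open>x\<close> for each of them.\<close>

locale pattern =
 fixes N n :: nat and b ep x :: real
 assumes b: "b >= 0" and x: "0 < x" "x <= 1"
  and bounds: "LF N n b ep f <= Zr N n b * (x ^ 6) ^ card {s \<in> sites N. f s = LB}"
   "LF N n b ep f <= Zr N n b * (x ^ 6) ^ nvert N f" "LF N n b ep f <= Zr N n b * (x ^ 6) ^ nhor N f"
begin

text \<open>Sum over the letters at the ends of the edges in \<open>F\<close>, leaving all other
  sites free: three letters at no more than two ends per edge give the 9.\<close>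

lemma bad_edges_weight:
 assumes F: "F <= gedges N"
 shows "(\<Sum>sg\<in>confs N n. gw N n b sg * of_bool (\<forall>e\<in>F. ltr ep n (sg (fst e)) ~= ltr ep n (sg (stp e)))) <= Zr N n b * (9 * x) ^ card F"
proof -
 define V where "V = fst ` F \<union> stp ` F"
 define G where "G = {g \<in> PiE V (%_. {LB, L1, L0}). \<forall>e\<in>F. g (fst e) ~= g (stp e)}"
 define ext where "ext = (%g s. if s \<in> V then g s else LI)"
 have fF: "finite F" using F finite_gedges by (rule finite_subset)
 have V: "finite V" "V <= sites N" "card V <= 2 * card F"
  using fF F card_Un_le[of "fst ` F" "stp ` F"] card_image_le[OF fF, of fst] card_image_le[OF fF, of stp]
  by (auto simp: V_def gedges_def)
 have fP: "finite (PiE V (%_. {LB, L1, L0}))" using V by (intro finite_PiE) auto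
 have fG: "finite G" unfolding G_def using fP by simp
 have "(\<Sum>sg\<in>confs N n. gw N n b sg * of_bool (\<forall>e\<in>F. ltr ep n (sg (fst e)) ~= ltr ep n (sg (stp e))))
  <= (\<Sum>sg\<in>confs N n. gw N n b sg * (\<Sum>g\<in>G. \<Prod>s\<in>sites N. lf ep n (ext g s) (sg s)))"
 proof (intro sum_mono mult_left_mono gw_nonneg[OF b])
  fix sg
  have nn: "(\<Prod>s\<in>sites N. lf ep n (ext g s) (sg s)) >= 0" for g by (intro prod_nonneg) (auto simp: lf_range)
  show "of_bool (\<forall>e\<in>F. ltr ep n (sg (fst e)) ~= ltr ep n (sg (stp e))) <= (\<Sum>g\<in>G. \<Prod>s\<in>sites N. lf ep n (ext g s) (sg s))"
  proof (cases "\<forall>e\<in>F. ltr ep n (sg (fst e)) ~= ltr ep n (sg (stp e))")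
   case True
   define g where "g = restrict (%s. ltr ep n (sg s)) V"
   have "g \<in> G" using True unfolding G_def g_def V_def by (auto simp: ltr_def)
   then have "(\<Prod>s\<in>sites N. lf ep n (ext g s) (sg s)) <= (\<Sum>g\<in>G. \<Prod>s\<in>sites N. lf ep n (ext g s) (sg s))"
    using nn by (intro member_le_sum[OF _ _ fG]) auto
   moreover have "(\<Prod>s\<in>sites N. lf ep n (ext g s) (sg s)) = 1"
    unfolding ext_def g_def by (intro prod.neutral) (auto simp: lf_ltr, simp add: lf_def)
   ultimately show ?thesis using True by simp
  next
   case False
   have "0 <= (\<Sum>g\<in>G. \<Prod>s\<in>sites N. lf ep n (ext g s) (sg s))" by (intro sum_nonneg nn)
   then show ?thesis by (simp only: False of_bool_eq)
  qed
 qed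
 also have "... = (\<Sum>g\<in>G. LF N n b ep (ext g))"
  unfolding LF_def fw_def by (simp add: sum_distrib_left) (rule sum.swap)
 also have "... <= (\<Sum>g\<in>G. Zr N n b * x ^ card F)"
 proof (rule sum_mono)
  fix g assume g: "g \<in> G"
  define k where "k = card {s \<in> sites N. ext g s = LB}"
  have "ext g (fst e) ~= ext g (stp e) & ext g (fst e) ~= LI & ext g (stp e) ~= LI" if e: "e \<in> F" for e
  proof -
   have "fst e \<in> V" "stp e \<in> V" using e by (auto simp: V_def)
   then show ?thesis using g e PiE_mem[of g V "%_. {LB, L1, L0}"] unfolding G_def ext_def by fastforce
  qed
  then have "card F <= 4 * k + nvert N (ext g) + nhor N (ext g)" unfolding k_def by (intro bad_edge_count[OF F]) auto
  then have "card F <= 6 * k \<or> card F <= 6 * nvert N (ext g) \<or> card F <= 6 * nhor N (ext g)" by linarith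
  then obtain m where m: "card F <= 6 * m" "LF N n b ep (ext g) <= Zr N n b * (x ^ 6) ^ m"
   using bounds[of "ext g"] unfolding k_def by blast
  have "(x ^ 6) ^ m <= x ^ card F" unfolding power_mult[symmetric] using x m by (intro power_decreasing) auto
  then show "LF N n b ep (ext g) <= Zr N n b * x ^ card F"
   using m(2) Zr_pos[of N n b] by (meson less_imp_le mult_left_mono order_trans)
 qed
 also have "... = real (card G) * (Zr N n b * x ^ card F)" by simp
 also have "... <= 9 ^ card F * (Zr N n b * x ^ card F)"
 proof (rule mult_right_mono)
  have "card G <= card (PiE V (%_. {LB, L1, L0}))" unfolding G_def by (intro card_mono fP) auto
  also have "... = 3 ^ card V" using V(1) by (simp add: card_PiE numeral_3_eq_3)
  also have "... <= 3 ^ (2 * card F)" using V(3) by (intro power_increasing) auto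
  also have "... = 9 ^ card F" by (simp add: power_mult)
  finally show "real (card G) <= 9 ^ card F" by (metis of_nat_le_iff of_nat_numeral of_nat_power)
 qed (use Zr_pos[of N n b] x in auto)
 finally show ?thesis by (simp add: power_mult_distrib mult_ac)
qed

end

lemma geometric_two_sided:
 assumes t: "0 < t" "t <= (1/2::real)" and a: "a < N"
 shows "(\<Sum>i<N. t ^ ndist a i) <= 4"
proof -
 have geo: "(\<Sum>i<m. t ^ i) <= 2" for m
 proof -
  have "(\<Sum>i<m. t ^ i) = (1 - t ^ m) / (1 - t)" using t by (subst sum_gp_strict) auto
  also have "... <= 1 / (1/2)" using t by (intro frac_le) auto
  finally show ?thesis by simp
 qed
 have "(\<Sum>i<N. t ^ ndist a i) = (\<Sum>i<Suc a. t ^ ndist a i) + (\<Sum>i=Suc a..<N. t ^ ndist a i)"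
  using a by (simp only: lessThan_atLeast0) (rule sum.atLeastLessThan_concat[symmetric], auto)
 also have "(\<Sum>i<Suc a. t ^ ndist a i) = (\<Sum>i<Suc a. t ^ i)"
  by (rule sum.reindex_bij_witness[of _ "%i. a - i" "%i. a - i"]) (auto simp: ndist_def)
 also have "(\<Sum>i=Suc a..<N. t ^ ndist a i) = (\<Sum>i<N - Suc a. t ^ Suc i)"
  by (rule sum.reindex_bij_witness[of _ "%i. i + Suc a" "%i. i - Suc a"]) (auto simp: ndist_def Suc_diff_Suc simp flip: power_Suc)
 also have "... <= (\<Sum>i<N - Suc a. t ^ i)" using t by (intro sum_mono power_decreasing) auto
 finally show ?thesis using geo[of "Suc a"] geo[of "N - Suc a"] by linarith
qed

context pattern
begin

text \<open>At most \<open>8 ^ k\<close> walks of weight \<open>(9 * x) ^ (k + 1)\<close> start at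
  an edge, so \<open>72 * x = t ^ 8\<close> leaves \<open>t ^ (8 * (k + 1))\<close>. With
  \<open>k\<close> about half the distance \<open>d\<close> to the nearer of \<open>r\<close> and
  \<open>r'\<close>, this is at most \<open>t ^ (4 + 2 * d)\<close>: the part \<open>t ^ 4\<close>
  is the gain, and the rest is summable over the plane. The 64 is 2 * 32, one sum around each of the
  two sites.\<close>

theorem peierls:
 assumes t: "0 < t" "t <= 1/2" and xt: "72 * x = t ^ 8" and r: "r \<in> sites N" "r' \<in> sites N"
 shows "(\<Sum>sg\<in>confs N n. gw N n b sg * of_bool (ltr ep n (sg r) ~= ltr ep n (sg r'))) <= Zr N n b * (64 * t ^ 4)"
proof -
 define k where "k = (%e::edge. (min (sdist r (fst e)) (sdist r' (fst e)) - 1) div 2)"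
 define W where "W = (%e. {c \<in> walks (k e) e. distinct c & set c <= gedges N})"
 define bd where "bd = (%sg (c::edge list). of_bool (\<forall>e\<in>set c. ltr ep n (sg (fst e)) ~= ltr ep n (sg (stp e))) :: real)"
 have fW: "finite (W e)" for e unfolding W_def using finite_walks by simp
 have Z: "Zr N n b > 0" by (rule Zr_pos)
 have S: "(\<Sum>e\<in>gedges N. t ^ (2 * sdist q (fst e))) <= 32" if q: "q \<in> sites N" for q
 proof -
  have "(\<Sum>e\<in>gedges N. t ^ (2 * sdist q (fst e))) <= (\<Sum>e\<in>sites N \<times> (UNIV::bool set). t ^ (2 * sdist q (fst e)))"
   using t by (intro sum_mono2) (auto simp: gedges_def mem_Times_iff)
  also have "... = 2 * (\<Sum>c\<in>sites N. t ^ (2 * sdist q c))"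
   using sum.cartesian_product[of "%c (_::bool). t ^ (2 * sdist q c)" UNIV "sites N"] by (simp add: split_beta sum_distrib_left)
  also have "(\<Sum>c\<in>sites N. t ^ (2 * sdist q c)) <= (\<Sum>c\<in>sites N. t ^ ndist (fst q) (fst c) * t ^ ndist (snd q) (snd c))"
   unfolding power_add[symmetric] using t by (intro sum_mono power_decreasing) (auto simp: sdist_def)
  also have "... = (\<Sum>i<N. t ^ ndist (fst q) i) * (\<Sum>j<N. t ^ ndist (snd q) j)"
   unfolding sites_def by (simp add: sum_product sum.cartesian_product split_beta)
  also have "... <= 4 * 4"
   using geometric_two_sided[OF t] sites_fst_lt[OF q] t by (intro mult_mono sum_nonneg) auto
  finally show ?thesis by simp
 qed
 have "(\<Sum>sg\<in>confs N n. gw N n b sg * of_bool (ltr ep n (sg r) ~= ltr ep n (sg r')))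
  <= (\<Sum>sg\<in>confs N n. gw N n b sg * (\<Sum>e\<in>gedges N. \<Sum>c\<in>W e. bd sg c))"
 proof (intro sum_mono mult_left_mono gw_nonneg[OF b])
  fix sg
  have nn: "(\<Sum>c\<in>W e. bd sg c) >= 0" for e by (intro sum_nonneg) (auto simp: bd_def)
  show "of_bool (ltr ep n (sg r) ~= ltr ep n (sg r')) <= (\<Sum>e\<in>gedges N. \<Sum>c\<in>W e. bd sg c)"
  proof (cases "ltr ep n (sg r) = ltr ep n (sg r')")
   case True
   have "0 <= (\<Sum>e\<in>gedges N. \<Sum>c\<in>W e. bd sg c)" by (intro sum_nonneg nn)
   then show ?thesis using True by simp
  next
   case False
   define A where "A = {s. ltr ep n (sg s) = ltr ep n (sg r)}"
   have "cut N A <= {e. ltr ep n (sg (fst e)) ~= ltr ep n (sg (stp e))}"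
   proof
    fix e assume "e \<in> cut N A"
    then show "e \<in> {e. ltr ep n (sg (fst e)) ~= ltr ep n (sg (stp e))}" by (simp add: cut_def A_def) metis
   qed
   moreover have "r \<in> A" "r' ~: A" using False by (auto simp: A_def)
   ultimately obtain e c where e: "e \<in> gedges N" "c \<in> walks (k e) e" "distinct c" "set c <= {e. ltr ep n (sg (fst e)) ~= ltr ep n (sg (stp e))} \<inter> gedges N"
    using separating_walk[OF r, of A "{e. ltr ep n (sg (fst e)) ~= ltr ep n (sg (stp e))}"] unfolding k_def by blast
   have "1 = bd sg c" using e(4) by (auto simp: bd_def)
   also have "... <= (\<Sum>c\<in>W e. bd sg c)" using e by (intro member_le_sum fW) (auto simp: W_def bd_def)
   also have "... <= (\<Sum>e\<in>gedges N. \<Sum>c\<in>W e. bd sg c)" using e nn by (intro member_le_sum finite_gedges) auto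
   finally show ?thesis using False by simp
  qed
 qed
 also have "... = (\<Sum>e\<in>gedges N. \<Sum>c\<in>W e. \<Sum>sg\<in>confs N n. gw N n b sg * bd sg c)"
  by (simp add: sum_distrib_left sum.swap[of _ "W _" "confs N n"] sum.swap[of _ "gedges N" "confs N n"])
 also have "... <= (\<Sum>e\<in>gedges N. Zr N n b * t ^ 4 * (t ^ (2 * sdist r (fst e)) + t ^ (2 * sdist r' (fst e))))"
 proof (rule sum_mono)
  fix e assume "e \<in> gedges N"
  define d where "d = min (sdist r (fst e)) (sdist r' (fst e))"
  have "(\<Sum>c\<in>W e. \<Sum>sg\<in>confs N n. gw N n b sg * bd sg c) <= (\<Sum>c\<in>W e. Zr N n b * (9 * x) ^ Suc (k e))"
  proof (rule sum_mono)
   fix c assume c: "c \<in> W e"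
   then have "card (set c) = Suc (k e)" using walks_length[of c "k e" e] by (simp add: W_def distinct_card)
   then show "(\<Sum>sg\<in>confs N n. gw N n b sg * bd sg c) <= Zr N n b * (9 * x) ^ Suc (k e)"
    using bad_edges_weight[of "set c"] c unfolding bd_def W_def by simp
  qed
  also have "... = real (card (W e)) * (Zr N n b * (9 * x) ^ Suc (k e))" by simp
  also have "... <= 8 ^ Suc (k e) * (Zr N n b * (9 * x) ^ Suc (k e))"
  proof (rule mult_right_mono)
   have "card (W e) <= card (walks (k e) e)" unfolding W_def by (intro card_mono finite_walks) auto
   also have "... <= 8 ^ k e" by (rule card_walks)
   also have "... <= 8 ^ Suc (k e)" by simp
   finally show "real (card (W e)) <= 8 ^ Suc (k e)" by (metis of_nat_le_iff of_nat_numeral of_nat_power)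
  qed (use Z x in auto)
  also have "... = Zr N n b * (8 * (9 * x)) ^ Suc (k e)" unfolding power_mult_distrib by (simp only: mult_ac)
  also have "... = Zr N n b * t ^ (8 * Suc (k e))" using xt unfolding power_mult by (simp only: mult.assoc[symmetric], simp)
  also have "... <= Zr N n b * t ^ (4 + 2 * d)"
  proof -
   have "4 + 2 * d <= 8 * Suc (k e)" unfolding k_def d_def[symmetric] by presburger
   then show ?thesis using t Z by (intro mult_left_mono power_decreasing) auto
  qed
  also have "... <= Zr N n b * t ^ 4 * (t ^ (2 * sdist r (fst e)) + t ^ (2 * sdist r' (fst e)))"
   unfolding power_add mult.assoc using t Z by (intro mult_left_mono) (auto simp: d_def min_def)
  finally show "(\<Sum>c\<in>W e. \<Sum>sg\<in>confs N n. gw N n b sg * bd sg c) <= Zr N n b * t ^ 4 * (t ^ (2 * sdist r (fst e)) + t ^ (2 * sdist r' (fst e)))" .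
 qed
 also have "... = Zr N n b * t ^ 4 * ((\<Sum>e\<in>gedges N. t ^ (2 * sdist r (fst e))) + (\<Sum>e\<in>gedges N. t ^ (2 * sdist r' (fst e))))"
  by (simp add: sum_distrib_left sum.distrib distrib_left)
 also have "... <= Zr N n b * t ^ 4 * (32 + 32)"
  using S[OF r(1)] S[OF r(2)] t Z by (intro mult_left_mono add_mono) auto
 finally show ?thesis by simp
qed

end

text \<open>If both sites carry the same good letter, the product is at most \<open>ep\<close>,
  through its first factor for \<open>L0\<close> and its second for \<open>L1\<close>. Otherwise a
  site is bad, which is a one-letter pattern, or the letters differ, which is the event of
  \<open>peierls\<close>.\<close>

theorem order_bound:
 fixes \<delta> :: real
 assumes \<delta>: "\<delta> > 0"
 obtains b0 where "b0 >= 36" "!!b n. b >= b0 ==> real n >= 2000 * b\<^sup>2 ==> \<exists>N0. \<forall>N\<ge>N0. even N --> (\<forall>r\<in>sites N. \<forall>r'\<in>sites N.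
   (\<Sum>sg\<in>confs N n. gw N n b sg * ((mz n (sg r'))\<^sup>2 * (1 - (mz n (sg r))\<^sup>2))) <= Zr N n b * \<delta>)"
proof -
 define ep where "ep = min (1/8) (\<delta> / 4)"
 define t where "t = min (1/2) (\<delta> / 32)"
 define x where "x = t ^ 8 / 72"
 have ep: "0 < ep" "ep <= 1/8" "ep <= \<delta> / 4" and t: "0 < t" "t <= 1/2" "t <= \<delta> / 32" using \<delta> by (auto simp: ep_def t_def)
 have "t ^ 8 <= t ^ 1" using t by (intro power_decreasing) auto
 then have x: "0 < x" "x <= t" "x <= 1" using t by (auto simp: x_def)
 have "x ^ 6 <= x ^ 1" using x by (intro power_decreasing) auto
 then have k: "0 < x ^ 6" "x ^ 6 <= \<delta> / 32" using x t by auto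
 have t4: "64 * t ^ 4 <= \<delta> / 4"
 proof -
  have "t ^ 3 <= (1/2) ^ 3" using t by (intro power_mono) auto
  then have "t * t ^ 3 <= t * (1/2) ^ 3" using t by (intro mult_left_mono) auto
  then have "64 * t ^ 4 <= 8 * t" by (simp add: power_Suc[of t 3, simplified, symmetric] power_divide)
  then show ?thesis using t by simp
 qed
 obtain b0 where b0: "b0 >= 36" and P: "!!b n. b >= b0 ==> real n >= 2000 * b\<^sup>2 ==> \<exists>N0. \<forall>N\<ge>N0. even N --> (\<forall>f.
   LF N n b ep f <= Zr N n b * (x ^ 6) ^ card {s \<in> sites N. f s = LB} &
   LF N n b ep f <= Zr N n b * (x ^ 6) ^ nvert N f & LF N n b ep f <= Zr N n b * (x ^ 6) ^ nhor N f)"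
  using pattern_bounds[OF ep(1,2) k(1)] by blast
 show thesis
 proof (rule that[OF b0])
  fix b n assume bn: "b >= b0" "real n >= 2000 * b\<^sup>2"
  have b: "b >= 0" and n1: "n >= 1" using bn b0 bp_bounds(5)[of b n] by auto
  obtain N0 where N0: "!!N f. N >= N0 ==> even N ==>
   LF N n b ep f <= Zr N n b * (x ^ 6) ^ card {s \<in> sites N. f s = LB} &
   LF N n b ep f <= Zr N n b * (x ^ 6) ^ nvert N f & LF N n b ep f <= Zr N n b * (x ^ 6) ^ nhor N f"
   using P[OF bn] by blast
  show "\<exists>N0. \<forall>N\<ge>N0. even N --> (\<forall>r\<in>sites N. \<forall>r'\<in>sites N.
   (\<Sum>sg\<in>confs N n. gw N n b sg * ((mz n (sg r'))\<^sup>2 * (1 - (mz n (sg r))\<^sup>2))) <= Zr N n b * \<delta>)"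
  proof (intro exI[of _ N0] allI impI ballI)
   fix N r r' assume N: "N >= N0" "even N" and r: "r \<in> sites N" "r' \<in> sites N"
   interpret pattern N n b ep x by unfold_locales (use b x N0[OF N] in auto)
   have Z: "Zr N n b > 0" by (rule Zr_pos)
   have bad: "(\<Sum>sg\<in>confs N n. gw N n b sg * of_bool (ltr ep n (sg q) = LB)) <= Zr N n b * (\<delta> / 32)" if q: "q \<in> sites N" for q
   proof -
    define f where "f = (%s. if s = q then LB else LI)"
    have "(\<Prod>s\<in>sites N. lf ep n (f s) (sg s)) = of_bool (ltr ep n (sg q) = LB)" for sg
    proof -
     have "(\<Prod>s\<in>sites N. lf ep n (f s) (sg s)) = lf ep n (f q) (sg q) * (\<Prod>s\<in>sites N - {q}. lf ep n (f s) (sg s))"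
      using q by (intro prod.remove) auto
     also have "(\<Prod>s\<in>sites N - {q}. lf ep n (f s) (sg s)) = 1" by (intro prod.neutral) (auto simp: f_def lf_def)
     finally show ?thesis using ep by (auto simp: f_def lf_def ltr_def)
    qed
    then have "(\<Sum>sg\<in>confs N n. gw N n b sg * of_bool (ltr ep n (sg q) = LB)) = LF N n b ep f" by (simp add: LF_def fw_def)
    also have "... <= Zr N n b * (x ^ 6) ^ card {s \<in> sites N. f s = LB}" by (rule bounds)
    also have "{s \<in> sites N. f s = LB} = {q}" using q by (auto simp: f_def)
    also have "Zr N n b * (x ^ 6) ^ card {q} <= Zr N n b * (\<delta> / 32)" using mult_left_mono[OF k(2), of "Zr N n b"] Z by simp
    finally show ?thesis .
   qed
   have "(\<Sum>sg\<in>confs N n. gw N n b sg * ((mz n (sg r'))\<^sup>2 * (1 - (mz n (sg r))\<^sup>2)))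
    <= (\<Sum>sg\<in>confs N n. gw N n b sg * (ep + of_bool (ltr ep n (sg r) = LB) + of_bool (ltr ep n (sg r') = LB) + of_bool (ltr ep n (sg r) ~= ltr ep n (sg r'))))"
   proof (intro sum_mono mult_left_mono gw_nonneg[OF b])
    fix sg assume s: "sg \<in> confs N n"
    define u where "u = (mz n (sg r))\<^sup>2"
    define v where "v = (mz n (sg r'))\<^sup>2"
    have "\<bar>mz n (sg r)\<bar> <= 1" "\<bar>mz n (sg r')\<bar> <= 1" using mz_abs[OF _ n1] conf_le[OF s] r by auto
    then have uv: "0 <= u" "u <= 1" "0 <= v" "v <= 1" unfolding u_def v_def by (auto simp: abs_square_le_1)
    have p: "v * (1 - u) <= 1 * (1 - u)" "v * (1 - u) <= v * 1" using uv by (intro mult_mono; simp)+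
    have "v * (1 - u) <= ep" if "ltr ep n (sg r) ~= LB" "ltr ep n (sg r) = ltr ep n (sg r')"
     using that p unfolding ltr_def u_def[symmetric] v_def[symmetric] by (auto split: if_splits)
    then show "(mz n (sg r'))\<^sup>2 * (1 - (mz n (sg r))\<^sup>2) <= ep + of_bool (ltr ep n (sg r) = LB) + of_bool (ltr ep n (sg r') = LB) + of_bool (ltr ep n (sg r) ~= ltr ep n (sg r'))"
     unfolding u_def[symmetric] v_def[symmetric] using p uv ep by (auto simp: of_bool_def)
   qed
   also have "... = ep * Zr N n b + (\<Sum>sg\<in>confs N n. gw N n b sg * of_bool (ltr ep n (sg r) = LB)) + (\<Sum>sg\<in>confs N n. gw N n b sg * of_bool (ltr ep n (sg r') = LB))
     + (\<Sum>sg\<in>confs N n. gw N n b sg * of_bool (ltr ep n (sg r) ~= ltr ep n (sg r')))"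
    unfolding Zr_sum by (simp only: distrib_left sum.distrib sum_distrib_left mult.commute[of ep])
   also have "... <= (\<delta> / 4) * Zr N n b + Zr N n b * (\<delta> / 32) + Zr N n b * (\<delta> / 32) + Zr N n b * (\<delta> / 4)"
   proof (intro add_mono bad r)
    show "ep * Zr N n b <= (\<delta> / 4) * Zr N n b" using ep Z by (intro mult_right_mono) auto
    have "(\<Sum>sg\<in>confs N n. gw N n b sg * of_bool (ltr ep n (sg r) ~= ltr ep n (sg r'))) <= Zr N n b * (64 * t ^ 4)"
     by (rule peierls[OF t(1,2) _ r]) (simp add: x_def)
    also have "... <= Zr N n b * (\<delta> / 4)" using t4 Z by (intro mult_left_mono) auto
    finally show "(\<Sum>sg\<in>confs N n. gw N n b sg * of_bool (ltr ep n (sg r) ~= ltr ep n (sg r'))) <= Zr N n b * (\<delta> / 4)" .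
   qed
   also have "... <= Zr N n b * \<delta>" using mult_pos_pos[OF Z \<delta>] by (simp add: mult.commute)
   finally show "(\<Sum>sg\<in>confs N n. gw N n b sg * ((mz n (sg r'))\<^sup>2 * (1 - (mz n (sg r))\<^sup>2))) <= Zr N n b * \<delta>" .
  qed
 qed
qed

section \<open>Second moments of the spin components\<close>

definition "Pm n = mmul {..n} (zm n) (zm n)"
definition "Qm n = mmul {..n} (xm n) (xm n)"
definition "Rm n = msc (-1) (mmul {..n} (ym n) (ym n))"

lemma Pm_diag:
 assumes "k <= n"
 shows "Pm n k l = (if k = l then (mz n k)\<^sup>2 else 0)"
proof -
 have "Pm n k l = (\<Sum>j\<le>n. if j = k then mz n k * zm n k l else 0)"
  unfolding Pm_def mmul_def by (intro sum.cong) (auto simp: zm_def)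
 then show ?thesis using assms by (simp add: zm_def power2_eq_square)
qed

text \<open>The Casimir identity: \<open>S * (S + 1) / S^2 = 1 + 2 / n\<close> for
  \<open>S = n / 2\<close>.\<close>

lemma PQR:
 assumes k: "k <= n" and n: "n >= 1"
 shows "Pm n k l + Qm n k l + Rm n k l = (1 + 2 / n) * mid k l"
proof -
 have "xm n k j * xm n j l - ym n k j * ym n j l = (if k = l then 2 * (xm n k j * xm n k j) else 0)" for j
 proof -
  consider "j = Suc k" | "k = Suc j" | "j ~= Suc k" "k ~= Suc j" by blast
  then show ?thesis
  proof cases
   case 1
   show ?thesis unfolding 1 xm_def ym_def by simp
  next
   case 2
   show ?thesis unfolding 2 xm_def ym_def by simp
  qed (simp add: xm_def ym_def)
 qed
 then have "Qm n k l + Rm n k l = (\<Sum>j\<le>n. if k = l then 2 * (xm n k j * xm n k j) else 0)"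
  unfolding Qm_def Rm_def msc_def mmul_def by (simp add: sum_subtractf[symmetric])
 moreover have "(mz n k)\<^sup>2 + 2 * (\<Sum>j\<le>n. xm n k j * xm n k j) = 1 + 2 / n"
 proof -
  define W where "W = (real n - real k) * (real k + 1) + (real n - real k + 1) * real k"
  have q: "sqrt A / n * (sqrt A / n) = A / (real n)\<^sup>2" if "A >= 0" for A using that by (simp add: power2_eq_square)
  have "(\<Sum>j\<le>n. xm n k j * xm n k j) = W / (real n)\<^sup>2"
  proof (cases k)
   case 0
   then show ?thesis unfolding sum_xm[OF k] W_def by (simp add: xm_def power2_eq_square)
  next
   case (Suc j)
   have "xm n k (Suc k) = sqrt ((real n - real k) * (real k + 1)) / n" "xm n k j = sqrt ((real n - real j) * (real j + 1)) / n"
    by (simp_all add: xm_def Suc)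
   then have "(\<Sum>j\<le>n. xm n k j * xm n k j) = ((real n - real k) * (real k + 1)) / (real n)\<^sup>2 + ((real n - real j) * (real j + 1)) / (real n)\<^sup>2"
    unfolding sum_xm[OF k] using q[of "(real n - real k) * (real k + 1)"] q[of "(real n - real j) * (real j + 1)"] k Suc by simp
   then show ?thesis unfolding W_def by (simp add: Suc add_divide_distrib)
  qed
  then have "(mz n k)\<^sup>2 + 2 * (\<Sum>j\<le>n. xm n k j * xm n k j) = ((2 * real k - real n)\<^sup>2 + 2 * W) / (real n)\<^sup>2"
   by (simp add: mz_def power_divide add_divide_distrib)
  also have "(2 * real k - real n)\<^sup>2 + 2 * W = (real n)\<^sup>2 + 2 * real n" unfolding W_def by (simp add: power2_eq_square algebra_simps)
  finally show ?thesis using n by (simp add: add_divide_distrib power2_eq_square)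
 qed
 ultimately show ?thesis using k by (cases "k = l") (simp_all add: Pm_diag mid_def sum_distrib_left add.assoc)
qed

lemma conf_eq_site: "(\<forall>s. s ~= r --> sg s = ta s) ==> sg = ta \<longleftrightarrow> sg r = ta r"
 by (metis ext)

lemma sop_PQR:
 assumes "sg \<in> confs N n" "r \<in> sites N" "n >= 1"
 shows "sop r (Pm n) sg ta + sop r (Qm n) sg ta + sop r (Rm n) sg ta = (1 + 2 / n) * mid sg ta"
proof (cases "\<forall>s. s ~= r --> sg s = ta s")
 case True
 show ?thesis using PQR[OF conf_le[OF assms(1,2)] assms(3), of "ta r"] unfolding sop_def mid_def if_P[OF True] conf_eq_site[OF True] .
next
 case False
 then have "sg ~= ta" by blast
 then show ?thesis unfolding sop_def mid_def if_not_P[OF False] by simp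
qed

lemma tg_expand: "tg N n b Y B = (\<Sum>sg\<in>confs N n. \<Sum>ta\<in>confs N n. B sg ta * mexp (confs N n) (hamr N n b Y) ta sg)"
 by (simp add: tg_def mtr_def mmul_def)

lemma tg_add: "tg N n b Y (%sg ta. A sg ta + B sg ta) = tg N n b Y A + tg N n b Y B"
 unfolding tg_expand by (simp add: distrib_right sum.distrib)

lemma tg_msc: "tg N n b Y (msc c A) = c * tg N n b Y A"
 unfolding tg_expand msc_def by (simp add: sum_distrib_left mult.assoc)

lemma tg_sum: "tg N n b Y (%sg ta. \<Sum>a\<in>S. A a sg ta) = (\<Sum>a\<in>S. tg N n b Y (A a))"
 by (induction S rule: infinite_finite_induct) (simp_all add: tg_add, simp_all add: tg_expand)

lemma tg_diag:
 assumes "!!sg ta. sg \<in> confs N n ==> ta \<in> confs N n ==> B sg ta = (if sg = ta then d sg else 0)"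
 shows "tg N n b (ety n) B = (\<Sum>sg\<in>confs N n. gw N n b sg * d sg)"
 unfolding tg_expand gw_def
proof (intro sum.cong refl)
 fix sg assume s: "sg \<in> confs N n"
 have "(\<Sum>ta\<in>confs N n. B sg ta * mexp (confs N n) (ham N n b) ta sg) = (\<Sum>ta\<in>confs N n. if sg = ta then d sg * mexp (confs N n) (ham N n b) sg sg else 0)"
  using assms[OF s] by (intro sum.cong) auto
 then show "(\<Sum>ta\<in>confs N n. B sg ta * mexp (confs N n) (ham N n b) ta sg) = mexp (confs N n) (ham N n b) sg sg * d sg"
  using s by simp
qed

lemma tg_mid: "tg N n b (ety n) mid = Zr N n b"
 using tg_diag[of N n mid "%_. 1"] by (simp add: mid_def Zr_sum)

lemma sop_Pm:
 assumes s: "sg \<in> confs N n" and r: "r \<in> sites N"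
 shows "sop r (Pm n) sg ta = (if sg = ta then (mz n (sg r))\<^sup>2 else 0)"
  "mmul (confs N n) (sop r (Pm n)) B sg ta = (mz n (sg r))\<^sup>2 * B sg ta"
proof -
 show "sop r (Pm n) sg ta = (if sg = ta then (mz n (sg r))\<^sup>2 else 0)"
 proof (cases "\<forall>s. s ~= r --> sg s = ta s")
  case True
  show ?thesis using Pm_diag[OF conf_le[OF s r], of "ta r"] unfolding sop_def if_P[OF True] conf_eq_site[OF True] .
 next
  case False
  then have "sg ~= ta" by blast
  then show ?thesis unfolding sop_def if_not_P[OF False] by simp
 qed
 show "mmul (confs N n) (sop r (Pm n)) B sg ta = (mz n (sg r))\<^sup>2 * B sg ta"
 proof -
  have "mmul (confs N n) (sop r (Pm n)) B sg ta = (\<Sum>k\<le>n. if k = sg r then (mz n (sg r))\<^sup>2 * B sg ta else 0)"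
   unfolding mmul_sop[OF r s] using conf_le[OF s r] by (intro sum.cong) (auto simp: Pm_diag)
  then show ?thesis using conf_le[OF s r] by simp
 qed
qed

lemma mtp_sop: "mtp (sop r X) = sop r (mtp X)"
proof (intro ext)
 fix sg ta :: conf
 have "(\<forall>s. s ~= r --> ta s = sg s) = (\<forall>s. s ~= r --> sg s = ta s)" by metis
 then show "mtp (sop r X) sg ta = sop r (mtp X) sg ta" unfolding mtp_def sop_def by (simp only:)
qed

lemma mtp_mmul: "mtp (mmul I A B) = mmul I (mtp B) (mtp A)"
 by (simp add: mtp_def mmul_def mult.commute)

lemma mtp_mtp: "mtp (mtp A) = A"
 by (simp add: mtp_def)

lemma mtp_xyz: "mtp (xm n) = xm n" "mtp (zm n) = zm n" "mtp (ym n) = msc (-1) (ym n)"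
 unfolding mtp_def msc_def by (intro ext xm_sym zm_sym | auto simp: ym_def)+

lemma Rm_mtp: "Rm n = mmul {..n} (mtp (ym n)) (ym n)" "Rm n = mmul {..n} (ym n) (mtp (ym n))"
 by (simp_all add: Rm_def mtp_xyz mmul_msc_left mmul_msc_right)

lemma mtp_PQR: "mtp (Pm n) = Pm n" "mtp (Rm n) = Rm n"
 by (simp_all add: Pm_def mtp_mmul mtp_xyz(2)) (simp add: Rm_mtp(1) mtp_mmul mtp_mtp)

lemma tg_square: "tg N n b (ety n) (mmul (confs N n) (mtp B) B) >= 0"
 unfolding tg_def by (rule fin_index.mtr_square_nonneg[OF fin_index_confs msym_ham])

lemma tg_sop_same:
 assumes "r \<in> sites N"
 shows "tg N n b Y (mmul (confs N n) (sop r X) (sop r X')) = tg N n b Y (sop r (mmul {..n} X X'))"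
 by (rule tg_cong) (rule mmul_sop_same[OF assms])

lemma tg_sop_square: "r \<in> sites N ==> tg N n b (ety n) (sop r (mmul {..n} (mtp B) B)) >= 0"
 using tg_square[of N n b "sop r B"] by (simp add: mtp_sop tg_sop_same)

lemma tg_sop_cauchy_schwarz:
 assumes "mtp X = X" "mtp X' = X'"
 shows "(tg N n b (ety n) (mmul (confs N n) (sop r X) (sop r' X')))\<^sup>2
  <= tg N n b (ety n) (mmul (confs N n) (sop r X) (sop r X)) * tg N n b (ety n) (mmul (confs N n) (sop r' X') (sop r' X'))"
 using fin_index.mtr_cauchy_schwarz[OF fin_index_confs msym_ham, of N n "sop r X" "sop r' X'" N n b]
 unfolding tg_def mtp_sop assms .

text \<open>For \<open>Y = ym n\<close> one has \<open>Rm n = Y\<^sup>T Y = Y Y\<^sup>T\<close>, so \<open>(Rm n)\<^sup>2 = Y\<^sup>T (Rm n) Y\<close>, and by the sum rule the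
 difference of the two sides is a sum of squares.\<close>

lemma tg_RR_le:
 assumes r: "r \<in> sites N" and n: "n >= 1"
 shows "tg N n b (ety n) (mmul (confs N n) (sop r (Rm n)) (sop r (Rm n))) <= (1 + 2 / n) * tg N n b (ety n) (sop r (Rm n))"
proof -
 let ?J = "{..n}" and ?Y = "ym n" and ?c = "1 + 2 / n"
 let ?T = "mtp ?Y"
 let ?m = "%X. mmul ?J ?T (mmul ?J X ?Y)"
 have R: "mmul ?J (Rm n) (Rm n) = ?m (Rm n)"
 proof -
  have "mmul ?J (Rm n) (Rm n) = mmul ?J (mmul ?J ?T ?Y) (mmul ?J ?T ?Y)" by (simp only: Rm_mtp(1)[symmetric])
  also have "... = mmul ?J ?T (mmul ?J (mmul ?J ?Y ?T) ?Y)" by (simp only: mmul_assoc)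
  finally show ?thesis by (simp only: Rm_mtp(2)[symmetric])
 qed
 have sq: "?m (mmul ?J X X) = mmul ?J (mtp (mmul ?J X ?Y)) (mmul ?J X ?Y)" if "mtp X = X" for X
  by (simp add: mtp_mmul that mmul_assoc)
 have h: "mmul ?J (Pm n) ?Y i l + mmul ?J (Qm n) ?Y i l + mmul ?J (Rm n) ?Y i l = ?c * ?Y i l" if i: "i <= n" for i l
 proof -
  have "mmul ?J (Pm n) ?Y i l + mmul ?J (Qm n) ?Y i l + mmul ?J (Rm n) ?Y i l = (\<Sum>j\<le>n. (Pm n i j + Qm n i j + Rm n i j) * ?Y j l)"
   by (simp add: mmul_def sum.distrib distrib_right)
  also have "... = ?c * mmul ?J mid ?Y i l" unfolding PQR[OF i n] mmul_def by (simp add: sum_distrib_left mult.assoc)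
  finally show ?thesis using mmul_mid_left[of ?J i ?Y l] i by simp
 qed
 have e: "?m (Pm n) k l + ?m (Qm n) k l + ?m (Rm n) k l = ?c * Rm n k l" for k l
 proof -
  have "?m (Pm n) k l + ?m (Qm n) k l + ?m (Rm n) k l
    = (\<Sum>i\<le>n. ?T k i * (mmul ?J (Pm n) ?Y i l + mmul ?J (Qm n) ?Y i l + mmul ?J (Rm n) ?Y i l))"
   by (simp add: mmul_def[of _ ?T] sum.distrib distrib_left)
  also have "... = ?c * mmul ?J ?T ?Y k l" using h by (simp add: mmul_def sum_distrib_left mult_ac)
  finally show ?thesis by (simp only: Rm_mtp(1)[symmetric])
 qed
 have "tg N n b (ety n) (%sg ta. sop r (?m (Pm n)) sg ta + sop r (?m (Qm n)) sg ta + sop r (?m (Rm n)) sg ta) = tg N n b (ety n) (msc ?c (sop r (Rm n)))"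
  by (rule tg_cong) (use e in \<open>auto simp: sop_def msc_def\<close>)
 then have "tg N n b (ety n) (sop r (?m (Pm n))) + tg N n b (ety n) (sop r (?m (Qm n))) + tg N n b (ety n) (sop r (?m (Rm n)))
   = ?c * tg N n b (ety n) (sop r (Rm n))" by (simp only: tg_add tg_msc)
 moreover have "tg N n b (ety n) (sop r (?m (Pm n))) >= 0" "tg N n b (ety n) (sop r (?m (Qm n))) >= 0"
  unfolding Pm_def Qm_def sq[OF mtp_xyz(2)] sq[OF mtp_xyz(1)] using tg_sop_square[OF r] by auto
 ultimately show ?thesis unfolding tg_sop_same[OF r] R by linarith
qed

lemma tg_sop_rl:
 assumes p: "bij_betw \<pi> (sites N) (sites N)" and r: "r \<in> sites N"
  and H: "!!sg ta. sg \<in> confs N n ==> ta \<in> confs N n ==> hamr N n b Y (rl N \<pi> sg) (rl N \<pi> ta) = hamr N n b Y' sg ta"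
 shows "tg N n b Y (sop r X) = tg N n b Y' (sop (\<pi> r) X)"
proof -
 have "tg N n b Y (sop r X) = tg N n b Y' (%sg ta. sop r X (rl N \<pi> sg) (rl N \<pi> ta))" by (rule tg_rl[OF p]) (rule H)
 also have "... = tg N n b Y' (sop (\<pi> r) X)" by (rule tg_cong) (rule sop_rl[OF p _ _ r])
 finally show ?thesis .
qed

text \<open>A shift by one site changes edge types, so transitivity on sites has to come from
  elsewhere: bond reflections move the first coordinate to 0, and the exchange of coordinates does
  the rest.\<close>

lemma tg_sop_uniform:
 assumes N: "even N" "N > 0" and r: "r \<in> sites N"
 shows "tg N n b (ety n) (sop r X) = tg N n b (ety n) (sop (0, 0) X)"
proof -
 have R: "tg N n b (ety n) (sop s X) = tg N n b (ety n) (sop (refl1 N a s) X)" if "odd a" "s \<in> sites N" for a s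
  by (rule tg_sop_rl[OF refl1_bij that(2) ham_refl1[OF N that(1)]])
 have W: "tg N n b (ety n) (sop s X) = tg N n b (ety n) (sop (prod.swap s) X)" if "s \<in> sites N" for s
  by (rule tg_sop_rl[OF swap_bij that ham_swap])
 have z: "tg N n b (ety n) (sop s X) = tg N n b (ety n) (sop (0, snd s) X)" if s: "s \<in> sites N" for s
 proof -
  \<comment> \<open>An odd first coordinate can itself serve as the parameter of the reflection,
    which then moves it to 0; an even one is first reflected to an odd one.\<close>
  have o: "tg N n b (ety n) (sop s X) = tg N n b (ety n) (sop (0, snd s) X)" if s: "s \<in> sites N" "odd (fst s)" for s
   using R[OF s(2,1)] by (simp add: refl1_def rf_def)
  show ?thesis
  proof (cases "odd (fst s)")
   case False
   then have "odd (fst (refl1 N 1 s))" using rf_parity[OF N(2,1)] by (simp add: refl1_def)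
   then show ?thesis using R[of 1 s] o[of "refl1 N 1 s"] refl1_sites[OF s] s by (simp add: refl1_def)
  qed (rule o[OF s])
 qed
 have "(0, snd r) \<in> sites N" "(snd r, 0) \<in> sites N" using r by (auto simp: sites_def)
 then show ?thesis using z[OF r] W[of "(0, snd r)"] z[of "(snd r, 0)"] by simp
qed

lemma Pm_vm: "i <= n ==> k <= n ==> n >= 1 ==> mmul {..n} (Pm n) (vm n) i k = mmul {..n} (vm n) (Qm n) i k"
proof -
 assume a: "i <= n" "k <= n" "n >= 1"
 have "mmul {..n} (Pm n) (vm n) i k = mmul {..n} (zm n) (mmul {..n} (vm n) (xm n)) i k"
  unfolding Pm_def mmul_assoc by (rule mmul_cong) (use zm_vm a in auto)
 also have "... = mmul {..n} (mmul {..n} (vm n) (xm n)) (xm n) i k"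
  unfolding mmul_assoc[symmetric] by (rule mmul_cong) (use zm_vm a in auto)
 finally show ?thesis by (simp add: Qm_def mmul_assoc)
qed

text \<open>The intertwiner turns third components into first ones but exchanges the edge types.
  Inversion about \<open>r\<close> restores the types; it leaves the observable at \<open>r\<close>
  in place and moves the one at \<open>r'\<close>.\<close>

lemma tg_PQ:
 assumes N: "even N" "N >= 2" and n: "n >= 1" and r: "r \<in> sites N" "r' \<in> sites N"
 shows "tg N n b (ety n) (sop r (Pm n)) = tg N n b (ety n) (sop r (Qm n))"
  "tg N n b (ety n) (mmul (confs N n) (sop r (Pm n)) (sop r' (Pm n)))
   = tg N n b (ety n) (mmul (confs N n) (sop r (Qm n)) (sop (inv2 N r r') (Qm n)))"
proof -
 have N0: "N > 0" using N by simp
 have I: "intw (confs N n) (pvm N n) (sop s (Pm n)) (sop s (Qm n))" if "s \<in> sites N" for s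
  by (rule intw_sop[OF that]) (use Pm_vm n in auto)
 note H = ham_inv2[OF N(1) N0, where r=r]
 show "tg N n b (ety n) (sop r (Pm n)) = tg N n b (ety n) (sop r (Qm n))"
 proof -
  have "tg N n b (etys n) (sop r (Qm n)) = tg N n b (ety n) (sop (inv2 N r r) (Qm n))" by (rule tg_sop_rl[OF inv2_bij r(1)]) (rule H)
  then show ?thesis using tg_swap[OF N(2) n I[OF r(1)], of b] inv2_self[OF r(1)] by simp
 qed
 have "tg N n b (etys n) (mmul (confs N n) (sop r (Qm n)) (sop r' (Qm n)))
   = tg N n b (ety n) (mmul (confs N n) (sop r (Qm n)) (sop (inv2 N r r') (Qm n)))"
 proof -
  have "tg N n b (etys n) (mmul (confs N n) (sop r (Qm n)) (sop r' (Qm n))) = tg N n b (ety n) (%sg ta.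
    mmul (confs N n) (sop r (Qm n)) (sop r' (Qm n)) (rl N (inv2 N r) sg) (rl N (inv2 N r) ta))" by (rule tg_rl[OF inv2_bij]) (rule H)
  also have "... = tg N n b (ety n) (mmul (confs N n) (sop r (Qm n)) (sop (inv2 N r r') (Qm n)))"
   unfolding mmul_rl[OF inv2_bij]
   by (intro tg_cong mmul_cong) (use sop_rl[OF inv2_bij _ _ r(1)] sop_rl[OF inv2_bij _ _ r(2)] inv2_self[OF r(1)] in auto)
  finally show ?thesis .
 qed
 then show "tg N n b (ety n) (mmul (confs N n) (sop r (Pm n)) (sop r' (Pm n)))
   = tg N n b (ety n) (mmul (confs N n) (sop r (Qm n)) (sop (inv2 N r r') (Qm n)))"
  using tg_swap[OF N(2) n intw_mmul[OF I[OF r(1)] I[OF r(2)]], of b] by simp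
qed

text \<open>The square of the difference of the two site matrices has nonnegative
  expectation.\<close>

lemma tg_eop_le:
 assumes r: "r \<in> sites N" "r' \<in> sites N" "r ~= r'" and X: "mtp X = X"
 shows "2 * tg N n b (ety n) (eop r r' X) <= tg N n b (ety n) (sop r (mmul {..n} X X)) + tg N n b (ety n) (sop r' (mmul {..n} X X))"
proof -
 let ?B = "%sg ta. sop r X sg ta + msc (-1) (sop r' X) sg ta"
 have "mtp (sop s X) sg ta = sop s X sg ta" for s sg ta by (simp only: mtp_sop X)
 then have t: "mtp ?B = ?B" unfolding mtp_def msc_def by simp
 have "tg N n b (ety n) (mmul (confs N n) ?B ?B) = tg N n b (ety n) (%sg ta. sop r (mmul {..n} X X) sg ta + sop r' (mmul {..n} X X) sg ta + msc (-2) (eop r r' X) sg ta)"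
 proof (rule tg_cong)
  fix sg ta assume s: "sg \<in> confs N n" "ta \<in> confs N n"
  show "mmul (confs N n) ?B ?B sg ta = sop r (mmul {..n} X X) sg ta + sop r' (mmul {..n} X X) sg ta + msc (-2) (eop r r' X) sg ta"
   unfolding mmul_add_left mmul_add_right mmul_msc_left mmul_msc_right unfolding msc_apply mmul_sop_same[OF r(1) s(1)] mmul_sop_same[OF r(2) s(1)]
    eop_eq_mmul[OF r s, symmetric] eop_eq_mmul[OF r(2,1) r(3)[symmetric] s, symmetric] eop_commute[of r' r] by simp
 qed
 then show ?thesis using tg_square[of N n b ?B] unfolding t tg_add tg_msc by linarith
qed

text \<open>By \<open>tg_eop_le\<close> and uniformity the mean energy is at most \<open>b\<close>
  per site times the second moments of the first and third components together. By convexity it is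
  at least the logarithm of \<open>Z\<close> over the dimension, which \<open>Zr_lower\<close>
  bounds by nearly \<open>b\<close> per site. So the two moments nearly exhaust the Casimir
  value.\<close>

theorem energy_bound:
 assumes N: "even N" "N >= 2" and b: "b >= 36" and n: "real n >= 2000 * b\<^sup>2" and r: "r \<in> sites N"
 shows "Zr N n b * (1 - 14 / sqrt b) <= tg N n b (ety n) (sop r (Pm n)) + tg N n b (ety n) (sop r (Qm n))"
proof -
 define Z where "Z = Zr N n b"
 define M where "M = real (N * N)"
 define T where "T = tg N n b (ety n) (sop r (Pm n)) + tg N n b (ety n) (sop r (Qm n))"
 have N0: "N > 0" using N by simp
 have Z: "Z > 0" and M: "M > 0" using Zr_pos N0 by (auto simp: Z_def M_def)
 have n1: "real n >= 1" using n b self_le_power[of b 2] by simp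
 have u: "tg N n b (ety n) (sop s X) = tg N n b (ety n) (sop r X)" if "s \<in> sites N" for s X
  using tg_sop_uniform[OF N(1) N0 that] tg_sop_uniform[OF N(1) N0 r] by simp
 let ?w = "%X s. tg N n b (ety n) (sop s X) / 2"
 have edge: "tg N n b (ety n) (eop (fst e) (nbd N (snd e) (fst e)) (ety n e)) <=
   (if even (crd (snd e) (fst e)) = True then ?w (Qm n) (fst e) + ?w (Qm n) (nbd N (snd e) (fst e)) else 0)
  + (if even (crd (snd e) (fst e)) = False then ?w (Pm n) (fst e) + ?w (Pm n) (nbd N (snd e) (fst e)) else 0)" if e: "e \<in> edges N" for e
 proof -
  have rs: "fst e \<in> sites N" "nbd N (snd e) (fst e) \<in> sites N" "fst e ~= nbd N (snd e) (fst e)"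
   using e nbd_sites[of "fst e" N "snd e"] nbd_neq[OF _ N(2), of "fst e" "snd e"] by (auto simp: edges_iff simp del: split_paired_All)
  show ?thesis using tg_eop_le[OF rs mtp_xyz(1)[of n], of n b] tg_eop_le[OF rs mtp_xyz(2)[of n], of n b]
   by (cases "even (crd (snd e) (fst e))") (simp_all add: ety_def Pm_def Qm_def)
 qed
 have "tg N n b (ety n) (ham N n b) = b * (\<Sum>e\<in>edges N. tg N n b (ety n) (eop (fst e) (nbd N (snd e) (fst e)) (ety n e)))"
  unfolding tg_sum[symmetric] tg_msc[symmetric] hamr_def msc_def ..
 also have "... <= b * (\<Sum>e\<in>edges N. (if even (crd (snd e) (fst e)) = True then ?w (Qm n) (fst e) + ?w (Qm n) (nbd N (snd e) (fst e)) else 0)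
  + (if even (crd (snd e) (fst e)) = False then ?w (Pm n) (fst e) + ?w (Pm n) (nbd N (snd e) (fst e)) else 0))"
  using b by (intro mult_left_mono sum_mono edge) auto
 also have "... = b * (2 * (\<Sum>s\<in>sites N. ?w (Qm n) s) + 2 * (\<Sum>s\<in>sites N. ?w (Pm n) s))"
  unfolding sum.distrib edge_sum[OF N(1), where w="?w (Qm n)"] edge_sum[OF N(1), where w="?w (Pm n)"] ..
 also have "... = b * (M * T)" using u by (simp add: T_def M_def card_sites sum_divide_distrib[symmetric] algebra_simps)
 finally have "tg N n b (ety n) (ham N n b) / Z <= b * (M * T) / Z" using Z by (intro divide_right_mono) auto
 moreover have "ln (Z / card (confs N n)) <= tg N n b (ety n) (ham N n b) / Z"
  unfolding Z_def Zr_def tg_def by (rule fin_index.trace_energy_bound[OF fin_index_confs msym_ham confs_nonempty])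
 moreover have "M * (b - 36 - ln (16 * b)) <= ln (Z / card (confs N n))"
 proof -
  have s1: "1 <= sqrt (sqrt b) / 2"
  proof -
   have "sqrt b >= 2\<^sup>2" by (rule real_le_rsqrt) (use b in simp)
   then have "sqrt (sqrt b) >= 2" by (rule real_le_rsqrt)
   then show ?thesis by simp
  qed
  have "exp (b - 36) / (16 * b) <= exp (b - 36) * (real n / (8 * b)) / (real n + 1)"
  proof -
   have "exp (b - 36) * (real n / (8 * b)) / (real n + 1) = exp (b - 36) / (16 * b) * (2 * real n / (real n + 1))" by simp
   moreover have "1 <= 2 * real n / (real n + 1)" using n1 by simp
   moreover have "0 <= exp (b - 36) / (16 * b)" using b by simp
   ultimately show ?thesis using mult_left_mono[of 1 "2 * real n / (real n + 1)" "exp (b - 36) / (16 * b)"] by (simp only: mult_1_right)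
  qed
  then have "(exp (b - 36) / (16 * b)) ^ (N * N) <= (exp (b - 36) * (real n / (8 * b)) / (real n + 1)) ^ (N * N)"
   using b by (intro power_mono) auto
  also have "... = exp ((b - 36) * real (N * N)) * 1 * (real n / (8 * b)) ^ (N * N) / (real n + 1) ^ (N * N)"
   by (simp add: power_mult_distrib power_divide exp_of_nat_mult[symmetric] mult.commute)
  also have "... <= exp ((b - 36) * real (N * N)) * (sqrt (sqrt b) / 2) ^ ((N div 2) * (N div 2)) * (real n / (8 * b)) ^ (N * N) / (real n + 1) ^ (N * N)"
   using s1 b by (intro divide_right_mono mult_right_mono mult_left_mono one_le_power) auto
  also have "... <= Z / (real n + 1) ^ (N * N)" unfolding Z_def by (intro divide_right_mono Zr_lower[OF N b n]) auto
  also have "(real n + 1) ^ (N * N) = card (confs N n)" by (simp add: card_confs add.commute)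
  finally have "ln ((exp (b - 36) / (16 * b)) ^ (N * N)) <= ln (Z / card (confs N n))" using b Z by (intro ln_mono) auto
  moreover have "ln ((exp (b - 36) / (16 * b)) ^ (N * N)) = M * (b - 36 - ln (16 * b))"
   using b by (simp add: ln_realpow ln_div M_def)
  ultimately show ?thesis by simp
 qed
 ultimately have "M * (b - 36 - ln (16 * b)) <= M * (b * (T / Z))" by (simp add: mult_ac)
 then have main: "b - 36 - ln (16 * b) <= b * (T / Z)" using M by (simp only: mult_le_cancel_left_pos)
 define s where "s = sqrt b"
 have s6: "s >= 6" unfolding s_def by (rule real_le_rsqrt) (use b in simp)
 have ss: "b = s * s" using b by (simp add: s_def)
 \<comment> \<open>With \<open>s = sqrt b >= 6\<close> one has \<open>36 <= 6 * s\<close> and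
   \<open>ln (16 * b) <= 8 * s\<close>; division by \<open>b = s * s\<close> gives the 14.\<close>
 have "ln (16 * b) = ln ((4 * s)\<^sup>2)" by (simp add: ss power2_eq_square)
 also have "... = 2 * ln (4 * s)" using s6 by (subst ln_realpow) auto
 also have "... <= 8 * s" using ln_le_minus_one[of "4 * s"] s6 by simp
 finally have "b * (1 - 14 / s) <= b * (T / Z)" using main s6 unfolding ss by (simp add: algebra_simps)
 then have "1 - 14 / s <= T / Z" using b by (simp only: mult_le_cancel_left_pos)
 then show ?thesis using Z unfolding Z_def[symmetric] T_def[symmetric] s_def[symmetric] by (simp add: pos_le_divide_eq mult.commute)
qed

fun axm :: "nat => axis => nat => nat => real" where
 "axm n AX = Qm n"
| "axm n AY = Rm n"
| "axm n AZ = Pm n"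

lemma sq_corr_expect:
 assumes n: "n >= 1" and N: "N >= 2" and r: "r \<in> sites N" "r' \<in> sites N"
 shows "complex_of_real (1 / spinS n ^ 4) * expect N n J J \<beta> (sq_corr N n a r a' r')
   = complex_of_real (tg N n (\<beta> * J) (ety n) (mmul (confs N n) (sop r (axm n a)) (sop r' (axm n a'))) / Zr N n (\<beta> * J))"
proof -
 have G: "crel N n (gibbs N n J J \<beta>) (mexp (confs N n) (ham N n (\<beta> * J)))"
  unfolding gibbs_def by (rule crel_exp[OF crel_hamiltonian[OF n N]])
 have S: "crel N n (op_mult N n (spin_op a n r) (spin_op a n r)) (msc ((spinS n)\<^sup>2) (sop r (axm n a)))" if "r \<in> sites N" for a r
  using crel_spin_sq[OF n that] by (cases a) (auto simp: Pm_def Qm_def Rm_def)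
 have "crel N n (sq_corr N n a r a' r') (msc (spinS n ^ 4) (mmul (confs N n) (sop r (axm n a)) (sop r' (axm n a'))))"
  using crel_mult[OF S[OF r(1), of a] S[OF r(2), of a']]
  unfolding sq_corr_def crel_def mmul_msc_left mmul_msc_right msc_apply mult.assoc[symmetric] by (simp flip: power_add)
 note T = crel_trace[OF crel_mult[OF this G]]
 have "spinS n ~= 0" using n by (simp add: spinS_def)
 then show ?thesis unfolding expect_def T crel_trace[OF G] tg_def[symmetric] Zr_def[symmetric] tg_msc
  by (simp flip: of_real_mult of_real_divide)
qed

text \<open>The second component has a moment of order \<open>1 / sqrt b\<close>, and the other two
  moments are equal, so each is nearly 1/2. Long range order makes the two-point function of the
  third component nearly its one-point function; symmetry transfers this to the first. Mixed
  correlations follow from the Casimir identity at one of the two sites.\<close>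

theorem correlation_bounds:
 fixes \<delta> b :: real
 assumes N: "even N" "N >= 2" and b: "b >= 36" and n: "real n >= 2000 * b\<^sup>2" and r: "r \<in> sites N" "r' \<in> sites N"
  and ord: "!!r r'. r \<in> sites N ==> r' \<in> sites N ==>
   (\<Sum>sg\<in>confs N n. gw N n b sg * ((mz n (sg r'))\<^sup>2 * (1 - (mz n (sg r))\<^sup>2))) <= Zr N n b * \<delta>"
 defines "E \<equiv> %X Y. tg N n b (ety n) (mmul (confs N n) (sop r (X n)) (sop r' (Y n))) / Zr N n b" and "\<Gamma> \<equiv> 15 / sqrt b"
 shows "1/2 - \<Gamma> / 2 - \<delta> <= E Pm Pm" "1/2 - \<Gamma> / 2 - \<delta> <= E Qm Qm" "E Rm Rm <= 2 * \<Gamma>" "\<bar>E Qm Pm\<bar> <= \<delta> + \<Gamma> + sqrt (2 * \<Gamma>)"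
proof -
 define Z where "Z = Zr N n b"
 define t where "t = (%X r. tg N n b (ety n) (sop r (X n)))"
 define T where "T = (%X r Y r'. tg N n b (ety n) (mmul (confs N n) (sop r (X n)) (sop r' (Y n))))"
 define c where "c = 1 + 2 / real n"
 have Z: "Z > 0" unfolding Z_def by (rule Zr_pos)
 have b0: "b >= 0" using b by simp
 have sb: "sqrt b >= 6" by (rule real_le_rsqrt) (use b in simp)
 have "sqrt b * 1 <= sqrt b * sqrt b" using sb b by (intro mult_left_mono) auto
 then have "sqrt b <= b" using b by simp
 moreover have "b * 1 <= b * b" using b by (intro mult_left_mono) auto
 ultimately have nb: "2 * sqrt b <= real n" using n b unfolding power2_eq_square by linarith
 then have n1: "n >= 1" using sb b by (cases n) auto
 have n2: "2 / real n <= 1 / sqrt b" using nb n1 sb b by (simp add: field_simps)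
 have "1 / sqrt b <= 1 / 6" using sb b by (intro divide_left_mono) auto
 then have c: "1 <= c" "c <= 2" unfolding c_def using n2 by auto
 have G0: "\<Gamma> > 0" "1 / sqrt b <= \<Gamma>" "\<Gamma> = 15 * (1 / sqrt b)" using b sb by (auto simp: \<Gamma>_def divide_right_mono)
 have msq: "0 <= (mz n (sg q))\<^sup>2" "(mz n (sg q))\<^sup>2 <= 1" if "sg \<in> confs N n" "q \<in> sites N" for sg q
  using mz_sq[OF conf_le[OF that] n1] by auto
 have lin: "t Pm q + t Qm q + t Rm q = c * Z" if q: "q \<in> sites N" for q
 proof -
  have "tg N n b (ety n) (%sg ta. sop q (Pm n) sg ta + sop q (Qm n) sg ta + sop q (Rm n) sg ta) = tg N n b (ety n) (msc c mid)"
   by (rule tg_cong) (simp add: sop_PQR[OF _ q n1] msc_def c_def)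
  then show ?thesis unfolding t_def Z_def by (simp only: tg_add tg_msc tg_mid)
 qed
 \<comment> \<open>15 = 14 + 1: the additional unit absorbs \<open>2 / n\<close>, the surplus of the
   Casimir value over 1.\<close>
 have R: "t Rm q <= Z * \<Gamma>" if q: "q \<in> sites N" for q
 proof -
  have "Z * (1 - 14 / sqrt b) <= t Pm q + t Qm q" unfolding Z_def t_def by (rule energy_bound[OF N b n q])
  then have "t Rm q <= Z * (2 / real n + 14 / sqrt b)" using lin[OF q] unfolding c_def by (simp add: algebra_simps)
  also have "... <= Z * \<Gamma>" using n2 Z by (intro mult_left_mono) (auto simp: \<Gamma>_def)
  finally show ?thesis .
 qed
 \<comment> \<open>A fourth moment at one site, controlled by the second moment through
   \<open>tg_RR_le\<close>; Cauchy-Schwarz later reduces correlations at two sites to it.\<close>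
 have RR: "T Rm q Rm q <= Z * (2 * \<Gamma>)" "0 <= T Rm q Rm q" if q: "q \<in> sites N" for q
 proof -
  have "T Rm q Rm q <= c * t Rm q" unfolding T_def t_def c_def by (rule tg_RR_le[OF q n1])
  also have "... <= 2 * t Rm q" using c tg_sop_square[OF q, of n b "ym n"] unfolding t_def Rm_mtp(1)[symmetric] by (intro mult_right_mono) auto
  finally show "T Rm q Rm q <= Z * (2 * \<Gamma>)" using R[OF q] by simp
  show "0 <= T Rm q Rm q" using tg_square[of N n b "sop q (Rm n)"] unfolding T_def mtp_sop mtp_PQR .
 qed
 have tP: "t Pm q = (\<Sum>sg\<in>confs N n. gw N n b sg * (mz n (sg q))\<^sup>2)" if q: "q \<in> sites N" for q
  unfolding t_def by (rule tg_diag) (rule sop_Pm(1)[OF _ q])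
 have TP: "T Pm q Pm q' = (\<Sum>sg\<in>confs N n. gw N n b sg * ((mz n (sg q))\<^sup>2 * (mz n (sg q'))\<^sup>2))" if q: "q \<in> sites N" "q' \<in> sites N" for q q'
  unfolding T_def by (rule tg_diag) (simp add: sop_Pm(2)[OF _ q(1)] sop_Pm(1)[OF _ q(2)])
 have diff: "0 <= t Pm q' - T Pm q Pm q'" "t Pm q' - T Pm q Pm q' <= Z * \<delta>" if q: "q \<in> sites N" "q' \<in> sites N" for q q'
 proof -
  have e: "t Pm q' - T Pm q Pm q' = (\<Sum>sg\<in>confs N n. gw N n b sg * ((mz n (sg q'))\<^sup>2 * (1 - (mz n (sg q))\<^sup>2)))"
   unfolding tP[OF q(2)] TP[OF q] sum_subtractf[symmetric] by (simp add: algebra_simps)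
  show "t Pm q' - T Pm q Pm q' <= Z * \<delta>" unfolding e Z_def by (rule ord[OF q])
  show "0 <= t Pm q' - T Pm q Pm q'" unfolding e
   by (intro sum_nonneg mult_nonneg_nonneg gw_nonneg[OF b0]) (use msq q in auto)
 qed
 have tP1: "t Pm q <= Z" "T Pm q Pm q <= Z" if q: "q \<in> sites N" for q
 proof -
  have "gw N n b sg * (mz n (sg q))\<^sup>2 <= gw N n b sg * 1" if "sg \<in> confs N n" for sg
   using msq[OF that q] by (intro mult_left_mono gw_nonneg[OF b0 that]) auto
  then show "t Pm q <= Z" unfolding tP[OF q] Z_def Zr_sum by (simp add: sum_mono)
  then show "T Pm q Pm q <= Z" using diff(1)[OF q q] by linarith
 qed
 have P: "Z * (1 - \<Gamma>) / 2 <= t Pm q" if q: "q \<in> sites N" for q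
 proof -
  have "t Pm q = t Qm q" unfolding t_def by (rule tg_PQ(1)[OF N n1 q q])
  then have "2 * t Pm q >= c * Z - Z * \<Gamma>" using lin[OF q] R[OF q] by linarith
  moreover have "1 * Z <= c * Z" using c Z by (intro mult_right_mono) auto
  ultimately show ?thesis by (simp add: algebra_simps)
 qed
 have low: "1/2 - \<Gamma> / 2 - \<delta> <= T Pm q Pm q' / Z" if q: "q \<in> sites N" "q' \<in> sites N" for q q'
 proof -
  have "(1/2 - \<Gamma> / 2 - \<delta>) * Z <= T Pm q Pm q'" using P[OF q(2)] diff(2)[OF q] by (simp add: field_simps)
  then show ?thesis using Z by (simp add: pos_le_divide_eq)
 qed
 show "1/2 - \<Gamma> / 2 - \<delta> <= E Pm Pm" using low[OF r] unfolding E_def T_def Z_def .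
 \<comment> \<open>The inversion about \<open>r\<close> moves \<open>s\<close> to \<open>r'\<close>,
   so the first-component correlation at \<open>r, r'\<close> is the third-component one at
   \<open>r, s\<close>.\<close>
 obtain s where s: "s \<in> sites N" "inv2 N r s = r'" using inv2_bij[of N r] r(2) unfolding bij_betw_def by (metis imageE)
 then have "T Qm r Qm r' = T Pm r Pm s" unfolding T_def using tg_PQ(2)[OF N n1 r(1) s(1), of b] by simp
 then show "1/2 - \<Gamma> / 2 - \<delta> <= E Qm Qm" using low[OF r(1) s(1)] unfolding E_def T_def Z_def by simp
 have le: "\<bar>x\<bar> <= Z * y" if "x\<^sup>2 <= (Z * y)\<^sup>2" "y >= 0" for x y
  using that Z abs_le_square_iff[of x "Z * y"] by simp
 have "(T Rm r Rm r')\<^sup>2 <= T Rm r Rm r * T Rm r' Rm r'" unfolding T_def by (rule tg_sop_cauchy_schwarz[OF mtp_PQR(2) mtp_PQR(2)])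
 also have "... <= (Z * (2 * \<Gamma>)) * (Z * (2 * \<Gamma>))" using RR r Z G0 by (intro mult_mono) auto
 finally have "(T Rm r Rm r')\<^sup>2 <= (Z * (2 * \<Gamma>))\<^sup>2" by (simp only: power2_eq_square)
 then have "\<bar>T Rm r Rm r'\<bar> <= Z * (2 * \<Gamma>)" using G0 by (intro le) auto
 then have "T Rm r Rm r' <= (2 * \<Gamma>) * Z" by (simp add: abs_le_iff mult.commute)
 then show "E Rm Rm <= 2 * \<Gamma>" using Z unfolding E_def T_def Z_def by (simp add: pos_divide_le_eq)
 have "(T Rm r Pm r')\<^sup>2 <= T Rm r Rm r * T Pm r' Pm r'" unfolding T_def by (rule tg_sop_cauchy_schwarz[OF mtp_PQR(2) mtp_PQR(1)])
 also have "... <= (Z * (2 * \<Gamma>)) * Z"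
 proof (rule mult_mono)
  show "0 <= T Pm r' Pm r'" using tg_square[of N n b "sop r' (Pm n)"] unfolding T_def mtp_sop mtp_PQR .
 qed (use RR[OF r(1)] tP1[OF r(2)] Z G0 in auto)
 also have "... = (Z * sqrt (2 * \<Gamma>))\<^sup>2" 
 proof -
  have "(sqrt (2 * \<Gamma>))\<^sup>2 = 2 * \<Gamma>" using G0(1) by simp
  then show ?thesis unfolding power_mult_distrib by (simp add: power2_eq_square)
 qed
 finally have RP: "\<bar>T Rm r Pm r'\<bar> <= Z * sqrt (2 * \<Gamma>)" using G0 by (intro le) auto
 \<comment> \<open>The Casimir identity at \<open>r\<close> multiplied by the square of the third
   component at \<open>r'\<close>. The mixed term is then a difference that is small by order, up to
   \<open>2 / n\<close> and a term with the second component.\<close>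
 have "T Pm r Pm r' + T Qm r Pm r' + T Rm r Pm r' = c * t Pm r'"
 proof -
  let ?B = "sop r' (Pm n)"
  have "tg N n b (ety n) (%sg ta. mmul (confs N n) (sop r (Pm n)) ?B sg ta + mmul (confs N n) (sop r (Qm n)) ?B sg ta + mmul (confs N n) (sop r (Rm n)) ?B sg ta)
    = tg N n b (ety n) (msc c ?B)"
  proof (rule tg_cong)
   fix sg ta assume s: "sg \<in> confs N n"
   have "mmul (confs N n) (sop r (Pm n)) ?B sg ta + mmul (confs N n) (sop r (Qm n)) ?B sg ta + mmul (confs N n) (sop r (Rm n)) ?B sg ta
    = (\<Sum>\<rho>\<in>confs N n. (sop r (Pm n) sg \<rho> + sop r (Qm n) sg \<rho> + sop r (Rm n) sg \<rho>) * ?B \<rho> ta)"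
    by (simp add: mmul_def sum.distrib distrib_right)
   also have "... = c * mmul (confs N n) mid ?B sg ta" unfolding sop_PQR[OF s r(1) n1] mmul_def c_def by (simp add: sum_distrib_left mult.assoc)
   finally show "mmul (confs N n) (sop r (Pm n)) ?B sg ta + mmul (confs N n) (sop r (Qm n)) ?B sg ta + mmul (confs N n) (sop r (Rm n)) ?B sg ta = msc c ?B sg ta"
    using mmul_mid_left[OF finite_confs s, of ?B ta] by (simp add: msc_def)
  qed
  then show ?thesis unfolding T_def t_def by (simp only: tg_add tg_msc)
 qed
 then have QP: "T Qm r Pm r' = (t Pm r' - T Pm r Pm r') + 2 / real n * t Pm r' - T Rm r Pm r'" unfolding c_def by (simp add: algebra_simps)
 have "0 <= t Pm r'" unfolding tP[OF r(2)] by (intro sum_nonneg mult_nonneg_nonneg gw_nonneg[OF b0]) auto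
 then have "0 <= 2 / real n * t Pm r'" "2 / real n * t Pm r' <= \<Gamma> * Z"
  using mult_mono[OF order_trans[OF n2 G0(2)] tP1(1)[OF r(2)]] G0(1) by auto
 then have "\<bar>T Qm r Pm r'\<bar> <= Z * \<delta> + \<Gamma> * Z + Z * sqrt (2 * \<Gamma>)" using diff[OF r] RP unfolding QP by linarith
 also have "... = (\<delta> + \<Gamma> + sqrt (2 * \<Gamma>)) * Z" by (simp add: algebra_simps)
 finally show "\<bar>E Qm Pm\<bar> <= \<delta> + \<Gamma> + sqrt (2 * \<Gamma>)"
  using Z unfolding E_def T_def Z_def by (simp add: pos_divide_le_eq)
qed

theorem theorem2p5:
  fixes J :: real
  assumes "J > 0"
  shows "\<forall>\<delta>>0. \<exists>c>0. \<exists>\<beta>0::real. \<forall>\<beta>\<ge>\<beta>0. \<forall>n::nat.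
           1 \<le> n \<and> spinS n \<ge> c * \<beta>\<^sup>2 \<longrightarrow>
           (\<exists>N0::nat. \<forall>N\<ge>N0. even N \<longrightarrow>
              (\<forall>r\<in>sites N. \<forall>r'\<in>sites N.
                 (\<forall>a\<in>{AX, AZ}.
                    Im (complex_of_real (1 / spinS n ^ 4) * expect N n J J \<beta> (sq_corr N n a r a r')) = 0
                  \<and> Re (complex_of_real (1 / spinS n ^ 4) * expect N n J J \<beta> (sq_corr N n a r a r')) \<ge> 1/2 - \<delta>)
               \<and> Im (complex_of_real (1 / spinS n ^ 4) * expect N n J J \<beta> (sq_corr N n AY r AY r')) = 0
               \<and> Re (complex_of_real (1 / spinS n ^ 4) * expect N n J J \<beta> (sq_corr N n AY r AY r')) < \<delta>
               \<and> (1 / spinS n ^ 4) * cmod (expect N n J J \<beta> (sq_corr N n AX r AZ r')) < \<delta>))"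
proof (intro allI impI)
 let ?P = "%\<delta> \<beta> n N r r'. (\<forall>a\<in>{AX, AZ}.
    Im (complex_of_real (1 / spinS n ^ 4) * expect N n J J \<beta> (sq_corr N n a r a r')) = 0
   & Re (complex_of_real (1 / spinS n ^ 4) * expect N n J J \<beta> (sq_corr N n a r a r')) >= 1/2 - \<delta>)
   & Im (complex_of_real (1 / spinS n ^ 4) * expect N n J J \<beta> (sq_corr N n AY r AY r')) = 0
   & Re (complex_of_real (1 / spinS n ^ 4) * expect N n J J \<beta> (sq_corr N n AY r AY r')) < \<delta>
   & (1 / spinS n ^ 4) * cmod (expect N n J J \<beta> (sq_corr N n AX r AZ r')) < \<delta>"
 fix \<delta> :: real assume \<delta>: "\<delta> > 0"
 \<comment> \<open>\<open>\<Gamma> <= m\<close> gives both \<open>\<Gamma> <= \<delta> / 4\<close>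
   and \<open>sqrt (2 * \<Gamma>) <= \<delta> / 4\<close>.\<close>
 define m where "m = min (\<delta> / 4) (\<delta>\<^sup>2 / 32)"
 have m: "m > 0" using \<delta> by (simp add: m_def)
 from \<delta> have "\<delta> / 4 > 0" by simp
 then show "\<exists>c>0. \<exists>\<beta>0::real. \<forall>\<beta>\<ge>\<beta>0. \<forall>n::nat. 1 <= n & spinS n >= c * \<beta>\<^sup>2 -->
   (\<exists>N0::nat. \<forall>N\<ge>N0. even N --> (\<forall>r\<in>sites N. \<forall>r'\<in>sites N. ?P \<delta> \<beta> n N r r'))"
 proof (rule order_bound)
  fix b0 assume b0: "b0 >= (36::real)" and ord: "!!b n. b >= b0 ==> real n >= 2000 * b\<^sup>2 ==> \<exists>N0. \<forall>N\<ge>N0. even N --> (\<forall>r\<in>sites N. \<forall>r'\<in>sites N.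
   (\<Sum>sg\<in>confs N n. gw N n b sg * ((mz n (sg r'))\<^sup>2 * (1 - (mz n (sg r))\<^sup>2))) <= Zr N n b * (\<delta> / 4))"
  \<comment> \<open>\<open>b >= (15 / m)^2\<close> is what makes
    \<open>15 / sqrt b <= m\<close>.\<close>
  define b1 where "b1 = max b0 ((15 / m)\<^sup>2)"
  have core: "\<exists>N0::nat. \<forall>N\<ge>N0. even N --> (\<forall>r\<in>sites N. \<forall>r'\<in>sites N. ?P \<delta> \<beta> n N r r')"
   if be: "b1 / J <= \<beta>" and sn: "1 <= n" "1000 * J\<^sup>2 * \<beta>\<^sup>2 <= spinS n" for \<beta> n
  proof -
   define b where "b = \<beta> * J"
   have "b1 <= b" using be assms by (simp add: b_def pos_divide_le_eq)
   then have bb: "b >= b0" "b >= (15 / m)\<^sup>2" "b >= 36" using b0 unfolding b1_def by auto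
   \<comment> \<open>\<open>spinS n\<close> is \<open>n / 2\<close> and \<open>b\<close> is
     \<open>\<beta> * J\<close>; this is where the constant \<open>1000 * J^2\<close> comes
     from.\<close>
   have n: "real n >= 2000 * b\<^sup>2" using sn(2) unfolding spinS_def b_def power_mult_distrib by (simp add: mult_ac)
   define \<Gamma> where "\<Gamma> = 15 / sqrt b"
   have "15 / m <= sqrt b" using bb(2) by (rule real_le_rsqrt)
   moreover have "sqrt b > 0" using bb by simp
   ultimately have "\<Gamma> <= m" unfolding \<Gamma>_def using m by (simp add: field_simps)
   then have G: "\<Gamma> <= \<delta> / 4" "2 * \<Gamma> <= (\<delta> / 4)\<^sup>2" by (auto simp: m_def power_divide)
   have sG: "sqrt (2 * \<Gamma>) <= \<delta> / 4" using G(2) \<delta> by (intro real_le_lsqrt) (auto simp: \<Gamma>_def)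
   obtain N0 where N0: "\<forall>N\<ge>N0. even N --> (\<forall>r\<in>sites N. \<forall>r'\<in>sites N.
    (\<Sum>sg\<in>confs N n. gw N n b sg * ((mz n (sg r'))\<^sup>2 * (1 - (mz n (sg r))\<^sup>2))) <= Zr N n b * (\<delta> / 4))"
    using ord[OF bb(1) n] by (elim exE)
   have "?P \<delta> \<beta> n N r r'" if N: "N >= max N0 2" "even N" and r: "r \<in> sites N" "r' \<in> sites N" for N r r'
   proof -
    have N2: "N >= 2" "N >= N0" using N by auto
    have or: "(\<Sum>sg\<in>confs N n. gw N n b sg * ((mz n (sg r'))\<^sup>2 * (1 - (mz n (sg r))\<^sup>2))) <= Zr N n b * (\<delta> / 4)"
     if "r \<in> sites N" "r' \<in> sites N" for r r'
     by (rule N0[rule_format, OF N2(2) N(2) that])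
    note B = correlation_bounds[OF N(2) N2(1) bb(3) n r or, folded \<Gamma>_def]
    note X = sq_corr_expect[OF sn(1) N2(1) r, of J \<beta>, folded b_def]
    have 1: "1/2 - \<delta> <= tg N n b (ety n) (mmul (confs N n) (sop r (axm n a)) (sop r' (axm n a))) / Zr N n b" if "a \<in> {AX, AZ}" for a
    proof -
     have l: "1/2 - \<delta> <= 1/2 - \<Gamma> / 2 - \<delta> / 4" using G(1) \<delta> by simp
     show ?thesis using that order_trans[OF l B(1)] order_trans[OF l B(2)] by auto
    qed
    have 2: "tg N n b (ety n) (mmul (confs N n) (sop r (axm n AY)) (sop r' (axm n AY))) / Zr N n b < \<delta>"
     using B(3) G(1) \<delta> unfolding axm.simps by linarith
    have "(1 / spinS n ^ 4) * cmod (expect N n J J \<beta> (sq_corr N n AX r AZ r'))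
      = cmod (complex_of_real (1 / spinS n ^ 4) * expect N n J J \<beta> (sq_corr N n AX r AZ r'))"
     unfolding norm_mult norm_of_real by (simp add: spinS_def)
    also have "... < \<delta>" unfolding X norm_of_real axm.simps using B(4) G(1) sG \<delta> by linarith
    finally show ?thesis unfolding X Re_complex_of_real Im_complex_of_real using 1 2 by blast
   qed
   then show ?thesis by (intro exI[of _ "max N0 2"] allI impI ballI)
  qed
  show ?thesis
  proof (rule exI[of _ "1000 * J\<^sup>2"], rule conjI)
   show "1000 * J\<^sup>2 > 0" using assms by simp
   show "\<exists>\<beta>0::real. \<forall>\<beta>\<ge>\<beta>0. \<forall>n::nat. 1 <= n & spinS n >= 1000 * J\<^sup>2 * \<beta>\<^sup>2 -->
    (\<exists>N0::nat. \<forall>N\<ge>N0. even N --> (\<forall>r\<in>sites N. \<forall>r'\<in>sites N. ?P \<delta> \<beta> n N r r'))"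
    by (rule exI[of _ "b1 / J"], intro allI impI, elim conjE, rule core)
  qed
 qed
qed

end
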